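(* Let $K$ be a field and let $X=\mathrm{Spec}(A)$ be a smooth affine $K$-scheme of finite type, purely of dimension $n$. Let $f,f_1,\ldots,f_r\in A$ ($r\ge 1$), put $I=(f_1,\ldots,f_r)\subseteq A$, $B=A/I$, and assume that $Y=\mathrm{Spec}(B)$ is a smooth $K$-scheme, purely of codimension $r$ in $X$. Let $\bar f\in B$ be the image of $f$. Then there is an isomorphism of $B$-modules \[ H^{n-r}(\Omega^{\bullet}_{B/K},\phi_{\bar f})\simeq \Bigl(\Omega^n_{A/K}\big/\bigl(d_{A/K}f\wedge d_{A/K}f_1\wedge\cdots\wedge d_{A/K}f_r\wedge\Omega^{n-r-1}_{A/K}\bigr)\Bigr)\otimes_A B. \]
   Context: $\Omega^k_{A/K}$ and $\Omega^k_{B/K}$ are the modules of Kähler differential $k$-forms of $A$ and $B$ over $K$ (zero for $k<0$), and $d_{A/K}$, $d_{B/K}$ are the exterior derivatives. The differential of the complex $(\Omega^{\bullet}_{B/K},\phi_{\bar f})$ is $\phi_{\bar f}:\Omega^k_{B/K}\to\Omega^{k+1}_{B/K}$, $\phi_{\bar f}(\omega)=d_{B/K}\bar f\wedge\omega$. *)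

theory Defs
  imports "HOL-Algebra.Algebra" "HOL-Library.Extended_Nat" "HOL-Library.Multiset"
begin

section \<open>Modules\<close>

text \<open>
  Modules are records of type \<^typ>\<open>('a, 'b) module\<close>, which also have the fields
  \<^const>\<open>monoid.mult\<close> and \<^const>\<open>one\<close>. These two fields carry a meaning only for the tensor and
  exterior algebras below.
\<close>

definition free_module :: "('a, 'm) ring_scheme \<Rightarrow> 'x set \<Rightarrow> ('a, 'x \<Rightarrow> 'a) module" where
  "free_module R S =
    \<lparr>carrier = {p. (\<forall>x. p x \<in> carrier R) \<and> {x. p x \<noteq> \<zero>\<^bsub>R\<^esub>} \<subseteq> S \<and> finite {x. p x \<noteq> \<zero>\<^bsub>R\<^esub>}},
     monoid.mult = undefined,
     one = undefined,
     ring.zero = (\<lambda>x. \<zero>\<^bsub>R\<^esub>),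
     ring.add = (\<lambda>p q x. p x \<oplus>\<^bsub>R\<^esub> q x),
     smult = (\<lambda>a p x. a \<otimes>\<^bsub>R\<^esub> p x)\<rparr>"

definition basis_elt :: "('a, 'm) ring_scheme \<Rightarrow> 'x \<Rightarrow> 'x \<Rightarrow> 'a" where
  "basis_elt R x = (\<lambda>y. if y = x then \<one>\<^bsub>R\<^esub> else \<zero>\<^bsub>R\<^esub>)"

definition submodule_span ::
  "('a, 'm) ring_scheme \<Rightarrow> ('a, 'b, 'n) module_scheme \<Rightarrow> 'b set \<Rightarrow> 'b set" where
  "submodule_span R M S = \<Inter>{N. submodule N R M \<and> S \<subseteq> N}"

text \<open>The quotient \<open>M/N\<close>; its elements are cosets, as in \<^const>\<open>FactRing\<close>.\<close>

definition quot_module :: "('a, 'b, 'n) module_scheme \<Rightarrow> 'b set \<Rightarrow> ('a, 'b set) module" where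
  "quot_module M N =
    \<lparr>carrier = a_rcosets\<^bsub>M\<^esub> N,
     monoid.mult = rcoset_mult M N,
     one = N +>\<^bsub>M\<^esub> \<one>\<^bsub>M\<^esub>,
     ring.zero = N,
     ring.add = set_add M,
     smult = (\<lambda>a U. \<Union>x\<in>U. N +>\<^bsub>M\<^esub> (a \<odot>\<^bsub>M\<^esub> x))\<rparr>"

definition module_iso ::
  "('a, 'm) ring_scheme \<Rightarrow> ('a, 'b, 'n) module_scheme \<Rightarrow> ('a, 'c, 'p) module_scheme
    \<Rightarrow> ('b \<Rightarrow> 'c) set" where
  "module_iso R M N =
    {h. bij_betw h (carrier M) (carrier N) \<and>
        (\<forall>x\<in>carrier M. \<forall>y\<in>carrier M. h (x \<oplus>\<^bsub>M\<^esub> y) = h x \<oplus>\<^bsub>N\<^esub> h y) \<and>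
        (\<forall>a\<in>carrier R. \<forall>x\<in>carrier M. h (a \<odot>\<^bsub>M\<^esub> x) = a \<odot>\<^bsub>N\<^esub> h x)}"

text \<open>
  For a ring homomorphism \<open>\<pi> : A \<rightarrow> B\<close>, the tensor product \<open>M \<otimes>\<^sub>A B\<close> as a \<open>B\<close>-module: it is
  generated by the symbols \<open>m \<otimes> b\<close>, subject to biadditivity, \<open>A\<close>-balancedness and
  \<open>b' \<cdot> (m \<otimes> b) = m \<otimes> b'b\<close>.
\<close>

definition tensor_relations ::
  "('a, 'm) ring_scheme \<Rightarrow> ('b, 'n) ring_scheme \<Rightarrow> ('a \<Rightarrow> 'b) \<Rightarrow> ('a, 'c, 'p) module_scheme
    \<Rightarrow> ('c \<times> 'b \<Rightarrow> 'b) set" where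
  "tensor_relations A B \<pi> M =
    (let F = free_module B (carrier M \<times> carrier B); \<delta> = (\<lambda>m b. basis_elt B (m, b)) in
      {\<delta> (m \<oplus>\<^bsub>M\<^esub> m') b \<ominus>\<^bsub>F\<^esub> (\<delta> m b \<oplus>\<^bsub>F\<^esub> \<delta> m' b) | m m' b.
          m \<in> carrier M \<and> m' \<in> carrier M \<and> b \<in> carrier B} \<union>
      {\<delta> m (b \<oplus>\<^bsub>B\<^esub> b') \<ominus>\<^bsub>F\<^esub> (\<delta> m b \<oplus>\<^bsub>F\<^esub> \<delta> m b') | m b b'.
          m \<in> carrier M \<and> b \<in> carrier B \<and> b' \<in> carrier B} \<union>
      {\<delta> (a \<odot>\<^bsub>M\<^esub> m) b \<ominus>\<^bsub>F\<^esub> \<delta> m (\<pi> a \<otimes>\<^bsub>B\<^esub> b) | a m b.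
          a \<in> carrier A \<and> m \<in> carrier M \<and> b \<in> carrier B} \<union>
      {b' \<odot>\<^bsub>F\<^esub> \<delta> m b \<ominus>\<^bsub>F\<^esub> \<delta> m (b' \<otimes>\<^bsub>B\<^esub> b) | b' m b.
          b' \<in> carrier B \<and> m \<in> carrier M \<and> b \<in> carrier B})"

definition tensor_product ::
  "('a, 'm) ring_scheme \<Rightarrow> ('b, 'n) ring_scheme \<Rightarrow> ('a \<Rightarrow> 'b) \<Rightarrow> ('a, 'c, 'p) module_scheme
    \<Rightarrow> ('b, ('c \<times> 'b \<Rightarrow> 'b) set) module" where
  "tensor_product A B \<pi> M =
    (let F = free_module B (carrier M \<times> carrier B) in
      quot_module F (submodule_span B F (tensor_relations A B \<pi> M)))"

text \<open>
  The cohomology in degree \<open>k\<close> of a cochain complex \<open>C\<close> whose differential in every degree is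
  the restriction of \<open>\<phi>\<close>.
\<close>

definition cohomology ::
  "(int \<Rightarrow> ('a, 'b, 'n) module_scheme) \<Rightarrow> ('b \<Rightarrow> 'b) \<Rightarrow> int \<Rightarrow> ('a, 'b set) module" where
  "cohomology C \<phi> k =
    quot_module ((C k)\<lparr>carrier := {x \<in> carrier (C k). \<phi> x = \<zero>\<^bsub>C (k + 1)\<^esub>}\<rparr>)
      (\<phi> ` carrier (C (k - 1)))"


section \<open>The exterior algebra\<close>

text \<open>
  The free module on the lists over \<open>M\<close>, with the convolution product extending
  concatenation of lists; a list \<open>[m\<^sub>1, \<dots>, m\<^sub>k]\<close> stands for \<open>m\<^sub>1 \<otimes> \<dots> \<otimes> m\<^sub>k\<close>. Multilinearity
  is imposed together with \<open>m \<and> m = 0\<close> in the next definition.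
\<close>

definition list_algebra ::
  "('a, 'm) ring_scheme \<Rightarrow> ('a, 'b, 'n) module_scheme \<Rightarrow> ('a, 'b list \<Rightarrow> 'a) module" where
  "list_algebra R M =
    (free_module R (lists (carrier M)))
      \<lparr>monoid.mult := (\<lambda>p q xs. \<Oplus>\<^bsub>R\<^esub>i\<in>{0..length xs}. p (take i xs) \<otimes>\<^bsub>R\<^esub> q (drop i xs)),
       one := basis_elt R []\<rparr>"

definition exterior_relations ::
  "('a, 'm) ring_scheme \<Rightarrow> ('a, 'b, 'n) module_scheme \<Rightarrow> ('b list \<Rightarrow> 'a) set" where
  "exterior_relations R M =
    (let T = list_algebra R M; \<delta> = basis_elt R in
      {\<delta> (xs @ (m \<oplus>\<^bsub>M\<^esub> m') # ys) \<ominus>\<^bsub>T\<^esub> (\<delta> (xs @ m # ys) \<oplus>\<^bsub>T\<^esub> \<delta> (xs @ m' # ys)) | xs ys m m'.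
          set xs \<subseteq> carrier M \<and> set ys \<subseteq> carrier M \<and> m \<in> carrier M \<and> m' \<in> carrier M} \<union>
      {\<delta> (xs @ (a \<odot>\<^bsub>M\<^esub> m) # ys) \<ominus>\<^bsub>T\<^esub> a \<odot>\<^bsub>T\<^esub> \<delta> (xs @ m # ys) | xs ys a m.
          set xs \<subseteq> carrier M \<and> set ys \<subseteq> carrier M \<and> a \<in> carrier R \<and> m \<in> carrier M} \<union>
      {\<delta> (xs @ m # m # ys) | xs ys m.
          set xs \<subseteq> carrier M \<and> set ys \<subseteq> carrier M \<and> m \<in> carrier M})"

definition exterior_ideal ::
  "('a, 'm) ring_scheme \<Rightarrow> ('a, 'b, 'n) module_scheme \<Rightarrow> ('b list \<Rightarrow> 'a) set" where
  "exterior_ideal R M = submodule_span R (list_algebra R M) (exterior_relations R M)"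

text \<open>The multiplication of this record is the wedge product.\<close>

definition exterior_algebra ::
  "('a, 'm) ring_scheme \<Rightarrow> ('a, 'b, 'n) module_scheme \<Rightarrow> ('a, ('b list \<Rightarrow> 'a) set) module" where
  "exterior_algebra R M = quot_module (list_algebra R M) (exterior_ideal R M)"

definition wedge_list ::
  "('a, 'm) ring_scheme \<Rightarrow> ('a, 'b, 'n) module_scheme \<Rightarrow> 'b list \<Rightarrow> ('b list \<Rightarrow> 'a) set" where
  "wedge_list R M xs = exterior_ideal R M +>\<^bsub>list_algebra R M\<^esub> basis_elt R xs"

text \<open>
  The homogeneous component of degree \<open>k\<close>, as a submodule of the exterior algebra. Degrees are
  integers and the component of a negative degree is the zero module.
\<close>

definition exterior_power ::
  "('a, 'm) ring_scheme \<Rightarrow> ('a, 'b, 'n) module_scheme \<Rightarrow> int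
    \<Rightarrow> ('a, ('b list \<Rightarrow> 'a) set) module" where
  "exterior_power R M k =
    (exterior_algebra R M)
      \<lparr>carrier := {exterior_ideal R M +>\<^bsub>list_algebra R M\<^esub> p | p.
         p \<in> carrier (list_algebra R M) \<and> (\<forall>xs. p xs \<noteq> \<zero>\<^bsub>R\<^esub> \<longrightarrow> int (length xs) = k)}\<rparr>"


section \<open>Kaehler differentials\<close>

text \<open>
  A \<open>K\<close>-algebra is a commutative ring \<open>A\<close> with a ring homomorphism \<open>\<iota> : K \<rightarrow> A\<close>. The module of
  differentials is generated by the symbols \<open>da\<close> for \<open>a \<in> A\<close>.
\<close>

definition kahler_relations ::
  "('k, 'l) ring_scheme \<Rightarrow> ('a, 'm) ring_scheme \<Rightarrow> ('k \<Rightarrow> 'a) \<Rightarrow> ('a \<Rightarrow> 'a) set" where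
  "kahler_relations K A \<iota> =
    (let F = free_module A (carrier A); \<delta> = basis_elt A in
      {\<delta> (a \<oplus>\<^bsub>A\<^esub> b) \<ominus>\<^bsub>F\<^esub> (\<delta> a \<oplus>\<^bsub>F\<^esub> \<delta> b) | a b. a \<in> carrier A \<and> b \<in> carrier A} \<union>
      {\<delta> (a \<otimes>\<^bsub>A\<^esub> b) \<ominus>\<^bsub>F\<^esub> (a \<odot>\<^bsub>F\<^esub> \<delta> b \<oplus>\<^bsub>F\<^esub> b \<odot>\<^bsub>F\<^esub> \<delta> a) | a b. a \<in> carrier A \<and> b \<in> carrier A} \<union>
      {\<delta> (\<iota> c) | c. c \<in> carrier K})"

definition kahler_span ::
  "('k, 'l) ring_scheme \<Rightarrow> ('a, 'm) ring_scheme \<Rightarrow> ('k \<Rightarrow> 'a) \<Rightarrow> ('a \<Rightarrow> 'a) set" where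
  "kahler_span K A \<iota> = submodule_span A (free_module A (carrier A)) (kahler_relations K A \<iota>)"

definition kahler_module ::
  "('k, 'l) ring_scheme \<Rightarrow> ('a, 'm) ring_scheme \<Rightarrow> ('k \<Rightarrow> 'a) \<Rightarrow> ('a, ('a \<Rightarrow> 'a) set) module" where
  "kahler_module K A \<iota> = quot_module (free_module A (carrier A)) (kahler_span K A \<iota>)"

definition universal_derivation ::
  "('k, 'l) ring_scheme \<Rightarrow> ('a, 'm) ring_scheme \<Rightarrow> ('k \<Rightarrow> 'a) \<Rightarrow> 'a \<Rightarrow> ('a \<Rightarrow> 'a) set" where
  "universal_derivation K A \<iota> a =
    kahler_span K A \<iota> +>\<^bsub>free_module A (carrier A)\<^esub> basis_elt A a"

type_synonym 'a form = "(('a \<Rightarrow> 'a) set list \<Rightarrow> 'a) set"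

definition all_forms ::
  "('k, 'l) ring_scheme \<Rightarrow> ('a, 'm) ring_scheme \<Rightarrow> ('k \<Rightarrow> 'a) \<Rightarrow> ('a, 'a form) module" where
  "all_forms K A \<iota> = exterior_algebra A (kahler_module K A \<iota>)"

definition forms ::
  "('k, 'l) ring_scheme \<Rightarrow> ('a, 'm) ring_scheme \<Rightarrow> ('k \<Rightarrow> 'a) \<Rightarrow> int \<Rightarrow> ('a, 'a form) module" where
  "forms K A \<iota> k = exterior_power A (kahler_module K A \<iota>) k"

text \<open>The exterior derivative of a function, as an element of degree 1 of the algebra of forms.\<close>

definition dfun ::
  "('k, 'l) ring_scheme \<Rightarrow> ('a, 'm) ring_scheme \<Rightarrow> ('k \<Rightarrow> 'a) \<Rightarrow> 'a \<Rightarrow> 'a form" where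
  "dfun K A \<iota> a = wedge_list A (kahler_module K A \<iota>) [universal_derivation K A \<iota> a]"

text \<open>\<open>d_wedge K A \<iota> f \<omega> = df \<and> \<omega>\<close>; for varying degrees this is the differential \<open>\<phi>\<^sub>f\<close>.\<close>

definition d_wedge ::
  "('k, 'l) ring_scheme \<Rightarrow> ('a, 'm) ring_scheme \<Rightarrow> ('k \<Rightarrow> 'a) \<Rightarrow> 'a \<Rightarrow> 'a form \<Rightarrow> 'a form" where
  "d_wedge K A \<iota> f \<omega> = dfun K A \<iota> f \<otimes>\<^bsub>all_forms K A \<iota>\<^esub> \<omega>"


section \<open>Dimension and codimension\<close>

definition minimal_prime_over :: "('a, 'm) ring_scheme \<Rightarrow> 'a set \<Rightarrow> 'a set \<Rightarrow> bool" where
  "minimal_prime_over R I P \<longleftrightarrow>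
    primeideal P R \<and> I \<subseteq> P \<and> (\<forall>Q. primeideal Q R \<and> I \<subseteq> Q \<and> Q \<subseteq> P \<longrightarrow> Q = P)"

definition prime_chain :: "('a, 'm) ring_scheme \<Rightarrow> nat \<Rightarrow> (nat \<Rightarrow> 'a set) \<Rightarrow> bool" where
  "prime_chain R k p \<longleftrightarrow> (\<forall>i\<le>k. primeideal (p i) R) \<and> (\<forall>i<k. p i \<subset> p (Suc i))"

definition krull_dim :: "('a, 'm) ring_scheme \<Rightarrow> enat" where
  "krull_dim R = Sup {enat k | k. \<exists>p. prime_chain R k p}"

definition height :: "('a, 'm) ring_scheme \<Rightarrow> 'a set \<Rightarrow> enat" where
  "height R P = Sup {enat k | k. \<exists>p. prime_chain R k p \<and> p k = P}"

text \<open>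
  The irreducible components of the closed subset \<open>V(I)\<close> of \<open>Spec R\<close> are the sets
  \<open>V(P) = Spec (R/P)\<close> for the minimal primes \<open>P\<close> over \<open>I\<close>, and the codimension of \<open>V(P)\<close> in
  \<open>Spec R\<close> is the height of \<open>P\<close>. The empty scheme has every pure dimension and codimension.
\<close>

definition pure_dim :: "('a, 'm) ring_scheme \<Rightarrow> nat \<Rightarrow> bool" where
  "pure_dim R n \<longleftrightarrow> (\<forall>P. minimal_prime_over R {\<zero>\<^bsub>R\<^esub>} P \<longrightarrow> krull_dim (R Quot P) = enat n)"

definition pure_codim :: "('a, 'm) ring_scheme \<Rightarrow> 'a set \<Rightarrow> nat \<Rightarrow> bool" where
  "pure_codim R I r \<longleftrightarrow> (\<forall>P. minimal_prime_over R I P \<longrightarrow> height R P = enat r)"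


section \<open>Smooth algebras\<close>

definition finite_type_algebra ::
  "('k, 'l) ring_scheme \<Rightarrow> ('a, 'm) ring_scheme \<Rightarrow> ('k \<Rightarrow> 'a) \<Rightarrow> bool" where
  "finite_type_algebra K A \<iota> \<longleftrightarrow>
    (\<exists>S. finite S \<and> S \<subseteq> carrier A \<and> generate_ring A (\<iota> ` carrier K \<union> S) = carrier A)"

text \<open>
  The infinitesimal lifting property: for every \<open>K\<close>-algebra \<open>(C, \<kappa>)\<close> and every ideal
  \<open>J \<subseteq> C\<close> with \<open>J\<^sup>2 = 0\<close>, every homomorphism of \<open>K\<close>-algebras \<open>u : A \<rightarrow> C/J\<close> lifts to \<open>v : A \<rightarrow> C\<close>.
\<close>

definition lifts_along ::
  "('k, 'l) ring_scheme \<Rightarrow> ('a, 'm) ring_scheme \<Rightarrow> ('k \<Rightarrow> 'a)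
    \<Rightarrow> ('c, 'n) ring_scheme \<Rightarrow> ('k \<Rightarrow> 'c) \<Rightarrow> 'c set \<Rightarrow> bool" where
  "lifts_along K A \<iota> C \<kappa> J \<longleftrightarrow>
    (\<forall>u \<in> ring_hom A (C Quot J).
      (\<forall>c\<in>carrier K. u (\<iota> c) = J +>\<^bsub>C\<^esub> \<kappa> c) \<longrightarrow>
      (\<exists>v \<in> ring_hom A C.
        (\<forall>c\<in>carrier K. v (\<iota> c) = \<kappa> c) \<and> (\<forall>a\<in>carrier A. J +>\<^bsub>C\<^esub> v a = u a)))"

definition square_zero_ideal :: "'c set \<Rightarrow> ('c, 'n) ring_scheme \<Rightarrow> bool" where
  "square_zero_ideal J C \<longleftrightarrow> ideal J C \<and> (\<forall>x\<in>J. \<forall>y\<in>J. x \<otimes>\<^bsub>C\<^esub> y = \<zero>\<^bsub>C\<^esub>)"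

text \<open>
  A type variable cannot be quantified inside a definition, so the test algebras have a fixed
  carrier type. It holds a copy of every quotient of a polynomial ring \<open>K[X\<^sub>1, \<dots>, X\<^sub>m]\<close>
  (polynomials are functions from monomials to coefficients, elements of a quotient are cosets).
  This suffices if \<open>A\<close> is of finite type: to lift \<open>u : A \<rightarrow> C/J\<close> for a \<open>K\<close>-algebra \<open>C\<close> on any
  type one may replace \<open>C\<close> by its subalgebra generated by representatives of the images of
  finitely many generators of \<open>A\<close>, which is such a quotient.
\<close>

type_synonym 'k test = "(nat multiset \<Rightarrow> 'k) set"

definition formally_smooth ::
  "('k, 'l) ring_scheme \<Rightarrow> ('a, 'm) ring_scheme \<Rightarrow> ('k \<Rightarrow> 'a) \<Rightarrow> bool" where
  "formally_smooth K A \<iota> \<longleftrightarrow>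
    (\<forall>(C :: 'k test ring) \<kappa> J.
      cring C \<and> \<kappa> \<in> ring_hom K C \<and> square_zero_ideal J C \<longrightarrow> lifts_along K A \<iota> C \<kappa> J)"

text \<open>
  Smooth means formally smooth and of finite presentation; over a field \<open>K\<close> finite
  presentation is the same as finite type.
\<close>

definition smooth_algebra ::
  "('k, 'l) ring_scheme \<Rightarrow> ('a, 'm) ring_scheme \<Rightarrow> ('k \<Rightarrow> 'a) \<Rightarrow> bool" where
  "smooth_algebra K A \<iota> \<longleftrightarrow> finite_type_algebra K A \<iota> \<and> formally_smooth K A \<iota>"

end

theory Submission
  imports Defs "HOL-Library.Nat_Bijection"
begin

text \<open>
  Put \<open>d = n - r\<close>. Wedging with \<open>df\<^sub>1 \<and> \<dots> \<and> df\<^sub>r\<close> sends \<open>\<Omega>\<^sup>d\<^sub>B\<close> to \<open>\<Omega>\<^sup>n\<^sub>A \<otimes> B\<close>, because it kills the \<open>df\<^sub>i\<close> and so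
  does not see the choice of lifts from \<open>B\<close> to \<open>A\<close>; it carries \<open>df \<and> \<Omega>\<^sup>d\<^sup>-\<^sup>1\<^sub>B\<close> into the submodule that is
  divided out. As \<open>\<Omega>\<^sup>k\<^sub>B = 0\<close> for \<open>k > d\<close>, every \<open>d\<close>-form on \<open>Y\<close> is a cocycle.

  Formal smoothness of \<open>B\<close> splits the conormal sequence, which gives derivations \<open>\<theta>\<^sub>i : A \<rightarrow> B\<close> whose
  values on the \<open>f\<^sub>k\<close> are the coordinates of \<open>f\<^sub>k\<close> in \<open>I/I\<^sup>2\<close>. Since \<open>I\<close> has height \<open>r\<close> and \<open>r\<close>
  generators, coefficients of relations in \<open>I/I\<^sup>2\<close> lie in all primes over \<open>I\<close>, so the idempotent matrix
  \<open>1 - (\<theta>\<^sub>i f\<^sub>k)\<close> vanishes by Nakayama; contraction with the \<open>\<theta>\<^sub>i\<close> then inverts the wedge map on the left.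
  Surjectivity holds since an \<open>n\<close>-form containing fewer than \<open>r\<close> of the \<open>df\<^sub>i\<close> factors through a form on
  \<open>B\<close> of degree above \<open>d\<close>.

  For \<open>\<Omega>\<^sup>k\<^sub>B = 0\<close>, take a polynomial ring \<open>P = K[x\<^sub>1, \<dots>, x\<^sub>N]\<close> mapping onto \<open>B\<close> with kernel \<open>J\<close> and a
  maximal ideal. By the splitting, \<open>J\<close> is locally generated by \<open>N - t\<close> elements if \<open>\<Omega>\<^sub>B\<close> locally needs
  \<open>t\<close> generators. A maximal chain of primes in \<open>P\<close> and Krull's height theorem produce a chain of
  length \<open>t\<close> in \<open>B\<close>, hence \<open>t \<le> d\<close>.
\<close>


text \<open>No localization is ever formed: a statement at a prime \<open>P\<close> is made about
  multiples \<open>s x\<close> with \<open>s\<close> outside \<open>P\<close>, so that all modules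
  stay over one ring. Forms are handled as alternating functions on lists, and only their vanishing
  is followed through permutations; no sign or determinant is computed. This suffices because the
  comparison maps are evaluated on wedges in a fixed order, and elsewhere only the vanishing of
  values is at stake. The lifting property is given for algebras on one carrier type only, so an
  algebra to be lifted into must be of finite type and is first copied there. Smoothness of
  \<open>A\<close> has a task of its own: as \<open>I/I^2\<close> is not known to be free on the
  \<open>f_i\<close>, coordinates of its elements must be chosen by a homomorphism, and lifting the
  quotient map from \<open>A\<close> to \<open>A/I^2\<close> through the square-zero extension of
  \<open>B\<close> by a free module of rank \<open>r\<close> makes that choice. If \<open>B\<close>
  is the zero ring, purity of the codimension says nothing and \<open>r\<close> may exceed
  \<open>n\<close>; this case is settled apart.\<close>

section \<open>Closure properties of submodules\<close>

lemma (in abelian_group) minus_zero_iff: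
  assumes "x \<in> carrier G" "y \<in> carrier G" shows "x \<ominus> y = \<zero> \<longleftrightarrow> x = y"
  using assms by (metis a_minus_def add.inv_equality add.inv_inv local.minus_closed r_neg minus_minus a_inv_closed)

lemma (in module) submoduleD:
  assumes "submodule N R M"
  shows "N \<subseteq> carrier M" "\<And>x. x \<in> N \<Longrightarrow> x \<in> carrier M" "\<zero>\<^bsub>M\<^esub> \<in> N"
    and "\<And>x y. x \<in> N \<Longrightarrow> y \<in> N \<Longrightarrow> x \<oplus>\<^bsub>M\<^esub> y \<in> N"
    and "\<And>x. x \<in> N \<Longrightarrow> \<ominus>\<^bsub>M\<^esub> x \<in> N"
    and "\<And>x y. x \<in> N \<Longrightarrow> y \<in> N \<Longrightarrow> x \<ominus>\<^bsub>M\<^esub> y \<in> N"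
    and "\<And>a x. a \<in> carrier R \<Longrightarrow> x \<in> N \<Longrightarrow> a \<odot>\<^bsub>M\<^esub> x \<in> N"
proof -
  note E = submoduleE[OF assms]
  show 1: "N \<subseteq> carrier M" using E by blast
  show "x \<in> N \<Longrightarrow> x \<in> carrier M" for x using 1 by blast
  obtain x where x: "x \<in> N" using E by blast
  hence "\<zero> \<odot>\<^bsub>M\<^esub> x \<in> N" using E by blast
  thus "\<zero>\<^bsub>M\<^esub> \<in> N" using x 1 by auto
  show "\<And>x y. x \<in> N \<Longrightarrow> y \<in> N \<Longrightarrow> x \<oplus>\<^bsub>M\<^esub> y \<in> N" "\<And>x. x \<in> N \<Longrightarrow> \<ominus>\<^bsub>M\<^esub> x \<in> N"
    "\<And>a x. a \<in> carrier R \<Longrightarrow> x \<in> N \<Longrightarrow> a \<odot>\<^bsub>M\<^esub> x \<in> N" using E by blast+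
  show "\<And>x y. x \<in> N \<Longrightarrow> y \<in> N \<Longrightarrow> x \<ominus>\<^bsub>M\<^esub> y \<in> N" unfolding a_minus_def using E by blast
qed

lemma (in module) submoduleI':
  assumes "H \<subseteq> carrier M" and "\<zero>\<^bsub>M\<^esub> \<in> H"
    and "\<And>a b. a \<in> H \<Longrightarrow> b \<in> H \<Longrightarrow> a \<oplus>\<^bsub>M\<^esub> b \<in> H"
    and "\<And>a x. a \<in> carrier R \<Longrightarrow> x \<in> H \<Longrightarrow> a \<odot>\<^bsub>M\<^esub> x \<in> H"
  shows "submodule H R M"
proof (rule submoduleI)
  fix a assume a: "a \<in> H"
  have "(\<ominus> \<one>) \<odot>\<^bsub>M\<^esub> a \<in> H" using a assms(4) by simp
  moreover have "(\<ominus> \<one>) \<odot>\<^bsub>M\<^esub> a = \<ominus>\<^bsub>M\<^esub> a" using a assms(1) smult_l_minus by auto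
  ultimately show "\<ominus>\<^bsub>M\<^esub> a \<in> H" by simp
qed (use assms in auto)

lemma (in module) submodule_finsum:
  assumes "submodule N R M" "\<And>i. i \<in> F \<Longrightarrow> g i \<in> N"
  shows "(\<Oplus>\<^bsub>M\<^esub>i\<in>F. g i) \<in> N"
  using assms(2)
proof (induction F rule: infinite_finite_induct)
  case (insert x F)
  then have "g \<in> F \<rightarrow> carrier M" "g x \<in> carrier M" using submoduleD(2)[OF assms(1)] by auto
  then show ?case using insert submoduleD(4)[OF assms(1)] by simp
qed (use submoduleD(3)[OF assms(1)] in auto)

lemma (in module) abelian_subgroup_submodule: "submodule N R M \<Longrightarrow> abelian_subgroup N M"
  using abelian_subgroupI3[OF additive_subgroup.intro M.abelian_group_axioms] submodule.axioms(1) by blast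

subsection \<open>Linear maps\<close>

text \<open>A bare predicate without module axioms or extensionality: one function can be linear
  over several scalar rings by way of \<open>restr\<close>, and composites are plain lambda
  terms.\<close>

definition lin_map where
  "lin_map R M N h \<longleftrightarrow> h \<in> carrier M \<rightarrow> carrier N \<and>
     (\<forall>x\<in>carrier M. \<forall>y\<in>carrier M. h (x \<oplus>\<^bsub>M\<^esub> y) = h x \<oplus>\<^bsub>N\<^esub> h y) \<and>
     (\<forall>a\<in>carrier R. \<forall>x\<in>carrier M. h (a \<odot>\<^bsub>M\<^esub> x) = a \<odot>\<^bsub>N\<^esub> h x)"

lemma lin_mapD:
  assumes "lin_map R M N h"
  shows "\<And>x. x \<in> carrier M \<Longrightarrow> h x \<in> carrier N"
    and "\<And>x y. x \<in> carrier M \<Longrightarrow> y \<in> carrier M \<Longrightarrow> h (x \<oplus>\<^bsub>M\<^esub> y) = h x \<oplus>\<^bsub>N\<^esub> h y"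
    and "\<And>a x. a \<in> carrier R \<Longrightarrow> x \<in> carrier M \<Longrightarrow> h (a \<odot>\<^bsub>M\<^esub> x) = a \<odot>\<^bsub>N\<^esub> h x"
  using assms unfolding lin_map_def by auto

lemma lin_mapI:
  assumes "\<And>x. x \<in> carrier M \<Longrightarrow> h x \<in> carrier N"
    and "\<And>x y. x \<in> carrier M \<Longrightarrow> y \<in> carrier M \<Longrightarrow> h (x \<oplus>\<^bsub>M\<^esub> y) = h x \<oplus>\<^bsub>N\<^esub> h y"
    and "\<And>a x. a \<in> carrier R \<Longrightarrow> x \<in> carrier M \<Longrightarrow> h (a \<odot>\<^bsub>M\<^esub> x) = a \<odot>\<^bsub>N\<^esub> h x"
  shows "lin_map R M N h"
  using assms unfolding lin_map_def by auto

lemma lin_map_comp: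
  "lin_map R M N g \<Longrightarrow> lin_map R N L h \<Longrightarrow> lin_map R M L (\<lambda>x. h (g x))"
  unfolding lin_map_def by (auto simp: Pi_iff)

lemma lin_map_zero:
  assumes "module R M" "module R N" "lin_map R M N h" shows "h \<zero>\<^bsub>M\<^esub> = \<zero>\<^bsub>N\<^esub>"
proof -
  interpret M: module R M by fact
  interpret N: module R N by fact
  have "h (\<zero>\<^bsub>R\<^esub> \<odot>\<^bsub>M\<^esub> \<zero>\<^bsub>M\<^esub>) = \<zero>\<^bsub>R\<^esub> \<odot>\<^bsub>N\<^esub> h \<zero>\<^bsub>M\<^esub>"
    by (rule lin_mapD(3)[OF assms(3)]) auto
  thus ?thesis using lin_mapD(1)[OF assms(3) M.M.zero_closed] by simp
qed

lemma lin_map_inv: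
  assumes "module R M" "module R N" "lin_map R M N h" "x \<in> carrier M"
  shows "h (\<ominus>\<^bsub>M\<^esub> x) = \<ominus>\<^bsub>N\<^esub> h x"
proof -
  interpret M: module R M by fact
  interpret N: module R N by fact
  have "h (\<ominus>\<^bsub>R\<^esub> \<one>\<^bsub>R\<^esub> \<odot>\<^bsub>M\<^esub> x) = \<ominus>\<^bsub>R\<^esub> \<one>\<^bsub>R\<^esub> \<odot>\<^bsub>N\<^esub> h x"
    by (rule lin_mapD(3)[OF assms(3)]) (use assms(4) in auto)
  thus ?thesis using lin_mapD(1)[OF assms(3)] assms(4) by (simp add: M.smult_l_minus N.smult_l_minus)
qed

lemma lin_map_minus:
  assumes "module R M" "module R N" "lin_map R M N h" "x \<in> carrier M" "y \<in> carrier M"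
  shows "h (x \<ominus>\<^bsub>M\<^esub> y) = h x \<ominus>\<^bsub>N\<^esub> h y"
proof -
  interpret M: module R M by fact
  show ?thesis unfolding a_minus_def
    using lin_mapD[OF assms(3)] lin_map_inv[OF assms(1-3)] assms(4,5) by simp
qed

lemma lin_map_vimage_submodule:
  assumes "module R M" "module R N" "lin_map R M N h" "submodule L R N"
  shows "submodule {x \<in> carrier M. h x \<in> L} R M"
proof -
  interpret M: module R M by fact
  interpret N: module R N by fact
  show ?thesis
    by (rule M.submoduleI') (use lin_mapD[OF assms(3)] lin_map_zero[OF assms(1-3)] N.submoduleD[OF assms(4)] in auto)
qed

lemma (in module) zero_submodule: "submodule {\<zero>\<^bsub>M\<^esub>} R M"
  by (rule submoduleI') auto

lemma lin_map_image_submodule: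
  assumes "module R M" "module R N" "lin_map R M N h" "submodule L R M"
  shows "submodule (h ` L) R N"
proof -
  interpret M: module R M by fact
  interpret N: module R N by fact
  note L = M.submoduleD[OF assms(4)]
  show ?thesis
  proof (rule N.submoduleI')
    show "h ` L \<subseteq> carrier N" using L lin_mapD[OF assms(3)] by auto
    show "\<zero>\<^bsub>N\<^esub> \<in> h ` L" using L lin_map_zero[OF assms(1-3)] by (metis image_eqI)
    show "a \<oplus>\<^bsub>N\<^esub> b \<in> h ` L" if "a \<in> h ` L" "b \<in> h ` L" for a b
    proof -
      obtain x y where "x \<in> L" "y \<in> L" "a = h x" "b = h y" using \<open>a \<in> h ` L\<close> \<open>b \<in> h ` L\<close> by auto
      then have "a \<oplus>\<^bsub>N\<^esub> b = h (x \<oplus>\<^bsub>M\<^esub> y)" "x \<oplus>\<^bsub>M\<^esub> y \<in> L" using lin_mapD[OF assms(3)] L by auto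
      thus ?thesis by blast
    qed
    show "a \<odot>\<^bsub>N\<^esub> x \<in> h ` L" if "a \<in> carrier R" "x \<in> h ` L" for a x
    proof -
      obtain y where "y \<in> L" "x = h y" using \<open>x \<in> h ` L\<close> by auto
      then have "a \<odot>\<^bsub>N\<^esub> x = h (a \<odot>\<^bsub>M\<^esub> y)" "a \<odot>\<^bsub>M\<^esub> y \<in> L" using lin_mapD[OF assms(3)] L \<open>a \<in> carrier R\<close> by auto
      thus ?thesis by blast
    qed
  qed
qed

subsection \<open>Spans\<close>

lemma (in module) submodule_Inter:
  assumes "\<And>N. N \<in> \<N> \<Longrightarrow> submodule N R M" "\<N> \<noteq> {}"
  shows "submodule (\<Inter>\<N>) R M"
proof -
  note D = submoduleD[OF assms(1)]
  show ?thesis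
  proof (rule submoduleI')
    show "\<Inter>\<N> \<subseteq> carrier M" using D(1) assms(2) by blast
  qed (use D(3,4,7) in blast)+
qed

lemma (in module) span_submodule:
  assumes "S \<subseteq> carrier M" shows "submodule (submodule_span R M S) R M"
  unfolding submodule_span_def
  using submodule_Inter[of "{N. submodule N R M \<and> S \<subseteq> N}"] assms carrier_is_submodule by blast

lemma (in module) span_incl: "S \<subseteq> submodule_span R M S"
  unfolding submodule_span_def by auto

lemma (in module) span_incl': "x \<in> S \<Longrightarrow> x \<in> submodule_span R M S"
  unfolding submodule_span_def by auto

lemma (in module) span_least: "submodule N R M \<Longrightarrow> S \<subseteq> N \<Longrightarrow> submodule_span R M S \<subseteq> N"
  unfolding submodule_span_def by auto

lemma (in module) span_mono: "S \<subseteq> T \<Longrightarrow> submodule_span R M S \<subseteq> submodule_span R M T"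
  unfolding submodule_span_def by auto

subsection \<open>Quotients\<close>

context module begin

lemma coset_eq_iff:
  assumes "submodule N R M" "x \<in> carrier M" "y \<in> carrier M"
  shows "N +>\<^bsub>M\<^esub> x = N +>\<^bsub>M\<^esub> y \<longleftrightarrow> x \<ominus>\<^bsub>M\<^esub> y \<in> N"
proof -
  have sg: "subgroup N (add_monoid M)" using assms(1) submodule.axioms(1) by blast
  note N = submoduleD[OF assms(1)]
  show ?thesis
  proof
    assume "N +>\<^bsub>M\<^esub> x = N +>\<^bsub>M\<^esub> y"
    then have "N +>\<^bsub>M\<^esub> (x \<oplus>\<^bsub>M\<^esub> (\<ominus>\<^bsub>M\<^esub> y)) = N" using a_coset_add_inv2 assms N by blast
    then show "x \<ominus>\<^bsub>M\<^esub> y \<in> N" unfolding a_minus_def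
      using M.a_coset_join1 sg assms by (metis M.add.m_closed M.a_inv_closed)
  next
    assume *: "x \<ominus>\<^bsub>M\<^esub> y \<in> N"
    have "N +>\<^bsub>M\<^esub> (x \<oplus>\<^bsub>M\<^esub> (\<ominus>\<^bsub>M\<^esub> y)) = N"
      using M.a_coset_join2[OF _ sg] * assms unfolding a_minus_def by simp
    then show "N +>\<^bsub>M\<^esub> x = N +>\<^bsub>M\<^esub> y" using M.a_coset_add_inv1 assms N by blast
  qed
qed

lemma coset_eq_zero:
  assumes "submodule N R M" "x \<in> carrier M"
  shows "N +>\<^bsub>M\<^esub> x = N \<longleftrightarrow> x \<in> N"
proof -
  have "N +>\<^bsub>M\<^esub> \<zero>\<^bsub>M\<^esub> = N" using submoduleD(1)[OF assms(1)] by simp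
  moreover have "\<ominus>\<^bsub>M\<^esub> \<zero>\<^bsub>M\<^esub> = \<zero>\<^bsub>M\<^esub>" by (metis M.r_neg M.l_zero M.zero_closed M.a_inv_closed)
  then have "x \<ominus>\<^bsub>M\<^esub> \<zero>\<^bsub>M\<^esub> = x" using assms(2) by (simp only: a_minus_def M.r_zero)
  ultimately show ?thesis using coset_eq_iff[OF assms M.zero_closed] by simp
qed

lemma coset_self: "submodule N R M \<Longrightarrow> x \<in> carrier M \<Longrightarrow> x \<in> N +>\<^bsub>M\<^esub> x"
  using abelian_subgroup.a_rcos_self abelian_subgroup_submodule by metis

lemma coset_mem: "submodule N R M \<Longrightarrow> x \<in> carrier M \<Longrightarrow> y \<in> N +>\<^bsub>M\<^esub> x \<Longrightarrow>
  y \<in> carrier M \<and> N +>\<^bsub>M\<^esub> y = N +>\<^bsub>M\<^esub> x"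
  using M.a_repr_independence[OF _ _ submodule.axioms(1)] M.a_r_coset_subset_G[OF submoduleD(1)] by blast

lemma coset_add:
  "submodule N R M \<Longrightarrow> x \<in> carrier M \<Longrightarrow> y \<in> carrier M \<Longrightarrow>
   (N +>\<^bsub>M\<^esub> x) <+>\<^bsub>M\<^esub> (N +>\<^bsub>M\<^esub> y) = N +>\<^bsub>M\<^esub> (x \<oplus>\<^bsub>M\<^esub> y)"
  using abelian_subgroup.a_rcos_sum abelian_subgroup_submodule by metis

lemma quot_carrier: "carrier (quot_module M N) = {N +>\<^bsub>M\<^esub> x | x. x \<in> carrier M}"
  unfolding quot_module_def A_RCOSETS_def' by auto

lemma quot_zero: "\<zero>\<^bsub>quot_module M N\<^esub> = N" unfolding quot_module_def by simp

lemma quot_add: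
  "submodule N R M \<Longrightarrow> x \<in> carrier M \<Longrightarrow> y \<in> carrier M \<Longrightarrow>
   (N +>\<^bsub>M\<^esub> x) \<oplus>\<^bsub>quot_module M N\<^esub> (N +>\<^bsub>M\<^esub> y) = N +>\<^bsub>M\<^esub> (x \<oplus>\<^bsub>M\<^esub> y)"
  using coset_add unfolding quot_module_def by simp

lemma quot_smult:
  assumes "submodule N R M" "a \<in> carrier R" "x \<in> carrier M"
  shows "a \<odot>\<^bsub>quot_module M N\<^esub> (N +>\<^bsub>M\<^esub> x) = N +>\<^bsub>M\<^esub> (a \<odot>\<^bsub>M\<^esub> x)"
proof -
  have "N +>\<^bsub>M\<^esub> (a \<odot>\<^bsub>M\<^esub> y) = N +>\<^bsub>M\<^esub> (a \<odot>\<^bsub>M\<^esub> x)" if y: "y \<in> N +>\<^bsub>M\<^esub> x" for y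
  proof -
    have y': "y \<in> carrier M" "y \<ominus>\<^bsub>M\<^esub> x \<in> N" using coset_mem[OF assms(1,3) y] coset_eq_iff assms by auto
    have "a \<odot>\<^bsub>M\<^esub> (y \<ominus>\<^bsub>M\<^esub> x) \<in> N" by (rule submoduleD(7)[OF assms(1,2) y'(2)])
    then have "a \<odot>\<^bsub>M\<^esub> y \<ominus>\<^bsub>M\<^esub> a \<odot>\<^bsub>M\<^esub> x \<in> N"
      using assms y' by (simp add: a_minus_def smult_r_distr smult_r_minus)
    then show ?thesis using coset_eq_iff assms y' by auto
  qed
  then have "(\<Union>y\<in>N +>\<^bsub>M\<^esub> x. N +>\<^bsub>M\<^esub> (a \<odot>\<^bsub>M\<^esub> y)) = N +>\<^bsub>M\<^esub> (a \<odot>\<^bsub>M\<^esub> x)"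
    using coset_self[OF assms(1,3)] by blast
  then show ?thesis unfolding quot_module_def by simp
qed

lemma quot_zero': "submodule N R M \<Longrightarrow> \<zero>\<^bsub>quot_module M N\<^esub> = N +>\<^bsub>M\<^esub> \<zero>\<^bsub>M\<^esub>"
  using coset_eq_zero[of N "\<zero>\<^bsub>M\<^esub>"] submoduleD(3) quot_zero by auto

lemma quot_is_module:
  assumes "submodule N R M" shows "module R (quot_module M N)"
proof (rule moduleI)
  show "cring R" using R.is_cring .
  show "abelian_group (quot_module M N)"
  proof (rule abelian_groupI)
    show "\<exists>y\<in>carrier (quot_module M N). y \<oplus>\<^bsub>quot_module M N\<^esub> x = \<zero>\<^bsub>quot_module M N\<^esub>"
      if x: "x \<in> carrier (quot_module M N)" for x
    proof -
      obtain z where "z \<in> carrier M" "x = N +>\<^bsub>M\<^esub> z" using x by (auto simp: quot_carrier)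
      then have "(N +>\<^bsub>M\<^esub> (\<ominus>\<^bsub>M\<^esub> z)) \<oplus>\<^bsub>quot_module M N\<^esub> x = \<zero>\<^bsub>quot_module M N\<^esub>"
        "N +>\<^bsub>M\<^esub> (\<ominus>\<^bsub>M\<^esub> z) \<in> carrier (quot_module M N)"
        using quot_add[OF assms] by (auto simp: M.l_neg quot_zero'[OF assms] quot_carrier)
      then show ?thesis by blast
    qed
  qed (auto simp: quot_carrier quot_add[OF assms] quot_zero'[OF assms] M.a_ac)
qed (auto simp: quot_carrier quot_add[OF assms] quot_smult[OF assms] smult_l_distr smult_r_distr smult_assoc1)

lemma quot_lin: "submodule N R M \<Longrightarrow> lin_map R M (quot_module M N) (\<lambda>x. N +>\<^bsub>M\<^esub> x)"
  by (rule lin_mapI) (auto simp: quot_carrier quot_add quot_smult)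

end

text \<open>The induced map evaluates \<open>h\<close> at a chosen representative of the coset; two
  representatives differ by an element of \<open>N\<close>, where \<open>h\<close> vanishes.\<close>

lemma quot_induced:
  assumes "module R M" "module R L" "submodule N R M" "lin_map R M L h"
    "\<And>x. x \<in> N \<Longrightarrow> h x = \<zero>\<^bsub>L\<^esub>"
  obtains g where "lin_map R (quot_module M N) L g" "\<And>x. x \<in> carrier M \<Longrightarrow> g (N +>\<^bsub>M\<^esub> x) = h x"
proof -
  interpret M: module R M by fact
  interpret L: module R L by fact
  define g where "g U = h (SOME x. x \<in> U)" for U
  have eq: "g (N +>\<^bsub>M\<^esub> x) = h x" if x: "x \<in> carrier M" for x
  proof -
    have "(SOME y. y \<in> N +>\<^bsub>M\<^esub> x) \<in> N +>\<^bsub>M\<^esub> x" using M.coset_self[OF assms(3) x] by (metis someI)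
    then obtain y where y: "y = (SOME y. y \<in> N +>\<^bsub>M\<^esub> x)" "y \<in> N +>\<^bsub>M\<^esub> x" by blast
    then have y': "y \<in> carrier M" "y \<ominus>\<^bsub>M\<^esub> x \<in> N"
      using M.coset_mem[OF assms(3) x y(2)] M.coset_eq_iff[OF assms(3) _ x] by auto
    have "h y \<ominus>\<^bsub>L\<^esub> h x = \<zero>\<^bsub>L\<^esub>" using assms(5)[OF y'(2)] lin_map_minus[OF assms(1,2,4) y'(1) x] by simp
    then have "h y = h x" using L.M.minus_zero_iff[OF lin_mapD(1)[OF assms(4) y'(1)] lin_mapD(1)[OF assms(4) x]] by simp
    then show ?thesis unfolding g_def y(1) .
  qed
  have "lin_map R (quot_module M N) L g"
  proof (rule lin_mapI)
    fix U assume "U \<in> carrier (quot_module M N)"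
    then obtain x where x: "x \<in> carrier M" "U = N +>\<^bsub>M\<^esub> x" by (auto simp: M.quot_carrier)
    show "g U \<in> carrier L" using x eq lin_mapD(1)[OF assms(4)] by simp
    show "g (a \<odot>\<^bsub>quot_module M N\<^esub> U) = a \<odot>\<^bsub>L\<^esub> g U" if a: "a \<in> carrier R" for a
      using x a eq lin_mapD(3)[OF assms(4)] by (simp add: M.quot_smult[OF assms(3)])
    fix V assume "V \<in> carrier (quot_module M N)"
    then obtain y where y: "y \<in> carrier M" "V = N +>\<^bsub>M\<^esub> y" by (auto simp: M.quot_carrier)
    show "g (U \<oplus>\<^bsub>quot_module M N\<^esub> V) = g U \<oplus>\<^bsub>L\<^esub> g V"
      using x y eq lin_mapD(2)[OF assms(4)] by (simp add: M.quot_add[OF assms(3)])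
  qed
  then show ?thesis using that eq by blast
qed

subsection \<open>Free modules\<close>

lemma free_simps:
  "carrier (free_module R S) = {p. (\<forall>x. p x \<in> carrier R) \<and> {x. p x \<noteq> \<zero>\<^bsub>R\<^esub>} \<subseteq> S \<and> finite {x. p x \<noteq> \<zero>\<^bsub>R\<^esub>}}"
  "\<zero>\<^bsub>free_module R S\<^esub> = (\<lambda>x. \<zero>\<^bsub>R\<^esub>)"
  "p \<oplus>\<^bsub>free_module R S\<^esub> q = (\<lambda>x. p x \<oplus>\<^bsub>R\<^esub> q x)"
  "a \<odot>\<^bsub>free_module R S\<^esub> p = (\<lambda>x. a \<otimes>\<^bsub>R\<^esub> p x)"
  by (auto simp: free_module_def)

lemma free_is_module:
  fixes R (structure)
  assumes "cring R" shows "module R (free_module R S)"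
proof -
  interpret cring R by fact
  have add: "(\<lambda>x. p x \<oplus> q x) \<in> carrier (free_module R S)"
    if "p \<in> carrier (free_module R S)" "q \<in> carrier (free_module R S)" for p q
  proof -
    have "{x. p x \<oplus> q x \<noteq> \<zero>} \<subseteq> {x. p x \<noteq> \<zero>} \<union> {x. q x \<noteq> \<zero>}" by auto
    moreover have "finite ({x. p x \<noteq> \<zero>} \<union> {x. q x \<noteq> \<zero>})" "{x. p x \<noteq> \<zero>} \<union> {x. q x \<noteq> \<zero>} \<subseteq> S"
      using that by (auto simp: free_simps)
    ultimately show ?thesis using that unfolding free_simps by (auto intro: finite_subset)
  qed
  have smult: "(\<lambda>x. a \<otimes> p x) \<in> carrier (free_module R S)"
    if "p \<in> carrier (free_module R S)" "a \<in> carrier R" for p a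
  proof -
    have "{x. a \<otimes> p x \<noteq> \<zero>} \<subseteq> {x. p x \<noteq> \<zero>}" using that by auto
    then show ?thesis using that unfolding free_simps by (auto intro: finite_subset)
  qed
  show ?thesis
  proof (rule moduleI)
    show "abelian_group (free_module R S)"
    proof (rule abelian_groupI)
      show "\<exists>q\<in>carrier (free_module R S). q \<oplus>\<^bsub>free_module R S\<^esub> p = \<zero>\<^bsub>free_module R S\<^esub>"
        if p: "p \<in> carrier (free_module R S)" for p
        using smult[OF p, of "\<ominus> \<one>"] p
        by (intro bexI[of _ "\<lambda>x. \<ominus> \<one> \<otimes> p x"]) (auto simp: free_simps l_minus l_neg fun_eq_iff)
    qed (use add in \<open>auto simp: free_simps a_ac fun_eq_iff\<close>)
  qed (use smult is_cring in \<open>auto simp: free_simps l_distr r_distr m_assoc fun_eq_iff\<close>)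
qed

lemma basis_elt_closed:
  fixes R (structure)
  assumes "cring R" "x \<in> S" shows "basis_elt R x \<in> carrier (free_module R S)"
proof -
  interpret cring R by fact
  have "{y. basis_elt R x y \<noteq> \<zero>} \<subseteq> {x}" by (auto simp: basis_elt_def)
  then show ?thesis using \<open>x \<in> S\<close> by (auto simp: free_simps basis_elt_def intro: finite_subset)
qed

text \<open>An element is built up from basis elements by induction on a finite set containing its
  support. The two index sets allow a submodule of the free module on all lists to be tested on
  elements supported on lists of one length.\<close>

lemma free_induct:
  fixes R (structure)
  assumes R: "cring R" and N: "submodule N R (free_module R S')"
    and S: "\<And>x. x \<in> S \<Longrightarrow> basis_elt R x \<in> N" and p: "p \<in> carrier (free_module R S)"
  shows "p \<in> N"
proof -
  interpret cring R by fact
  interpret F: module R "free_module R S'" by (rule free_is_module[OF R])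
  have "p \<in> N" if "finite U" "{x. p x \<noteq> \<zero>} \<subseteq> U" "U \<subseteq> S" "\<And>x. p x \<in> carrier R" for U p
    using that
  proof (induction U arbitrary: p)
    case empty
    then have "p = (\<lambda>x. \<zero>)" by auto
    then show ?case using F.submoduleD(3)[OF N] by (simp add: free_simps)
  next
    case (insert x U)
    define q where "q = (\<lambda>y. if y = x then \<zero> else p y)"
    have "q \<in> N" by (rule insert.IH) (use insert in \<open>auto simp: q_def\<close>)
    moreover have "p x \<odot>\<^bsub>free_module R S'\<^esub> basis_elt R x \<in> N"
      using insert by (intro F.submoduleD(7)[OF N] S) auto
    ultimately have "p x \<odot>\<^bsub>free_module R S'\<^esub> basis_elt R x \<oplus>\<^bsub>free_module R S'\<^esub> q \<in> N"
      by (rule F.submoduleD(4)[OF N, rotated])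
    moreover have "p x \<odot>\<^bsub>free_module R S'\<^esub> basis_elt R x \<oplus>\<^bsub>free_module R S'\<^esub> q = p"
      using insert.prems by (auto simp: free_simps q_def basis_elt_def)
    ultimately show ?case by simp
  qed
  from this[of "{x. p x \<noteq> \<zero>}" p] p show ?thesis by (auto simp: free_simps)
qed

definition free_ext where
  "free_ext R M g p = (\<Oplus>\<^bsub>M\<^esub>x\<in>{x. p x \<noteq> \<zero>\<^bsub>R\<^esub>}. p x \<odot>\<^bsub>M\<^esub> g x)"

lemma free_ext:
  fixes R (structure)
  assumes "module R M" "\<And>x. x \<in> S \<Longrightarrow> g x \<in> carrier M"
  shows "lin_map R (free_module R S) M (free_ext R M g)"
    and "\<And>x. x \<in> S \<Longrightarrow> free_ext R M g (basis_elt R x) = g x"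
proof -
  interpret module R M by fact
  \<comment> \<open>The support may be enlarged to any finite subset of \<open>S\<close>; this
    brings \<open>p\<close>, \<open>q\<close> and their sum over a common index set.\<close>
  have ext: "free_ext R M g p = (\<Oplus>\<^bsub>M\<^esub>x\<in>U. p x \<odot>\<^bsub>M\<^esub> g x)"
    if "finite U" "U \<subseteq> S" "{x. p x \<noteq> \<zero>} \<subseteq> U" "\<And>x. p x \<in> carrier R" for p U
    unfolding free_ext_def by (rule M.add.finprod_mono_neutral_cong) (use that assms in \<open>auto intro: finite_subset\<close>)
  show "lin_map R (free_module R S) M (free_ext R M g)"
  proof (rule lin_mapI)
    fix p assume p: "p \<in> carrier (free_module R S)"
    then have p': "finite {x. p x \<noteq> \<zero>}" "{x. p x \<noteq> \<zero>} \<subseteq> S" "\<And>x. p x \<in> carrier R" by (auto simp: free_simps)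
    show "free_ext R M g p \<in> carrier M" unfolding free_ext_def
      by (rule M.finsum_closed) (use p' assms in auto)
    show "free_ext R M g (a \<odot>\<^bsub>free_module R S\<^esub> p) = a \<odot>\<^bsub>M\<^esub> free_ext R M g p" if a: "a \<in> carrier R" for a
    proof -
      have "free_ext R M g (a \<odot>\<^bsub>free_module R S\<^esub> p) = (\<Oplus>\<^bsub>M\<^esub>x\<in>{x. p x \<noteq> \<zero>}. (a \<otimes> p x) \<odot>\<^bsub>M\<^esub> g x)"
        by (subst ext[of "{x. p x \<noteq> \<zero>}"]) (use a p' in \<open>auto simp: free_simps\<close>)
      also have "\<dots> = (\<Oplus>\<^bsub>M\<^esub>x\<in>{x. p x \<noteq> \<zero>}. a \<odot>\<^bsub>M\<^esub> (p x \<odot>\<^bsub>M\<^esub> g x))"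
        by (rule M.finsum_cong') (use a p' assms in \<open>auto simp: smult_assoc1\<close>)
      also have "\<dots> = a \<odot>\<^bsub>M\<^esub> free_ext R M g p" unfolding free_ext_def
        by (rule finsum_smult_ldistr[symmetric]) (use a p' assms in auto)
      finally show ?thesis .
    qed
    fix q assume q: "q \<in> carrier (free_module R S)"
    then have q': "finite {x. q x \<noteq> \<zero>}" "{x. q x \<noteq> \<zero>} \<subseteq> S" "\<And>x. q x \<in> carrier R" by (auto simp: free_simps)
    define U where "U = {x. p x \<noteq> \<zero>} \<union> {x. q x \<noteq> \<zero>}"
    have U: "finite U" "U \<subseteq> S" "{x. p x \<noteq> \<zero>} \<subseteq> U" "{x. q x \<noteq> \<zero>} \<subseteq> U" using p' q' by (auto simp: U_def)
    have "free_ext R M g (p \<oplus>\<^bsub>free_module R S\<^esub> q) = (\<Oplus>\<^bsub>M\<^esub>x\<in>U. (p x \<oplus> q x) \<odot>\<^bsub>M\<^esub> g x)"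
      by (subst ext[OF U(1,2)]) (use p' q' in \<open>auto simp: free_simps U_def\<close>)
    also have "\<dots> = (\<Oplus>\<^bsub>M\<^esub>x\<in>U. p x \<odot>\<^bsub>M\<^esub> g x \<oplus>\<^bsub>M\<^esub> q x \<odot>\<^bsub>M\<^esub> g x)"
      by (rule M.finsum_cong') (use p' q' U assms in \<open>auto simp: smult_l_distr\<close>)
    also have "\<dots> = free_ext R M g p \<oplus>\<^bsub>M\<^esub> free_ext R M g q"
      unfolding ext[OF U(1-3) p'(3)] ext[OF U(1,2,4) q'(3)]
      by (rule M.finsum_addf) (use p' q' U assms in auto)
    finally show "free_ext R M g (p \<oplus>\<^bsub>free_module R S\<^esub> q) = free_ext R M g p \<oplus>\<^bsub>M\<^esub> free_ext R M g q" .
  qed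
  show "free_ext R M g (basis_elt R x) = g x" if "x \<in> S" for x
    by (subst ext[of "{x}"]) (use that assms in \<open>auto simp: basis_elt_def\<close>)
qed

subsection \<open>Restriction of scalars\<close>

definition restr :: "('a \<Rightarrow> 'b) \<Rightarrow> ('b, 'c, 'd) module_scheme \<Rightarrow> ('a, 'c) module" where
  "restr \<pi> Z = \<lparr>carrier = carrier Z, monoid.mult = monoid.mult Z, one = one Z, ring.zero = ring.zero Z,
     ring.add = ring.add Z, smult = (\<lambda>a z. \<pi> a \<odot>\<^bsub>Z\<^esub> z)\<rparr>"

lemma restr_simps [simp]:
  "carrier (restr \<pi> Z) = carrier Z" "\<zero>\<^bsub>restr \<pi> Z\<^esub> = \<zero>\<^bsub>Z\<^esub>"
  "x \<oplus>\<^bsub>restr \<pi> Z\<^esub> y = x \<oplus>\<^bsub>Z\<^esub> y" "a \<odot>\<^bsub>restr \<pi> Z\<^esub> z = \<pi> a \<odot>\<^bsub>Z\<^esub> z"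
  by (simp_all add: restr_def)

lemma restr_a_inv [simp]: "a_inv (restr \<pi> Z) = a_inv Z" "x \<ominus>\<^bsub>restr \<pi> Z\<^esub> y = x \<ominus>\<^bsub>Z\<^esub> y"
  by (simp_all add: a_inv_def m_inv_def a_minus_def fun_eq_iff)

lemma restr_is_module:
  assumes "cring A" "module B Z" "\<pi> \<in> ring_hom A B"
  shows "module A (restr \<pi> Z)"
proof -
  interpret A: cring A by fact
  interpret Z: module B Z by fact
  note h = ring_hom_closed[OF assms(3)] ring_hom_add[OF assms(3)] ring_hom_mult[OF assms(3)] ring_hom_one[OF assms(3)]
  show ?thesis
  proof (rule moduleI)
    show "abelian_group (restr \<pi> Z)"
    proof (rule abelian_groupI)
      fix x assume "x \<in> carrier (restr \<pi> Z)"
      then show "\<exists>y\<in>carrier (restr \<pi> Z). y \<oplus>\<^bsub>restr \<pi> Z\<^esub> x = \<zero>\<^bsub>restr \<pi> Z\<^esub>"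
        using Z.M.l_neg by (intro bexI[of _ "\<ominus>\<^bsub>Z\<^esub> x"]) auto
    qed (auto simp: Z.M.a_ac)
  qed (use assms in \<open>auto simp: h Z.smult_l_distr Z.smult_r_distr Z.smult_assoc1\<close>)
qed

lemma restr_lin:
  "\<pi> \<in> ring_hom A B \<Longrightarrow> lin_map B Z Z' h \<Longrightarrow> lin_map A (restr \<pi> Z) (restr \<pi> Z') h"
  unfolding lin_map_def by (auto simp: ring_hom_closed)

text \<open>It makes ideals into submodules, so that spans, the local-global principle and
  Nakayama's lemma for modules apply to ideals and to elements of the ring.\<close>

definition self_module :: "('a, 'm) ring_scheme \<Rightarrow> ('a, 'a) module" where
  "self_module R = \<lparr>carrier = carrier R, monoid.mult = monoid.mult R, one = one R, ring.zero = ring.zero R,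
     ring.add = ring.add R, smult = monoid.mult R\<rparr>"

lemma self_module_simps [simp]:
  "carrier (self_module R) = carrier R" "\<zero>\<^bsub>self_module R\<^esub> = \<zero>\<^bsub>R\<^esub>"
  "x \<oplus>\<^bsub>self_module R\<^esub> y = x \<oplus>\<^bsub>R\<^esub> y" "a \<odot>\<^bsub>self_module R\<^esub> z = a \<otimes>\<^bsub>R\<^esub> z"
  by (simp_all add: self_module_def)

lemma self_module_a_inv [simp]: "a_inv (self_module R) = a_inv R" "x \<ominus>\<^bsub>self_module R\<^esub> y = x \<ominus>\<^bsub>R\<^esub> y"
  by (simp_all add: a_inv_def m_inv_def a_minus_def fun_eq_iff)

lemma self_is_module:
  fixes R (structure)
  assumes "cring R" shows "module R (self_module R)"
proof -
  interpret cring R by fact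
  show ?thesis
  proof (rule moduleI)
    show "abelian_group (self_module R)"
    proof (rule abelian_groupI)
      fix x assume "x \<in> carrier (self_module R)"
      then show "\<exists>y\<in>carrier (self_module R). y \<oplus>\<^bsub>self_module R\<^esub> x = \<zero>\<^bsub>self_module R\<^esub>"
        using l_neg by (intro bexI[of _ "\<ominus> x"]) auto
    qed (auto simp: a_ac)
  qed (auto simp: l_distr r_distr m_assoc is_cring)
qed

lemma self_submodule_iff:
  assumes "cring R" shows "submodule I R (self_module R) \<longleftrightarrow> ideal I R"
proof -
  interpret cring R by fact
  interpret S: module R "self_module R" by (rule self_is_module[OF assms])
  show ?thesis
  proof
    assume "submodule I R (self_module R)"
    note D = S.submoduleD[OF this]
    show "ideal I R"
    proof (rule idealI)
      show "subgroup I (add_monoid R)"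
        by (rule add.subgroupI) (use D in \<open>auto simp flip: a_inv_def\<close>)
      fix a x assume "a \<in> I" "x \<in> carrier R"
      then show "x \<otimes>\<^bsub>R\<^esub> a \<in> I" "a \<otimes>\<^bsub>R\<^esub> x \<in> I" using D(7)[of x a] D(2)[of a] m_comm[of a x] by auto
    qed (rule ring_axioms)
  next
    assume "ideal I R"
    then interpret ideal I R .
    show "submodule I R (self_module R)"
      by (rule S.submoduleI') (auto simp: a_subset[THEN subsetD] I_l_closed)
  qed
qed

subsection \<open>Kaehler differentials\<close>

definition derivation where
  "derivation K A \<iota> Z D \<longleftrightarrow> D \<in> carrier A \<rightarrow> carrier Z \<and>
     (\<forall>a\<in>carrier A. \<forall>b\<in>carrier A. D (a \<oplus>\<^bsub>A\<^esub> b) = D a \<oplus>\<^bsub>Z\<^esub> D b) \<and>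
     (\<forall>a\<in>carrier A. \<forall>b\<in>carrier A. D (a \<otimes>\<^bsub>A\<^esub> b) = a \<odot>\<^bsub>Z\<^esub> D b \<oplus>\<^bsub>Z\<^esub> b \<odot>\<^bsub>Z\<^esub> D a) \<and>
     (\<forall>c\<in>carrier K. D (\<iota> c) = \<zero>\<^bsub>Z\<^esub>)"

lemma derivationD:
  assumes "derivation K A \<iota> Z D"
  shows "\<And>a. a \<in> carrier A \<Longrightarrow> D a \<in> carrier Z"
    and "\<And>a b. a \<in> carrier A \<Longrightarrow> b \<in> carrier A \<Longrightarrow> D (a \<oplus>\<^bsub>A\<^esub> b) = D a \<oplus>\<^bsub>Z\<^esub> D b"
    and "\<And>a b. a \<in> carrier A \<Longrightarrow> b \<in> carrier A \<Longrightarrow> D (a \<otimes>\<^bsub>A\<^esub> b) = a \<odot>\<^bsub>Z\<^esub> D b \<oplus>\<^bsub>Z\<^esub> b \<odot>\<^bsub>Z\<^esub> D a"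
    and "\<And>c. c \<in> carrier K \<Longrightarrow> D (\<iota> c) = \<zero>\<^bsub>Z\<^esub>"
  using assms unfolding derivation_def by auto

locale kahler =
  fixes K :: "('k, 'l) ring_scheme" and A :: "('a, 'm) ring_scheme" and \<iota> :: "'k \<Rightarrow> 'a"
  assumes K: "cring K" and A: "cring A" and hom: "\<iota> \<in> ring_hom K A"
begin

abbreviation "\<Omega> \<equiv> kahler_module K A \<iota>"
abbreviation "d \<equiv> universal_derivation K A \<iota>"
abbreviation "F \<equiv> free_module A (carrier A)"

sublocale A: cring A by (rule A)
sublocale F: module A F by (rule free_is_module[OF A])

lemma iota_closed: "c \<in> carrier K \<Longrightarrow> \<iota> c \<in> carrier A"
  using hom by (rule ring_hom_closed)

lemma basis_closed: "a \<in> carrier A \<Longrightarrow> basis_elt A a \<in> carrier F"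
  by (rule basis_elt_closed[OF A])

lemma kahler_relations_closed: "kahler_relations K A \<iota> \<subseteq> carrier F"
  using iota_closed by (auto simp: kahler_relations_def Let_def intro!: F.M.minus_closed F.M.a_closed F.smult_closed basis_closed)

lemma kahler_span_submodule: "submodule (kahler_span K A \<iota>) A F"
  unfolding kahler_span_def by (rule F.span_submodule[OF kahler_relations_closed])

lemma Omega_module: "module A \<Omega>"
  unfolding kahler_module_def by (rule F.quot_is_module[OF kahler_span_submodule])

sublocale Om: module A \<Omega> by (rule Omega_module)

lemma d_derivation: "derivation K A \<iota> \<Omega> d"
proof -
  let ?S = "kahler_span K A \<iota>"
  note q = F.quot_lin[OF kahler_span_submodule, folded kahler_module_def]
  have rel: "x \<in> kahler_relations K A \<iota> \<Longrightarrow> x \<in> ?S" for x unfolding kahler_span_def by (rule F.span_incl')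
  have rel1: "basis_elt A (a \<oplus>\<^bsub>A\<^esub> b) \<ominus>\<^bsub>F\<^esub> (basis_elt A a \<oplus>\<^bsub>F\<^esub> basis_elt A b) \<in> ?S"
    and rel2: "basis_elt A (a \<otimes>\<^bsub>A\<^esub> b) \<ominus>\<^bsub>F\<^esub> (a \<odot>\<^bsub>F\<^esub> basis_elt A b \<oplus>\<^bsub>F\<^esub> b \<odot>\<^bsub>F\<^esub> basis_elt A a) \<in> ?S"
    if "a \<in> carrier A" "b \<in> carrier A" for a b
    by (rule rel, unfold kahler_relations_def Let_def, use that in blast)+
  note eq = F.coset_eq_iff[OF kahler_span_submodule, THEN iffD2]
  show ?thesis unfolding derivation_def
  proof (intro conjI ballI)
    show "d \<in> carrier A \<rightarrow> carrier \<Omega>"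
      using lin_mapD(1)[OF q basis_closed] by (auto simp: universal_derivation_def)
  next
    fix a b assume ab: "a \<in> carrier A" "b \<in> carrier A"
    have "d (a \<oplus>\<^bsub>A\<^esub> b) = ?S +>\<^bsub>F\<^esub> (basis_elt A a \<oplus>\<^bsub>F\<^esub> basis_elt A b)" unfolding universal_derivation_def
      by (rule eq) (use ab in \<open>auto intro!: F.M.a_closed basis_closed rel1\<close>)
    then show "d (a \<oplus>\<^bsub>A\<^esub> b) = d a \<oplus>\<^bsub>\<Omega>\<^esub> d b"
      using lin_mapD(2)[OF q basis_closed basis_closed] ab by (simp add: universal_derivation_def)
    have "d (a \<otimes>\<^bsub>A\<^esub> b) = ?S +>\<^bsub>F\<^esub> (a \<odot>\<^bsub>F\<^esub> basis_elt A b \<oplus>\<^bsub>F\<^esub> b \<odot>\<^bsub>F\<^esub> basis_elt A a)" unfolding universal_derivation_def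
      by (rule eq) (use ab in \<open>auto intro!: F.M.a_closed F.smult_closed basis_closed rel2\<close>)
    then show "d (a \<otimes>\<^bsub>A\<^esub> b) = a \<odot>\<^bsub>\<Omega>\<^esub> d b \<oplus>\<^bsub>\<Omega>\<^esub> b \<odot>\<^bsub>\<Omega>\<^esub> d a"
      using lin_mapD(2)[OF q F.smult_closed F.smult_closed] lin_mapD(3)[OF q] basis_closed ab by (simp add: universal_derivation_def)
  next
    fix c assume c: "c \<in> carrier K"
    then have "basis_elt A (\<iota> c) \<in> ?S" by (auto intro!: rel simp: kahler_relations_def Let_def)
    then show "d (\<iota> c) = \<zero>\<^bsub>\<Omega>\<^esub>" unfolding universal_derivation_def kahler_module_def F.quot_zero
      using F.coset_eq_zero[OF kahler_span_submodule basis_closed[OF iota_closed[OF c]]] by simp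
  qed
qed

lemmas d_simps = derivationD[OF d_derivation]

lemma Omega_induct:
  assumes "submodule N A \<Omega>" "\<And>a. a \<in> carrier A \<Longrightarrow> d a \<in> N" "w \<in> carrier \<Omega>"
  shows "w \<in> N"
proof -
  note q = F.quot_lin[OF kahler_span_submodule, folded kahler_module_def]
  obtain p where p: "p \<in> carrier F" "w = kahler_span K A \<iota> +>\<^bsub>F\<^esub> p"
    using assms(3) by (auto simp: kahler_module_def F.quot_carrier)
  have "p \<in> {p \<in> carrier F. kahler_span K A \<iota> +>\<^bsub>F\<^esub> p \<in> N}"
    by (rule free_induct[OF A lin_map_vimage_submodule[OF F.module_axioms Omega_module q assms(1)] _ p(1)])
      (use assms(2) basis_closed in \<open>auto simp: universal_derivation_def\<close>)
  then show ?thesis using p by simp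
qed

lemma Omega_universal:
  assumes "module A Z" "derivation K A \<iota> Z D"
  obtains g where "lin_map A \<Omega> Z g" "\<And>a. a \<in> carrier A \<Longrightarrow> g (d a) = D a"
proof -
  interpret Z: module A Z by fact
  note D = derivationD[OF assms(2)]
  note e = free_ext[OF assms(1), of "carrier A" D, OF D(1)]
  let ?e = "free_ext A Z D"
  note eqs = lin_mapD(2,3)[OF e(1)] lin_map_minus[OF F.module_axioms assms(1) e(1)]
  have sub: "submodule {x \<in> carrier F. ?e x \<in> {\<zero>\<^bsub>Z\<^esub>}} A F"
    by (rule lin_map_vimage_submodule[OF F.module_axioms assms(1) e(1) Z.zero_submodule])
  have "kahler_relations K A \<iota> \<subseteq> {x \<in> carrier F. ?e x \<in> {\<zero>\<^bsub>Z\<^esub>}}"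
  proof (intro subsetI CollectI conjI)
    fix x assume x: "x \<in> kahler_relations K A \<iota>"
    show "x \<in> carrier F" using x kahler_relations_closed by blast
    have z: "y \<in> carrier Z \<Longrightarrow> y \<ominus>\<^bsub>Z\<^esub> y = \<zero>\<^bsub>Z\<^esub>" for y by (simp add: Z.M.minus_zero_iff)
    show "?e x \<in> {\<zero>\<^bsub>Z\<^esub>}" using x unfolding kahler_relations_def Let_def
      by (auto simp: eqs e(2) basis_closed D z iota_closed)
  qed
  then have "kahler_span K A \<iota> \<subseteq> {x \<in> carrier F. ?e x \<in> {\<zero>\<^bsub>Z\<^esub>}}"
    unfolding kahler_span_def by (rule F.span_least[OF sub])
  then have "\<And>x. x \<in> kahler_span K A \<iota> \<Longrightarrow> ?e x = \<zero>\<^bsub>Z\<^esub>" by auto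
  from quot_induced[OF F.module_axioms assms(1) kahler_span_submodule e(1) this]
  obtain g where g: "lin_map A \<Omega> Z g" "\<And>x. x \<in> carrier F \<Longrightarrow> g (kahler_span K A \<iota> +>\<^bsub>F\<^esub> x) = ?e x"
    unfolding kahler_module_def by blast
  have "g (d a) = D a" if "a \<in> carrier A" for a
    unfolding universal_derivation_def using g(2)[OF basis_closed[OF that]] e(2)[of a] that by simp
  then show ?thesis using that g(1) by blast
qed

end

subsection \<open>Exterior algebra\<close>

text \<open>The module axioms do not see the multiplication and the unit of the record. Hence
  \<open>list_algebra\<close> inherits them from the free module, and \<open>exterior_power\<close>
  from a submodule of the exterior algebra.\<close>

lemma module_fields_cong:
  assumes "module R M" "carrier M' = carrier M" "ring.zero M' = ring.zero M" "ring.add M' = ring.add M" "smult M' = smult M"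
  shows "module R M'"
proof -
  interpret module R M by fact
  show ?thesis
  proof (rule moduleI)
    show "abelian_group M'"
    proof (rule abelian_groupI)
      fix x assume "x \<in> carrier M'"
      then show "\<exists>y\<in>carrier M'. y \<oplus>\<^bsub>M'\<^esub> x = \<zero>\<^bsub>M'\<^esub>"
        using M.l_neg by (intro bexI[of _ "\<ominus>\<^bsub>M\<^esub> x"]) (auto simp: assms)
    qed (auto simp: assms M.a_ac)
  qed (auto simp: assms smult_l_distr smult_r_distr smult_assoc1 R.is_cring)
qed

text \<open>One function on lists of all lengths stands for a family of alternating multilinear
  maps, one in each degree. Only adjacent equal entries are required to give zero, in accordance
  with the relations of the exterior algebra.\<close>

definition alternating where
  "alternating R M Z G \<longleftrightarrow>
     (\<forall>xs. set xs \<subseteq> carrier M \<longrightarrow> G xs \<in> carrier Z) \<and>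
     (\<forall>xs ys m m'. set xs \<subseteq> carrier M \<and> set ys \<subseteq> carrier M \<and> m \<in> carrier M \<and> m' \<in> carrier M \<longrightarrow>
        G (xs @ (m \<oplus>\<^bsub>M\<^esub> m') # ys) = G (xs @ m # ys) \<oplus>\<^bsub>Z\<^esub> G (xs @ m' # ys)) \<and>
     (\<forall>xs ys a m. set xs \<subseteq> carrier M \<and> set ys \<subseteq> carrier M \<and> a \<in> carrier R \<and> m \<in> carrier M \<longrightarrow>
        G (xs @ (a \<odot>\<^bsub>M\<^esub> m) # ys) = a \<odot>\<^bsub>Z\<^esub> G (xs @ m # ys)) \<and>
     (\<forall>xs ys m. set xs \<subseteq> carrier M \<and> set ys \<subseteq> carrier M \<and> m \<in> carrier M \<longrightarrow>
        G (xs @ m # m # ys) = \<zero>\<^bsub>Z\<^esub>)"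

lemma alternatingD:
  assumes "alternating R M Z G"
  shows "\<And>xs. set xs \<subseteq> carrier M \<Longrightarrow> G xs \<in> carrier Z"
    and "\<And>xs ys m m'. set xs \<subseteq> carrier M \<Longrightarrow> set ys \<subseteq> carrier M \<Longrightarrow> m \<in> carrier M \<Longrightarrow> m' \<in> carrier M \<Longrightarrow>
        G (xs @ (m \<oplus>\<^bsub>M\<^esub> m') # ys) = G (xs @ m # ys) \<oplus>\<^bsub>Z\<^esub> G (xs @ m' # ys)"
    and "\<And>xs ys a m. set xs \<subseteq> carrier M \<Longrightarrow> set ys \<subseteq> carrier M \<Longrightarrow> a \<in> carrier R \<Longrightarrow> m \<in> carrier M \<Longrightarrow>
        G (xs @ (a \<odot>\<^bsub>M\<^esub> m) # ys) = a \<odot>\<^bsub>Z\<^esub> G (xs @ m # ys)"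
    and "\<And>xs ys m. set xs \<subseteq> carrier M \<Longrightarrow> set ys \<subseteq> carrier M \<Longrightarrow> m \<in> carrier M \<Longrightarrow>
        G (xs @ m # m # ys) = \<zero>\<^bsub>Z\<^esub>"
  using assms unfolding alternating_def by blast+

lemma alternatingI:
  assumes "\<And>xs. set xs \<subseteq> carrier M \<Longrightarrow> G xs \<in> carrier Z"
    and "\<And>xs ys m m'. set xs \<subseteq> carrier M \<Longrightarrow> set ys \<subseteq> carrier M \<Longrightarrow> m \<in> carrier M \<Longrightarrow> m' \<in> carrier M \<Longrightarrow>
        G (xs @ (m \<oplus>\<^bsub>M\<^esub> m') # ys) = G (xs @ m # ys) \<oplus>\<^bsub>Z\<^esub> G (xs @ m' # ys)"
    and "\<And>xs ys a m. set xs \<subseteq> carrier M \<Longrightarrow> set ys \<subseteq> carrier M \<Longrightarrow> a \<in> carrier R \<Longrightarrow> m \<in> carrier M \<Longrightarrow>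
        G (xs @ (a \<odot>\<^bsub>M\<^esub> m) # ys) = a \<odot>\<^bsub>Z\<^esub> G (xs @ m # ys)"
    and "\<And>xs ys m. set xs \<subseteq> carrier M \<Longrightarrow> set ys \<subseteq> carrier M \<Longrightarrow> m \<in> carrier M \<Longrightarrow>
        G (xs @ m # m # ys) = \<zero>\<^bsub>Z\<^esub>"
  shows "alternating R M Z G"
  using assms unfolding alternating_def by blast

lemma alternating_lin:
  assumes "module R Z" "module R Z'" "alternating R M Z G" "lin_map R Z Z' h"
  shows "alternating R M Z' (\<lambda>xs. h (G xs))"
  by (rule alternatingI)
    (use alternatingD[OF assms(3)] lin_mapD[OF assms(4)] lin_map_zero[OF assms(1,2,4)] in simp_all)

lemma alternating_Cons:
  assumes "alternating R M Z G" "x \<in> carrier M" shows "alternating R M Z (\<lambda>l. G (x # l))"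
proof -
  note D = alternatingD[OF assms(1)]
  show ?thesis
    by (rule alternatingI)
      (use D(1) D(2)[of "x # _"] D(3)[of "x # _"] D(4)[of "x # _"] assms(2) in simp_all)
qed

lemma alternating_append:
  assumes "alternating R M Z G" "set us \<subseteq> carrier M" shows "alternating R M Z (\<lambda>l. G (us @ l))"
  using assms
proof (induction us arbitrary: G)
  case (Cons u us)
  have "alternating R M Z (\<lambda>l. G (u # l))" by (rule alternating_Cons) (use Cons.prems in auto)
  from Cons.IH[OF this] Cons.prems show ?case by simp
qed simp

locale exterior = module R M for R (structure) and M (structure)
begin

abbreviation "T \<equiv> list_algebra R M"
abbreviation "L \<equiv> lists (carrier M)"
abbreviation "E \<equiv> exterior_ideal R M"
abbreviation "Ext \<equiv> exterior_algebra R M"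
abbreviation "wl \<equiv> wedge_list R M"
abbreviation "\<delta> \<equiv> basis_elt R"

lemma T_simps:
  "carrier T = carrier (free_module R L)" "\<zero>\<^bsub>T\<^esub> = \<zero>\<^bsub>free_module R L\<^esub>"
  "ring.add T = ring.add (free_module R L)" "smult T = smult (free_module R L)"
  "(p \<otimes>\<^bsub>T\<^esub> q) = (\<lambda>xs. \<Oplus>i\<in>{0..length xs}. p (take i xs) \<otimes> q (drop i xs))"
  by (simp_all add: list_algebra_def)

lemma T_module: "module R T"
  by (rule module_fields_cong[OF free_is_module[OF R.is_cring, of L]]) (simp_all add: T_simps)

sublocale T: module R T by (rule T_module)

lemma delta_closed: "set xs \<subseteq> carrier M \<Longrightarrow> \<delta> xs \<in> carrier T"
  unfolding T_simps by (rule basis_elt_closed[OF R.is_cring]) auto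

lemma T_carrierD: "p \<in> carrier T \<Longrightarrow> p x \<in> carrier R"
  by (simp add: T_simps free_simps)

lemma T_sub_free: "submodule N R T \<longleftrightarrow> submodule N R (free_module R L)"
  by (simp add: submodule_def submodule_axioms_def subgroup_def T_simps m_inv_def)

lemma T_induct:
  assumes "submodule N R T" "\<And>xs. set xs \<subseteq> carrier M \<Longrightarrow> \<delta> xs \<in> N" "p \<in> carrier T"
  shows "p \<in> N"
  using free_induct[of R N L L p] assms R.is_cring unfolding T_sub_free T_simps by auto

text \<open>A nonzero coefficient of the product at a list forces a cut of that list into a prefix
  and a suffix from the two supports, so the support of the product is finite.\<close>

lemma conv_closed:
  assumes p: "p \<in> carrier T" and q: "q \<in> carrier T" shows "p \<otimes>\<^bsub>T\<^esub> q \<in> carrier T"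
proof -
  let ?sp = "{x. p x \<noteq> \<zero>}" and ?sq = "{x. q x \<noteq> \<zero>}"
  have fin: "finite ?sp" "finite ?sq" "?sp \<subseteq> L" "?sq \<subseteq> L" and
    cl: "\<And>x. p x \<in> carrier R" "\<And>x. q x \<in> carrier R"
    using p q by (auto simp: T_simps free_simps)
  have "{x. (p \<otimes>\<^bsub>T\<^esub> q) x \<noteq> \<zero>} \<subseteq> (\<lambda>(a, b). a @ b) ` (?sp \<times> ?sq)"
  proof
    fix x assume "x \<in> {x. (p \<otimes>\<^bsub>T\<^esub> q) x \<noteq> \<zero>}"
    then have "(\<Oplus>i\<in>{0..length x}. p (take i x) \<otimes> q (drop i x)) \<noteq> \<zero>" by (simp add: T_simps)
    then obtain i where "p (take i x) \<otimes> q (drop i x) \<noteq> \<zero>"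
      using R.add.finprod_one_eqI[of "{0..length x}" "\<lambda>i. p (take i x) \<otimes> q (drop i x)"] by auto
    then have "take i x \<in> ?sp" "drop i x \<in> ?sq" using cl by auto
    then show "x \<in> (\<lambda>(a, b). a @ b) ` (?sp \<times> ?sq)"
      by (intro image_eqI[of _ _ "(take i x, drop i x)"]) auto
  qed
  moreover have "finite ((\<lambda>(a, b). a @ b) ` (?sp \<times> ?sq))" "(\<lambda>(a, b). a @ b) ` (?sp \<times> ?sq) \<subseteq> L"
    using fin by (simp, fastforce simp: in_lists_conv_set subset_iff)
  ultimately have "{x. (p \<otimes>\<^bsub>T\<^esub> q) x \<noteq> \<zero>} \<subseteq> L" "finite {x. (p \<otimes>\<^bsub>T\<^esub> q) x \<noteq> \<zero>}"
    by (blast, blast intro: finite_subset)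
  moreover have "(p \<otimes>\<^bsub>T\<^esub> q) x \<in> carrier R" for x
    unfolding T_simps by (rule R.finsum_closed) (use cl in auto)
  ultimately show ?thesis unfolding T_simps(1) free_simps by blast
qed

lemma conv_left_lin:
  assumes p: "p \<in> carrier T" shows "lin_map R T T (\<lambda>q. p \<otimes>\<^bsub>T\<^esub> q)"
proof (rule lin_mapI)
  fix q assume q: "q \<in> carrier T"
  show "p \<otimes>\<^bsub>T\<^esub> q \<in> carrier T" by (rule conv_closed[OF p q])
  show "p \<otimes>\<^bsub>T\<^esub> (a \<odot>\<^bsub>T\<^esub> q) = a \<odot>\<^bsub>T\<^esub> (p \<otimes>\<^bsub>T\<^esub> q)" if a: "a \<in> carrier R" for a
  proof
    fix x
    have "(\<Oplus>i\<in>{0..length x}. p (take i x) \<otimes> (a \<otimes> q (drop i x)))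
      = (\<Oplus>i\<in>{0..length x}. a \<otimes> (p (take i x) \<otimes> q (drop i x)))"
      by (rule R.finsum_cong') (use T_carrierD[OF p] T_carrierD[OF q] a in \<open>auto simp: R.m_lcomm\<close>)
    also have "\<dots> = a \<otimes> (\<Oplus>i\<in>{0..length x}. p (take i x) \<otimes> q (drop i x))"
      by (rule R.finsum_rdistr[symmetric]) (use T_carrierD[OF p] T_carrierD[OF q] a in auto)
    finally show "(p \<otimes>\<^bsub>T\<^esub> (a \<odot>\<^bsub>T\<^esub> q)) x = (a \<odot>\<^bsub>T\<^esub> (p \<otimes>\<^bsub>T\<^esub> q)) x"
      by (simp add: T_simps free_simps)
  qed
  fix q' assume q': "q' \<in> carrier T"
  show "p \<otimes>\<^bsub>T\<^esub> (q \<oplus>\<^bsub>T\<^esub> q') = (p \<otimes>\<^bsub>T\<^esub> q) \<oplus>\<^bsub>T\<^esub> (p \<otimes>\<^bsub>T\<^esub> q')"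
  proof
    fix x
    have "(\<Oplus>i\<in>{0..length x}. p (take i x) \<otimes> (q (drop i x) \<oplus> q' (drop i x)))
      = (\<Oplus>i\<in>{0..length x}. p (take i x) \<otimes> q (drop i x) \<oplus> p (take i x) \<otimes> q' (drop i x))"
      by (rule R.finsum_cong') (use T_carrierD[OF p] T_carrierD[OF q] T_carrierD[OF q'] in \<open>auto simp: R.r_distr\<close>)
    also have "\<dots> = (\<Oplus>i\<in>{0..length x}. p (take i x) \<otimes> q (drop i x)) \<oplus> (\<Oplus>i\<in>{0..length x}. p (take i x) \<otimes> q' (drop i x))"
      by (rule R.finsum_addf) (use T_carrierD[OF p] T_carrierD[OF q] T_carrierD[OF q'] in auto)
    finally show "(p \<otimes>\<^bsub>T\<^esub> (q \<oplus>\<^bsub>T\<^esub> q')) x = ((p \<otimes>\<^bsub>T\<^esub> q) \<oplus>\<^bsub>T\<^esub> (p \<otimes>\<^bsub>T\<^esub> q')) x"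
      by (simp add: T_simps free_simps)
  qed
qed

lemma conv_right_lin:
  assumes q: "q \<in> carrier T" shows "lin_map R T T (\<lambda>p. p \<otimes>\<^bsub>T\<^esub> q)"
proof (rule lin_mapI)
  fix p assume p: "p \<in> carrier T"
  show "p \<otimes>\<^bsub>T\<^esub> q \<in> carrier T" by (rule conv_closed[OF p q])
  show "(a \<odot>\<^bsub>T\<^esub> p) \<otimes>\<^bsub>T\<^esub> q = a \<odot>\<^bsub>T\<^esub> (p \<otimes>\<^bsub>T\<^esub> q)" if a: "a \<in> carrier R" for a
  proof
    fix x
    have "(\<Oplus>i\<in>{0..length x}. a \<otimes> p (take i x) \<otimes> q (drop i x))
      = (\<Oplus>i\<in>{0..length x}. a \<otimes> (p (take i x) \<otimes> q (drop i x)))"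
      by (rule R.finsum_cong') (use T_carrierD[OF p] T_carrierD[OF q] a in \<open>auto simp: R.m_assoc\<close>)
    also have "\<dots> = a \<otimes> (\<Oplus>i\<in>{0..length x}. p (take i x) \<otimes> q (drop i x))"
      by (rule R.finsum_rdistr[symmetric]) (use T_carrierD[OF p] T_carrierD[OF q] a in auto)
    finally show "((a \<odot>\<^bsub>T\<^esub> p) \<otimes>\<^bsub>T\<^esub> q) x = (a \<odot>\<^bsub>T\<^esub> (p \<otimes>\<^bsub>T\<^esub> q)) x"
      by (simp add: T_simps free_simps)
  qed
  fix p' assume p': "p' \<in> carrier T"
  show "(p \<oplus>\<^bsub>T\<^esub> p') \<otimes>\<^bsub>T\<^esub> q = (p \<otimes>\<^bsub>T\<^esub> q) \<oplus>\<^bsub>T\<^esub> (p' \<otimes>\<^bsub>T\<^esub> q)"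
  proof
    fix x
    have "(\<Oplus>i\<in>{0..length x}. (p (take i x) \<oplus> p' (take i x)) \<otimes> q (drop i x))
      = (\<Oplus>i\<in>{0..length x}. p (take i x) \<otimes> q (drop i x) \<oplus> p' (take i x) \<otimes> q (drop i x))"
      by (rule R.finsum_cong') (use T_carrierD[OF p] T_carrierD[OF q] T_carrierD[OF p'] in \<open>auto simp: R.l_distr\<close>)
    also have "\<dots> = (\<Oplus>i\<in>{0..length x}. p (take i x) \<otimes> q (drop i x)) \<oplus> (\<Oplus>i\<in>{0..length x}. p' (take i x) \<otimes> q (drop i x))"
      by (rule R.finsum_addf) (use T_carrierD[OF p] T_carrierD[OF q] T_carrierD[OF p'] in auto)
    finally show "((p \<oplus>\<^bsub>T\<^esub> p') \<otimes>\<^bsub>T\<^esub> q) x = ((p \<otimes>\<^bsub>T\<^esub> q) \<oplus>\<^bsub>T\<^esub> (p' \<otimes>\<^bsub>T\<^esub> q)) x"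
      by (simp add: T_simps free_simps)
  qed
qed

lemma conv_delta: "\<delta> xs \<otimes>\<^bsub>T\<^esub> \<delta> ys = \<delta> (xs @ ys)"
proof
  fix zs
  \<comment> \<open>Only the cut of \<open>zs\<close> at position \<open>length xs\<close> can
    contribute, and it exists only if \<open>zs\<close> is long enough.\<close>
  have "(\<delta> xs \<otimes>\<^bsub>T\<^esub> \<delta> ys) zs = (\<Oplus>i\<in>{0..length zs}. if length xs = i then \<delta> (xs @ ys) zs else \<zero>)"
    unfolding T_simps
    by (rule R.finsum_cong') (auto simp: basis_elt_def append_eq_conv_conj)
  also have "\<dots> = \<delta> (xs @ ys) zs"
  proof (cases "length xs \<le> length zs")
    case True
    then show ?thesis by (intro R.add.finprod_singleton) (auto simp: basis_elt_def)
  next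
    case False
    then have "(\<Oplus>i\<in>{0..length zs}. if length xs = i then \<delta> (xs @ ys) zs else \<zero>) = \<zero>"
      by (intro R.add.finprod_one_eqI) auto
    then show ?thesis using False by (auto simp: basis_elt_def)
  qed
  finally show "(\<delta> xs \<otimes>\<^bsub>T\<^esub> \<delta> ys) zs = \<delta> (xs @ ys) zs" .
qed

lemma relE:
  assumes "x \<in> exterior_relations R M"
  obtains (add) xs ys m m' where "x = \<delta> (xs @ (m \<oplus>\<^bsub>M\<^esub> m') # ys) \<ominus>\<^bsub>T\<^esub> (\<delta> (xs @ m # ys) \<oplus>\<^bsub>T\<^esub> \<delta> (xs @ m' # ys))"
      "set xs \<subseteq> carrier M" "set ys \<subseteq> carrier M" "m \<in> carrier M" "m' \<in> carrier M"
    | (smult) xs ys a m where "x = \<delta> (xs @ (a \<odot>\<^bsub>M\<^esub> m) # ys) \<ominus>\<^bsub>T\<^esub> a \<odot>\<^bsub>T\<^esub> \<delta> (xs @ m # ys)"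
      "set xs \<subseteq> carrier M" "set ys \<subseteq> carrier M" "a \<in> carrier R" "m \<in> carrier M"
    | (alt) xs ys m where "x = \<delta> (xs @ m # m # ys)" "set xs \<subseteq> carrier M" "set ys \<subseteq> carrier M" "m \<in> carrier M"
  using assms unfolding exterior_relations_def Let_def by blast

lemma rels:
  "set xs \<subseteq> carrier M \<Longrightarrow> set ys \<subseteq> carrier M \<Longrightarrow> m \<in> carrier M \<Longrightarrow> m' \<in> carrier M \<Longrightarrow>
    \<delta> (xs @ (m \<oplus>\<^bsub>M\<^esub> m') # ys) \<ominus>\<^bsub>T\<^esub> (\<delta> (xs @ m # ys) \<oplus>\<^bsub>T\<^esub> \<delta> (xs @ m' # ys)) \<in> exterior_relations R M"
  "set xs \<subseteq> carrier M \<Longrightarrow> set ys \<subseteq> carrier M \<Longrightarrow> a \<in> carrier R \<Longrightarrow> m \<in> carrier M \<Longrightarrow>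
    \<delta> (xs @ (a \<odot>\<^bsub>M\<^esub> m) # ys) \<ominus>\<^bsub>T\<^esub> a \<odot>\<^bsub>T\<^esub> \<delta> (xs @ m # ys) \<in> exterior_relations R M"
  "set xs \<subseteq> carrier M \<Longrightarrow> set ys \<subseteq> carrier M \<Longrightarrow> m \<in> carrier M \<Longrightarrow> \<delta> (xs @ m # m # ys) \<in> exterior_relations R M"
  unfolding exterior_relations_def Let_def by blast+

lemma exterior_relations_closed: "exterior_relations R M \<subseteq> carrier T"
proof
  fix x assume "x \<in> exterior_relations R M"
  then show "x \<in> carrier T"
    by (cases rule: relE) (auto intro!: T.M.minus_closed T.M.a_closed T.smult_closed delta_closed)
qed

lemma E_submodule: "submodule E R T"
  unfolding exterior_ideal_def by (rule T.span_submodule[OF exterior_relations_closed])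

lemma rel_in_E: "x \<in> exterior_relations R M \<Longrightarrow> x \<in> E"
  unfolding exterior_ideal_def by (rule T.span_incl')

lemma E_closed: "e \<in> E \<Longrightarrow> e \<in> carrier T"
  by (rule T.submoduleD(2)[OF E_submodule])

text \<open>The relations are stated with arbitrary context lists on both sides, so multiplying one
  by a basis list gives another relation. This is why a mere linear span is a two-sided
  ideal.\<close>

lemma E_conv_delta:
  assumes ys: "set ys \<subseteq> carrier M" and e: "e \<in> E"
  shows "\<delta> ys \<otimes>\<^bsub>T\<^esub> e \<in> E" "e \<otimes>\<^bsub>T\<^esub> \<delta> ys \<in> E"
proof -
  note l = conv_left_lin[OF delta_closed[OF ys]] and r = conv_right_lin[OF delta_closed[OF ys]]
  note sl = lin_map_vimage_submodule[OF T.module_axioms T.module_axioms l E_submodule]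
    and sr = lin_map_vimage_submodule[OF T.module_axioms T.module_axioms r E_submodule]
  note simps = lin_mapD(2,3)[OF l] lin_map_minus[OF T.module_axioms T.module_axioms l]
    lin_mapD(2,3)[OF r] lin_map_minus[OF T.module_axioms T.module_axioms r] conv_delta
  have "\<delta> ys \<otimes>\<^bsub>T\<^esub> x \<in> E \<and> x \<otimes>\<^bsub>T\<^esub> \<delta> ys \<in> E" if x: "x \<in> exterior_relations R M" for x
    using x
  proof (cases rule: relE)
    case (add xs zs m m')
    then show ?thesis using ys rel_in_E[OF rels(1)[of "ys @ xs" zs m m']] rel_in_E[OF rels(1)[of xs "zs @ ys" m m']]
      by (simp add: simps delta_closed)
  next
    case (smult xs zs a m)
    then show ?thesis using ys rel_in_E[OF rels(2)[of "ys @ xs" zs a m]] rel_in_E[OF rels(2)[of xs "zs @ ys" a m]]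
      by (simp add: simps delta_closed)
  next
    case (alt xs zs m)
    then show ?thesis using ys rel_in_E[OF rels(3)[of "ys @ xs" zs m]] rel_in_E[OF rels(3)[of xs "zs @ ys" m]]
      by (simp add: simps delta_closed)
  qed
  then have "exterior_relations R M \<subseteq> {x \<in> carrier T. \<delta> ys \<otimes>\<^bsub>T\<^esub> x \<in> E}"
    "exterior_relations R M \<subseteq> {x \<in> carrier T. x \<otimes>\<^bsub>T\<^esub> \<delta> ys \<in> E}" using exterior_relations_closed by auto
  from T.span_least[OF sl this(1)] T.span_least[OF sr this(2)]
  show "\<delta> ys \<otimes>\<^bsub>T\<^esub> e \<in> E" "e \<otimes>\<^bsub>T\<^esub> \<delta> ys \<in> E" using e unfolding exterior_ideal_def by auto
qed

lemma E_ideal: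
  assumes "e \<in> E" "p \<in> carrier T" shows "p \<otimes>\<^bsub>T\<^esub> e \<in> E" "e \<otimes>\<^bsub>T\<^esub> p \<in> E"
proof -
  note l = conv_left_lin[OF E_closed[OF assms(1)]] and r = conv_right_lin[OF E_closed[OF assms(1)]]
  note sl = lin_map_vimage_submodule[OF T.module_axioms T.module_axioms l E_submodule]
    and sr = lin_map_vimage_submodule[OF T.module_axioms T.module_axioms r E_submodule]
  have "p \<in> {x \<in> carrier T. e \<otimes>\<^bsub>T\<^esub> x \<in> E}"
    by (rule T_induct[OF sl _ assms(2)]) (use E_conv_delta assms(1) delta_closed in auto)
  then show "e \<otimes>\<^bsub>T\<^esub> p \<in> E" by simp
  have "p \<in> {x \<in> carrier T. x \<otimes>\<^bsub>T\<^esub> e \<in> E}"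
    by (rule T_induct[OF sr _ assms(2)]) (use E_conv_delta assms(1) delta_closed in auto)
  then show "p \<otimes>\<^bsub>T\<^esub> e \<in> E" by simp
qed

lemma Ext_module: "module R Ext"
  unfolding exterior_algebra_def by (rule T.quot_is_module[OF E_submodule])

sublocale Ext: module R Ext by (rule Ext_module)

lemma coset_lin: "lin_map R T Ext (\<lambda>p. E +>\<^bsub>T\<^esub> p)"
  unfolding exterior_algebra_def by (rule T.quot_lin[OF E_submodule])

lemma wl_closed: "set xs \<subseteq> carrier M \<Longrightarrow> wl xs \<in> carrier Ext"
  unfolding wedge_list_def by (rule lin_mapD(1)[OF coset_lin delta_closed])

lemma Ext_carrier: "carrier Ext = {E +>\<^bsub>T\<^esub> p | p. p \<in> carrier T}"
  unfolding exterior_algebra_def T.quot_carrier ..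

lemma wl_alternating: "alternating R M Ext wl"
proof (rule alternatingI)
  fix xs ys m m' assume *: "set xs \<subseteq> carrier M" "set ys \<subseteq> carrier M" "m \<in> carrier M" "m' \<in> carrier M"
  have "wl (xs @ (m \<oplus>\<^bsub>M\<^esub> m') # ys) = E +>\<^bsub>T\<^esub> (\<delta> (xs @ m # ys) \<oplus>\<^bsub>T\<^esub> \<delta> (xs @ m' # ys))"
    unfolding wedge_list_def
    by (rule T.coset_eq_iff[OF E_submodule, THEN iffD2])
      (use * in \<open>auto intro!: T.M.a_closed delta_closed rel_in_E rels(1)\<close>)
  then show "wl (xs @ (m \<oplus>\<^bsub>M\<^esub> m') # ys) = wl (xs @ m # ys) \<oplus>\<^bsub>Ext\<^esub> wl (xs @ m' # ys)"
    using lin_mapD(2)[OF coset_lin delta_closed delta_closed] * by (simp add: wedge_list_def)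
next
  fix xs ys a m assume *: "set xs \<subseteq> carrier M" "set ys \<subseteq> carrier M" "a \<in> carrier R" "m \<in> carrier M"
  have "wl (xs @ (a \<odot>\<^bsub>M\<^esub> m) # ys) = E +>\<^bsub>T\<^esub> (a \<odot>\<^bsub>T\<^esub> \<delta> (xs @ m # ys))"
    unfolding wedge_list_def
    by (rule T.coset_eq_iff[OF E_submodule, THEN iffD2])
      (use * in \<open>auto intro!: T.smult_closed delta_closed rel_in_E rels(2)\<close>)
  then show "wl (xs @ (a \<odot>\<^bsub>M\<^esub> m) # ys) = a \<odot>\<^bsub>Ext\<^esub> wl (xs @ m # ys)"
    using lin_mapD(3)[OF coset_lin _ delta_closed] * by (simp add: wedge_list_def)
next
  fix xs ys m assume *: "set xs \<subseteq> carrier M" "set ys \<subseteq> carrier M" "m \<in> carrier M"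
  then show "wl (xs @ m # m # ys) = \<zero>\<^bsub>Ext\<^esub>"
    unfolding wedge_list_def exterior_algebra_def T.quot_zero
    using T.coset_eq_zero[OF E_submodule delta_closed] rel_in_E[OF rels(3)] by simp
qed (rule wl_closed)

lemma Ext_universal:
  assumes "module R Z" "alternating R M Z G"
  obtains g where "lin_map R Ext Z g" "\<And>xs. set xs \<subseteq> carrier M \<Longrightarrow> g (wl xs) = G xs"
proof -
  interpret Z: module R Z by fact
  note D = alternatingD[OF assms(2)]
  let ?e = "free_ext R Z G"
  have "\<And>x. x \<in> L \<Longrightarrow> G x \<in> carrier Z" using D(1) by auto
  note fe = free_ext[OF assms(1), of L G, OF this]
  have e: "lin_map R T Z ?e" using fe(1) unfolding lin_map_def T_simps .
  have e2: "\<And>xs. set xs \<subseteq> carrier M \<Longrightarrow> ?e (\<delta> xs) = G xs" using fe(2) by auto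
  note eqs = lin_mapD(2,3)[OF e] lin_map_minus[OF T.module_axioms assms(1) e]
  have sub: "submodule {x \<in> carrier T. ?e x \<in> {\<zero>\<^bsub>Z\<^esub>}} R T"
    by (rule lin_map_vimage_submodule[OF T.module_axioms assms(1) e Z.zero_submodule])
  have "exterior_relations R M \<subseteq> {x \<in> carrier T. ?e x \<in> {\<zero>\<^bsub>Z\<^esub>}}"
  proof (intro subsetI CollectI conjI)
    fix x assume x: "x \<in> exterior_relations R M"
    show "x \<in> carrier T" using x exterior_relations_closed by blast
    have z: "y \<in> carrier Z \<Longrightarrow> y \<ominus>\<^bsub>Z\<^esub> y = \<zero>\<^bsub>Z\<^esub>" for y by (simp add: Z.M.minus_zero_iff)
    show "?e x \<in> {\<zero>\<^bsub>Z\<^esub>}" using x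
      by (cases rule: relE) (auto simp: eqs e2 delta_closed D z)
  qed
  then have "E \<subseteq> {x \<in> carrier T. ?e x \<in> {\<zero>\<^bsub>Z\<^esub>}}"
    unfolding exterior_ideal_def by (rule T.span_least[OF sub])
  then have "\<And>x. x \<in> E \<Longrightarrow> ?e x = \<zero>\<^bsub>Z\<^esub>" by auto
  from quot_induced[OF T.module_axioms assms(1) E_submodule e this]
  obtain g where g: "lin_map R Ext Z g" "\<And>x. x \<in> carrier T \<Longrightarrow> g (E +>\<^bsub>T\<^esub> x) = ?e x"
    unfolding exterior_algebra_def by blast
  have "g (wl xs) = G xs" if "set xs \<subseteq> carrier M" for xs
    unfolding wedge_list_def using g(2)[OF delta_closed[OF that]] e2[OF that] by simp
  then show ?thesis using that g(1) by blast
qed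

text \<open>The product of cosets is a union over all representatives; the ideal property of
  \<open>E\<close> collapses it to one coset.\<close>

lemma mult_cosets:
  assumes p: "p \<in> carrier T" and q: "q \<in> carrier T"
  shows "(E +>\<^bsub>T\<^esub> p) \<otimes>\<^bsub>Ext\<^esub> (E +>\<^bsub>T\<^esub> q) = E +>\<^bsub>T\<^esub> (p \<otimes>\<^bsub>T\<^esub> q)"
proof -
  have eq: "E +>\<^bsub>T\<^esub> (a \<otimes>\<^bsub>T\<^esub> b) = E +>\<^bsub>T\<^esub> (p \<otimes>\<^bsub>T\<^esub> q)"
    if a: "a \<in> E +>\<^bsub>T\<^esub> p" and b: "b \<in> E +>\<^bsub>T\<^esub> q" for a b
  proof -
    have a': "a \<in> carrier T" "a \<ominus>\<^bsub>T\<^esub> p \<in> E" and b': "b \<in> carrier T" "b \<ominus>\<^bsub>T\<^esub> q \<in> E"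
      using T.coset_mem[OF E_submodule p a] T.coset_mem[OF E_submodule q b]
        T.coset_eq_iff[OF E_submodule] p q by auto
    have "a \<otimes>\<^bsub>T\<^esub> b \<ominus>\<^bsub>T\<^esub> p \<otimes>\<^bsub>T\<^esub> b \<in> E"
      using E_ideal(2)[OF a'(2) b'(1)] lin_map_minus[OF T.module_axioms T.module_axioms conv_right_lin[OF b'(1)] a'(1) p] by simp
    moreover have "p \<otimes>\<^bsub>T\<^esub> b \<ominus>\<^bsub>T\<^esub> p \<otimes>\<^bsub>T\<^esub> q \<in> E"
      using E_ideal(1)[OF b'(2) p] lin_map_minus[OF T.module_axioms T.module_axioms conv_left_lin[OF p] b'(1) q] by simp
    ultimately show ?thesis using T.coset_eq_iff[OF E_submodule] conv_closed a' b' p q by metis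
  qed
  have "(\<Union>a\<in>E +>\<^bsub>T\<^esub> p. \<Union>b\<in>E +>\<^bsub>T\<^esub> q. E +>\<^bsub>T\<^esub> (a \<otimes>\<^bsub>T\<^esub> b)) = E +>\<^bsub>T\<^esub> (p \<otimes>\<^bsub>T\<^esub> q)"
    using eq T.coset_self[OF E_submodule p] T.coset_self[OF E_submodule q] by blast
  then show ?thesis by (simp add: exterior_algebra_def quot_module_def rcoset_mult_def)
qed

lemma left_wedge:
  assumes u: "u \<in> carrier M"
  shows "lin_map R Ext Ext (\<lambda>x. wl [u] \<otimes>\<^bsub>Ext\<^esub> x)"
    and "set xs \<subseteq> carrier M \<Longrightarrow> wl [u] \<otimes>\<^bsub>Ext\<^esub> wl xs = wl (u # xs)"
proof -
  have du: "\<delta> [u] \<in> carrier T" using u by (intro delta_closed) auto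
  note c = coset_lin and l = conv_left_lin[OF du]
  have eq: "wl [u] \<otimes>\<^bsub>Ext\<^esub> (E +>\<^bsub>T\<^esub> q) = E +>\<^bsub>T\<^esub> (\<delta> [u] \<otimes>\<^bsub>T\<^esub> q)" if "q \<in> carrier T" for q
    unfolding wedge_list_def by (rule mult_cosets[OF du that])
  show "lin_map R Ext Ext (\<lambda>x. wl [u] \<otimes>\<^bsub>Ext\<^esub> x)"
  proof (rule lin_mapI)
    fix x assume "x \<in> carrier Ext"
    then obtain p where p: "p \<in> carrier T" "x = E +>\<^bsub>T\<^esub> p" by (auto simp: Ext_carrier)
    show "wl [u] \<otimes>\<^bsub>Ext\<^esub> x \<in> carrier Ext" using p eq lin_mapD(1)[OF c] lin_mapD(1)[OF l] by simp
    show "wl [u] \<otimes>\<^bsub>Ext\<^esub> (a \<odot>\<^bsub>Ext\<^esub> x) = a \<odot>\<^bsub>Ext\<^esub> (wl [u] \<otimes>\<^bsub>Ext\<^esub> x)" if a: "a \<in> carrier R" for a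
      using p a eq lin_mapD(1)[OF l] by (simp add: lin_mapD(3)[OF c, symmetric] lin_mapD(3)[OF l])
    fix y assume "y \<in> carrier Ext"
    then obtain q where q: "q \<in> carrier T" "y = E +>\<^bsub>T\<^esub> q" by (auto simp: Ext_carrier)
    show "wl [u] \<otimes>\<^bsub>Ext\<^esub> (x \<oplus>\<^bsub>Ext\<^esub> y) = wl [u] \<otimes>\<^bsub>Ext\<^esub> x \<oplus>\<^bsub>Ext\<^esub> wl [u] \<otimes>\<^bsub>Ext\<^esub> y"
      using p q eq lin_mapD(1)[OF l] by (simp add: lin_mapD(2)[OF c, symmetric] lin_mapD(2)[OF l])
  qed
  show "wl [u] \<otimes>\<^bsub>Ext\<^esub> wl xs = wl (u # xs)" if "set xs \<subseteq> carrier M"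
    using eq[OF delta_closed[OF that]] by (simp add: conv_delta wedge_list_def)
qed

abbreviation "Pw k \<equiv> exterior_power R M k"

lemma Pw_simps:
  "\<zero>\<^bsub>Pw k\<^esub> = \<zero>\<^bsub>Ext\<^esub>" "ring.add (Pw k) = ring.add Ext" "smult (Pw k) = smult Ext"
  by (simp_all add: exterior_power_def)

lemma Pw_carrier:
  "carrier (Pw k) = (\<lambda>p. E +>\<^bsub>T\<^esub> p) ` carrier (free_module R {xs \<in> L. int (length xs) = k})"
proof -
  have "carrier (free_module R {xs \<in> L. int (length xs) = k}) =
      {p \<in> carrier T. \<forall>xs. p xs \<noteq> \<zero> \<longrightarrow> int (length xs) = k}"
    unfolding T_simps free_simps by auto
  then show ?thesis unfolding exterior_power_def by auto
qed

lemma Pw_submodule: "submodule (carrier (Pw k)) R Ext"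
proof -
  let ?S = "{xs \<in> L. int (length xs) = k}"
  interpret F: module R "free_module R ?S" by (rule free_is_module[OF R.is_cring])
  have "submodule (carrier (free_module R ?S)) R T"
    by (rule T.submoduleI')
      (use F.M.zero_closed F.M.a_closed F.smult_closed in \<open>auto simp: T_simps free_simps\<close>)
  then show ?thesis unfolding Pw_carrier
    by (rule lin_map_image_submodule[OF T.module_axioms Ext_module coset_lin])
qed

lemma Pw_module: "module R (Pw k)"
  by (rule module_fields_cong[OF submodule.submodule_is_module[OF Pw_submodule Ext_module]])
    (simp_all add: Pw_simps)

lemma Pw_sub: "x \<in> carrier (Pw k) \<Longrightarrow> x \<in> carrier Ext"
  by (rule Ext.submoduleD(2)[OF Pw_submodule])

lemma wl_Pw: "set xs \<subseteq> carrier M \<Longrightarrow> int (length xs) = k \<Longrightarrow> wl xs \<in> carrier (Pw k)"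
  unfolding Pw_carrier wedge_list_def by (rule imageI, rule basis_elt_closed[OF R.is_cring]) auto

text \<open>Used with preimages and equalizers of linear maps as \<open>N\<close>: a statement about
  forms of degree \<open>k\<close> is reduced to wedges of lists of length \<open>k\<close>.\<close>

lemma Pw_induct:
  assumes N: "submodule N R Ext" and "\<And>xs. set xs \<subseteq> carrier M \<Longrightarrow> int (length xs) = k \<Longrightarrow> wl xs \<in> N"
    and x: "x \<in> carrier (Pw k)"
  shows "x \<in> N"
proof -
  let ?S = "{xs \<in> L. int (length xs) = k}"
  obtain p where p: "x = E +>\<^bsub>T\<^esub> p" "p \<in> carrier (free_module R ?S)" using x unfolding Pw_carrier by blast
  have "submodule {q \<in> carrier T. E +>\<^bsub>T\<^esub> q \<in> N} R (free_module R L)"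
    using lin_map_vimage_submodule[OF T.module_axioms Ext_module coset_lin N] by (simp only: T_sub_free)
  then have "p \<in> {q \<in> carrier T. E +>\<^bsub>T\<^esub> q \<in> N}"
    by (rule free_induct[OF R.is_cring _ _ p(2)]) (use assms(2) delta_closed in \<open>auto simp: wedge_list_def\<close>)
  then show ?thesis using p by simp
qed

lemma Pw_sub_iff: "submodule N R (Pw k) \<longleftrightarrow> submodule N R Ext \<and> N \<subseteq> carrier (Pw k)"
proof
  assume N: "submodule N R (Pw k)"
  interpret P: module R "Pw k" by (rule Pw_module)
  note D = P.submoduleD[OF N]
  show "submodule N R Ext \<and> N \<subseteq> carrier (Pw k)"
    using D Pw_sub[OF D(2)] by (intro conjI Ext.submoduleI' subsetI) (auto simp: Pw_simps)
next
  assume N: "submodule N R Ext \<and> N \<subseteq> carrier (Pw k)"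
  interpret P: module R "Pw k" by (rule Pw_module)
  note D = Ext.submoduleD[OF conjunct1[OF N]]
  show "submodule N R (Pw k)"
    using D N by (intro P.submoduleI') (auto simp: Pw_simps)
qed

lemma Pw_lin: "lin_map R Ext Z g \<Longrightarrow> lin_map R (Pw k) Z g"
  unfolding lin_map_def by (auto simp: Pw_simps Pw_sub)

lemma left_wedge_Pw:
  assumes u: "u \<in> carrier M" and x: "x \<in> carrier (Pw k)"
  shows "wl [u] \<otimes>\<^bsub>Ext\<^esub> x \<in> carrier (Pw (k + 1))"
proof -
  note sub = lin_map_vimage_submodule[OF Ext_module Ext_module left_wedge(1)[OF u] Pw_submodule[of "k + 1"]]
  have "x \<in> {x \<in> carrier Ext. wl [u] \<otimes>\<^bsub>Ext\<^esub> x \<in> carrier (Pw (k + 1))}"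
    by (rule Pw_induct[OF sub _ x]) (use u in \<open>auto simp: left_wedge(2) wl_closed intro!: wl_Pw\<close>)
  then show ?thesis by simp
qed

end

subsection \<open>Base change\<close>

locale base_change =
  fixes A :: "('a, 'm) ring_scheme" and B :: "('b, 'n) ring_scheme" and \<pi> :: "'a \<Rightarrow> 'b"
    and M :: "('a, 'c, 'p) module_scheme"
  assumes B: "cring B" and hom: "\<pi> \<in> ring_hom A B" and M: "module A M"
begin

abbreviation "F \<equiv> free_module B (carrier M \<times> carrier B)"
abbreviation "T \<equiv> tensor_product A B \<pi> M"
abbreviation "\<S> \<equiv> submodule_span B F (tensor_relations A B \<pi> M)"

definition tens where "tens m b = \<S> +>\<^bsub>F\<^esub> basis_elt B (m, b)"

sublocale B: cring B by (rule B)
sublocale M: module A M by (rule M)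
sublocale F: module B F by (rule free_is_module[OF B])

lemma basis_closed: "m \<in> carrier M \<Longrightarrow> b \<in> carrier B \<Longrightarrow> basis_elt B (m, b) \<in> carrier F"
  by (rule basis_elt_closed[OF B]) simp

lemma pi_closed: "a \<in> carrier A \<Longrightarrow> \<pi> a \<in> carrier B" using hom by (rule ring_hom_closed)

lemma relE:
  assumes "x \<in> tensor_relations A B \<pi> M"
  obtains m m' b where "x = basis_elt B (m \<oplus>\<^bsub>M\<^esub> m', b) \<ominus>\<^bsub>F\<^esub> (basis_elt B (m, b) \<oplus>\<^bsub>F\<^esub> basis_elt B (m', b))"
      "m \<in> carrier M" "m' \<in> carrier M" "b \<in> carrier B"
    | m b b' where "x = basis_elt B (m, b \<oplus>\<^bsub>B\<^esub> b') \<ominus>\<^bsub>F\<^esub> (basis_elt B (m, b) \<oplus>\<^bsub>F\<^esub> basis_elt B (m, b'))"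
      "m \<in> carrier M" "b \<in> carrier B" "b' \<in> carrier B"
    | a m b where "x = basis_elt B (a \<odot>\<^bsub>M\<^esub> m, b) \<ominus>\<^bsub>F\<^esub> basis_elt B (m, \<pi> a \<otimes>\<^bsub>B\<^esub> b)"
      "a \<in> carrier A" "m \<in> carrier M" "b \<in> carrier B"
    | b' m b where "x = b' \<odot>\<^bsub>F\<^esub> basis_elt B (m, b) \<ominus>\<^bsub>F\<^esub> basis_elt B (m, b' \<otimes>\<^bsub>B\<^esub> b)"
      "b' \<in> carrier B" "m \<in> carrier M" "b \<in> carrier B"
  using assms unfolding tensor_relations_def Let_def by blast

lemma rels:
  "m \<in> carrier M \<Longrightarrow> m' \<in> carrier M \<Longrightarrow> b \<in> carrier B \<Longrightarrow>
    basis_elt B (m \<oplus>\<^bsub>M\<^esub> m', b) \<ominus>\<^bsub>F\<^esub> (basis_elt B (m, b) \<oplus>\<^bsub>F\<^esub> basis_elt B (m', b)) \<in> \<S>"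
  "a \<in> carrier A \<Longrightarrow> m \<in> carrier M \<Longrightarrow> b \<in> carrier B \<Longrightarrow>
    basis_elt B (a \<odot>\<^bsub>M\<^esub> m, b) \<ominus>\<^bsub>F\<^esub> basis_elt B (m, \<pi> a \<otimes>\<^bsub>B\<^esub> b) \<in> \<S>"
  "b' \<in> carrier B \<Longrightarrow> m \<in> carrier M \<Longrightarrow> b \<in> carrier B \<Longrightarrow>
    b' \<odot>\<^bsub>F\<^esub> basis_elt B (m, b) \<ominus>\<^bsub>F\<^esub> basis_elt B (m, b' \<otimes>\<^bsub>B\<^esub> b) \<in> \<S>"
  by (rule F.span_incl', simp only: tensor_relations_def Let_def, blast)+

lemma relations_closed: "tensor_relations A B \<pi> M \<subseteq> carrier F"
proof
  fix x assume "x \<in> tensor_relations A B \<pi> M"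
  then show "x \<in> carrier F"
    by (cases rule: relE) (auto intro!: F.M.minus_closed F.M.a_closed F.smult_closed basis_closed pi_closed)
qed

lemma S_submodule: "submodule \<S> B F"
  by (rule F.span_submodule[OF relations_closed])

lemma T_eq: "T = quot_module F \<S>" by (simp add: tensor_product_def Let_def)

lemma T_module: "module B T"
  unfolding T_eq by (rule F.quot_is_module[OF S_submodule])

sublocale T: module B T by (rule T_module)

lemma coset_lin: "lin_map B F T (\<lambda>p. \<S> +>\<^bsub>F\<^esub> p)"
  unfolding T_eq by (rule F.quot_lin[OF S_submodule])

lemma tens_closed: "m \<in> carrier M \<Longrightarrow> b \<in> carrier B \<Longrightarrow> tens m b \<in> carrier T"
  unfolding tens_def by (rule lin_mapD(1)[OF coset_lin basis_closed])

lemma tens_smult: "b' \<in> carrier B \<Longrightarrow> m \<in> carrier M \<Longrightarrow> b \<in> carrier B \<Longrightarrow> b' \<odot>\<^bsub>T\<^esub> tens m b = tens m (b' \<otimes>\<^bsub>B\<^esub> b)"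
  unfolding tens_def
  by (subst lin_mapD(3)[OF coset_lin, symmetric], simp, rule basis_closed, simp, simp,
      rule F.coset_eq_iff[OF S_submodule, THEN iffD2]) (auto intro!: basis_closed rels F.smult_closed)

lemma tens_one: "lin_map A M (restr \<pi> T) (\<lambda>m. tens m \<one>\<^bsub>B\<^esub>)"
proof (rule lin_mapI)
  fix m assume m: "m \<in> carrier M"
  show "tens m \<one>\<^bsub>B\<^esub> \<in> carrier (restr \<pi> T)" using m tens_closed by simp
  show "tens (a \<odot>\<^bsub>M\<^esub> m) \<one>\<^bsub>B\<^esub> = a \<odot>\<^bsub>restr \<pi> T\<^esub> tens m \<one>\<^bsub>B\<^esub>" if a: "a \<in> carrier A" for a
  proof -
    have "tens (a \<odot>\<^bsub>M\<^esub> m) \<one>\<^bsub>B\<^esub> = tens m (\<pi> a \<otimes>\<^bsub>B\<^esub> \<one>\<^bsub>B\<^esub>)" unfolding tens_def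
      by (rule F.coset_eq_iff[OF S_submodule, THEN iffD2]) (use a m in \<open>auto intro!: basis_closed rels pi_closed\<close>)
    then show ?thesis using a m by (simp add: tens_smult pi_closed)
  qed
  fix m' assume m': "m' \<in> carrier M"
  have "tens (m \<oplus>\<^bsub>M\<^esub> m') \<one>\<^bsub>B\<^esub> = \<S> +>\<^bsub>F\<^esub> (basis_elt B (m, \<one>\<^bsub>B\<^esub>) \<oplus>\<^bsub>F\<^esub> basis_elt B (m', \<one>\<^bsub>B\<^esub>))" unfolding tens_def
    by (rule F.coset_eq_iff[OF S_submodule, THEN iffD2]) (use m m' in \<open>auto intro!: basis_closed rels F.M.a_closed\<close>)
  then show "tens (m \<oplus>\<^bsub>M\<^esub> m') \<one>\<^bsub>B\<^esub> = tens m \<one>\<^bsub>B\<^esub> \<oplus>\<^bsub>restr \<pi> T\<^esub> tens m' \<one>\<^bsub>B\<^esub>"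
    using lin_mapD(2)[OF coset_lin basis_closed basis_closed] m m' by (simp add: tens_def)
qed

text \<open>The symbols with second entry one suffice as generators, since \<open>b\<close> can be
  pulled out of \<open>tens m b\<close> as a scalar.\<close>

lemma T_induct:
  assumes N: "submodule N B T" and "\<And>m. m \<in> carrier M \<Longrightarrow> tens m \<one>\<^bsub>B\<^esub> \<in> N" and x: "x \<in> carrier T"
  shows "x \<in> N"
proof -
  have t: "tens m b \<in> N" if "m \<in> carrier M" "b \<in> carrier B" for m b
    using T.submoduleD(7)[OF N that(2) assms(2)[OF that(1)]] that by (simp add: tens_smult)
  obtain p where p: "p \<in> carrier F" "x = \<S> +>\<^bsub>F\<^esub> p" using x unfolding T_eq F.quot_carrier by blast
  have "p \<in> {p \<in> carrier F. \<S> +>\<^bsub>F\<^esub> p \<in> N}"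
    by (rule free_induct[OF B lin_map_vimage_submodule[OF F.module_axioms T_module coset_lin N] _ p(1)])
      (use t basis_closed in \<open>auto simp: tens_def\<close>)
  then show ?thesis using p by simp
qed

text \<open>Extension of scalars is left adjoint to \<open>restr\<close>: the map is forced to send
  \<open>tens m b\<close> to the \<open>b\<close>-multiple of \<open>h m\<close>, and this respects
  the relations.\<close>

lemma T_universal:
  assumes Z: "module B Z" and h: "lin_map A M (restr \<pi> Z) h"
  obtains g where "lin_map B T Z g" "\<And>m. m \<in> carrier M \<Longrightarrow> g (tens m \<one>\<^bsub>B\<^esub>) = h m"
proof -
  interpret Z: module B Z by fact
  let ?G = "\<lambda>(m, b). b \<odot>\<^bsub>Z\<^esub> h m"
  let ?e = "free_ext B Z ?G"
  have hc: "m \<in> carrier M \<Longrightarrow> h m \<in> carrier Z" for m using lin_mapD(1)[OF h] by simp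
  have "\<And>x. x \<in> carrier M \<times> carrier B \<Longrightarrow> ?G x \<in> carrier Z" using hc by auto
  note fe = free_ext[OF Z, of "carrier M \<times> carrier B" ?G, OF this]
  have e: "lin_map B F Z ?e" by (rule fe(1))
  have e2: "m \<in> carrier M \<Longrightarrow> b \<in> carrier B \<Longrightarrow> ?e (basis_elt B (m, b)) = b \<odot>\<^bsub>Z\<^esub> h m" for m b
    using fe(2)[of "(m, b)"] by simp
  note eqs = lin_mapD(2,3)[OF e] lin_map_minus[OF F.module_axioms Z e]
  have sub: "submodule {x \<in> carrier F. ?e x \<in> {\<zero>\<^bsub>Z\<^esub>}} B F"
    by (rule lin_map_vimage_submodule[OF F.module_axioms Z e Z.zero_submodule])
  have hs: "m \<in> carrier M \<Longrightarrow> m' \<in> carrier M \<Longrightarrow> h (m \<oplus>\<^bsub>M\<^esub> m') = h m \<oplus>\<^bsub>Z\<^esub> h m'"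
    "a \<in> carrier A \<Longrightarrow> m \<in> carrier M \<Longrightarrow> h (a \<odot>\<^bsub>M\<^esub> m) = \<pi> a \<odot>\<^bsub>Z\<^esub> h m" for m m' a
    using lin_mapD(2,3)[OF h] by auto
  have "tensor_relations A B \<pi> M \<subseteq> {x \<in> carrier F. ?e x \<in> {\<zero>\<^bsub>Z\<^esub>}}"
  proof (intro subsetI CollectI conjI)
    fix x assume x: "x \<in> tensor_relations A B \<pi> M"
    show "x \<in> carrier F" using x relations_closed by blast
    have z: "y \<in> carrier Z \<Longrightarrow> y' \<in> carrier Z \<Longrightarrow> y \<ominus>\<^bsub>Z\<^esub> y' = \<zero>\<^bsub>Z\<^esub> \<longleftrightarrow> y = y'" for y y'
      by (rule Z.M.minus_zero_iff)
    show "?e x \<in> {\<zero>\<^bsub>Z\<^esub>}" using x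
      by (cases rule: relE)
        (auto simp: eqs e2 basis_closed hc hs z pi_closed Z.smult_r_distr Z.smult_l_distr
           Z.smult_assoc1[symmetric] B.m_comm)
  qed
  then have "\<S> \<subseteq> {x \<in> carrier F. ?e x \<in> {\<zero>\<^bsub>Z\<^esub>}}" by (rule F.span_least[OF sub])
  then have "\<And>x. x \<in> \<S> \<Longrightarrow> ?e x = \<zero>\<^bsub>Z\<^esub>" by auto
  from quot_induced[OF F.module_axioms Z S_submodule e this]
  obtain g where g: "lin_map B T Z g" "\<And>x. x \<in> carrier F \<Longrightarrow> g (\<S> +>\<^bsub>F\<^esub> x) = ?e x"
    unfolding T_eq by blast
  have "g (tens m \<one>\<^bsub>B\<^esub>) = h m" if "m \<in> carrier M" for m
    unfolding tens_def using g(2)[OF basis_closed[OF that B.one_closed]] e2[OF that B.one_closed] hc[OF that] by simp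
  then show ?thesis using that g(1) by blast
qed

end

lemma (in abelian_group) minus_zero_right: "x \<in> carrier G \<Longrightarrow> x \<ominus> \<zero> = x"
proof -
  assume "x \<in> carrier G"
  have "\<ominus> \<zero> = \<zero>" by (metis r_neg l_zero zero_closed a_inv_closed)
  then show ?thesis using \<open>x \<in> carrier G\<close> by (simp only: a_minus_def r_zero)
qed

lemma (in abelian_group) add_minus_add:
  assumes "a \<in> carrier G" "b \<in> carrier G" "c \<in> carrier G" "e \<in> carrier G"
  shows "(a \<oplus> b) \<ominus> (c \<oplus> e) = (a \<ominus> c) \<oplus> (b \<ominus> e)"
  using assms by (simp add: minus_eq minus_add a_ac)

lemma (in module) smult_minus:
  assumes "a \<in> carrier R" "x \<in> carrier M" "y \<in> carrier M"
  shows "a \<odot>\<^bsub>M\<^esub> (x \<ominus>\<^bsub>M\<^esub> y) = a \<odot>\<^bsub>M\<^esub> x \<ominus>\<^bsub>M\<^esub> a \<odot>\<^bsub>M\<^esub> y"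
  using assms by (simp add: M.minus_eq smult_r_distr smult_r_minus)

subsection \<open>Contraction and permutation of alternating maps\<close>

text \<open>Expanding the value zero at two adjacent entries \<open>a + b\<close> shows that a
  transposition changes the sign. Recording only whether the value is zero avoids carrying the sign
  along.\<close>

lemma alternating_vanish_move:
  assumes Z: "module R Z" and M: "module R M" and "alternating R M Z G"
    and "set p \<subseteq> carrier M" "set q \<subseteq> carrier M" "a \<in> carrier M"
  shows "G (p @ a # q) = \<zero>\<^bsub>Z\<^esub> \<longleftrightarrow> G (a # p @ q) = \<zero>\<^bsub>Z\<^esub>"
  using assms(3-)
proof (induction p arbitrary: G)
  case (Cons b p)
  interpret Z: module R Z by fact
  interpret M: module R M by fact
  note D = alternatingD[OF Cons.prems(1)]
  have b: "b \<in> carrier M" and pq: "set (p @ q) \<subseteq> carrier M" and a: "a \<in> carrier M" using Cons.prems by auto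
  have cl: "G (b # a # p @ q) \<in> carrier Z" "G (a # b # p @ q) \<in> carrier Z"
    using a b pq by (auto intro!: D(1))
  have e: "G ((a \<oplus>\<^bsub>M\<^esub> b) # (a \<oplus>\<^bsub>M\<^esub> b) # p @ q) = \<zero>\<^bsub>Z\<^esub>" "G (a # a # p @ q) = \<zero>\<^bsub>Z\<^esub>" "G (b # b # p @ q) = \<zero>\<^bsub>Z\<^esub>"
    using D(4)[of "[]" "p @ q"] a b pq by auto
  have "G ((a \<oplus>\<^bsub>M\<^esub> b) # (a \<oplus>\<^bsub>M\<^esub> b) # p @ q) = G (a # (a \<oplus>\<^bsub>M\<^esub> b) # p @ q) \<oplus>\<^bsub>Z\<^esub> G (b # (a \<oplus>\<^bsub>M\<^esub> b) # p @ q)"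
    using D(2)[of "[]" "(a \<oplus>\<^bsub>M\<^esub> b) # p @ q" a b] a b pq by simp
  also have "G (a # (a \<oplus>\<^bsub>M\<^esub> b) # p @ q) = G (a # a # p @ q) \<oplus>\<^bsub>Z\<^esub> G (a # b # p @ q)"
    using D(2)[of "[a]" "p @ q" a b] a b pq by simp
  also have "G (b # (a \<oplus>\<^bsub>M\<^esub> b) # p @ q) = G (b # a # p @ q) \<oplus>\<^bsub>Z\<^esub> G (b # b # p @ q)"
    using D(2)[of "[b]" "p @ q" a b] a b pq by simp
  finally have s: "G (a # b # p @ q) \<oplus>\<^bsub>Z\<^esub> G (b # a # p @ q) = \<zero>\<^bsub>Z\<^esub>" using e cl by simp
  have "G (b # p @ a # q) = \<zero>\<^bsub>Z\<^esub> \<longleftrightarrow> G (b # a # p @ q) = \<zero>\<^bsub>Z\<^esub>"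
    using Cons.IH[OF alternating_Cons[OF Cons.prems(1) b]] Cons.prems by simp
  also have "\<dots> \<longleftrightarrow> G (a # b # p @ q) = \<zero>\<^bsub>Z\<^esub>" using s cl by (metis Z.M.l_zero Z.M.r_zero)
  finally show ?case by simp
qed simp

lemma alternating_vanish_perm:
  assumes Z: "module R Z" and M: "module R M" and "alternating R M Z G"
    and "mset xs = mset ys" "set xs \<subseteq> carrier M" "G xs = \<zero>\<^bsub>Z\<^esub>"
  shows "G ys = \<zero>\<^bsub>Z\<^esub>"
  using assms(3-)
proof (induction ys arbitrary: xs G)
  case (Cons a ys)
  have "a \<in> set xs" using Cons.prems(2) by (metis list.set_intros(1) mset_eq_setD)
  then obtain p q where pq: "xs = p @ a # q" by (meson split_list)
  have "G (a # p @ q) = \<zero>\<^bsub>Z\<^esub>"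
    using alternating_vanish_move[OF Z M Cons.prems(1), of p q a] Cons.prems pq by auto
  moreover have "alternating R M Z (\<lambda>l. G (a # l))"
    by (rule alternating_Cons[OF Cons.prems(1)]) (use Cons.prems pq in auto)
  ultimately show ?case using Cons.IH[of "\<lambda>l. G (a # l)" "p @ q"] Cons.prems pq by auto
qed simp

lemma alternating_vanish_repeat:
  assumes Z: "module R Z" and M: "module R M" and G: "alternating R M Z G"
    and "\<not> distinct xs" "set xs \<subseteq> carrier M"
  shows "G xs = \<zero>\<^bsub>Z\<^esub>"
proof -
  obtain p q s a where xs: "xs = p @ a # q @ a # s" using assms(4) not_distinct_decomp by fastforce
  have "G ([] @ a # a # (p @ q @ s)) = \<zero>\<^bsub>Z\<^esub>"
    by (rule alternatingD(4)[OF G]) (use assms(5) xs in auto)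
  from alternating_vanish_perm[OF Z M G _ _ this, of xs] show ?thesis using xs assms(5) by auto
qed

text \<open>\<open>contract Z \<theta> G (x\<^sub>1, \<dots>, x\<^sub>k)\<close> is the alternating sum of the \<open>\<theta>(x\<^sub>i) G(x\<^sub>1, \<dots>, x\<^sub>k without x\<^sub>i)\<close>.\<close>

fun contract where
  "contract Z \<theta> G [] = \<zero>\<^bsub>Z\<^esub>"
| "contract Z \<theta> G (x # xs) = \<theta> x \<odot>\<^bsub>Z\<^esub> G xs \<ominus>\<^bsub>Z\<^esub> contract Z \<theta> (\<lambda>l. G (x # l)) xs"

text \<open>In each term of the alternating sum either \<open>x\<close> has been removed, and the
  factor \<open>\<theta> x\<close> is zero, or \<open>x\<close> is still among the arguments of
  \<open>G\<close>.\<close>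

lemma contract_vanish:
  assumes "module B Z" "\<theta> \<in> carrier M \<rightarrow> carrier B" "\<theta> x = \<zero>\<^bsub>B\<^esub>"
    "\<And>l. set l \<subseteq> carrier M \<Longrightarrow> G l \<in> carrier Z"
    "\<And>l. set l \<subseteq> carrier M \<Longrightarrow> x \<in> set l \<Longrightarrow> G l = \<zero>\<^bsub>Z\<^esub>" "set xs \<subseteq> carrier M" "x \<in> set xs"
  shows "contract Z \<theta> G xs = \<zero>\<^bsub>Z\<^esub>"
proof -
  interpret Z: module B Z by fact
  have zero: "contract Z \<theta> G xs = \<zero>\<^bsub>Z\<^esub>"
    if "\<And>l. set l \<subseteq> carrier M \<Longrightarrow> G l = \<zero>\<^bsub>Z\<^esub>" "set xs \<subseteq> carrier M" for G xs
    using that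
  proof (induction xs arbitrary: G)
    case (Cons y ys)
    have "contract Z \<theta> (\<lambda>l. G (y # l)) ys = \<zero>\<^bsub>Z\<^esub>" by (rule Cons.IH) (use Cons.prems in auto)
    then show ?case using Cons.prems assms(2) by (simp add: Pi_iff Z.M.minus_zero_iff)
  qed simp
  show ?thesis using assms(4-)
  proof (induction xs arbitrary: G)
    case (Cons y ys)
    have "\<theta> y \<odot>\<^bsub>Z\<^esub> G ys = \<zero>\<^bsub>Z\<^esub>"
    proof (cases "x = y")
      case True then show ?thesis using assms(3) Cons.prems by simp
    next
      case False then show ?thesis using Cons.prems assms(2) by (simp add: Pi_iff)
    qed
    moreover have "contract Z \<theta> (\<lambda>l. G (y # l)) ys = \<zero>\<^bsub>Z\<^esub>"
    proof (cases "x = y")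
      case True then show ?thesis by (intro zero) (use Cons.prems in auto)
    next
      case False then show ?thesis by (intro Cons.IH) (use Cons.prems in auto)
    qed
    ultimately show ?case by (simp add: Z.M.minus_zero_iff)
  qed simp
qed

text \<open>Linearity in each slot is inherited term by term. For two adjacent equal entries, the
  terms that delete one of them cancel, and all others still contain both.\<close>

lemma contract_alternating:
  assumes A: "cring A" and hom: "\<pi> \<in> ring_hom A B" and Z: "module B Z" and M: "module A M"
    and \<theta>: "lin_map A M (restr \<pi> (self_module B)) \<theta>" and G: "alternating A M (restr \<pi> Z) G"
  shows "alternating A M (restr \<pi> Z) (contract Z \<theta> G)"
proof -
  interpret Z: module B Z by fact
  interpret M: module A M by fact
  note t = lin_mapD[OF \<theta>, simplified]
  have pi: "a \<in> carrier A \<Longrightarrow> \<pi> a \<in> carrier B" for a by (rule ring_hom_closed[OF hom])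
  note mm = Z.smult_r_distr Z.M.add_minus_add Z.smult_minus
  have cl: "contract Z \<theta> G xs \<in> carrier Z" if "alternating A M (restr \<pi> Z) G" "set xs \<subseteq> carrier M" for xs G
    using that
  proof (induction xs arbitrary: G)
    case (Cons x xs)
    have "alternating A M (restr \<pi> Z) (\<lambda>l. G (x # l))" by (rule alternating_Cons) (use Cons.prems in auto)
    then show ?case using Cons alternatingD(1)[OF Cons.prems(1)] t(1) by auto
  qed simp
  have zero: "contract Z \<theta> G xs = \<zero>\<^bsub>Z\<^esub>"
    if "\<And>l. set l \<subseteq> carrier M \<Longrightarrow> G l = \<zero>\<^bsub>Z\<^esub>" "set xs \<subseteq> carrier M" for G xs
    using that
  proof (induction xs arbitrary: G)
    case (Cons y ys)
    have "contract Z \<theta> (\<lambda>l. G (y # l)) ys = \<zero>\<^bsub>Z\<^esub>" by (rule Cons.IH) (use Cons.prems in auto)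
    then show ?case using Cons.prems t(1) by (simp add: Z.M.minus_zero_iff)
  qed simp
  have cong: "contract Z \<theta> G1 xs = contract Z \<theta> G2 xs"
    if "\<And>l. set l \<subseteq> carrier M \<Longrightarrow> G1 l = G2 l" "set xs \<subseteq> carrier M" for G1 G2 xs
    using that
  proof (induction xs arbitrary: G1 G2)
    case (Cons x xs)
    have "contract Z \<theta> (\<lambda>l. G1 (x # l)) xs = contract Z \<theta> (\<lambda>l. G2 (x # l)) xs"
      by (rule Cons.IH) (use Cons.prems in auto)
    moreover have "G1 xs = G2 xs" using Cons.prems by auto
    ultimately show ?case by simp
  qed simp
  \<comment> \<open>The recursion moves leading entries into the function, so linearity in an
    argument of \<open>contract\<close> becomes linearity in \<open>G\<close>; this is proved
    beforehand.\<close>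
  have addG: "contract Z \<theta> (\<lambda>l. G l \<oplus>\<^bsub>Z\<^esub> H l) xs = contract Z \<theta> G xs \<oplus>\<^bsub>Z\<^esub> contract Z \<theta> H xs"
    if "alternating A M (restr \<pi> Z) G" "alternating A M (restr \<pi> Z) H" "set xs \<subseteq> carrier M" for G H xs
    using that
  proof (induction xs arbitrary: G H)
    case (Cons x xs)
    have x: "x \<in> carrier M" "set xs \<subseteq> carrier M" using Cons.prems by auto
    note a = alternating_Cons[OF Cons.prems(1) x(1)] alternating_Cons[OF Cons.prems(2) x(1)]
    show ?case using Cons.IH[OF a x(2)] cl[OF a(1) x(2)] cl[OF a(2) x(2)] t(1)[OF x(1)]
        alternatingD(1)[OF Cons.prems(1) x(2)] alternatingD(1)[OF Cons.prems(2) x(2)]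
      by (simp add: mm)
  qed simp
  have smultG: "contract Z \<theta> (\<lambda>l. b \<odot>\<^bsub>Z\<^esub> G l) xs = b \<odot>\<^bsub>Z\<^esub> contract Z \<theta> G xs"
    if "alternating A M (restr \<pi> Z) G" "b \<in> carrier B" "set xs \<subseteq> carrier M" for G xs b
    using that
  proof (induction xs arbitrary: G)
    case (Cons x xs)
    have x: "x \<in> carrier M" "set xs \<subseteq> carrier M" using Cons.prems by auto
    note a = alternating_Cons[OF Cons.prems(1) x(1)]
    have "\<theta> x \<odot>\<^bsub>Z\<^esub> (b \<odot>\<^bsub>Z\<^esub> G xs) = b \<odot>\<^bsub>Z\<^esub> (\<theta> x \<odot>\<^bsub>Z\<^esub> G xs)"
      using t(1)[OF x(1)] Cons.prems(2) alternatingD(1)[OF Cons.prems(1) x(2)]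
      by (simp add: Z.smult_assoc1[symmetric] Z.R.m_comm)
    then show ?case using Cons.IH[OF a _ x(2)] cl[OF a(1) x(2)] t(1)[OF x(1)] Cons.prems(2)
        alternatingD(1)[OF Cons.prems(1) x(2)]
      by (simp add: mm)
  qed simp
  show ?thesis
  proof (rule alternatingI, goal_cases)
    case (1 xs) then show ?case using cl[OF G] by simp
  next
    case (2 xs ys m m')
    then show ?case using G
    proof (induction xs arbitrary: G)
      case Nil
      note D = alternatingD[OF Nil.prems(5), simplified]
      note a = alternating_Cons[OF Nil.prems(5) Nil.prems(3)] alternating_Cons[OF Nil.prems(5) Nil.prems(4)]
      have "contract Z \<theta> (\<lambda>l. G ((m \<oplus>\<^bsub>M\<^esub> m') # l)) ys = contract Z \<theta> (\<lambda>l. G (m # l) \<oplus>\<^bsub>Z\<^esub> G (m' # l)) ys"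
        by (rule cong) (use D(2)[of "[]"] Nil.prems in auto)
      then show ?case using addG[OF a Nil.prems(2)] Nil.prems cl[OF a(1) Nil.prems(2)] cl[OF a(2) Nil.prems(2)] t D(1)[of ys]
        by (simp add: mm Z.smult_l_distr)
    next
      case (Cons x xs)
      have x: "x \<in> carrier M" "set xs \<subseteq> carrier M" using Cons.prems by auto
      note a = alternating_Cons[OF Cons.prems(5) x(1)]
      have c: "set (xs @ n # ys) \<subseteq> carrier M" if "n \<in> carrier M" for n using that x Cons.prems by auto
      show ?case using Cons.IH[OF x(2) Cons.prems(2-4) a] Cons.prems t(1)[OF x(1)] x
          alternatingD(2)[OF Cons.prems(5) x(2) Cons.prems(2-4)]
          alternatingD(1)[OF Cons.prems(5) c] cl[OF a c]
        by (simp add: mm)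
    qed
  next
    case (3 xs ys b m)
    then show ?case using G
    proof (induction xs arbitrary: G)
      case Nil
      note D = alternatingD[OF Nil.prems(5), simplified]
      note a = alternating_Cons[OF Nil.prems(5) Nil.prems(4)]
      have "contract Z \<theta> (\<lambda>l. G ((b \<odot>\<^bsub>M\<^esub> m) # l)) ys = contract Z \<theta> (\<lambda>l. \<pi> b \<odot>\<^bsub>Z\<^esub> G (m # l)) ys"
        by (rule cong) (use D(3)[of "[]"] Nil.prems in auto)
      then show ?case using smultG[OF a pi Nil.prems(2)] Nil.prems cl[OF a(1) Nil.prems(2)] t D(1)[of ys] pi
        by (simp add: mm Z.smult_assoc1)
    next
      case (Cons x xs)
      have x: "x \<in> carrier M" "set xs \<subseteq> carrier M" using Cons.prems by auto
      note a = alternating_Cons[OF Cons.prems(5) x(1)]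
      have c: "set (xs @ n # ys) \<subseteq> carrier M" if "n \<in> carrier M" for n using that x Cons.prems by auto
      have Gc: "G (xs @ m # ys) \<in> carrier Z" using alternatingD(1)[OF Cons.prems(5) c[OF Cons.prems(4)]] by simp
      have "\<theta> x \<odot>\<^bsub>Z\<^esub> (\<pi> b \<odot>\<^bsub>Z\<^esub> G (xs @ m # ys)) = \<pi> b \<odot>\<^bsub>Z\<^esub> (\<theta> x \<odot>\<^bsub>Z\<^esub> G (xs @ m # ys))"
        using t(1)[OF x(1)] pi[OF Cons.prems(3)] Gc by (simp add: Z.smult_assoc1[symmetric] Z.R.m_comm)
      then show ?case using Cons.IH[OF x(2) Cons.prems(2-4) a] Cons.prems t(1)[OF x(1)] x pi
          alternatingD(3)[OF Cons.prems(5) x(2) Cons.prems(2-4)]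
          Gc cl[OF a c]
        by (simp add: mm)
    qed
  next
    case (4 xs ys m)
    then show ?case using G
    proof (induction xs arbitrary: G)
      case Nil
      note D = alternatingD[OF Nil.prems(4), simplified]
      \<comment> \<open>Two unfoldings produce the terms that delete the first and the second
        \<open>m\<close>, with opposite signs; the remainder keeps both copies in front.\<close>
      have "contract Z \<theta> (\<lambda>l. G (m # m # l)) ys = \<zero>\<^bsub>Z\<^esub>"
        by (rule zero) (use D(4)[of "[]"] Nil.prems in auto)
      then show ?case using Nil.prems t(1) D(1)[of "m # ys"] by (simp add: Z.M.minus_zero_iff Z.M.minus_zero_right)
    next
      case (Cons x xs)
      have x: "x \<in> carrier M" "set xs \<subseteq> carrier M" using Cons.prems by auto
      note a = alternating_Cons[OF Cons.prems(4) x(1)]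
      show ?case using Cons.IH[OF x(2) Cons.prems(2,3) a] alternatingD(4)[OF Cons.prems(4) x(2) Cons.prems(2,3)] t(1)[OF x(1)]
        by (simp add: Z.M.minus_zero_iff)
    qed
  qed
qed

subsection \<open>Prime ideals, Nakayama's lemma and localization\<close>

lemma (in ideal) ideal_simps:
  "\<zero> \<in> I" "x \<in> I \<Longrightarrow> x \<in> carrier R" "x \<in> I \<Longrightarrow> y \<in> I \<Longrightarrow> x \<oplus> y \<in> I" "x \<in> I \<Longrightarrow> y \<in> I \<Longrightarrow> x \<ominus> y \<in> I"
  "a \<in> carrier R \<Longrightarrow> x \<in> I \<Longrightarrow> a \<otimes> x \<in> I" "a \<in> carrier R \<Longrightarrow> x \<in> I \<Longrightarrow> x \<otimes> a \<in> I"
  by (auto simp: a_minus_def I_l_closed I_r_closed)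

lemma (in cring) idealI':
  assumes "I \<subseteq> carrier R" "\<zero> \<in> I" "\<And>x y. x \<in> I \<Longrightarrow> y \<in> I \<Longrightarrow> x \<oplus> y \<in> I"
    "\<And>a x. a \<in> carrier R \<Longrightarrow> x \<in> I \<Longrightarrow> a \<otimes> x \<in> I"
  shows "ideal I R"
proof -
  interpret S: module R "self_module R" by (rule self_is_module[OF is_cring])
  have "submodule I R (self_module R)" by (rule S.submoduleI') (use assms in auto)
  then show ?thesis using self_submodule_iff[OF is_cring] by simp
qed

lemma (in cring) finsum_ideal:
  "finite S \<Longrightarrow> ideal I R \<Longrightarrow> (\<And>j. j \<in> S \<Longrightarrow> h j \<in> I) \<Longrightarrow> (\<Oplus>j\<in>S. h j) \<in> I"
proof (induction S rule: finite_induct)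
  case empty then show ?case using ideal.ideal_simps(1) by simp
next
  case (insert x S)
  note D = ideal.ideal_simps[OF insert.prems(1)]
  show ?case using insert D by (simp add: Pi_def)
qed

lemma (in cring) ex_maximal:
  assumes "ideal I R" "\<one> \<notin> I"
  obtains M where "maximalideal M R" "I \<subseteq> M"
proof -
  let ?A = "{J. ideal J R \<and> I \<subseteq> J \<and> \<one> \<notin> J}"
  have "\<exists>M\<in>(?A). \<forall>Y\<in>?A. M \<subseteq> Y \<longrightarrow> Y = M"
  proof (rule subset_Zorn_nonempty)
    show "?A \<noteq> {}" using assms by auto
    fix C assume C: "C \<noteq> {}" "subset.chain ?A C"
    then have "subset.chain {I. ideal I R} C" by (auto simp: subset_chain_def)
    from chain_Union_is_ideal[OF this] C show "\<Union>C \<in> ?A" by (auto simp: subset_chain_def)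
  qed
  then obtain M where M: "ideal M R" "I \<subseteq> M" "\<one> \<notin> M" "\<And>Y. ideal Y R \<Longrightarrow> I \<subseteq> Y \<Longrightarrow> \<one> \<notin> Y \<Longrightarrow> M \<subseteq> Y \<Longrightarrow> Y = M" by auto
  have "maximalideal M R"
  proof (rule maximalidealI[OF M(1)])
    show "carrier R \<noteq> M" using M(3) by auto
    fix J assume "ideal J R" "M \<subseteq> J" "J \<subseteq> carrier R"
    then show "J = M \<or> J = carrier R" using M(2) M(4)[of J] ideal.one_imp_carrier by blast
  qed
  then show ?thesis using that M by blast
qed

text \<open>The scalars that carry \<open>w\<close> into \<open>Y\<close> form an ideal contained in
  no maximal ideal, so this ideal contains one.\<close>

lemma (in cring) local_global:
  assumes "module R M" "submodule Y R M" "w \<in> carrier M"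
    "\<And>P. maximalideal P R \<Longrightarrow> \<exists>s\<in>carrier R - P. s \<odot>\<^bsub>M\<^esub> w \<in> Y"
  shows "w \<in> Y"
proof -
  interpret M: module R M by fact
  note D = M.submoduleD[OF assms(2)]
  let ?I = "{s \<in> carrier R. s \<odot>\<^bsub>M\<^esub> w \<in> Y}"
  have "ideal ?I R"
    by (rule idealI') (use assms(3) D in \<open>auto simp: M.smult_l_distr M.smult_assoc1\<close>)
  moreover have "\<not> ?I \<subseteq> P" if "maximalideal P R" for P using assms(4)[OF that] by blast
  ultimately have "\<one> \<in> ?I" using ex_maximal[of ?I] by blast
  then show ?thesis using assms(3) by simp
qed

text \<open>The intersection of a chain of primes is prime. Complements are used because the form of
  Zorn's lemma at hand yields maximal elements for inclusion.\<close>

lemma (in cring) ex_minimal_prime: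
  assumes "primeideal Q R" "Y \<subseteq> Q"
  obtains P where "minimal_prime_over R Y P" "P \<subseteq> Q"
proof -
  let ?A = "{- P | P. primeideal P R \<and> Y \<subseteq> P \<and> P \<subseteq> Q}"
  have "\<exists>M\<in>(?A). \<forall>Y\<in>(?A). M \<subseteq> Y \<longrightarrow> Y = M"
  proof (rule subset_Zorn_nonempty)
    show "?A \<noteq> {}" using assms by auto
    fix C assume C: "C \<noteq> {}" "subset.chain ?A C"
    have sub: "\<And>c. c \<in> C \<Longrightarrow> primeideal (- c) R \<and> Y \<subseteq> - c \<and> - c \<subseteq> Q" using C by (auto simp: subset_chain_def)
    have tot: "\<And>c d. c \<in> C \<Longrightarrow> d \<in> C \<Longrightarrow> c \<subseteq> d \<or> d \<subseteq> c" using C by (auto simp: subset_chain_def)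
    note pr = primeideal.axioms(1)[OF conjunct1[OF sub]]
    note is0 = ideal.ideal_simps[OF pr, simplified]
    obtain c0 where c0: "c0 \<in> C" using C by auto
    have id: "ideal (- \<Union>C) R"
    proof (rule idealI')
      show "- \<Union>C \<subseteq> carrier R" using is0(2)[OF c0] c0 by blast
      show "\<zero> \<in> - \<Union>C" using is0(1) by auto
      show "x \<oplus> y \<in> - \<Union>C" if "x \<in> - \<Union>C" "y \<in> - \<Union>C" for x y using is0(3) that by blast
      show "a \<otimes> x \<in> - \<Union>C" if "a \<in> carrier R" "x \<in> - \<Union>C" for a x using is0(5) that by blast
    qed
    have "primeideal (- \<Union>C) R"
    proof (rule primeidealI[OF id is_cring])
      have "\<one> \<notin> Q" using ideal.one_imp_carrier[OF primeideal.axioms(1)[OF assms(1)]] primeideal.I_notcarr[OF assms(1)] by blast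
      then show "carrier R \<noteq> - \<Union>C" using sub[OF c0] c0 one_closed by blast
      fix a b assume ab: "a \<in> carrier R" "b \<in> carrier R" "a \<otimes> b \<in> - \<Union>C"
      show "a \<in> - \<Union>C \<or> b \<in> - \<Union>C"
      proof (rule ccontr)
        assume "\<not> ?thesis"
        then obtain c d where cd: "c \<in> C" "d \<in> C" "a \<in> c" "b \<in> d" by auto
        then obtain e where e: "e \<in> C" "a \<in> e" "b \<in> e" using tot[OF cd(1,2)] by blast
        then have "a \<otimes> b \<in> - e" using ab by auto
        then show False using primeideal.I_prime[OF conjunct1[OF sub[OF e(1)]] ab(1,2)] e by auto
      qed
    qed
    moreover have "Y \<subseteq> - \<Union>C" using sub by blast
    moreover have "- \<Union>C \<subseteq> Q" using sub[OF c0] c0 by blast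
    ultimately show "\<Union>C \<in> ?A" by (auto intro!: exI[of _ "- \<Union>C"])
  qed
  then obtain M where M: "M \<in> ?A" "\<forall>Y\<in>?A. M \<subseteq> Y \<longrightarrow> Y = M" ..
  from M(1) obtain P where P: "M = - P" "primeideal P R" "Y \<subseteq> P" "P \<subseteq> Q" by (elim CollectE exE conjE)
  note max = bspec[OF M(2), rule_format, unfolded P(1)]
  have "minimal_prime_over R Y P" unfolding minimal_prime_over_def
  proof (intro conjI allI impI)
    fix P' assume P': "primeideal P' R \<and> Y \<subseteq> P' \<and> P' \<subseteq> P"
    then have "- P' \<in> ?A" "- P \<subseteq> - P'" using P by auto
    from max[OF this] show "P' = P" by auto
  qed (use P in auto)
  then show ?thesis using that P by blast
qed

section \<open>Nakayama's lemma at a prime\<close>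

context module begin

text \<open>The submodule \<open>P W + Y\<close> appears in two guises: here as explicit
  combinations of the finitely many elements of \<open>W\<close>, suited to elimination, and in
  \<open>nak\<close> as a span, suited to checking membership.\<close>

definition comb where
  "comb P W Y = {(\<Oplus>\<^bsub>M\<^esub>v\<in>W. c v \<odot>\<^bsub>M\<^esub> v) \<oplus>\<^bsub>M\<^esub> y | c y. c \<in> W \<rightarrow> P \<and> y \<in> Y}"

definition nak where
  "nak P W Y = submodule_span R M ({p \<odot>\<^bsub>M\<^esub> x | p x. p \<in> P \<and> x \<in> submodule_span R M W} \<union> Y)"

lemma comb_submodule:
  assumes P: "ideal P R" and W: "finite W" "W \<subseteq> carrier M" and Y: "submodule Y R M"
  shows "submodule (comb P W Y) R M"
proof -
  interpret P: ideal P R by fact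
  note D = submoduleD[OF Y]
  have cl: "c v \<odot>\<^bsub>M\<^esub> v \<in> carrier M" if "c \<in> W \<rightarrow> P" "v \<in> W" for c v
    using that W P.ideal_simps(2) by (auto simp: Pi_iff subset_iff)
  have cl': "(\<Oplus>\<^bsub>M\<^esub>v\<in>W. c v \<odot>\<^bsub>M\<^esub> v) \<in> carrier M" if "c \<in> W \<rightarrow> P" for c
    by (rule M.finsum_closed) (use cl that in auto)
  show ?thesis
  proof (rule submoduleI')
    show "comb P W Y \<subseteq> carrier M" using D(2) cl' by (auto simp: comb_def)
    have "(\<Oplus>\<^bsub>M\<^esub>v\<in>W. \<zero> \<odot>\<^bsub>M\<^esub> v) = \<zero>\<^bsub>M\<^esub>" by (rule M.add.finprod_one_eqI) (use W in auto)
    then show "\<zero>\<^bsub>M\<^esub> \<in> comb P W Y" using D(3) unfolding comb_def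
      by (intro CollectI exI[of _ "\<lambda>_. \<zero>"] exI[of _ "\<zero>\<^bsub>M\<^esub>"]) (auto simp: P.ideal_simps)
    show "a \<oplus>\<^bsub>M\<^esub> b \<in> comb P W Y" if ab: "a \<in> comb P W Y" "b \<in> comb P W Y" for a b
    proof -
      obtain c y c' y' where *: "a = (\<Oplus>\<^bsub>M\<^esub>v\<in>W. c v \<odot>\<^bsub>M\<^esub> v) \<oplus>\<^bsub>M\<^esub> y" "b = (\<Oplus>\<^bsub>M\<^esub>v\<in>W. c' v \<odot>\<^bsub>M\<^esub> v) \<oplus>\<^bsub>M\<^esub> y'"
        "c \<in> W \<rightarrow> P" "c' \<in> W \<rightarrow> P" "y \<in> Y" "y' \<in> Y" using ab unfolding comb_def by blast
      have "(\<Oplus>\<^bsub>M\<^esub>v\<in>W. (c v \<oplus> c' v) \<odot>\<^bsub>M\<^esub> v) = (\<Oplus>\<^bsub>M\<^esub>v\<in>W. c v \<odot>\<^bsub>M\<^esub> v \<oplus>\<^bsub>M\<^esub> c' v \<odot>\<^bsub>M\<^esub> v)"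
        by (rule M.finsum_cong') (use * W P.ideal_simps(2) cl in \<open>auto simp: smult_l_distr Pi_iff subset_iff\<close>)
      also have "\<dots> = (\<Oplus>\<^bsub>M\<^esub>v\<in>W. c v \<odot>\<^bsub>M\<^esub> v) \<oplus>\<^bsub>M\<^esub> (\<Oplus>\<^bsub>M\<^esub>v\<in>W. c' v \<odot>\<^bsub>M\<^esub> v)"
        by (rule M.finsum_addf) (use cl * in auto)
      finally have "a \<oplus>\<^bsub>M\<^esub> b = (\<Oplus>\<^bsub>M\<^esub>v\<in>W. (c v \<oplus> c' v) \<odot>\<^bsub>M\<^esub> v) \<oplus>\<^bsub>M\<^esub> (y \<oplus>\<^bsub>M\<^esub> y')"
        using * cl'[OF *(3)] cl'[OF *(4)] D(2) by (simp add: M.a_ac)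
      then show ?thesis using * D(4) unfolding comb_def
        by (intro CollectI exI[of _ "\<lambda>v. c v \<oplus> c' v"] exI[of _ "y \<oplus>\<^bsub>M\<^esub> y'"]) (auto simp: P.ideal_simps Pi_iff)
    qed
    show "a \<odot>\<^bsub>M\<^esub> b \<in> comb P W Y" if ab: "a \<in> carrier R" "b \<in> comb P W Y" for a b
    proof -
      obtain c y where *: "b = (\<Oplus>\<^bsub>M\<^esub>v\<in>W. c v \<odot>\<^bsub>M\<^esub> v) \<oplus>\<^bsub>M\<^esub> y" "c \<in> W \<rightarrow> P" "y \<in> Y" using ab unfolding comb_def by blast
      have "a \<odot>\<^bsub>M\<^esub> (\<Oplus>\<^bsub>M\<^esub>v\<in>W. c v \<odot>\<^bsub>M\<^esub> v) = (\<Oplus>\<^bsub>M\<^esub>v\<in>W. a \<odot>\<^bsub>M\<^esub> (c v \<odot>\<^bsub>M\<^esub> v))"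
        by (rule finsum_smult_ldistr) (use W ab cl * in auto)
      also have "\<dots> = (\<Oplus>\<^bsub>M\<^esub>v\<in>W. (a \<otimes> c v) \<odot>\<^bsub>M\<^esub> v)"
        by (rule M.finsum_cong') (use * W P.ideal_simps(2) ab in \<open>auto simp: smult_assoc1 Pi_iff subset_iff\<close>)
      finally have "a \<odot>\<^bsub>M\<^esub> b = (\<Oplus>\<^bsub>M\<^esub>v\<in>W. (a \<otimes> c v) \<odot>\<^bsub>M\<^esub> v) \<oplus>\<^bsub>M\<^esub> (a \<odot>\<^bsub>M\<^esub> y)"
        using * cl'[OF *(2)] D(2) ab by (simp add: smult_r_distr)
      then show ?thesis using * D(7) ab unfolding comb_def
        by (intro CollectI exI[of _ "\<lambda>v. a \<otimes> c v"] exI[of _ "a \<odot>\<^bsub>M\<^esub> y"]) (auto simp: P.ideal_simps Pi_iff)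
    qed
  qed
qed

text \<open>The elements all of whose multiples by \<open>P\<close> are explicit combinations form a
  submodule; it contains \<open>W\<close> and hence the span of \<open>W\<close>.\<close>

lemma nak_sub_comb:
  assumes P: "ideal P R" and W: "finite W" "W \<subseteq> carrier M" and Y: "submodule Y R M"
  shows "nak P W Y \<subseteq> comb P W Y"
proof -
  interpret P: ideal P R by fact
  note C = comb_submodule[OF assms]
  note D = submoduleD[OF Y] and DC = submoduleD[OF C]
  have pw: "p \<odot>\<^bsub>M\<^esub> w \<in> comb P W Y" if "p \<in> P" "w \<in> W" for p w
  proof -
    have "(\<Oplus>\<^bsub>M\<^esub>v\<in>W. (if w = v then p else \<zero>) \<odot>\<^bsub>M\<^esub> v) = (\<Oplus>\<^bsub>M\<^esub>v\<in>W. (if w = v then p \<odot>\<^bsub>M\<^esub> v else \<zero>\<^bsub>M\<^esub>))"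
      by (rule M.finsum_cong') (use that W P.ideal_simps(2) in \<open>auto simp: subset_iff\<close>)
    also have "\<dots> = p \<odot>\<^bsub>M\<^esub> w"
      by (rule M.add.finprod_singleton) (use that W P.ideal_simps(2) in auto)
    finally have "p \<odot>\<^bsub>M\<^esub> w = (\<Oplus>\<^bsub>M\<^esub>v\<in>W. (if w = v then p else \<zero>) \<odot>\<^bsub>M\<^esub> v) \<oplus>\<^bsub>M\<^esub> \<zero>\<^bsub>M\<^esub>"
      using that W P.ideal_simps(2) by auto
    then show ?thesis using D(3) that unfolding comb_def
      by (intro CollectI exI[of _ "\<lambda>v. if w = v then p else \<zero>"] exI[of _ "\<zero>\<^bsub>M\<^esub>"]) (auto simp: P.ideal_simps)
  qed
  have "submodule {x \<in> carrier M. \<forall>p\<in>P. p \<odot>\<^bsub>M\<^esub> x \<in> comb P W Y} R M"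
  proof (rule submoduleI', goal_cases)
    case (2) then show ?case using DC(3) P.ideal_simps(2) by auto
  next
    case (3 a b) then show ?case using DC(4) P.ideal_simps(2) by (auto simp: smult_r_distr)
  next
    case (4 a x)
    then show ?case using P.ideal_simps(2,6) by (auto simp: smult_assoc1[symmetric])
  qed auto
  then have "submodule_span R M W \<subseteq> {x \<in> carrier M. \<forall>p\<in>P. p \<odot>\<^bsub>M\<^esub> x \<in> comb P W Y}"
    by (rule span_least) (use W pw in auto)
  moreover have "Y \<subseteq> comb P W Y"
  proof
    fix x assume x: "x \<in> Y"
    have "(\<Oplus>\<^bsub>M\<^esub>v\<in>W. \<zero> \<odot>\<^bsub>M\<^esub> v) = \<zero>\<^bsub>M\<^esub>" by (rule M.add.finprod_one_eqI) (use W in auto)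
    then show "x \<in> comb P W Y" using x D(2)[OF x] unfolding comb_def
      by (intro CollectI exI[of _ "\<lambda>_. \<zero>"] exI[of _ x]) (auto simp: P.ideal_simps)
  qed
  ultimately show ?thesis unfolding nak_def by (intro span_least[OF C]) auto
qed

text \<open>Generators are eliminated one at a time instead of using a determinant. With
  \<open>v\<close> absorbed into \<open>Y\<close>, the other generators become multiples of
  \<open>v\<close> modulo \<open>Y\<close>; substituting them into the relation for \<open>v\<close>
  leaves a coefficient of \<open>v\<close> outside \<open>P\<close>.\<close>

lemma nakayama_comb:
  assumes P: "primeideal P R" and "finite W" "W \<subseteq> carrier M" "submodule Y R M"
    "\<And>w. w \<in> W \<Longrightarrow> \<exists>s\<in>carrier R - P. s \<odot>\<^bsub>M\<^esub> w \<in> comb P W Y"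
  shows "\<exists>s\<in>carrier R - P. \<forall>w\<in>W. s \<odot>\<^bsub>M\<^esub> w \<in> Y"
proof -
  interpret P: primeideal P R by fact
  have mult: "s \<otimes> t \<in> carrier R - P" if "s \<in> carrier R - P" "t \<in> carrier R - P" for s t
    using that P.I_prime by auto
  show ?thesis using assms(2-)
  proof (induction W arbitrary: Y)
    case empty
    have "\<one> \<in> carrier R - P" using P.I_notcarr P.one_imp_carrier by auto
    then show ?case by auto
  next
    case (insert v W)
    note D = submoduleD[OF insert.prems(2)]
    have v: "v \<in> carrier M" and W: "W \<subseteq> carrier M" using insert.prems by auto
    \<comment> \<open>The submodule \<open>Y + R v\<close>, modulo which the induction hypothesis
      treats the remaining generators.\<close>
    let ?Y = "{x \<oplus>\<^bsub>M\<^esub> r \<odot>\<^bsub>M\<^esub> v | x r. x \<in> Y \<and> r \<in> carrier R}"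
    have X': "submodule ?Y R M"
    proof (rule submoduleI', goal_cases)
      case 1 show ?case using D(2) v by auto
    next
      case 2 show ?case using D(3) v by (intro CollectI exI[of _ "\<zero>\<^bsub>M\<^esub>"] exI[of _ \<zero>]) auto
    next
      case (3 a b)
      then obtain x r x' r' where *: "a = x \<oplus>\<^bsub>M\<^esub> r \<odot>\<^bsub>M\<^esub> v" "b = x' \<oplus>\<^bsub>M\<^esub> r' \<odot>\<^bsub>M\<^esub> v" "x \<in> Y" "x' \<in> Y" "r \<in> carrier R" "r' \<in> carrier R" by auto
      then have "a \<oplus>\<^bsub>M\<^esub> b = (x \<oplus>\<^bsub>M\<^esub> x') \<oplus>\<^bsub>M\<^esub> (r \<oplus> r') \<odot>\<^bsub>M\<^esub> v" using D(2) v by (simp add: smult_l_distr M.a_ac)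
      then show ?case using * D(4) by blast
    next
      case (4 a b)
      then obtain x r where *: "b = x \<oplus>\<^bsub>M\<^esub> r \<odot>\<^bsub>M\<^esub> v" "x \<in> Y" "r \<in> carrier R" by auto
      then have "a \<odot>\<^bsub>M\<^esub> b = a \<odot>\<^bsub>M\<^esub> x \<oplus>\<^bsub>M\<^esub> (a \<otimes> r) \<odot>\<^bsub>M\<^esub> v" using D(2) v 4 by (simp add: smult_r_distr smult_assoc1)
      then show ?case using * D(7) 4 by blast
    qed
    have split: "(\<Oplus>\<^bsub>M\<^esub>u\<in>insert v W. c u \<odot>\<^bsub>M\<^esub> u) = c v \<odot>\<^bsub>M\<^esub> v \<oplus>\<^bsub>M\<^esub> (\<Oplus>\<^bsub>M\<^esub>u\<in>W. c u \<odot>\<^bsub>M\<^esub> u)"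
      if "c \<in> insert v W \<rightarrow> P" for c
      by (rule M.finsum_insert) (use that insert.hyps v W P.ideal_simps(2) in \<open>auto simp: Pi_iff subset_iff\<close>)
    have scl: "(\<Oplus>\<^bsub>M\<^esub>u\<in>W. c u \<odot>\<^bsub>M\<^esub> u) \<in> carrier M" if "c \<in> insert v W \<rightarrow> P" for c
      by (rule M.finsum_closed) (use that W P.ideal_simps(2) in \<open>auto simp: Pi_iff subset_iff\<close>)
    have "\<exists>s\<in>carrier R - P. \<forall>w\<in>W. s \<odot>\<^bsub>M\<^esub> w \<in> ?Y"
    proof (rule insert.IH[OF W X'])
      fix w assume "w \<in> W"
      then obtain s c y where s: "s \<in> carrier R - P" "c \<in> insert v W \<rightarrow> P" "y \<in> Y"
        "s \<odot>\<^bsub>M\<^esub> w = (\<Oplus>\<^bsub>M\<^esub>u\<in>insert v W. c u \<odot>\<^bsub>M\<^esub> u) \<oplus>\<^bsub>M\<^esub> y"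
        using insert.prems(3)[of w] unfolding comb_def by blast
      have "s \<odot>\<^bsub>M\<^esub> w = (\<Oplus>\<^bsub>M\<^esub>u\<in>W. c u \<odot>\<^bsub>M\<^esub> u) \<oplus>\<^bsub>M\<^esub> (y \<oplus>\<^bsub>M\<^esub> c v \<odot>\<^bsub>M\<^esub> v)"
        unfolding s(4) split[OF s(2)] using scl[OF s(2)] s D(2) v P.ideal_simps(2)[of "c v"] by (simp add: M.a_ac Pi_iff)
      moreover have "c v \<in> carrier R" using s(2) P.ideal_simps(2) by auto
      then have "y \<oplus>\<^bsub>M\<^esub> c v \<odot>\<^bsub>M\<^esub> v \<in> ?Y" using s(3) by blast
      ultimately have "s \<odot>\<^bsub>M\<^esub> w \<in> comb P W ?Y" unfolding comb_def using s(2) by blast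
      then show "\<exists>s\<in>carrier R - P. s \<odot>\<^bsub>M\<^esub> w \<in> comb P W ?Y" using s(1) by blast
    qed
    then obtain s' where s': "s' \<in> carrier R - P" "\<And>w. w \<in> W \<Longrightarrow> s' \<odot>\<^bsub>M\<^esub> w \<in> ?Y" by blast
    then have "\<forall>w\<in>W. \<exists>r x. r \<in> carrier R \<and> x \<in> Y \<and> s' \<odot>\<^bsub>M\<^esub> w = x \<oplus>\<^bsub>M\<^esub> r \<odot>\<^bsub>M\<^esub> v" by blast
    then obtain r x where rx: "\<And>w. w \<in> W \<Longrightarrow> r w \<in> carrier R" "\<And>w. w \<in> W \<Longrightarrow> x w \<in> Y"
      "\<And>w. w \<in> W \<Longrightarrow> s' \<odot>\<^bsub>M\<^esub> w = x w \<oplus>\<^bsub>M\<^esub> r w \<odot>\<^bsub>M\<^esub> v" by metis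
    obtain s c y where s: "s \<in> carrier R - P" "c \<in> insert v W \<rightarrow> P" "y \<in> Y"
        "s \<odot>\<^bsub>M\<^esub> v = (\<Oplus>\<^bsub>M\<^esub>u\<in>insert v W. c u \<odot>\<^bsub>M\<^esub> u) \<oplus>\<^bsub>M\<^esub> y"
      using insert.prems(3)[of v] unfolding comb_def by blast
    have cP: "\<And>u. u \<in> W \<Longrightarrow> c u \<in> P" "c v \<in> P" using s(2) by auto
    have cR: "\<And>u. u \<in> W \<Longrightarrow> c u \<in> carrier R" "c v \<in> carrier R" using cP P.ideal_simps(2) by auto
    \<comment> \<open>\<open>s' \<cdot> \<Sum>\<^sub>W c u\<close> is congruent to \<open>p \<cdot> v\<close> modulo \<open>Y\<close> for some \<open>p \<in> P\<close>\<close>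
    have "\<exists>p\<in>P. \<exists>z\<in>Y. s' \<odot>\<^bsub>M\<^esub> (\<Oplus>\<^bsub>M\<^esub>u\<in>W. c u \<odot>\<^bsub>M\<^esub> u) = z \<oplus>\<^bsub>M\<^esub> p \<odot>\<^bsub>M\<^esub> v"
    proof -
      have "\<exists>p\<in>P. \<exists>z\<in>Y. s' \<odot>\<^bsub>M\<^esub> (\<Oplus>\<^bsub>M\<^esub>u\<in>U. c u \<odot>\<^bsub>M\<^esub> u) = z \<oplus>\<^bsub>M\<^esub> p \<odot>\<^bsub>M\<^esub> v" if "finite U" "U \<subseteq> W" for U
        using that
      proof (induction U)
        case empty
        show ?case using s' v D(3) by (intro bexI[of _ \<zero>] bexI[of _ "\<zero>\<^bsub>M\<^esub>"]) (auto simp: P.ideal_simps)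
      next
        case (insert u U)
        then obtain p z where pz: "p \<in> P" "z \<in> Y" "s' \<odot>\<^bsub>M\<^esub> (\<Oplus>\<^bsub>M\<^esub>u\<in>U. c u \<odot>\<^bsub>M\<^esub> u) = z \<oplus>\<^bsub>M\<^esub> p \<odot>\<^bsub>M\<^esub> v" by auto
        have u: "u \<in> W" "u \<in> carrier M" using insert W by auto
        have cl: "(\<Oplus>\<^bsub>M\<^esub>u\<in>U. c u \<odot>\<^bsub>M\<^esub> u) \<in> carrier M"
          by (rule M.finsum_closed) (use insert W cR in auto)
        have "(\<Oplus>\<^bsub>M\<^esub>u\<in>insert u U. c u \<odot>\<^bsub>M\<^esub> u) = c u \<odot>\<^bsub>M\<^esub> u \<oplus>\<^bsub>M\<^esub> (\<Oplus>\<^bsub>M\<^esub>u\<in>U. c u \<odot>\<^bsub>M\<^esub> u)"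
          by (rule M.finsum_insert) (use insert W cR u in auto)
        moreover have "s' \<odot>\<^bsub>M\<^esub> (c u \<odot>\<^bsub>M\<^esub> u) = c u \<odot>\<^bsub>M\<^esub> x u \<oplus>\<^bsub>M\<^esub> (c u \<otimes> r u) \<odot>\<^bsub>M\<^esub> v"
        proof -
          have "s' \<odot>\<^bsub>M\<^esub> (c u \<odot>\<^bsub>M\<^esub> u) = c u \<odot>\<^bsub>M\<^esub> (s' \<odot>\<^bsub>M\<^esub> u)"
            using s' cR u by (simp add: smult_assoc1[symmetric] R.m_comm)
          then show ?thesis using rx[OF u(1)] cR u v D(2) by (simp add: smult_r_distr smult_assoc1)
        qed
        ultimately have "s' \<odot>\<^bsub>M\<^esub> (\<Oplus>\<^bsub>M\<^esub>u\<in>insert u U. c u \<odot>\<^bsub>M\<^esub> u)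
           = (c u \<odot>\<^bsub>M\<^esub> x u \<oplus>\<^bsub>M\<^esub> (c u \<otimes> r u) \<odot>\<^bsub>M\<^esub> v) \<oplus>\<^bsub>M\<^esub> (z \<oplus>\<^bsub>M\<^esub> p \<odot>\<^bsub>M\<^esub> v)"
          using s' cR(1)[OF u(1)] u(2) cl pz by (simp add: smult_r_distr)
        also have "\<dots> = (c u \<odot>\<^bsub>M\<^esub> x u \<oplus>\<^bsub>M\<^esub> z) \<oplus>\<^bsub>M\<^esub> (c u \<otimes> r u \<oplus> p) \<odot>\<^bsub>M\<^esub> v"
          using cR(1)[OF u(1)] rx[OF u(1)] pz D(2) v P.ideal_simps(2) by (simp add: smult_l_distr M.a_ac)
        finally show ?case using cP(1)[OF u(1)] cR(1)[OF u(1)] rx(1,2)[OF u(1)] pz D(4,7)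
          by (intro bexI[of _ "c u \<otimes> r u \<oplus> p"] bexI[of _ "c u \<odot>\<^bsub>M\<^esub> x u \<oplus>\<^bsub>M\<^esub> z"]) (auto simp: P.ideal_simps)
      qed
      from this[OF insert.hyps(1)] show ?thesis by simp
    qed
    then obtain p z where pz: "p \<in> P" "z \<in> Y" "s' \<odot>\<^bsub>M\<^esub> (\<Oplus>\<^bsub>M\<^esub>u\<in>W. c u \<odot>\<^bsub>M\<^esub> u) = z \<oplus>\<^bsub>M\<^esub> p \<odot>\<^bsub>M\<^esub> v" by blast
    \<comment> \<open>All contributions of \<open>v\<close> to the right-hand side, multiplied by
      \<open>s'\<close>, have been collected in \<open>?q\<close>, which lies in \<open>P\<close>.
      As \<open>s'\<close> times \<open>s\<close> lies outside \<open>P\<close>, so does the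
      difference \<open>t\<close>, and \<open>t v\<close> lies in \<open>Y\<close>.\<close>
    let ?q = "p \<oplus> s' \<otimes> c v"
    define t where "t = s' \<otimes> s \<ominus> ?q"
    have q: "?q \<in> P" "?q \<in> carrier R" using pz cP cR s' P.ideal_simps by auto
    have t: "t \<in> carrier R - P"
    proof -
      have "t \<oplus> ?q = s' \<otimes> s" unfolding t_def using q s s' by (simp add: R.minus_eq R.a_assoc R.l_neg)
      then have "t \<notin> P" using mult[OF s'(1) s(1)] P.ideal_simps(3) q(1) by (metis DiffD2)
      then show ?thesis using q s s' by (simp add: t_def)
    qed
    have "s' \<odot>\<^bsub>M\<^esub> (s \<odot>\<^bsub>M\<^esub> v) = (z \<oplus>\<^bsub>M\<^esub> s' \<odot>\<^bsub>M\<^esub> y) \<oplus>\<^bsub>M\<^esub> ?q \<odot>\<^bsub>M\<^esub> v"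
      unfolding s(4) split[OF s(2)] using s' s(3) scl[OF s(2)] cR(2) v D(2) pz P.ideal_simps(2)
      by (simp add: smult_r_distr smult_l_distr smult_assoc1 M.a_ac)
    moreover have "t \<odot>\<^bsub>M\<^esub> v = s' \<odot>\<^bsub>M\<^esub> (s \<odot>\<^bsub>M\<^esub> v) \<ominus>\<^bsub>M\<^esub> ?q \<odot>\<^bsub>M\<^esub> v"
      unfolding t_def R.minus_eq M.minus_eq using s s' v q by (simp add: smult_l_distr smult_l_minus smult_assoc1)
    ultimately have "t \<odot>\<^bsub>M\<^esub> v = z \<oplus>\<^bsub>M\<^esub> s' \<odot>\<^bsub>M\<^esub> y"
      using q v D(2) pz s(3) s' by (simp add: M.minus_eq M.a_assoc M.r_neg)
    then have tv: "t \<odot>\<^bsub>M\<^esub> v \<in> Y" using pz s(3) s' D(4,7) by auto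
    show ?case
    proof (intro bexI[of _ "t \<otimes> s'"] ballI)
      fix w assume w: "w \<in> insert v W"
      show "(t \<otimes> s') \<odot>\<^bsub>M\<^esub> w \<in> Y"
      proof (cases "w = v")
        case True
        have "(t \<otimes> s') \<odot>\<^bsub>M\<^esub> v = s' \<odot>\<^bsub>M\<^esub> (t \<odot>\<^bsub>M\<^esub> v)" using t s' v by (simp add: smult_assoc1[symmetric] R.m_comm)
        then show ?thesis using True tv s' D(7) by auto
      next
        case False
        then have w: "w \<in> W" "w \<in> carrier M" using w W by auto
        have "(t \<otimes> s') \<odot>\<^bsub>M\<^esub> w = t \<odot>\<^bsub>M\<^esub> x w \<oplus>\<^bsub>M\<^esub> r w \<odot>\<^bsub>M\<^esub> (t \<odot>\<^bsub>M\<^esub> v)"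
          using t s' w v rx[OF w(1)] D(2) by (simp add: smult_assoc1 smult_r_distr) (simp add: smult_assoc1[symmetric] R.m_comm)
        then show ?thesis using t rx[OF w(1)] tv D(4,7) by auto
      qed
    qed (rule mult[OF t s'(1)])
  qed
qed

lemma nakayama:
  assumes P: "primeideal P R" and W: "finite W" "W \<subseteq> carrier M" and Y: "submodule Y R M"
    and "\<And>w. w \<in> W \<Longrightarrow> \<exists>s\<in>carrier R - P. s \<odot>\<^bsub>M\<^esub> w \<in> nak P W Y"
  shows "\<exists>s\<in>carrier R - P. \<forall>w\<in>submodule_span R M W. s \<odot>\<^bsub>M\<^esub> w \<in> Y"
proof -
  interpret P: primeideal P R by fact
  have "\<exists>s\<in>carrier R - P. \<forall>w\<in>W. s \<odot>\<^bsub>M\<^esub> w \<in> Y"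
    by (rule nakayama_comb[OF P W Y]) (use assms(5) nak_sub_comb[OF P.is_ideal W Y] in blast)
  then obtain s where s: "s \<in> carrier R - P" "\<And>w. w \<in> W \<Longrightarrow> s \<odot>\<^bsub>M\<^esub> w \<in> Y" by blast
  note D = submoduleD[OF Y]
  have "submodule {w \<in> carrier M. s \<odot>\<^bsub>M\<^esub> w \<in> Y} R M"
  proof (rule submoduleI', goal_cases)
    case (4 a x)
    then have "s \<odot>\<^bsub>M\<^esub> (a \<odot>\<^bsub>M\<^esub> x) = a \<odot>\<^bsub>M\<^esub> (s \<odot>\<^bsub>M\<^esub> x)" using s by (simp add: smult_assoc1[symmetric] R.m_comm)
    then show ?case using 4 D by auto
  qed (use s D in \<open>auto simp: smult_r_distr\<close>)
  from span_least[OF this, of W] W s show ?thesis by blast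
qed

end

subsection \<open>Krull's principal ideal theorem\<close>

lemma (in noetherian_ring) ex_max_ideal:
  assumes "S \<noteq> {}" "\<And>I. I \<in> S \<Longrightarrow> ideal I R"
  obtains I where "I \<in> S" "\<And>J. J \<in> S \<Longrightarrow> I \<subseteq> J \<Longrightarrow> J = I"
proof -
  have "\<exists>I\<in>S. \<forall>J\<in>S. I \<subseteq> J \<longrightarrow> J = I"
  proof (rule subset_Zorn_nonempty[OF assms(1)])
    fix C assume C: "C \<noteq> {}" "subset.chain S C"
    then have "subset.chain {I. ideal I R} C" using assms(2) by (auto simp: subset_chain_def)
    from ideal_chain_is_trivial[OF C(1) this] C show "\<Union>C \<in> S" by (auto simp: subset_chain_def)
  qed
  then show ?thesis using that by blast
qed

context cring begin

text \<open>\<open>sat P I\<close> is the contraction to \<open>R\<close> of the extension of \<open>I\<close> to the localization at \<open>P\<close>.\<close>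

definition sat where "sat P I = {a \<in> carrier R. \<exists>s\<in>carrier R - P. s \<otimes> a \<in> I}"

lemma sat_mono: "I \<subseteq> J \<Longrightarrow> sat P I \<subseteq> sat P J" by (auto simp: sat_def)

lemma satI: "a \<in> carrier R \<Longrightarrow> s \<in> carrier R \<Longrightarrow> s \<notin> P \<Longrightarrow> s \<otimes> a \<in> I \<Longrightarrow> a \<in> sat P I"
  by (auto simp: sat_def)

lemma satE:
  assumes "a \<in> sat P I"
  obtains s where "a \<in> carrier R" "s \<in> carrier R" "s \<notin> P" "s \<otimes> a \<in> I"
  using assms by (auto simp: sat_def)

lemma prime_mult_notin: "primeideal P R \<Longrightarrow> s \<in> carrier R \<Longrightarrow> t \<in> carrier R \<Longrightarrow> s \<notin> P \<Longrightarrow> t \<notin> P \<Longrightarrow> s \<otimes> t \<notin> P"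
  using primeideal.I_prime[of P R s t] by blast

lemma prime_one_notin: "primeideal P R \<Longrightarrow> \<one> \<notin> P"
  using ideal.one_imp_carrier[OF primeideal.axioms(1), of P R] primeideal.I_notcarr[of P R] by blast

lemma sat_incl:
  assumes "primeideal P R" "I \<subseteq> carrier R" shows "I \<subseteq> sat P I"
proof
  fix x assume "x \<in> I"
  then show "x \<in> sat P I" using assms prime_one_notin[OF assms(1)] by (intro satI[of _ \<one>]) auto
qed

lemma sat_ideal:
  assumes P: "primeideal P R" and I: "ideal I R" shows "ideal (sat P I) R"
proof (rule idealI')
  note D = ideal.ideal_simps[OF I]
  show "sat P I \<subseteq> carrier R" by (auto simp: sat_def)
  show "\<zero> \<in> sat P I" using sat_incl[OF P] D(1) ideal.Icarr[OF I] by blast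
  show "x \<oplus> y \<in> sat P I" if xy: "x \<in> sat P I" "y \<in> sat P I" for x y
  proof -
    obtain s where s: "x \<in> carrier R" "s \<in> carrier R" "s \<notin> P" "s \<otimes> x \<in> I" using xy(1) by (rule satE)
    obtain t where t: "y \<in> carrier R" "t \<in> carrier R" "t \<notin> P" "t \<otimes> y \<in> I" using xy(2) by (rule satE)
    have "(s \<otimes> t) \<otimes> (x \<oplus> y) = t \<otimes> (s \<otimes> x) \<oplus> s \<otimes> (t \<otimes> y)" using s t by (simp add: r_distr m_ac)
    then show ?thesis using s t D prime_mult_notin[OF P] by (intro satI[of _ "s \<otimes> t"]) auto
  qed
  show "a \<otimes> x \<in> sat P I" if a: "a \<in> carrier R" and x: "x \<in> sat P I" for a x
  proof -
    obtain s where s: "x \<in> carrier R" "s \<in> carrier R" "s \<notin> P" "s \<otimes> x \<in> I" using x by (rule satE)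
    have "s \<otimes> (a \<otimes> x) = a \<otimes> (s \<otimes> x)" using s a by (simp add: m_ac)
    then show ?thesis using s a D by (intro satI[of _ s]) auto
  qed
qed

lemma sat_sat:
  assumes P: "primeideal P R" and a: "a \<in> carrier R" "s \<in> carrier R" "s \<notin> P" "s \<otimes> a \<in> sat P I"
  shows "a \<in> sat P I"
proof -
  obtain t where t: "t \<in> carrier R" "t \<notin> P" "t \<otimes> (s \<otimes> a) \<in> I" using a(4) by (rule satE)
  then show ?thesis using a prime_mult_notin[OF P t(1) a(2) t(2) a(3)] by (intro satI[of _ "t \<otimes> s"]) (auto simp: m_assoc)
qed

lemma sat_prime:
  assumes "primeideal Q R" "Q \<subseteq> P" shows "sat P Q \<subseteq> Q"
proof
  fix x assume "x \<in> sat P Q"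
  then obtain s where "x \<in> carrier R" "s \<in> carrier R" "s \<notin> P" "s \<otimes> x \<in> Q" by (rule satE)
  then show "x \<in> Q" using primeideal.I_prime[OF assms(1)] assms(2) by blast
qed

text \<open>The ideal \<open>I + R y\<close>, given by explicit sums so that its elements can be
  decomposed at once.\<close>

definition adj where "adj I y = {j \<oplus> c \<otimes> y | j c. j \<in> I \<and> c \<in> carrier R}"

lemma adj_ideal:
  assumes I: "ideal I R" and y: "y \<in> carrier R"
  shows "ideal (adj I y) R" "I \<subseteq> adj I y" "y \<in> adj I y"
proof -
  note D = ideal.ideal_simps[OF I]
  show "ideal (adj I y) R"
  proof (rule idealI')
    show "adj I y \<subseteq> carrier R" using D y by (auto simp: adj_def)
    show "\<zero> \<in> adj I y" using D y unfolding adj_def by (intro CollectI exI[of _ \<zero>]) auto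
    show "x \<oplus> z \<in> adj I y" if xz: "x \<in> adj I y" "z \<in> adj I y" for x z
    proof -
      obtain j c j' c' where *: "x = j \<oplus> c \<otimes> y" "z = j' \<oplus> c' \<otimes> y" "j \<in> I" "j' \<in> I" "c \<in> carrier R" "c' \<in> carrier R"
        using xz by (auto simp: adj_def)
      then have "x \<oplus> z = (j \<oplus> j') \<oplus> (c \<oplus> c') \<otimes> y" using D(2) y by (simp add: l_distr a_ac)
      then show ?thesis using * D(3) unfolding adj_def by blast
    qed
    show "a \<otimes> x \<in> adj I y" if ax: "a \<in> carrier R" "x \<in> adj I y" for a x
    proof -
      obtain j c where *: "x = j \<oplus> c \<otimes> y" "j \<in> I" "c \<in> carrier R" using ax by (auto simp: adj_def)
      then have "a \<otimes> x = a \<otimes> j \<oplus> (a \<otimes> c) \<otimes> y" using D(2) y ax by (simp add: r_distr m_assoc)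
      then show ?thesis using * D(5) ax unfolding adj_def by blast
    qed
  qed
  show "I \<subseteq> adj I y"
  proof
    fix x assume x: "x \<in> I"
    then show "x \<in> adj I y" using D(2)[OF x] y unfolding adj_def by (intro CollectI exI[of _ x] exI[of _ \<zero>]) auto
  qed
  show "y \<in> adj I y" using D(1) y unfolding adj_def by (intro CollectI exI[of _ \<zero>] exI[of _ \<one>]) auto
qed

text \<open>The localization at \<open>P\<close> of the quotient by \<open>I\<close> is Artinian
  when \<open>P\<close> is minimal over \<open>I\<close>. The proof is Noetherian induction on
  \<open>I\<close>: for a largest counterexample \<open>L\<close> an element \<open>y\<close> is
  found that spans a simple module over the local ring modulo \<open>L\<close>, and the claim is
  known for the larger ideal \<open>L + R y\<close>.\<close>

lemma dcc:
  assumes N: "noetherian_ring R" and P: "primeideal P R"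
    and I: "ideal I R" and min: "\<And>Q. primeideal Q R \<Longrightarrow> I \<subseteq> Q \<Longrightarrow> Q \<subseteq> P \<Longrightarrow> Q = P"
    and J: "\<And>n::nat. ideal (J n) R" "\<And>n. I \<subseteq> J n" "\<And>n. J (Suc n) \<subseteq> J n"
  shows "\<exists>n0. \<forall>n\<ge>n0. J n \<subseteq> sat P (J (Suc n))"
proof (rule ccontr)
  assume contr: "\<not> ?thesis"
  define good where "good I \<longleftrightarrow> (\<forall>J::nat \<Rightarrow> 'a set. (\<forall>n. ideal (J n) R) \<and> (\<forall>n. I \<subseteq> J n) \<and> (\<forall>n. J (Suc n) \<subseteq> J n) \<longrightarrow>
      (\<exists>n0. \<forall>n\<ge>n0. J n \<subseteq> sat P (J (Suc n))))" for I
  \<comment> \<open>Minimality of \<open>P\<close> is kept in the definition, because the larger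
    ideals compared with \<open>L\<close> have to satisfy it as well.\<close>
  define Bad where "Bad = {I. ideal I R \<and> (\<forall>Q. primeideal Q R \<and> I \<subseteq> Q \<and> Q \<subseteq> P \<longrightarrow> Q = P) \<and> \<not> good I}"
  have "I \<in> Bad" unfolding Bad_def good_def using I min contr J by blast
  then obtain L where L: "L \<in> Bad" and Lmax: "\<And>J. J \<in> Bad \<Longrightarrow> L \<subseteq> J \<Longrightarrow> J = L"
    using noetherian_ring.ex_max_ideal[OF N, of Bad] unfolding Bad_def by blast
  have Lid: "ideal L R" and Lmin: "\<And>Q. primeideal Q R \<Longrightarrow> L \<subseteq> Q \<Longrightarrow> Q \<subseteq> P \<Longrightarrow> Q = P"
    using L unfolding Bad_def by auto
  have "\<not> good L" using L by (simp add: Bad_def)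
  then have "\<exists>J::nat \<Rightarrow> 'a set. (\<forall>n. ideal (J n) R) \<and> (\<forall>n. L \<subseteq> J n) \<and> (\<forall>n. J (Suc n) \<subseteq> J n) \<and>
      \<not> (\<exists>n0. \<forall>n\<ge>n0. J n \<subseteq> sat P (J (Suc n)))"
    unfolding good_def by (simp only: not_all not_imp conj_assoc)
  then obtain J where J: "\<And>n::nat. ideal (J n) R" "\<And>n. L \<subseteq> J n" "\<And>n. J (Suc n) \<subseteq> J n"
    and bad: "\<And>n0. \<exists>n\<ge>n0. \<not> J n \<subseteq> sat P (J (Suc n))" by (elim exE conjE) (simp; blast)
  note JD = ideal.ideal_simps[OF J(1)]
  have sid: "ideal (sat P L) R" by (rule sat_ideal[OF P Lid])
  note SD = ideal.ideal_simps[OF sid]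
  have Lsub: "L \<subseteq> carrier R" using ideal.ideal_simps(2)[OF Lid] by blast
  have J_dec: "m \<le> n \<Longrightarrow> J n \<subseteq> J m" for m n using lift_Suc_antimono_le[of J] J(3) by blast
  show False
  proof (cases "\<one> \<in> sat P L")
    \<comment> \<open>Here \<open>L\<close> contains an element outside \<open>P\<close>, so locally
      the quotient is zero and every chain is constant.\<close>
    case True
    then obtain s where s: "s \<in> carrier R" "s \<notin> P" "s \<otimes> \<one> \<in> L" by (rule satE)
    have "J n \<subseteq> sat P (J (Suc n))" for n
    proof
      fix a assume a: "a \<in> J n"
      then have "a \<in> carrier R" using JD(2) by blast
      moreover have "s \<in> J (Suc n)" using s J(2) by auto
      ultimately show "a \<in> sat P (J (Suc n))" using s JD(6) by (intro satI[of a s]) auto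
    qed
    then show False using bad by blast
  next
    case False
    \<comment> \<open>Annihilators modulo the saturation of \<open>L\<close>. A maximal one among
      those of elements outside the saturation is prime; it lies between \<open>L\<close> and
      \<open>P\<close> and hence equals \<open>P\<close>.\<close>
    define ann where "ann z = {c \<in> carrier R. c \<otimes> z \<in> sat P L}" for z
    have ann_ideal: "ideal (ann z) R" if "z \<in> carrier R" for z
      by (rule idealI') (use that SD in \<open>auto simp: ann_def l_distr m_assoc\<close>)
    let ?F = "ann ` (carrier R - sat P L)"
    have "?F \<noteq> {}" using False by auto
    then obtain M where M: "M \<in> ?F" "\<And>J. J \<in> ?F \<Longrightarrow> M \<subseteq> J \<Longrightarrow> J = M"
      using noetherian_ring.ex_max_ideal[OF N, of ?F] ann_ideal by blast
    then obtain y where y: "y \<in> carrier R" "y \<notin> sat P L" "M = ann y" by auto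
    have My: "ideal M R" using ann_ideal y by auto
    have "primeideal M R"
    proof (rule primeidealI[OF My is_cring])
      have "\<one> \<notin> M" using y by (simp add: ann_def)
      then show "carrier R \<noteq> M" by blast
      fix a b assume ab: "a \<in> carrier R" "b \<in> carrier R" "a \<otimes> b \<in> M"
      show "a \<in> M \<or> b \<in> M"
      proof (rule disjCI)
        assume b: "b \<notin> M"
        then have by_: "b \<otimes> y \<in> carrier R - sat P L" using ab y by (auto simp: ann_def)
        have "M \<subseteq> ann (b \<otimes> y)"
        proof
          fix z assume "z \<in> M"
          then have z: "z \<in> carrier R" "z \<otimes> y \<in> sat P L" using y by (auto simp: ann_def)
          then have "z \<otimes> (b \<otimes> y) = b \<otimes> (z \<otimes> y)" using ab y by (simp add: m_lcomm)
          then show "z \<in> ann (b \<otimes> y)" using z SD(5)[OF ab(2) z(2)] by (simp add: ann_def)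
        qed
        then have "ann (b \<otimes> y) = M" using M(2) by_ by blast
        moreover have "a \<in> ann (b \<otimes> y)" using ab y by (auto simp: ann_def m_assoc)
        ultimately show "a \<in> M" by simp
      qed
    qed
    moreover have "L \<subseteq> M" using sat_incl[OF P Lsub] SD(6)[OF y(1)] Lsub unfolding y(3) ann_def by blast
    moreover have "M \<subseteq> P" unfolding y(3) ann_def using sat_sat[OF P y(1)] y(2) by blast
    ultimately have MP: "M = P" by (rule Lmin)
    \<comment> \<open>Thus \<open>y\<close> spans a copy of the residue field at \<open>P\<close> in
      the localized quotient by \<open>L\<close>.\<close>
    have socle: "c \<otimes> y \<in> sat P L" if "c \<in> P" for c using that MP y(3) by (auto simp: ann_def)
    note A = adj_ideal[OF Lid y(1)]
    have "adj L y \<notin> Bad"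
    proof
      assume "adj L y \<in> Bad"
      from Lmax[OF this A(2)] A(3) have "y \<in> L" by simp
      then show False using y(2) sat_incl[OF P Lsub] by blast
    qed
    moreover have "\<forall>Q. primeideal Q R \<and> adj L y \<subseteq> Q \<and> Q \<subseteq> P \<longrightarrow> Q = P" using Lmin A(2) by blast
    ultimately have g: "good (adj L y)" unfolding Bad_def using A(1) by blast
    have "adj (J (Suc n)) y \<subseteq> adj (J n) y" for n
      using J(3) unfolding adj_def by blast
    moreover have "adj L y \<subseteq> adj (J n) y" for n using J(2) unfolding adj_def by blast
    ultimately obtain n0 where n0: "\<And>n. n \<ge> n0 \<Longrightarrow> adj (J n) y \<subseteq> sat P (adj (J (Suc n)) y)"
      using g[unfolded good_def, rule_format, of "\<lambda>n. adj (J n) y"] adj_ideal(1)[OF J(1) y(1)] by blast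
    have step: "\<exists>s j c. s \<in> carrier R \<and> s \<notin> P \<and> j \<in> J (Suc n) \<and> c \<in> carrier R \<and> s \<otimes> a = j \<oplus> c \<otimes> y"
      if "a \<in> J n" "n \<ge> n0" for a n
    proof -
      have "a \<in> sat P (adj (J (Suc n)) y)" using n0[OF that(2)] adj_ideal(2)[OF J(1) y(1)] that(1) by blast
      then obtain s where "s \<in> carrier R" "s \<notin> P" "s \<otimes> a \<in> adj (J (Suc n)) y" by (rule satE)
      then show ?thesis unfolding adj_def by blast
    qed
    \<comment> \<open>the multiple \<open>c y\<close> lands in \<open>J (Suc n)\<close> up to an element outside \<open>P\<close>\<close>
    have fin: "J n \<subseteq> sat P (J (Suc n))"
      if n: "n \<ge> n0" and cy: "\<And>c. c \<in> carrier R \<Longrightarrow> c \<otimes> y \<in> J n \<or> y \<in> sat P (J (Suc n)) \<Longrightarrow> c \<otimes> y \<in> sat P (J (Suc n))" for n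
    proof
      fix a assume a: "a \<in> J n"
      then have aR: "a \<in> carrier R" by (rule JD(2))
      obtain s j c where s: "s \<in> carrier R" "s \<notin> P" "j \<in> J (Suc n)" "c \<in> carrier R" "s \<otimes> a = j \<oplus> c \<otimes> y" using step[OF a n] by blast
      have jn: "j \<in> J n" and jR: "j \<in> carrier R" using s(3) J(3) JD(2) by auto
      have "c \<otimes> y = s \<otimes> a \<ominus> j" unfolding s(5) using jR s(4) y(1) by (simp add: minus_eq a_ac r_neg1 r_neg2)
      then have "c \<otimes> y \<in> J n" using JD(4)[OF JD(5)[OF s(1) a] jn] by simp
      then have "c \<otimes> y \<in> sat P (J (Suc n))" using cy s(4) by blast
      moreover have "j \<in> sat P (J (Suc n))" using sat_incl[OF P] s(3) JD(2) by blast
      ultimately have "s \<otimes> a \<in> sat P (J (Suc n))" unfolding s(5)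
        using ideal.ideal_simps(3)[OF sat_ideal[OF P J(1)]] by blast
      then show "a \<in> sat P (J (Suc n))" by (rule sat_sat[OF P aR s(1,2)])
    qed
    show False
    \<comment> \<open>If \<open>y\<close> lies locally in every term, its multiples cause no loss.
      Otherwise, from some term on, \<open>c y\<close> in \<open>J n\<close> forces \<open>c\<close>
      into \<open>P\<close>, and then \<open>c y\<close> lies locally in \<open>L\<close>.\<close>
    proof (cases "\<forall>n. y \<in> sat P (J n)")
      case True
      have "J n \<subseteq> sat P (J (Suc n))" if "n \<ge> n0" for n
        by (rule fin[OF that]) (use True ideal.ideal_simps(5)[OF sat_ideal[OF P J(1)]] in blast)
      then show False using bad[of n0] by blast
    next
      case False
      then obtain n1 where n1: "y \<notin> sat P (J n1)" by blast
      have "J n \<subseteq> sat P (J (Suc n))" if n: "n \<ge> max n0 n1" for n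
      proof (rule fin)
        show "n \<ge> n0" using n by simp
        fix c assume c: "c \<in> carrier R" "c \<otimes> y \<in> J n \<or> y \<in> sat P (J (Suc n))"
        have yn: "y \<notin> sat P (J m)" if "m \<ge> n1" for m using n1 sat_mono[OF J_dec[OF that]] by blast
        have cy: "c \<otimes> y \<in> J n" using c yn[of "Suc n"] n by auto
        have "c \<in> P"
        proof (rule ccontr)
          assume "c \<notin> P"
          then have "y \<in> sat P (J n)" using c cy y by (intro satI[of y c]) auto
          then show False using yn[of n] n by auto
        qed
        then show "c \<otimes> y \<in> sat P (J (Suc n))" using socle sat_mono[OF J(2)] by blast
      qed
      then show False using bad[of "max n0 n1"] by blast
    qed
  qed
qed

text \<open>Noetherianity supplies finitely many generators of \<open>W\<close>, so the module
  version applies to \<open>self_module\<close>; the multiplier that it yields is absorbed by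
  \<open>sat\<close>.\<close>

lemma nakayama_ideal:
  assumes N: "noetherian_ring R" and P: "primeideal P R" and W: "ideal W R" and I: "ideal I R"
    and sub: "W \<subseteq> sat P (Idl ({p \<otimes> x | p x. p \<in> P \<and> x \<in> W} \<union> I))"
  shows "W \<subseteq> sat P I"
proof -
  interpret S: module R "self_module R" by (rule self_is_module[OF is_cring])
  obtain G where G: "G \<subseteq> carrier R" "finite G" "W = Idl G" using noetherian_ring.finetely_gen[OF N W] by blast
  note si = self_submodule_iff[OF is_cring]
  have WG: "W \<subseteq> submodule_span R (self_module R) G"
    unfolding G(3) by (rule genideal_minimal) (use S.span_submodule[of G] G(1) S.span_incl in \<open>auto simp: si\<close>)
  have "\<exists>s\<in>carrier R - P. s \<odot>\<^bsub>self_module R\<^esub> w \<in> S.nak P G I" if w: "w \<in> G" for w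
  proof -
    have "w \<in> W" using w G genideal_self by blast
    then obtain s where s: "s \<in> carrier R" "s \<notin> P" "s \<otimes> w \<in> Idl ({p \<otimes> x | p x. p \<in> P \<and> x \<in> W} \<union> I)"
      using sub satE by blast
    have "ideal (S.nak P G I) R" unfolding si[symmetric] S.nak_def
      by (rule S.span_submodule) (use G(1) ideal.Icarr[OF I] ideal.Icarr[OF primeideal.axioms(1)[OF P]]
          S.submoduleD(2)[OF S.span_submodule[of G]] in auto)
    then have "Idl ({p \<otimes> x | p x. p \<in> P \<and> x \<in> W} \<union> I) \<subseteq> S.nak P G I"
      by (rule genideal_minimal) (use WG in \<open>auto simp: S.nak_def intro!: S.span_incl'\<close>)
    then show ?thesis using s by auto
  qed
  from S.nakayama[OF P G(2) _ _ this] G(1) I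
  obtain s where s: "s \<in> carrier R - P" "\<And>w. w \<in> submodule_span R (self_module R) G \<Longrightarrow> s \<otimes> w \<in> I"
    by (auto simp: si)
  then show ?thesis using WG ideal.Icarr[OF W] by (auto intro!: satI)
qed

text \<open>Krull's argument with symbolic powers, carried out modulo \<open>Q'\<close>. The
  descending chain condition at \<open>P\<close> makes the symbolic powers of \<open>Q\<close>
  stationary modulo \<open>x\<close>; Nakayama at \<open>P\<close> removes \<open>x\<close>, and
  Nakayama at \<open>Q\<close> then puts some symbolic power inside \<open>Q'\<close>.\<close>

lemma principal_ideal_theorem:
  assumes N: "noetherian_ring R" and P: "primeideal P R" and Q: "primeideal Q R" and Q': "primeideal Q' R"
    and chain: "Q' \<subset> Q" "Q \<subset> P" and x: "x \<in> P"
    and min: "\<And>L. primeideal L R \<Longrightarrow> Q' \<subseteq> L \<Longrightarrow> x \<in> L \<Longrightarrow> L \<subseteq> P \<Longrightarrow> L = P"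
  shows False
proof -
  have xR: "x \<in> carrier R" using ideal.Icarr[OF primeideal.axioms(1)[OF P]] x by blast
  have xQ: "x \<notin> Q" using min[OF Q] chain by blast
  have Pi: "ideal P R" "ideal Q R" "ideal Q' R" using P Q Q' primeideal.axioms(1) by auto
  \<comment> \<open>Symbolic powers of \<open>Q\<close> modulo \<open>Q'\<close>: each step
    multiplies by \<open>Q\<close>, adds \<open>Q'\<close> and contracts from the localization at
    \<open>Q\<close>.\<close>
  define S where "S = rec_nat Q (\<lambda>_ J. sat Q (Idl ({p \<otimes> x | p x. p \<in> Q \<and> x \<in> J} \<union> Q')))"
  have S0: "S 0 = Q" and SS: "S (Suc n) = sat Q (Idl ({p \<otimes> x | p x. p \<in> Q \<and> x \<in> S n} \<union> Q'))" for n
    unfolding S_def by simp_all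
  have gsub: "{p \<otimes> x | p x. p \<in> Q \<and> x \<in> J} \<union> Q' \<subseteq> carrier R" if "ideal J R" for J
    using ideal.Icarr[OF Pi(2)] ideal.Icarr[OF Pi(3)] ideal.Icarr[OF that] by auto
  have Sid: "ideal (S n) R" for n
  proof (induction n)
    case (Suc n) then show ?case unfolding SS by (intro sat_ideal[OF Q] genideal_ideal gsub)
  qed (simp add: S0 Pi)
  note SD = ideal.ideal_simps[OF Sid]
  have SQ': "Q' \<subseteq> S n" for n
  proof (cases n)
    case (Suc m)
    have "Q' \<subseteq> Idl ({p \<otimes> x | p x. p \<in> Q \<and> x \<in> S m} \<union> Q')" using genideal_self[OF gsub[OF Sid]] by blast
    then show ?thesis unfolding Suc SS
      using sat_incl[OF Q] ideal.Icarr[OF genideal_ideal[OF gsub[OF Sid[of m]]]] by blast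
  qed (use S0 chain in auto)
  have Ssat: "a \<in> S n" if "a \<in> carrier R" "s \<in> carrier R" "s \<notin> Q" "s \<otimes> a \<in> S n" for a s n
    using that sat_sat[OF Q] primeideal.I_prime[OF Q] S0 SS by (cases n) blast+
  have Sdec: "S (Suc n) \<subseteq> S n" for n
  proof
    fix a assume a: "a \<in> S (Suc n)"
    then obtain s where s: "a \<in> carrier R" "s \<in> carrier R" "s \<notin> Q" "s \<otimes> a \<in> Idl ({p \<otimes> x | p x. p \<in> Q \<and> x \<in> S n} \<union> Q')"
      unfolding SS by (rule satE)
    have "Idl ({p \<otimes> x | p x. p \<in> Q \<and> x \<in> S n} \<union> Q') \<subseteq> S n"
      by (rule genideal_minimal[OF Sid]) (use SQ' SD(5) ideal.Icarr[OF Pi(2)] in auto)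
    then show "a \<in> S n" using s Ssat by blast
  qed
  note A = adj_ideal[OF Sid xR] and AQ = adj_ideal[OF Pi(3) xR]
  have "\<exists>n0. \<forall>n\<ge>n0. adj (S n) x \<subseteq> sat P (adj (S (Suc n)) x)"
  proof (rule dcc[OF N P AQ(1)])
    show "L = P" if "primeideal L R" "adj Q' x \<subseteq> L" "L \<subseteq> P" for L using min[of L] that AQ by blast
    show "ideal (adj (S n) x) R" for n by (rule A(1))
    show "adj Q' x \<subseteq> adj (S n) x" for n using SQ' unfolding adj_def by blast
    show "adj (S (Suc n)) x \<subseteq> adj (S n) x" for n using Sdec unfolding adj_def by blast
  qed
  then obtain n where n: "adj (S n) x \<subseteq> sat P (adj (S (Suc n)) x)" by blast
  have "S n \<subseteq> sat P (Idl ({p \<otimes> z | p z. p \<in> P \<and> z \<in> S n} \<union> S (Suc n)))"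
  proof
    fix a assume a: "a \<in> S n"
    then have aR: "a \<in> carrier R" by (rule SD(2))
    have "a \<in> sat P (adj (S (Suc n)) x)" using n A(2) a by blast
    then obtain s j c where s: "s \<in> carrier R" "s \<notin> P" "j \<in> S (Suc n)" "c \<in> carrier R" "s \<otimes> a = j \<oplus> c \<otimes> x"
      by (elim satE) (auto simp: adj_def)
    have jR: "j \<in> carrier R" using s(3) SD(2) by blast
    have "c \<otimes> x = s \<otimes> a \<ominus> j" unfolding s(5) using jR s(4) xR by (simp add: minus_eq a_ac r_neg1 r_neg2)
    then have "x \<otimes> c \<in> S n" using SD(4)[OF SD(5)[OF s(1) a]] Sdec s(3,4) xR by (auto simp: m_comm)
    \<comment> \<open>Every \<open>S n\<close> is saturated with respect to \<open>Q\<close>, and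
      \<open>x\<close> lies outside \<open>Q\<close>, so \<open>x\<close> can be cancelled.\<close>
    then have c: "c \<in> S n" using Ssat s(4) xR xQ by blast
    have sub: "{p \<otimes> z | p z. p \<in> P \<and> z \<in> S n} \<union> S (Suc n) \<subseteq> carrier R"
      using ideal.Icarr[OF Pi(1)] SD(2) by auto
    note GD = ideal.ideal_simps[OF genideal_ideal[OF sub]] and Gs = genideal_self[OF sub]
    have "c \<otimes> x = x \<otimes> c" using s(4) xR by (rule m_comm)
    then have "c \<otimes> x \<in> {p \<otimes> z | p z. p \<in> P \<and> z \<in> S n}" using x c by blast
    then have "s \<otimes> a \<in> Idl ({p \<otimes> z | p z. p \<in> P \<and> z \<in> S n} \<union> S (Suc n))"
      unfolding s(5) using GD(3) Gs s(3) by blast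
    then show "a \<in> sat P (Idl ({p \<otimes> z | p z. p \<in> P \<and> z \<in> S n} \<union> S (Suc n)))" using s aR by (intro satI)
  qed
  from nakayama_ideal[OF N P Sid Sid this] have "S n \<subseteq> sat P (S (Suc n))" .
  also have "\<dots> \<subseteq> S (Suc n)"
  proof
    fix a assume "a \<in> sat P (S (Suc n))"
    then obtain s where "a \<in> carrier R" "s \<in> carrier R" "s \<notin> P" "s \<otimes> a \<in> S (Suc n)" by (rule satE)
    moreover then have "s \<notin> Q" using chain by blast
    ultimately show "a \<in> S (Suc n)" using Ssat by blast
  qed
  finally have "S n \<subseteq> sat Q (Idl ({p \<otimes> x | p x. p \<in> Q \<and> x \<in> S n} \<union> Q'))" unfolding SS .
  from nakayama_ideal[OF N Q Sid Pi(3) this] have "S n \<subseteq> sat Q Q'" .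
  also have "\<dots> \<subseteq> Q'" by (rule sat_prime[OF Q']) (use chain in auto)
  finally have "S n \<subseteq> Q'" .
  \<comment> \<open>Descent in \<open>n\<close>: with \<open>q\<close> in \<open>Q\<close> but not
    in \<open>Q'\<close>, multiplication by \<open>q\<close> sends \<open>S n\<close> into
    \<open>S (Suc n)\<close>, and primality of \<open>Q'\<close> cancels \<open>q\<close>.\<close>
  then have "Q \<subseteq> Q'"
  proof (induction n)
    case (Suc n)
    obtain q where q: "q \<in> Q" "q \<notin> Q'" using chain by blast
    have "S n \<subseteq> Q'"
    proof
      fix z assume z: "z \<in> S n"
      have "q \<otimes> z \<in> Idl ({p \<otimes> x | p x. p \<in> Q \<and> x \<in> S n} \<union> Q')" using q z genideal_self[OF gsub[OF Sid[of n]]] by blast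
      then have "q \<otimes> z \<in> S (Suc n)" unfolding SS
        using sat_incl[OF Q] ideal.Icarr[OF genideal_ideal[OF gsub[OF Sid[of n]]]] by blast
      then show "z \<in> Q'" using Suc.prems q z SD(2) ideal.Icarr[OF Pi(2)] primeideal.I_prime[OF Q'] by blast
    qed
    then show ?case by (rule Suc.IH)
  qed (simp add: S0)
  then show False using chain by blast
qed

section \<open>Chains of primes through given elements\<close>

lemma prime_chainD:
  assumes "prime_chain R k p"
  shows "i \<le> k \<Longrightarrow> primeideal (p i) R" "i < k \<Longrightarrow> p i \<subset> p (Suc i)" "i \<le> j \<Longrightarrow> j \<le> k \<Longrightarrow> p i \<subseteq> p j"
proof -
  show "i \<le> k \<Longrightarrow> primeideal (p i) R" "i < k \<Longrightarrow> p i \<subset> p (Suc i)" using assms by (auto simp: prime_chain_def)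
  show "i \<le> j \<Longrightarrow> j \<le> k \<Longrightarrow> p i \<subseteq> p j"
  proof (induction j)
    case (Suc j)
    show ?case
    proof (cases "i = Suc j")
      case False
      then have "p i \<subseteq> p j" "p j \<subset> p (Suc j)" using Suc assms by (auto simp: prime_chain_def)
      then show ?thesis by blast
    qed simp
  qed simp
qed

lemma prime_chain_snoc:
  assumes "prime_chain R k p" "primeideal Q R" "p k \<subset> Q"
  shows "prime_chain R (Suc k) (p(Suc k := Q))"
  using assms unfolding prime_chain_def by (auto simp: less_Suc_eq le_Suc_eq)

text \<open>The element \<open>x\<close> is pushed down the chain one step at a time: the prime
  below the top is replaced by a prime minimal over its predecessor and \<open>x\<close>. The top
  stays fixed, and one step is lost at the bottom.\<close>

lemma prime_chain_through:
  assumes N: "noetherian_ring R" and "prime_chain R (Suc k) p" "x \<in> p (Suc k)"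
  shows "\<exists>p'. prime_chain R k p' \<and> p' k = p (Suc k) \<and> x \<in> p' 0 \<and> p 0 \<subseteq> p' 0"
  using assms(2,3)
proof (induction k arbitrary: p)
  case 0
  then show ?case by (intro exI[of _ "\<lambda>_. p 1"]) (auto simp: prime_chain_def)
next
  case (Suc k)
  note D = prime_chainD[OF Suc.prems(1)]
  have p: "primeideal (p k) R" "primeideal (p (Suc k)) R" "primeideal (p (Suc (Suc k))) R"
    "p k \<subset> p (Suc k)" "p (Suc k) \<subset> p (Suc (Suc k))" using D(1,2) by auto
  obtain Q where Q: "prime_chain R (Suc k) (p(Suc k := Q))" "x \<in> Q" "Q \<subset> p (Suc (Suc k))"
  proof (cases "x \<in> p (Suc k)")
    case True
    have "prime_chain R (Suc k) (p(Suc k := p (Suc k)))" using Suc.prems(1) by (auto simp: prime_chain_def)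
    then show ?thesis using that True p(5) by blast
  next
    case False
    have "insert x (p k) \<subseteq> p (Suc (Suc k))" using Suc.prems(2) p by blast
    then obtain Q where Q: "minimal_prime_over R (insert x (p k)) Q" "Q \<subseteq> p (Suc (Suc k))"
      using ex_minimal_prime[OF p(3)] by blast
    have Qp: "primeideal Q R" "x \<in> Q" "p k \<subseteq> Q" using Q(1) by (auto simp: minimal_prime_over_def)
    \<comment> \<open>This is where the principal ideal theorem enters: two strict steps above
      \<open>p k\<close> are too many for a prime minimal over \<open>p k\<close> and
      \<open>x\<close>.\<close>
    have "Q \<noteq> p (Suc (Suc k))"
    proof
      assume eq: "Q = p (Suc (Suc k))"
      show False
      proof (rule principal_ideal_theorem[OF N p(3,2,1) p(4,5) Suc.prems(2)])
        fix L assume "primeideal L R" "p k \<subseteq> L" "x \<in> L" "L \<subseteq> p (Suc (Suc k))"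
        then show "L = p (Suc (Suc k))" using Q(1) eq by (auto simp: minimal_prime_over_def)
      qed
    qed
    moreover have "p k \<noteq> Q" using False p(4) Qp(2) by blast
    ultimately have Qs: "Q \<subset> p (Suc (Suc k))" "p k \<subset> Q" using Q(2) Qp by auto
    have "prime_chain R k p" using Suc.prems(1) by (auto simp: prime_chain_def)
    from prime_chain_snoc[OF this Qp(1) Qs(2)] show ?thesis using that Qp Qs by blast
  qed
  then obtain p' where p': "prime_chain R k p'" "p' k = Q" "x \<in> p' 0" "p 0 \<subseteq> p' 0"
    using Suc.IH[OF Q(1)] by auto
  have "prime_chain R (Suc k) (p'(Suc k := p (Suc (Suc k))))"
    by (rule prime_chain_snoc[OF p'(1) p(3)]) (use p' Q in auto)
  moreover have "(p'(Suc k := p (Suc (Suc k)))) (Suc k) = p (Suc (Suc k))" "(p'(Suc k := p (Suc (Suc k)))) 0 = p' 0" by simp_all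
  ultimately show ?case using p' by metis
qed

text \<open>Krull's height theorem, in the form of a statement about chains.\<close>

lemma prime_chain_through_set:
  assumes N: "noetherian_ring R" and "finite G" "card G \<le> k" "prime_chain R k p" "G \<subseteq> p k"
  shows "\<exists>p'. prime_chain R (k - card G) p' \<and> p' (k - card G) = p k \<and> G \<subseteq> p' 0 \<and> p 0 \<subseteq> p' 0"
  using assms(2-)
proof (induction G)
  case empty then show ?case by auto
next
  case (insert x G)
  then obtain p' where p': "prime_chain R (k - card G) p'" "p' (k - card G) = p k" "G \<subseteq> p' 0" "p 0 \<subseteq> p' 0" by auto
  define m where "m = k - card (insert x G)"
  have m: "k - card G = Suc m" using insert.hyps insert.prems(1) by (simp add: m_def)
  from prime_chain_through[OF N p'(1)[unfolded m], of x] p'(2) insert.prems(3)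
  obtain p'' where "prime_chain R m p''" "p'' m = p' (Suc m)" "x \<in> p'' 0" "p' 0 \<subseteq> p'' 0" unfolding m by auto
  then show ?case using p' unfolding m_def[symmetric] m by (intro exI[of _ p'']) auto
qed

end

subsection \<open>Algebras of finite type\<close>

text \<open>Generation is expressed by subrings containing the generators, since subrings are easy
  to pull back along homomorphisms.\<close>

lemma finite_typeI:
  fixes C (structure)
  assumes "ring C" "finite S" "S \<subseteq> carrier C" "\<kappa> ` carrier K \<subseteq> carrier C"
    "\<And>N. subring N C \<Longrightarrow> \<kappa> ` carrier K \<subseteq> N \<Longrightarrow> S \<subseteq> N \<Longrightarrow> carrier C \<subseteq> N"
  shows "finite_type_algebra K C \<kappa>"
proof -
  interpret ring C by fact
  have sub: "\<kappa> ` carrier K \<union> S \<subseteq> carrier C" using assms by auto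
  have "carrier C \<subseteq> generate_ring C (\<kappa> ` carrier K \<union> S)"
    by (rule assms(5)[OF generate_ring_is_subring[OF sub]]) (auto intro: generate_ring.incl)
  then show ?thesis unfolding finite_type_algebra_def
    using assms(2,3) generate_ring_in_carrier[OF sub] by blast
qed

lemma finite_typeE:
  fixes C (structure)
  assumes "ring C" "finite_type_algebra K C \<kappa>" "\<kappa> ` carrier K \<subseteq> carrier C"
  obtains S where "finite S" "S \<subseteq> carrier C"
    "\<And>N. subring N C \<Longrightarrow> \<kappa> ` carrier K \<subseteq> N \<Longrightarrow> S \<subseteq> N \<Longrightarrow> carrier C \<subseteq> N"
proof -
  interpret ring C by fact
  obtain S where S: "finite S" "S \<subseteq> carrier C" "generate_ring C (\<kappa> ` carrier K \<union> S) = carrier C"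
    using assms(2) unfolding finite_type_algebra_def by blast
  have "carrier C \<subseteq> N" if "subring N C" "\<kappa> ` carrier K \<subseteq> N" "S \<subseteq> N" for N
  proof -
    have "\<kappa> ` carrier K \<union> S \<subseteq> carrier C" "\<kappa> ` carrier K \<union> S \<subseteq> N" using that S(2) assms(3) by blast+
    from generate_ring_min_subring1[OF this(1) that(1) this(2)] show ?thesis using S(3) by simp
  qed
  then show ?thesis using that S by blast
qed

lemma finite_type_image:
  assumes "ring C" "ring D" "finite_type_algebra K C \<kappa>" "\<kappa> ` carrier K \<subseteq> carrier C"
    "h \<in> ring_hom C D" "h ` carrier C = carrier D"
  shows "finite_type_algebra K D (h \<circ> \<kappa>)"
proof -
  interpret h: ring_hom_ring C D h using ring_hom_ringI2[OF assms(1,2,5)] .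
  obtain S where S: "finite S" "S \<subseteq> carrier C"
    "\<And>N. subring N C \<Longrightarrow> \<kappa> ` carrier K \<subseteq> N \<Longrightarrow> S \<subseteq> N \<Longrightarrow> carrier C \<subseteq> N"
    using finite_typeE[OF assms(1,3,4)] by blast
  show ?thesis
  proof (rule finite_typeI[OF assms(2), of "h ` S"])
    fix N assume N: "subring N D" "(h \<circ> \<kappa>) ` carrier K \<subseteq> N" "h ` S \<subseteq> N"
    note D = subringE[OF N(1)]
    have "subring {x \<in> carrier C. h x \<in> N} C"
      by (rule h.R.subringI) (use D in auto)
    moreover have "\<kappa> ` carrier K \<subseteq> {x \<in> carrier C. h x \<in> N}" "S \<subseteq> {x \<in> carrier C. h x \<in> N}"
      using N(2,3) assms(4) S(2) by (auto simp: image_subset_iff)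
    ultimately have "carrier C \<subseteq> {x \<in> carrier C. h x \<in> N}" by (rule S(3))
    then show "carrier D \<subseteq> N" unfolding assms(6)[symmetric] by blast
  qed (use S assms(4) in auto)
qed

text \<open>
  Elements of a finitely generated algebra are named by programs of a stack machine: an instruction
  pushes a constant or a generator, or applies a ring operation to the top of the stack.
\<close>

definition exec where
  "exec C \<kappa> (g :: nat \<Rightarrow> _) i st = (case i of Inl k \<Rightarrow> \<kappa> k # st
     | Inr n \<Rightarrow> if n = 0 then (hd (tl st) \<oplus>\<^bsub>C\<^esub> hd st) # tl (tl st)
               else if n = 1 then (hd (tl st) \<otimes>\<^bsub>C\<^esub> hd st) # tl (tl st)
               else if n = 2 then (\<ominus>\<^bsub>C\<^esub> hd st) # tl st
               else g (n - 3) # st)"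

lemma exec_simps:
  "exec C \<kappa> g (Inl k) st = \<kappa> k # st"
  "exec C \<kappa> g (Inr 0) (b # a # st) = (a \<oplus>\<^bsub>C\<^esub> b) # st"
  "exec C \<kappa> g (Inr 1) (b # a # st) = (a \<otimes>\<^bsub>C\<^esub> b) # st"
  "exec C \<kappa> g (Inr 2) (a # st) = (\<ominus>\<^bsub>C\<^esub> a) # st"
  "exec C \<kappa> g (Inr (n + 3)) st = g n # st"
  by (simp_all add: exec_def)

text \<open>The rest \<open>st\<close> of the stack is arbitrary, so that programs for subterms can
  be concatenated.\<close>

lemma exec_complete:
  assumes "a \<in> generate_ring C (\<kappa> ` carrier K \<union> g ` {..<m::nat})" "\<kappa> \<in> ring_hom K C"
  shows "\<exists>l. \<forall>st. fold (exec C \<kappa> g) l st = a # st"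
  using assms(1)
proof (induction rule: generate_ring.induct)
  case one
  show ?case by (intro exI[of _ "[Inl \<one>\<^bsub>K\<^esub>]"]) (simp add: exec_simps ring_hom_one[OF assms(2)])
next
  case (incl h)
  then consider k where "h = \<kappa> k" | n where "h = g n" by blast
  then show ?case
  proof cases
    case 1 then show ?thesis by (intro exI[of _ "[Inl k]"]) (simp add: exec_simps exec_simps(3)[simplified])
  next
    \<comment> \<open>The codes 0, 1 and 2 denote the ring operations, which shifts the generator
      \<open>n\<close> to the code \<open>n + 3\<close>.\<close>
    case 2 then show ?thesis by (intro exI[of _ "[Inr (n + 3)]"]) (simp add: exec_simps(5))
  qed
next
  case (a_inv h)
  then obtain l where "\<forall>st. fold (exec C \<kappa> g) l st = h # st" by blast
  then show ?case by (intro exI[of _ "l @ [Inr 2]"]) (simp add: exec_simps)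
next
  case (eng_add h1 h2)
  then obtain l1 l2 where "\<forall>st. fold (exec C \<kappa> g) l1 st = h1 # st" "\<forall>st. fold (exec C \<kappa> g) l2 st = h2 # st" by blast
  then show ?case by (intro exI[of _ "l1 @ l2 @ [Inr 0]"]) (simp add: exec_simps exec_simps(3)[simplified])
next
  case (eng_mult h1 h2)
  then obtain l1 l2 where "\<forall>st. fold (exec C \<kappa> g) l1 st = h1 # st" "\<forall>st. fold (exec C \<kappa> g) l2 st = h2 # st" by blast
  then show ?case by (intro exI[of _ "l1 @ l2 @ [Inr 1]"]) (simp add: exec_simps exec_simps(3)[simplified])
qed

text \<open>An instruction \<open>x\<close> at position \<open>i\<close> becomes a function on
  multisets that uses only their size. Size 0 stores the constant, if there is one; the sizes from 1
  on carry the indicator function of a number encoding the kind of instruction by its parity, and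
  the position and the code by its value.\<close>

definition instr_code :: "'k \<Rightarrow> 'k \<Rightarrow> nat \<Rightarrow> 'k + nat \<Rightarrow> nat multiset \<Rightarrow> 'k" where
  "instr_code z e i x \<mu> = (case size \<mu> of 0 \<Rightarrow> (case x of Inl k \<Rightarrow> k | Inr n \<Rightarrow> z)
     | Suc j \<Rightarrow> if j = (case x of Inl _ \<Rightarrow> 2 * i | Inr n \<Rightarrow> 2 * prod_encode (i, n) + 1) then e else z)"

lemma instr_code_inj:
  assumes "z \<noteq> e" "instr_code z e i x = instr_code z e i' x'"
  shows "i = i' \<and> x = x'"
proof -
  define c where "c i x = (case x of Inl _ \<Rightarrow> 2 * i | Inr n \<Rightarrow> 2 * prod_encode (i, n) + 1)" for i :: nat and x :: "'a + nat"
  \<comment> \<open>Multisets of size \<open>Suc j\<close> probe whether the number of the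
    instruction is \<open>j\<close>; comparing these values recovers it because \<open>z\<close> and
    \<open>e\<close> differ.\<close>
  have "instr_code z e i x (replicate_mset (Suc j) 0) = (if j = c i x then e else z)" for i x j
    by (simp add: instr_code_def c_def)
  then have "c i x = c i' x'" using assms by metis
  moreover have "instr_code z e i x {#} = instr_code z e i' x' {#}" using assms(2) by simp
  ultimately show ?thesis
    by (cases x; cases x') (simp_all add: c_def instr_code_def prod_encode_eq, presburger+)
qed

text \<open>Positions are part of the code of an instruction, so the mere set of codes determines
  the list.\<close>

definition prog_code where
  "prog_code z e l = {instr_code z e i (l ! i) | i. i < length l}"

lemma prog_code_inj:
  assumes "z \<noteq> e" "prog_code z e l = prog_code z e l'"
  shows "l = l'"
proof -
  have *: "i < length l' \<and> l ! i = l' ! i" if "prog_code z e l \<subseteq> prog_code z e l'" "i < length l" for i l l'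
  proof -
    have "instr_code z e i (l ! i) \<in> prog_code z e l'" using that by (auto simp: prog_code_def)
    then obtain j where "j < length l'" "instr_code z e i (l ! i) = instr_code z e j (l' ! j)" by (auto simp: prog_code_def)
    then show ?thesis using instr_code_inj[OF assms(1)] by blast
  qed
  have "length l = length l'"
    using *[of l l'] *[of l' l] assms(2) by (metis linorder_neqE_nat order_refl order_less_irrefl)
  then show ?thesis using *[of l l'] assms(2) by (auto intro: nth_equalityI)
qed

text \<open>Every element is the value of some program, and distinct elements have distinct
  programs. Coding one program per element embeds the carrier in the test type, and the ring
  structure is transported along this injection.\<close>

lemma test_copy:
  fixes K :: "('k, 'l) ring_scheme" and C :: "('c, 'd) ring_scheme"
  assumes "field K" "cring C" "\<kappa> \<in> ring_hom K C" "finite_type_algebra K C \<kappa>"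
  obtains D :: "'k test ring" and h where "cring D" "h \<in> ring_iso C D"
proof -
  interpret K: field K by fact
  interpret C: cring C by fact
  obtain S where S: "finite S" "S \<subseteq> carrier C" "generate_ring C (\<kappa> ` carrier K \<union> S) = carrier C"
    using assms(4) unfolding finite_type_algebra_def by blast
  obtain m and g :: "nat \<Rightarrow> 'c" where g: "S = g ` {..<m}"
    using finite_imp_nat_seg_image_inj_on[OF S(1)] by (metis lessThan_def)
  have "\<exists>l. \<forall>st. fold (exec C \<kappa> g) l st = a # st" if "a \<in> carrier C" for a
    by (rule exec_complete[OF _ assms(3)]) (use that S g in auto)
  then obtain l where l: "\<And>a st. a \<in> carrier C \<Longrightarrow> fold (exec C \<kappa> g) (l a) st = a # st" by metis
  let ?\<phi> = "\<lambda>a. prog_code \<zero>\<^bsub>K\<^esub> \<one>\<^bsub>K\<^esub> (l a)"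
  have inj: "inj_on ?\<phi> (carrier C)"
  proof (rule inj_onI)
    fix a b assume ab: "a \<in> carrier C" "b \<in> carrier C" "?\<phi> a = ?\<phi> b"
    then have "l a = l b" using prog_code_inj K.zero_not_one by metis
    then show "a = b" using l[OF ab(1), of "[]"] l[OF ab(2), of "[]"] by (metis list.inject)
  qed
  note iso = inj_imp_image_ring_iso[OF inj]
  have "cring (image_ring ?\<phi> C)"
    using C.ring_iso_imp_img_cring[OF iso] by (simp add: image_ring_def image_group_def monoid.defs)
  then show ?thesis using that iso by blast
qed

lemma ring_iso_inverse:
  assumes "cring C" "cring D" and h: "h \<in> ring_iso C D"
  obtains k where "k \<in> ring_hom D C" "\<And>x. x \<in> carrier D \<Longrightarrow> h (k x) = x" "\<And>x. x \<in> carrier C \<Longrightarrow> k (h x) = x"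
proof -
  interpret C: cring C by fact
  interpret D: cring D by fact
  define k where "k = inv_into (carrier C) h"
  have hk: "h (k x) = x" "k x \<in> carrier C" if "x \<in> carrier D" for x
    using that ring_iso_memE(5)[OF h] unfolding k_def by (auto simp: bij_betw_def f_inv_into_f inv_into_into)
  have kh: "k (h x) = x" if "x \<in> carrier C" for x
    using that ring_iso_memE(5)[OF h] unfolding k_def by (auto simp: bij_betw_def inv_into_f_f)
  have hh: "h \<in> ring_hom C D" using h by (auto simp: ring_iso_def)
  have "k \<in> ring_hom D C"
  proof (rule ring_hom_memI)
    fix x assume x: "x \<in> carrier D"
    show "k x \<in> carrier C" using hk(2)[OF x] .
    fix y assume y: "y \<in> carrier D"
    show "k (x \<otimes>\<^bsub>D\<^esub> y) = k x \<otimes>\<^bsub>C\<^esub> k y"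
      using kh[of "k x \<otimes>\<^bsub>C\<^esub> k y"] ring_hom_mult[OF hh hk(2)[OF x] hk(2)[OF y]] hk x y by simp
    show "k (x \<oplus>\<^bsub>D\<^esub> y) = k x \<oplus>\<^bsub>C\<^esub> k y"
      using kh[of "k x \<oplus>\<^bsub>C\<^esub> k y"] ring_hom_add[OF hh hk(2)[OF x] hk(2)[OF y]] hk x y by simp
  next
    show "k \<one>\<^bsub>D\<^esub> = \<one>\<^bsub>C\<^esub>" using kh[of "\<one>\<^bsub>C\<^esub>"] ring_hom_one[OF hh] by simp
  qed
  then show ?thesis using that hk(1) kh by blast
qed

text \<open>Frees the lifting property from the test type: \<open>C\<close> is replaced by a copy
  \<open>D\<close> there, the square-zero ideal is the kernel of the map from \<open>D\<close> to
  \<open>C'\<close>, and the lift is carried back to \<open>C\<close>.\<close>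

lemma smooth_lift:
  fixes K :: "('k, 'l) ring_scheme" and C :: "('c, 'd) ring_scheme" and A :: "('a, 'm) ring_scheme"
  assumes K: "field K" and smooth: "smooth_algebra K A \<iota>" and A: "cring A"
    and C: "cring C" and \<kappa>: "\<kappa> \<in> ring_hom K C" and ft: "finite_type_algebra K C \<kappa>"
    and C': "cring C'" and g: "g \<in> ring_hom C C'" and onto: "g ` carrier C = carrier C'"
    and ker: "\<And>x y. x \<in> carrier C \<Longrightarrow> y \<in> carrier C \<Longrightarrow> g x = \<zero>\<^bsub>C'\<^esub> \<Longrightarrow> g y = \<zero>\<^bsub>C'\<^esub> \<Longrightarrow> x \<otimes>\<^bsub>C\<^esub> y = \<zero>\<^bsub>C\<^esub>"
    and u: "u \<in> ring_hom A C'" and compat: "\<And>c. c \<in> carrier K \<Longrightarrow> u (\<iota> c) = g (\<kappa> c)"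
  obtains v where "v \<in> ring_hom A C" "\<And>c. c \<in> carrier K \<Longrightarrow> v (\<iota> c) = \<kappa> c" "\<And>a. a \<in> carrier A \<Longrightarrow> g (v a) = u a"
proof -
  interpret K: field K by fact
  interpret A: cring A by fact
  interpret C: cring C by fact
  interpret C': cring C' by fact
  obtain D :: "'k test ring" and h where D: "cring D" and h: "h \<in> ring_iso C D"
    using test_copy[OF K C \<kappa> ft] by blast
  interpret D: cring D by fact
  have hh: "h \<in> ring_hom C D" using h by (auto simp: ring_iso_def)
  obtain k where kk: "k \<in> ring_hom D C" and hk1: "\<And>x. x \<in> carrier D \<Longrightarrow> h (k x) = x"
    and kh: "\<And>x. x \<in> carrier C \<Longrightarrow> k (h x) = x"
    using ring_iso_inverse[OF C D h] by blast
  have hk: "h (k x) = x" "k x \<in> carrier C" if "x \<in> carrier D" for x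
    using hk1[OF that] ring_hom_closed[OF kk that] .
  have gk: "g \<circ> k \<in> ring_hom D C'" using ring_hom_trans[OF kk g] .
  interpret gk: ring_hom_ring D C' "g \<circ> k" by (intro ring_hom_ringI2 D.ring_axioms C'.ring_axioms gk)
  let ?J = "a_kernel D C' (g \<circ> k)"
  have Jmem: "x \<in> ?J \<longleftrightarrow> x \<in> carrier D \<and> g (k x) = \<zero>\<^bsub>C'\<^esub>" for x by (auto simp: a_kernel_def kernel_def)
  have J: "ideal ?J D" by (rule gk.kernel_is_ideal)
  interpret J: ideal ?J D by (rule J)
  have sq: "square_zero_ideal ?J D" unfolding square_zero_ideal_def
  proof (intro conjI J ballI)
    fix x y assume "x \<in> ?J" "y \<in> ?J"
    then have xy: "x \<in> carrier D" "y \<in> carrier D" "g (k x) = \<zero>\<^bsub>C'\<^esub>" "g (k y) = \<zero>\<^bsub>C'\<^esub>" by (auto simp: Jmem)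
    then have "k x \<otimes>\<^bsub>C\<^esub> k y = \<zero>\<^bsub>C\<^esub>" using ker hk(2) by blast
    then have "k (x \<otimes>\<^bsub>D\<^esub> y) = k \<zero>\<^bsub>D\<^esub>" using ring_hom_mult[OF kk xy(1,2)] ring_hom_zero[OF kk D.ring_axioms C.ring_axioms] by simp
    then show "x \<otimes>\<^bsub>D\<^esub> y = \<zero>\<^bsub>D\<^esub>" using hk(1) xy by (metis D.m_closed D.zero_closed)
  qed
  have coset: "?J +>\<^bsub>D\<^esub> x = ?J +>\<^bsub>D\<^esub> y \<longleftrightarrow> g (k x) = g (k y)" if "x \<in> carrier D" "y \<in> carrier D" for x y
  proof -
    have "?J +>\<^bsub>D\<^esub> x = ?J +>\<^bsub>D\<^esub> y \<longleftrightarrow> x \<ominus>\<^bsub>D\<^esub> y \<in> ?J" using D.quotient_eq_iff_same_a_r_cos[OF J that] by simp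
    also have "\<dots> \<longleftrightarrow> g (k x) = g (k y)"
      using that gk.hom_closed C'.minus_zero_iff[of "g (k x)" "g (k y)"]
        gk.hom_add[of x "\<ominus>\<^bsub>D\<^esub> y"] gk.hom_a_inv[of y] by (simp add: Jmem a_minus_def)
    finally show ?thesis .
  qed
  have "\<forall>y\<in>carrier C'. \<exists>x\<in>carrier D. g (k x) = y"
    using onto kh hh ring_hom_closed by (metis imageE)
  then obtain l where l: "\<And>y. y \<in> carrier C' \<Longrightarrow> l y \<in> carrier D" "\<And>y. y \<in> carrier C' \<Longrightarrow> g (k (l y)) = y" by metis
  note ucl = ring_hom_closed[OF u]
  \<comment> \<open>The given map \<open>u\<close> read in the quotient of \<open>D\<close> by
    \<open>?J\<close> instead of \<open>C'\<close>; \<open>l\<close> picks preimages in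
    \<open>D\<close>, whose cosets do not depend on the choice.\<close>
  define u' where "u' a = ?J +>\<^bsub>D\<^esub> l (u a)" for a
  have q: "(+>\<^bsub>D\<^esub>) ?J \<in> ring_hom D (D Quot ?J)" by (rule J.rcos_ring_hom)
  have gkm: "g (k (x \<oplus>\<^bsub>D\<^esub> y)) = g (k x) \<oplus>\<^bsub>C'\<^esub> g (k y)" "g (k (x \<otimes>\<^bsub>D\<^esub> y)) = g (k x) \<otimes>\<^bsub>C'\<^esub> g (k y)"
    if "x \<in> carrier D" "y \<in> carrier D" for x y using ring_hom_add[OF gk that] ring_hom_mult[OF gk that] by auto
  have u': "u' \<in> ring_hom A (D Quot ?J)"
  proof (rule ring_hom_memI)
    fix a assume a: "a \<in> carrier A"
    show "u' a \<in> carrier (D Quot ?J)" unfolding u'_def using ring_hom_closed[OF q l(1)[OF ucl[OF a]]] .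
    fix b assume b: "b \<in> carrier A"
    show "u' (a \<otimes>\<^bsub>A\<^esub> b) = u' a \<otimes>\<^bsub>D Quot ?J\<^esub> u' b"
      unfolding u'_def ring_hom_mult[OF q l(1)[OF ucl[OF a]] l(1)[OF ucl[OF b]], symmetric]
      by (subst coset) (use a b l ucl gkm ring_hom_mult[OF u] in auto)
    show "u' (a \<oplus>\<^bsub>A\<^esub> b) = u' a \<oplus>\<^bsub>D Quot ?J\<^esub> u' b"
      unfolding u'_def ring_hom_add[OF q l(1)[OF ucl[OF a]] l(1)[OF ucl[OF b]], symmetric]
      by (subst coset) (use a b l ucl gkm ring_hom_add[OF u] in auto)
  next
    show "u' \<one>\<^bsub>A\<^esub> = \<one>\<^bsub>D Quot ?J\<^esub>"
      unfolding u'_def ring_hom_one[OF q, symmetric]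
      by (subst coset) (use l ucl ring_hom_one[OF u] ring_hom_one[OF gk] in auto)
  qed
  have h\<kappa>: "h \<circ> \<kappa> \<in> ring_hom K D" by (rule ring_hom_trans[OF \<kappa> hh])
  have compat': "u' (\<iota> c) = ?J +>\<^bsub>D\<^esub> (h \<circ> \<kappa>) c" if c: "c \<in> carrier K" for c
  proof -
    have kc: "\<kappa> c \<in> carrier C" using ring_hom_closed[OF \<kappa> c] .
    have "u (\<iota> c) \<in> carrier C'" using compat[OF c] ring_hom_closed[OF g kc] by simp
    then show ?thesis unfolding u'_def
      by (subst coset) (use kc compat[OF c] l kh ring_hom_closed[OF hh] in auto)
  qed
  have lifts: "lifts_along K A \<iota> D (h \<circ> \<kappa>) ?J"
    using smooth D h\<kappa> sq unfolding smooth_algebra_def formally_smooth_def by blast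
  then obtain v where v: "v \<in> ring_hom A D" "\<forall>c\<in>carrier K. v (\<iota> c) = (h \<circ> \<kappa>) c" "\<forall>a\<in>carrier A. ?J +>\<^bsub>D\<^esub> v a = u' a"
    using lifts[unfolded lifts_along_def, rule_format, OF u' compat'] by blast
  show ?thesis
  proof (rule that)
    show "k \<circ> v \<in> ring_hom A C" by (rule ring_hom_trans[OF v(1) kk])
    show "(k \<circ> v) (\<iota> c) = \<kappa> c" if "c \<in> carrier K" for c using v(2) that kh ring_hom_closed[OF \<kappa> that] by simp
    show "g ((k \<circ> v) a) = u a" if a: "a \<in> carrier A" for a
    proof -
      have "?J +>\<^bsub>D\<^esub> v a = ?J +>\<^bsub>D\<^esub> l (u a)" using v(3) a by (simp add: u'_def)
      then have "g (k (v a)) = g (k (l (u a)))" using coset ring_hom_closed[OF v(1) a] l(1)[OF ucl[OF a]] by blast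
      then show ?thesis using l(2)[OF ucl[OF a]] by simp
    qed
  qed
qed

subsection \<open>Idealization\<close>

definition idealization where
  "idealization B F = \<lparr>carrier = carrier B \<times> carrier F,
     monoid.mult = (\<lambda>(a, x) (b, y). (a \<otimes>\<^bsub>B\<^esub> b, a \<odot>\<^bsub>F\<^esub> y \<oplus>\<^bsub>F\<^esub> b \<odot>\<^bsub>F\<^esub> x)),
     one = (\<one>\<^bsub>B\<^esub>, \<zero>\<^bsub>F\<^esub>), ring.zero = (\<zero>\<^bsub>B\<^esub>, \<zero>\<^bsub>F\<^esub>),
     ring.add = (\<lambda>(a, x) (b, y). (a \<oplus>\<^bsub>B\<^esub> b, x \<oplus>\<^bsub>F\<^esub> y))\<rparr>"

lemma idealization_simps:
  "carrier (idealization B F) = carrier B \<times> carrier F"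
  "(a, x) \<otimes>\<^bsub>idealization B F\<^esub> (b, y) = (a \<otimes>\<^bsub>B\<^esub> b, a \<odot>\<^bsub>F\<^esub> y \<oplus>\<^bsub>F\<^esub> b \<odot>\<^bsub>F\<^esub> x)"
  "(a, x) \<oplus>\<^bsub>idealization B F\<^esub> (b, y) = (a \<oplus>\<^bsub>B\<^esub> b, x \<oplus>\<^bsub>F\<^esub> y)"
  "\<one>\<^bsub>idealization B F\<^esub> = (\<one>\<^bsub>B\<^esub>, \<zero>\<^bsub>F\<^esub>)" "\<zero>\<^bsub>idealization B F\<^esub> = (\<zero>\<^bsub>B\<^esub>, \<zero>\<^bsub>F\<^esub>)"
  by (simp_all add: idealization_def)

lemma (in module) idealization_cring: "cring (idealization R M)"
proof (rule cringI)
  show "abelian_group (idealization R M)"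
  proof (rule abelian_groupI)
    show "\<exists>y\<in>carrier (idealization R M). y \<oplus>\<^bsub>idealization R M\<^esub> x = \<zero>\<^bsub>idealization R M\<^esub>"
      if "x \<in> carrier (idealization R M)" for x
      using that by (intro bexI[of _ "(\<ominus> fst x, \<ominus>\<^bsub>M\<^esub> snd x)"]) (auto simp: idealization_simps R.l_neg M.l_neg)
  qed (auto simp: idealization_simps R.a_ac M.a_ac)
  show "Group.comm_monoid (idealization R M)"
    by (rule Group.comm_monoidI)
      (auto simp: idealization_simps R.m_ac M.a_ac smult_r_distr smult_assoc1[symmetric])
qed (auto simp: idealization_simps R.l_distr smult_r_distr smult_l_distr M.a_ac)

subsection \<open>Sections modulo the square of an ideal\<close>

lemma quot_ring_carrier: "carrier (R Quot I) = {I +>\<^bsub>R\<^esub> x | x. x \<in> carrier R}"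
  by (auto simp: FactRing_def A_RCOSETS_def')

lemma quot_ring_factor:
  assumes R: "cring R" and B: "cring B" and I: "ideal I R" and g: "g \<in> ring_hom R B" and zero: "\<And>x. x \<in> I \<Longrightarrow> g x = \<zero>\<^bsub>B\<^esub>"
  obtains gb where "gb \<in> ring_hom (R Quot I) B" "\<And>x. x \<in> carrier R \<Longrightarrow> gb (I +>\<^bsub>R\<^esub> x) = g x"
proof -
  interpret R: cring R by fact
  interpret B: cring B by fact
  interpret I: ideal I R by fact
  interpret g: ring_hom_ring R B g by (intro ring_hom_ringI2 R.ring_axioms B.ring_axioms g)
  define gb where "gb U = g (SOME x. x \<in> U)" for U
  have q: "(+>\<^bsub>R\<^esub>) I \<in> ring_hom R (R Quot I)" by (rule I.rcos_ring_hom)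
  have eq: "gb (I +>\<^bsub>R\<^esub> x) = g x" if x: "x \<in> carrier R" for x
  proof -
    have "x \<in> I +>\<^bsub>R\<^esub> x" by (rule I.a_rcos_self[OF x])
    then have "(SOME y. y \<in> I +>\<^bsub>R\<^esub> x) \<in> I +>\<^bsub>R\<^esub> x" by (rule someI)
    then obtain i where i: "i \<in> I" "(SOME y. y \<in> I +>\<^bsub>R\<^esub> x) = i \<oplus>\<^bsub>R\<^esub> x" unfolding a_r_coset_def' by blast
    have "g (i \<oplus>\<^bsub>R\<^esub> x) = g x" using i x zero I.Icarr by simp
    then show ?thesis unfolding gb_def i(2) .
  qed
  have "gb \<in> ring_hom (R Quot I) B"
  proof (rule ring_hom_memI)
    fix U assume "U \<in> carrier (R Quot I)"
    then obtain x where x: "x \<in> carrier R" "U = I +>\<^bsub>R\<^esub> x" by (auto simp: quot_ring_carrier)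
    show "gb U \<in> carrier B" using x eq by simp
    fix V assume "V \<in> carrier (R Quot I)"
    then obtain y where y: "y \<in> carrier R" "V = I +>\<^bsub>R\<^esub> y" by (auto simp: quot_ring_carrier)
    show "gb (U \<otimes>\<^bsub>R Quot I\<^esub> V) = gb U \<otimes>\<^bsub>B\<^esub> gb V"
      using x y eq by (simp add: ring_hom_mult[OF q, symmetric])
    show "gb (U \<oplus>\<^bsub>R Quot I\<^esub> V) = gb U \<oplus>\<^bsub>B\<^esub> gb V"
      using x y eq by (simp add: ring_hom_add[OF q, symmetric])
  next
    show "gb \<one>\<^bsub>R Quot I\<^esub> = \<one>\<^bsub>B\<^esub>" using eq[of "\<one>\<^bsub>R\<^esub>"] by (simp add: ring_hom_one[OF q, symmetric])
  qed
  then show ?thesis using that eq by blast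
qed

text \<open>Instantiated both with \<open>A\<close> in the role of \<open>R\<close> and with a
  polynomial ring that maps onto \<open>B\<close>.\<close>

locale smooth_quotient =
  fixes K :: "('k, 'l) ring_scheme" and R :: "('a, 'm) ring_scheme" (structure) and \<kappa> :: "'k \<Rightarrow> 'a"
    and B :: "('b, 'n) ring_scheme" and g :: "'a \<Rightarrow> 'b"
  assumes K: "field K" and R: "cring R" and \<kappa>: "\<kappa> \<in> ring_hom K R" and ft: "finite_type_algebra K R \<kappa>"
    and B: "cring B" and g: "g \<in> ring_hom R B" and onto: "g ` carrier R = carrier B"
    and smooth: "smooth_algebra K B (g \<circ> \<kappa>)"
begin

sublocale K: field K by (rule K)
sublocale R: cring R by (rule R)
sublocale B: cring B by (rule B)
sublocale g: ring_hom_ring R B g by (intro ring_hom_ringI2 R.ring_axioms B.ring_axioms g)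

abbreviation "J \<equiv> a_kernel R B g"
abbreviation "J2 \<equiv> ideal_prod R J J"

lemma J_mem: "x \<in> J \<longleftrightarrow> x \<in> carrier R \<and> g x = \<zero>\<^bsub>B\<^esub>" unfolding a_kernel_def kernel_def by simp

lemma J_ideal: "ideal J R" by (rule g.kernel_is_ideal)

lemma J2_ideal: "ideal J2 R" by (rule R.ideal_prod_is_ideal[OF J_ideal J_ideal])

lemma J2_sub: "J2 \<subseteq> J" using R.ideal_prod_inter[OF J_ideal J_ideal] by blast

lemma J2_mult: "x \<in> J \<Longrightarrow> y \<in> J \<Longrightarrow> x \<otimes> y \<in> J2" by (rule ideal_prod.prod)

sublocale J2: ideal J2 R by (rule J2_ideal)

abbreviation "Q \<equiv> R Quot J2"
abbreviation "c2 x \<equiv> J2 +> x"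

sublocale Q: cring Q using J2.quotient_is_cring[OF R] .

lemma q: "(+>) J2 \<in> ring_hom R Q" by (rule J2.rcos_ring_hom)

lemmas q_simps = ring_hom_mult[OF q] ring_hom_add[OF q] ring_hom_one[OF q] ring_hom_closed[OF q]

lemma c2_eq: "x \<in> carrier R \<Longrightarrow> y \<in> carrier R \<Longrightarrow> c2 x = c2 y \<longleftrightarrow> x \<ominus> y \<in> J2"
  using R.quotient_eq_iff_same_a_r_cos[OF J2_ideal] by blast

lemma c2_zero: "x \<in> carrier R \<Longrightarrow> c2 x = \<zero>\<^bsub>Q\<^esub> \<longleftrightarrow> x \<in> J2"
  using c2_eq[of x "\<zero>"] ring_hom_zero[OF q R.ring_axioms Q.ring_axioms] by (simp add: R.minus_zero_right)

lemma finite_type_Q: "finite_type_algebra K Q (\<lambda>c. c2 (\<kappa> c))"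
  using finite_type_image[OF R.ring_axioms Q.ring_axioms ft _ q] ring_hom_closed[OF \<kappa>]
  by (auto simp: quot_ring_carrier comp_def image_iff)

lemma kappa_Q: "(\<lambda>c. c2 (\<kappa> c)) \<in> ring_hom K Q"
  using ring_hom_trans[OF \<kappa> q] by (simp add: comp_def)

definition gb where "gb = (SOME gb. gb \<in> ring_hom Q B \<and> (\<forall>x\<in>carrier R. gb (c2 x) = g x))"

lemma gb: "gb \<in> ring_hom Q B" "x \<in> carrier R \<Longrightarrow> gb (c2 x) = g x"
proof -
  have "\<exists>gb. gb \<in> ring_hom Q B \<and> (\<forall>x\<in>carrier R. gb (c2 x) = g x)"
    using quot_ring_factor[OF R B J2_ideal g] J2_sub J_mem by (metis subsetD)
  from someI_ex[OF this] show "gb \<in> ring_hom Q B" "x \<in> carrier R \<Longrightarrow> gb (c2 x) = g x" unfolding gb_def by blast+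
qed

lemma gb_ker_square:
  assumes "U \<in> carrier Q" "V \<in> carrier Q" "gb U = \<zero>\<^bsub>B\<^esub>" "gb V = \<zero>\<^bsub>B\<^esub>"
  shows "U \<otimes>\<^bsub>Q\<^esub> V = \<zero>\<^bsub>Q\<^esub>"
proof -
  obtain x y where xy: "x \<in> carrier R" "U = c2 x" "y \<in> carrier R" "V = c2 y" using assms by (auto simp: quot_ring_carrier)
  then have "x \<otimes> y \<in> J2" using assms gb(2) by (intro J2_mult) (auto simp: J_mem)
  then show ?thesis using xy c2_zero[of "x \<otimes> y"] by (simp add: q_simps)
qed

text \<open>The identity of \<open>B\<close> is lifted along the surjection \<open>gb\<close>, whose
  kernel is the image of \<open>J\<close> modulo \<open>J2\<close> and so has square zero.\<close>

lemma ring_section: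
  obtains \<sigma> where "\<sigma> \<in> ring_hom B Q" "\<And>c. c \<in> carrier K \<Longrightarrow> \<sigma> (g (\<kappa> c)) = c2 (\<kappa> c)"
    "\<And>b. b \<in> carrier B \<Longrightarrow> gb (\<sigma> b) = b"
proof -
  have "gb ` carrier Q = (\<lambda>x. gb (c2 x)) ` carrier R" by (auto simp: quot_ring_carrier)
  also have "\<dots> = carrier B" unfolding onto[symmetric] by (rule image_cong) (simp_all add: gb(2))
  finally have "gb ` carrier Q = carrier B" .
  note gbonto = this
  have compat: "\<And>c. c \<in> carrier K \<Longrightarrow> id ((g \<circ> \<kappa>) c) = gb (c2 (\<kappa> c))"
    using gb(2) ring_hom_closed[OF \<kappa>] by simp
  show ?thesis
    by (rule smooth_lift[OF K smooth B Q.is_cring kappa_Q finite_type_Q B gb(1) gbonto gb_ker_square id_ring_hom[of B] compat])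
      (use that in auto)
qed

text \<open>The same cosets as in \<open>Q\<close>, but as a module over \<open>R\<close>, so that
  it can be the target of a derivation of \<open>R\<close>.\<close>

abbreviation "MQ \<equiv> quot_module (self_module R) J2"

lemma J2_submodule: "submodule J2 R (self_module R)"
  using J2_ideal self_submodule_iff[OF R] by blast

lemma self_coset: "I +>\<^bsub>self_module R\<^esub> x = I +> x"
  by (simp add: a_r_coset_def r_coset_def)

text \<open>The derivation \<open>p \<mapsto> p - \<sigma>(g p)\<close> splits the conormal sequence of \<open>R \<rightarrow> B\<close>.\<close>

lemma conormal_derivation:
  obtains E where "derivation K R \<kappa> MQ E" "\<And>j. j \<in> J \<Longrightarrow> E j = c2 j"
    "\<And>p. p \<in> carrier R \<Longrightarrow> \<exists>j\<in>J. E p = c2 j"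
proof -
  interpret S: module R "self_module R" by (rule self_is_module[OF R])
  obtain \<sigma> where \<sigma>: "\<sigma> \<in> ring_hom B Q" "\<And>c. c \<in> carrier K \<Longrightarrow> \<sigma> (g (\<kappa> c)) = c2 (\<kappa> c)"
    "\<And>b. b \<in> carrier B \<Longrightarrow> gb (\<sigma> b) = b" using ring_section by blast
  have "\<forall>b\<in>carrier B. \<exists>x\<in>carrier R. \<sigma> b = c2 x" using ring_hom_closed[OF \<sigma>(1)] by (auto simp: quot_ring_carrier)
  then obtain s where s: "\<And>b. b \<in> carrier B \<Longrightarrow> s b \<in> carrier R" "\<And>b. b \<in> carrier B \<Longrightarrow> \<sigma> b = c2 (s b)" by metis
  have gs: "b \<in> carrier B \<Longrightarrow> g (s b) = b" for b using \<sigma>(3) s gb(2) by metis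
  \<comment> \<open>A representative of the difference between \<open>p\<close> and the section
    applied to \<open>g p\<close>.\<close>
  define t where "t p = p \<ominus> s (g p)" for p
  have t: "t p \<in> carrier R" "t p \<in> J" if "p \<in> carrier R" for p
    using that s gs g.hom_closed[OF that] B.minus_zero_iff[of "g p" "g p"] by (auto simp: t_def J_mem a_minus_def)
  note quo = S.quot_add[OF J2_submodule] S.quot_smult[OF J2_submodule]
  note Mq = S.quot_lin[OF J2_submodule]
  have c2': "J2 +>\<^bsub>self_module R\<^esub> x = c2 x" for x by (rule self_coset)
  have add: "c2 x \<oplus>\<^bsub>MQ\<^esub> c2 y = c2 (x \<oplus> y)" if "x \<in> carrier R" "y \<in> carrier R" for x y
    using quo(1)[of x y] that by (simp add: c2')
  have smult: "a \<odot>\<^bsub>MQ\<^esub> c2 x = c2 (a \<otimes> x)" if "a \<in> carrier R" "x \<in> carrier R" for a x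
    using quo(2)[of a x] that by (simp add: c2')
  have zero: "\<zero>\<^bsub>MQ\<^esub> = c2 \<zero>" using S.quot_zero'[OF J2_submodule] by (simp add: c2')
  have s_add: "s (b \<oplus>\<^bsub>B\<^esub> b') \<ominus> (s b \<oplus> s b') \<in> J2"
    and s_mult: "s (b \<otimes>\<^bsub>B\<^esub> b') \<ominus> (s b \<otimes> s b') \<in> J2" if "b \<in> carrier B" "b' \<in> carrier B" for b b'
    using that s ring_hom_add[OF \<sigma>(1) that] ring_hom_mult[OF \<sigma>(1) that] c2_eq by (auto simp: q_simps(1,2)[symmetric])
  have "derivation K R \<kappa> MQ (\<lambda>p. c2 (t p))"
    unfolding derivation_def
  proof (intro conjI ballI)
    show "(\<lambda>p. c2 (t p)) \<in> carrier R \<rightarrow> carrier MQ" using t lin_mapD(1)[OF Mq] by (auto simp: c2')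
  next
    fix a b assume ab: "a \<in> carrier R" "b \<in> carrier R"
    note gab = g.hom_closed[OF ab(1)] g.hom_closed[OF ab(2)]
    note sab = s(1)[OF gab(1)] s(1)[OF gab(2)]
    have sab': "s (g a \<oplus>\<^bsub>B\<^esub> g b) \<in> carrier R" "s (g a \<otimes>\<^bsub>B\<^esub> g b) \<in> carrier R" using s(1) gab by auto
    have "t (a \<oplus> b) \<ominus> (t a \<oplus> t b) = \<ominus> (s (g a \<oplus>\<^bsub>B\<^esub> g b) \<ominus> (s (g a) \<oplus> s (g b)))"
      unfolding t_def using ab sab sab' by (simp, algebra)
    then have "t (a \<oplus> b) \<ominus> (t a \<oplus> t b) \<in> J2" using s_add[OF gab] J2.a_inv_closed by simp
    then show "c2 (t (a \<oplus> b)) = c2 (t a) \<oplus>\<^bsub>MQ\<^esub> c2 (t b)" using ab t by (simp add: add c2_eq)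
    \<comment> \<open>The failure of the Leibniz rule for \<open>t\<close> is the failure of
      multiplicativity of \<open>s\<close> plus a product of two elements of \<open>J\<close>, up to
      sign; both lie in \<open>J2\<close>.\<close>
    have id: "a \<otimes> b \<ominus> w \<ominus> (a \<otimes> (b \<ominus> v) \<oplus> b \<otimes> (a \<ominus> u)) =
      \<ominus> ((w \<ominus> u \<otimes> v) \<oplus> (a \<ominus> u) \<otimes> (b \<ominus> v))"
      if "u \<in> carrier R" "v \<in> carrier R" "w \<in> carrier R" for u v w
      using that ab by algebra
    have "t (a \<otimes> b) \<ominus> (a \<otimes> t b \<oplus> b \<otimes> t a) =
        \<ominus> ((s (g a \<otimes>\<^bsub>B\<^esub> g b) \<ominus> s (g a) \<otimes> s (g b)) \<oplus> t a \<otimes> t b)"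
      using id[OF sab sab'(2)] ab by (simp add: t_def)
    also have "\<dots> \<in> J2"
      using s_mult[OF gab] J2_mult[OF t(2)[OF ab(1)] t(2)[OF ab(2)]] by (intro J2.a_inv_closed J2.a_closed)
    finally have "c2 (t (a \<otimes> b)) = c2 (a \<otimes> t b \<oplus> b \<otimes> t a)" using ab t by (simp add: c2_eq)
    then show "c2 (t (a \<otimes> b)) = a \<odot>\<^bsub>MQ\<^esub> c2 (t b) \<oplus>\<^bsub>MQ\<^esub> b \<odot>\<^bsub>MQ\<^esub> c2 (t a)" using ab t by (simp add: add smult)
  next
    fix c assume c: "c \<in> carrier K"
    then have kc: "\<kappa> c \<in> carrier R" using ring_hom_closed[OF \<kappa>] by simp
    then have "c2 (s (g (\<kappa> c))) = c2 (\<kappa> c)" using \<sigma>(2)[OF c] s(2) by simp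
    then have "c2 (\<kappa> c) = c2 (s (g (\<kappa> c)))" by simp
    then have "t (\<kappa> c) \<in> J2" unfolding t_def using c2_eq[OF kc s(1)[OF g.hom_closed[OF kc]]] by simp
    then show "c2 (t (\<kappa> c)) = \<zero>\<^bsub>MQ\<^esub>" unfolding zero using t kc c2_eq[of "t (\<kappa> c)" "\<zero>"] by (simp add: R.minus_zero_right)
  qed
  moreover have "c2 (t j) = c2 j" if j: "j \<in> J" for j
  proof -
    have jR: "j \<in> carrier R" "g j = \<zero>\<^bsub>B\<^esub>" using j by (auto simp: J_mem)
    have "c2 (s \<zero>\<^bsub>B\<^esub>) = \<zero>\<^bsub>Q\<^esub>" using s(2)[of "\<zero>\<^bsub>B\<^esub>"] ring_hom_zero[OF \<sigma>(1) B.ring_axioms Q.ring_axioms] by simp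
    then have "s \<zero>\<^bsub>B\<^esub> \<in> J2" using c2_zero s(1) by simp
    moreover have "t j \<ominus> j = \<ominus> s \<zero>\<^bsub>B\<^esub>" unfolding t_def jR(2) using jR(1) s(1)[of "\<zero>\<^bsub>B\<^esub>"] by (simp, algebra)
    ultimately show ?thesis using t jR c2_eq J2.a_inv_closed by simp
  qed
  ultimately show ?thesis using that t(2) by blast
qed

end

lemma smooth_quotient_quot:
  assumes "field K" "cring A" "\<iota> \<in> ring_hom K A" "finite_type_algebra K A \<iota>" "ideal I A"
    "smooth_algebra K (A Quot I) ((\<lambda>a. I +>\<^bsub>A\<^esub> a) \<circ> \<iota>)"
  shows "smooth_quotient K A \<iota> (A Quot I) (\<lambda>a. I +>\<^bsub>A\<^esub> a)"
    and "a_kernel A (A Quot I) (\<lambda>a. I +>\<^bsub>A\<^esub> a) = I"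
proof -
  interpret I: ideal I A by fact
  show "smooth_quotient K A \<iota> (A Quot I) (\<lambda>a. I +>\<^bsub>A\<^esub> a)"
    using assms I.quotient_is_cring[OF assms(2)] I.rcos_ring_hom
    by (intro smooth_quotient.intro) (auto simp: quot_ring_carrier)
  interpret A: cring A by fact
  have "x \<in> carrier A \<and> I +>\<^bsub>A\<^esub> x = I \<longleftrightarrow> x \<in> I" for x
    using I.a_rcos_const[of x] I.a_rcos_self[of x] I.Icarr[of x] by blast
  then show "a_kernel A (A Quot I) (\<lambda>a. I +>\<^bsub>A\<^esub> a) = I"
    unfolding a_kernel_def kernel_def FactRing_def by simp
qed

context smooth_quotient begin

text \<open>Lifting \<open>A \<rightarrow> A/I\<^sup>2\<close> along the surjection from the idealization of \<open>B\<^sup>r\<close> given by generators of \<open>I\<close>.\<close>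

lemma conormal_coordinates:
  fixes r :: nat and fs :: "nat \<Rightarrow> 'a"
  assumes smoothR: "smooth_algebra K R \<kappa>" and fs: "\<And>i. i < r \<Longrightarrow> fs i \<in> carrier R" and J: "J = Idl\<^bsub>R\<^esub> (fs ` {..<r})"
  obtains \<theta> where "\<And>i. i < r \<Longrightarrow> derivation K R \<kappa> (restr g (self_module B)) (\<theta> i)"
    "\<And>a c. a \<in> J \<Longrightarrow> (\<And>i. i < r \<Longrightarrow> c i \<in> carrier R) \<Longrightarrow> (\<And>i. i < r \<Longrightarrow> g (c i) = \<theta> i a) \<Longrightarrow>
       a \<ominus>\<^bsub>R\<^esub> (\<Oplus>\<^bsub>R\<^esub>i\<in>{..<r}. c i \<otimes>\<^bsub>R\<^esub> fs i) \<in> J2"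
proof -
  obtain \<sigma> where \<sigma>: "\<sigma> \<in> ring_hom B Q" "\<And>c. c \<in> carrier K \<Longrightarrow> \<sigma> (g (\<kappa> c)) = c2 (\<kappa> c)"
    "\<And>b. b \<in> carrier B \<Longrightarrow> gb (\<sigma> b) = b" using ring_section by blast
  let ?F = "free_module B {..<r}"
  let ?C = "idealization B ?F"
  let ?Z = "restr \<sigma> (self_module Q)"
  interpret F: module B ?F by (rule free_is_module[OF B])
  interpret C: cring ?C by (rule F.idealization_cring)
  interpret SQ: module Q "self_module Q" by (rule self_is_module[OF Q.is_cring])
  interpret Z: module B ?Z by (rule restr_is_module[OF B SQ.module_axioms \<sigma>(1)])
  have fJ: "fs i \<in> J" if "i < r" for i unfolding J using R.genideal_self[of "fs ` {..<r}"] fs that by auto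
  have bc: "i < r \<Longrightarrow> basis_elt B i \<in> carrier ?F" for i by (rule basis_elt_closed[OF B]) simp
  \<comment> \<open>The map from the free module onto \<open>J\<close> modulo \<open>J2\<close>
    given by the generators; it is linear over \<open>B\<close> by way of the section
    \<open>\<sigma>\<close>.\<close>
  let ?e = "free_ext B ?Z (\<lambda>i. c2 (fs i))"
  have "\<And>i. i \<in> {..<r} \<Longrightarrow> c2 (fs i) \<in> carrier ?Z" using fs q_simps(4) by simp
  note fe = free_ext[OF Z.module_axioms, of "{..<r}" "\<lambda>i. c2 (fs i)", OF this]
  note e = lin_mapD[OF fe(1), simplified]
  have gbsig: "lin_map B ?Z (self_module B) gb"
    by (rule lin_mapI) (use ring_hom_closed[OF gb(1)] ring_hom_add[OF gb(1)] ring_hom_mult[OF gb(1)]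
        ring_hom_closed[OF \<sigma>(1)] \<sigma>(3) in auto)
  have gbe: "gb (?e x) = \<zero>\<^bsub>B\<^esub>" if "x \<in> carrier ?F" for x
  proof -
    interpret SB: module B "self_module B" by (rule self_is_module[OF B])
    note lm = lin_map_comp[OF fe(1) gbsig]
    have "x \<in> {x \<in> carrier ?F. gb (?e x) \<in> {\<zero>\<^bsub>self_module B\<^esub>}}"
      by (rule free_induct[OF B lin_map_vimage_submodule[OF F.module_axioms SB.module_axioms lm SB.zero_submodule] _ that])
        (use fe(2) fJ J_mem gb(2) bc in auto)
    then show ?thesis by simp
  qed
  have esq: "?e x \<otimes>\<^bsub>Q\<^esub> ?e y = \<zero>\<^bsub>Q\<^esub>" if "x \<in> carrier ?F" "y \<in> carrier ?F" for x y
    by (rule gb_ker_square) (use that e(1) gbe in auto)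
  \<comment> \<open>Multiplicative because the image of \<open>?e\<close> lies in a square-zero
    ideal, just as the free module does inside the idealization.\<close>
  define G where "G = (\<lambda>(b, x). \<sigma> b \<oplus>\<^bsub>Q\<^esub> ?e x)"
  note sc = ring_hom_closed[OF \<sigma>(1)]
  have Gh: "G \<in> ring_hom ?C Q"
  proof (rule ring_hom_memI)
    fix w assume "w \<in> carrier ?C"
    then obtain b x where w: "w = (b, x)" "b \<in> carrier B" "x \<in> carrier ?F" by (auto simp: idealization_simps)
    show "G w \<in> carrier Q" using w sc e(1) by (simp add: G_def)
    fix w' assume "w' \<in> carrier ?C"
    then obtain b' x' where w': "w' = (b', x')" "b' \<in> carrier B" "x' \<in> carrier ?F" by (auto simp: idealization_simps)
    show "G (w \<oplus>\<^bsub>?C\<^esub> w') = G w \<oplus>\<^bsub>Q\<^esub> G w'"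
      using w w' sc e ring_hom_add[OF \<sigma>(1)] by (simp add: G_def idealization_simps Q.a_ac)
    have "(s \<oplus>\<^bsub>Q\<^esub> a) \<otimes>\<^bsub>Q\<^esub> (s' \<oplus>\<^bsub>Q\<^esub> a') = s \<otimes>\<^bsub>Q\<^esub> s' \<oplus>\<^bsub>Q\<^esub> (s \<otimes>\<^bsub>Q\<^esub> a' \<oplus>\<^bsub>Q\<^esub> s' \<otimes>\<^bsub>Q\<^esub> a)"
      if "s \<in> carrier Q" "s' \<in> carrier Q" "a \<in> carrier Q" "a' \<in> carrier Q" "a \<otimes>\<^bsub>Q\<^esub> a' = \<zero>\<^bsub>Q\<^esub>" for s s' a a'
      using that by (simp add: Q.l_distr Q.r_distr Q.a_ac Q.m_ac)
    then show "G (w \<otimes>\<^bsub>?C\<^esub> w') = G w \<otimes>\<^bsub>Q\<^esub> G w'"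
      using w w' sc e ring_hom_mult[OF \<sigma>(1)] esq by (simp add: G_def idealization_simps)
  next
    show "G \<one>\<^bsub>?C\<^esub> = \<one>\<^bsub>Q\<^esub>" using ring_hom_one[OF \<sigma>(1)] lin_map_zero[OF F.module_axioms Z.module_axioms fe(1)]
      by (simp add: G_def idealization_simps)
  qed
  have eJ: "\<exists>x\<in>carrier ?F. c2 a = ?e x" if a: "a \<in> J" for a
  proof -
    let ?I = "{a \<in> J. \<exists>x\<in>carrier ?F. c2 a = ?e x}"
    note JD = ideal.ideal_simps[OF J_ideal]
    have "ideal ?I R"
    proof (rule R.idealI')
      show "?I \<subseteq> carrier R" using JD(2) by auto
      show "\<zero>\<^bsub>R\<^esub> \<in> ?I" using JD(1) c2_zero[of "\<zero>\<^bsub>R\<^esub>"] J2.ideal_simps(1)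
          lin_map_zero[OF F.module_axioms Z.module_axioms fe(1)] by (auto intro!: bexI[of _ "\<zero>\<^bsub>?F\<^esub>"])
      show "x \<oplus>\<^bsub>R\<^esub> y \<in> ?I" if "x \<in> ?I" "y \<in> ?I" for x y
      proof -
        obtain x' y' where *: "x' \<in> carrier ?F" "y' \<in> carrier ?F" "c2 x = ?e x'" "c2 y = ?e y'" using \<open>x \<in> ?I\<close> \<open>y \<in> ?I\<close> by auto
        then have "c2 (x \<oplus>\<^bsub>R\<^esub> y) = ?e (x' \<oplus>\<^bsub>?F\<^esub> y')" using \<open>x \<in> ?I\<close> \<open>y \<in> ?I\<close> JD(2) e(2) by (simp add: q_simps)
        moreover have "x \<oplus>\<^bsub>R\<^esub> y \<in> J" using JD(3)[of x y] \<open>x \<in> ?I\<close> \<open>y \<in> ?I\<close> by simp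
        ultimately show ?thesis using F.M.a_closed[OF *(1,2)] by (intro CollectI conjI bexI) (assumption+)
      qed
      show "a \<otimes>\<^bsub>R\<^esub> x \<in> ?I" if "a \<in> carrier R" "x \<in> ?I" for a x
      proof -
        obtain x' where *: "x' \<in> carrier ?F" "c2 x = ?e x'" using \<open>x \<in> ?I\<close> by auto
        have ga: "g a \<in> carrier B" using \<open>a \<in> carrier R\<close> by simp
        \<comment> \<open>The class of \<open>a\<close> differs from the section of
          \<open>g a\<close> by an element of the square-zero kernel, which annihilates the image of
          \<open>?e\<close>; so \<open>a\<close> acts there through \<open>g a\<close>.\<close>
        let ?k = "c2 a \<ominus>\<^bsub>Q\<^esub> \<sigma> (g a)"
        have k: "?k \<in> carrier Q" "gb ?k = \<zero>\<^bsub>B\<^esub>"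
        proof -
          interpret gb: ring_hom_ring Q B gb by (intro ring_hom_ringI2 Q.ring_axioms B.ring_axioms gb(1))
          show "?k \<in> carrier Q" "gb ?k = \<zero>\<^bsub>B\<^esub>"
            using \<open>a \<in> carrier R\<close> q_simps(4) sc[OF ga] gb(2) \<sigma>(3)[OF ga] ga B.minus_zero_iff[of "g a" "g a"] by (auto simp: a_minus_def)
        qed
        have ka: "c2 a = ?k \<oplus>\<^bsub>Q\<^esub> \<sigma> (g a)" using \<open>a \<in> carrier R\<close> q_simps(4) sc[OF ga] by (simp add: a_minus_def Q.a_assoc Q.l_neg)
        have "c2 a \<otimes>\<^bsub>Q\<^esub> ?e x' = ?k \<otimes>\<^bsub>Q\<^esub> ?e x' \<oplus>\<^bsub>Q\<^esub> \<sigma> (g a) \<otimes>\<^bsub>Q\<^esub> ?e x'"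
          using arg_cong[OF ka, of "\<lambda>z. z \<otimes>\<^bsub>Q\<^esub> ?e x'"] Q.l_distr[OF k(1) sc[OF ga] e(1)[OF *(1)]] by (rule trans)
        also have "?k \<otimes>\<^bsub>Q\<^esub> ?e x' = \<zero>\<^bsub>Q\<^esub>" by (rule gb_ker_square) (use k e(1) gbe * in auto)
        finally have "c2 (a \<otimes>\<^bsub>R\<^esub> x) = ?e (g a \<odot>\<^bsub>?F\<^esub> x')"
          using \<open>a \<in> carrier R\<close> \<open>x \<in> ?I\<close> JD(2) * e ga sc[OF ga] by (simp add: q_simps)
        moreover have "a \<otimes>\<^bsub>R\<^esub> x \<in> J" using JD(5)[OF \<open>a \<in> carrier R\<close>] \<open>x \<in> ?I\<close> by simp
        ultimately show ?thesis using F.smult_closed[OF ga *(1)] by (intro CollectI conjI bexI) (assumption+)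
      qed
    qed
    moreover have "fs ` {..<r} \<subseteq> ?I" using fJ fe(2) bc by (auto intro!: bexI[of _ "basis_elt B _"])
    ultimately have "Idl\<^bsub>R\<^esub> (fs ` {..<r}) \<subseteq> ?I" by (rule R.genideal_minimal)
    from subsetD[OF this a[unfolded J]] show ?thesis by simp
  qed
  have onto': "G ` carrier ?C = carrier Q"
  proof
    show "G ` carrier ?C \<subseteq> carrier Q" using ring_hom_closed[OF Gh] by auto
    show "carrier Q \<subseteq> G ` carrier ?C"
    proof
      fix U assume "U \<in> carrier Q"
      then obtain a where a: "a \<in> carrier R" "U = c2 a" by (auto simp: quot_ring_carrier)
      have ga: "g a \<in> carrier B" using a by simp
      obtain s where s: "s \<in> carrier R" "\<sigma> (g a) = c2 s" using sc[OF ga] by (auto simp: quot_ring_carrier)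
      have "g s = g a" using \<sigma>(3)[OF ga] s gb(2) by simp
      then have "a \<ominus>\<^bsub>R\<^esub> s \<in> J" using a s B.minus_zero_iff[of "g a" "g a"] by (simp add: J_mem a_minus_def)
      then obtain x where x: "x \<in> carrier ?F" "c2 (a \<ominus>\<^bsub>R\<^esub> s) = ?e x" using eJ by blast
      have "a = s \<oplus>\<^bsub>R\<^esub> (a \<ominus>\<^bsub>R\<^esub> s)" using a s by (simp add: a_minus_def R.a_ac R.r_neg R.r_neg1 R.r_neg2)
      then have "c2 a = c2 s \<oplus>\<^bsub>Q\<^esub> c2 (a \<ominus>\<^bsub>R\<^esub> s)" using a s by (metis R.minus_closed q_simps(2))
      then have "U = G (g a, x)" using a s x by (simp add: G_def)
      then show "U \<in> G ` carrier ?C" using ga x by (auto simp: idealization_simps)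
    qed
  qed
  have fstG: "gb (G w) = fst w" if wC: "w \<in> carrier ?C" for w
  proof -
    obtain b x where w: "w = (b, x)" "b \<in> carrier B" "x \<in> carrier ?F" using wC by (auto simp: idealization_simps)
    then show ?thesis using ring_hom_add[OF gb(1) sc e(1)] gbe \<sigma>(3) by (simp add: G_def)
  qed
  \<comment> \<open>Composing \<open>G\<close> with \<open>gb\<close> gives the first component, so
    kernel elements lie in the free summand, where products are zero.\<close>
  have ker: "w \<otimes>\<^bsub>?C\<^esub> w' = \<zero>\<^bsub>?C\<^esub>" if "w \<in> carrier ?C" "w' \<in> carrier ?C" "G w = \<zero>\<^bsub>Q\<^esub>" "G w' = \<zero>\<^bsub>Q\<^esub>" for w w'
  proof -
    have "gb \<zero>\<^bsub>Q\<^esub> = \<zero>\<^bsub>B\<^esub>" using ring_hom_zero[OF gb(1) Q.ring_axioms B.ring_axioms] .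
    then have "fst w = \<zero>\<^bsub>B\<^esub>" "fst w' = \<zero>\<^bsub>B\<^esub>" using that fstG[of w] fstG[of w'] by auto
    then show ?thesis using that by (cases w; cases w') (auto simp: idealization_simps)
  qed
  let ?\<kappa> = "\<lambda>c. (g (\<kappa> c), \<zero>\<^bsub>?F\<^esub>)"
  have gk: "c \<in> carrier K \<Longrightarrow> g (\<kappa> c) \<in> carrier B" for c using ring_hom_closed[OF \<kappa>] by simp
  have kC: "?\<kappa> \<in> ring_hom K ?C"
    using ring_hom_trans[OF \<kappa> g] gk
    by (auto simp: ring_hom_def idealization_simps)
  have ftC: "finite_type_algebra K ?C ?\<kappa>"
  proof -
    have ftB: "finite_type_algebra K B (g \<circ> \<kappa>)" using smooth by (simp add: smooth_algebra_def)
    obtain S where S: "finite S" "S \<subseteq> carrier B"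
      "\<And>N. subring N B \<Longrightarrow> (g \<circ> \<kappa>) ` carrier K \<subseteq> N \<Longrightarrow> S \<subseteq> N \<Longrightarrow> carrier B \<subseteq> N"
      using finite_typeE[OF B.ring_axioms ftB] gk by (auto simp: image_subset_iff)
    \<comment> \<open>Generators of the algebra \<open>B\<close> and the basis of the free module
      together generate the idealization, as required for copying it to the test type.\<close>
    let ?S = "(\<lambda>b. (b, \<zero>\<^bsub>?F\<^esub>)) ` S \<union> (\<lambda>i. (\<zero>\<^bsub>B\<^esub>, basis_elt B i)) ` {..<r}"
    show ?thesis
    proof (rule finite_typeI[OF C.ring_axioms, of ?S])
      show "finite ?S" using S by simp
      show "?S \<subseteq> carrier ?C" using S bc by (auto simp: idealization_simps)
      show "?\<kappa> ` carrier K \<subseteq> carrier ?C" using gk by (auto simp: idealization_simps)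
      fix N assume N: "subring N ?C" "?\<kappa> ` carrier K \<subseteq> N" "?S \<subseteq> N"
      note D = subringE[OF N(1)]
      have zN: "(\<zero>\<^bsub>B\<^esub>, \<zero>\<^bsub>?F\<^esub>) \<in> N" using D(2) by (simp add: idealization_simps)
      have ainv: "\<ominus>\<^bsub>?C\<^esub> (b, \<zero>\<^bsub>?F\<^esub>) = (\<ominus>\<^bsub>B\<^esub> b, \<zero>\<^bsub>?F\<^esub>)" if "b \<in> carrier B" for b
        by (rule C.minus_equality) (use that B.l_neg in \<open>auto simp: idealization_simps\<close>)
      have "subring {b \<in> carrier B. (b, \<zero>\<^bsub>?F\<^esub>) \<in> N} B"
      proof (rule B.subringI)
        show "\<one>\<^bsub>B\<^esub> \<in> {b \<in> carrier B. (b, \<zero>\<^bsub>?F\<^esub>) \<in> N}" using D(3) by (simp add: idealization_simps)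
        show "\<ominus>\<^bsub>B\<^esub> h \<in> {b \<in> carrier B. (b, \<zero>\<^bsub>?F\<^esub>) \<in> N}" if "h \<in> {b \<in> carrier B. (b, \<zero>\<^bsub>?F\<^esub>) \<in> N}" for h
          using that D(5)[of "(h, \<zero>\<^bsub>?F\<^esub>)"] ainv[of h] by auto
        show "h1 \<otimes>\<^bsub>B\<^esub> h2 \<in> {b \<in> carrier B. (b, \<zero>\<^bsub>?F\<^esub>) \<in> N}" "h1 \<oplus>\<^bsub>B\<^esub> h2 \<in> {b \<in> carrier B. (b, \<zero>\<^bsub>?F\<^esub>) \<in> N}"
          if "h1 \<in> {b \<in> carrier B. (b, \<zero>\<^bsub>?F\<^esub>) \<in> N}" "h2 \<in> {b \<in> carrier B. (b, \<zero>\<^bsub>?F\<^esub>) \<in> N}" for h1 h2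
          using that D(6)[of "(h1, \<zero>\<^bsub>?F\<^esub>)" "(h2, \<zero>\<^bsub>?F\<^esub>)"] D(7)[of "(h1, \<zero>\<^bsub>?F\<^esub>)" "(h2, \<zero>\<^bsub>?F\<^esub>)"]
          by (auto simp: idealization_simps)
      qed auto
      then have "carrier B \<subseteq> {b \<in> carrier B. (b, \<zero>\<^bsub>?F\<^esub>) \<in> N}"
        by (rule S(3)) (use N gk S(2) in auto)
      then have b0: "(b, \<zero>\<^bsub>?F\<^esub>) \<in> N" if "b \<in> carrier B" for b using that by blast
      have "submodule {x \<in> carrier ?F. (\<zero>\<^bsub>B\<^esub>, x) \<in> N} B ?F"
      proof (rule F.submoduleI')
        fix a b assume "a \<in> {x \<in> carrier ?F. (\<zero>\<^bsub>B\<^esub>, x) \<in> N}" "b \<in> {x \<in> carrier ?F. (\<zero>\<^bsub>B\<^esub>, x) \<in> N}"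
        then show "a \<oplus>\<^bsub>?F\<^esub> b \<in> {x \<in> carrier ?F. (\<zero>\<^bsub>B\<^esub>, x) \<in> N}"
          using D(7)[of "(\<zero>\<^bsub>B\<^esub>, a)" "(\<zero>\<^bsub>B\<^esub>, b)"] by (auto simp: idealization_simps)
      next
        fix a x assume "a \<in> carrier B" "x \<in> {x \<in> carrier ?F. (\<zero>\<^bsub>B\<^esub>, x) \<in> N}"
        then show "a \<odot>\<^bsub>?F\<^esub> x \<in> {x \<in> carrier ?F. (\<zero>\<^bsub>B\<^esub>, x) \<in> N}"
          using D(6)[of "(a, \<zero>\<^bsub>?F\<^esub>)" "(\<zero>\<^bsub>B\<^esub>, x)"] b0 by (auto simp: idealization_simps)
      qed (use zN in auto)
      note x0sub = this
      have x0: "(\<zero>\<^bsub>B\<^esub>, x) \<in> N" if "x \<in> carrier ?F" for x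
      proof -
        have "x \<in> {x \<in> carrier ?F. (\<zero>\<^bsub>B\<^esub>, x) \<in> N}"
          by (rule free_induct[OF B x0sub _ that]) (use N(3) bc in \<open>auto simp: image_subset_iff\<close>)
        then show ?thesis by simp
      qed
      show "carrier ?C \<subseteq> N"
      proof
        fix w assume "w \<in> carrier ?C"
        then obtain b x where w: "w = (b, x)" "b \<in> carrier B" "x \<in> carrier ?F" by (auto simp: idealization_simps)
        then show "w \<in> N" using D(7)[OF b0 x0] by (simp add: idealization_simps)
      qed
    qed
  qed
  have compat: "c2 (\<kappa> c) = G (?\<kappa> c)" if "c \<in> carrier K" for c
    using \<sigma>(2)[OF that] lin_map_zero[OF F.module_axioms Z.module_axioms fe(1)] sc[OF gk[OF that]]
    by (simp add: G_def)
  \<comment> \<open>Here smoothness of \<open>R\<close> is used: the quotient map to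
    \<open>Q\<close> lifts through \<open>G\<close>. The second component of the lift is a
    derivation, and its coordinates are the \<open>\<theta> i\<close>.\<close>
  obtain v where v: "v \<in> ring_hom R ?C" "\<And>c. c \<in> carrier K \<Longrightarrow> v (\<kappa> c) = ?\<kappa> c" "\<And>a. a \<in> carrier R \<Longrightarrow> G (v a) = c2 a"
    by (rule smooth_lift[OF K smoothR R C.is_cring kC ftC Q.is_cring Gh onto' ker q compat]) auto
  define \<theta> where "\<theta> i a = snd (v a) i" for i a
  have va: "v a \<in> carrier ?C" "fst (v a) = g a" "snd (v a) \<in> carrier ?F" if "a \<in> carrier R" for a
    using ring_hom_closed[OF v(1) that] fstG[OF ring_hom_closed[OF v(1) that]] v(3)[OF that] gb(2)[OF that]
    by (auto simp: idealization_simps)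
  have vpair: "v a = (g a, snd (v a))" if "a \<in> carrier R" for a using va(2)[OF that] by (metis prod.collapse)
  have der: "derivation K R \<kappa> (restr g (self_module B)) (\<theta> i)" for i
    unfolding derivation_def
  proof (intro conjI ballI)
    show "\<theta> i \<in> carrier R \<rightarrow> carrier (restr g (self_module B))" using va(3) by (auto simp: \<theta>_def free_simps)
  next
    fix a b assume ab: "a \<in> carrier R" "b \<in> carrier R"
    have "snd (v (a \<oplus>\<^bsub>R\<^esub> b)) = snd (v a) \<oplus>\<^bsub>?F\<^esub> snd (v b)"
      unfolding ring_hom_add[OF v(1) ab] by (subst vpair[OF ab(1)], subst vpair[OF ab(2)]) (simp add: idealization_simps)
    then show "\<theta> i (a \<oplus>\<^bsub>R\<^esub> b) = \<theta> i a \<oplus>\<^bsub>restr g (self_module B)\<^esub> \<theta> i b" by (simp add: \<theta>_def free_simps)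
    have "snd (v (a \<otimes>\<^bsub>R\<^esub> b)) = g a \<odot>\<^bsub>?F\<^esub> snd (v b) \<oplus>\<^bsub>?F\<^esub> g b \<odot>\<^bsub>?F\<^esub> snd (v a)"
      unfolding ring_hom_mult[OF v(1) ab] by (subst vpair[OF ab(1)], subst vpair[OF ab(2)]) (simp add: idealization_simps)
    then show "\<theta> i (a \<otimes>\<^bsub>R\<^esub> b) = a \<odot>\<^bsub>restr g (self_module B)\<^esub> \<theta> i b \<oplus>\<^bsub>restr g (self_module B)\<^esub> b \<odot>\<^bsub>restr g (self_module B)\<^esub> \<theta> i a"
      by (simp add: \<theta>_def free_simps)
  next
    fix c assume "c \<in> carrier K"
    then show "\<theta> i (\<kappa> c) = \<zero>\<^bsub>restr g (self_module B)\<^esub>" using v(2) by (simp add: \<theta>_def free_simps)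
  qed
  have "a \<ominus>\<^bsub>R\<^esub> (\<Oplus>\<^bsub>R\<^esub>i\<in>{..<r}. c i \<otimes>\<^bsub>R\<^esub> fs i) \<in> J2"
    if a: "a \<in> J" and c: "\<And>i. i < r \<Longrightarrow> c i \<in> carrier R" "\<And>i. i < r \<Longrightarrow> g (c i) = \<theta> i a" for a c
  proof -
    have aR: "a \<in> carrier R" "g a = \<zero>\<^bsub>B\<^esub>" using a by (auto simp: J_mem)
    let ?x = "snd (v a)"
    have x: "?x \<in> carrier ?F" by (rule va(3)[OF aR(1)])
    have "c2 a = \<sigma> \<zero>\<^bsub>B\<^esub> \<oplus>\<^bsub>Q\<^esub> ?e ?x" using v(3)[OF aR(1)] vpair[OF aR(1)] aR(2) by (simp add: G_def split: prod.splits)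
    then have c2a: "c2 a = ?e ?x" using ring_hom_zero[OF \<sigma>(1) B.ring_axioms Q.ring_axioms] e(1)[OF x] by simp
    \<comment> \<open>Replacing the section of a coordinate by another preimage \<open>c i\<close>
      changes it by an element of \<open>J\<close>, and multiplication by \<open>fs i\<close> sends
      this change into \<open>J2\<close>.\<close>
    have summand: "\<sigma> (?x i) \<otimes>\<^bsub>Q\<^esub> c2 (fs i) = c2 (c i \<otimes>\<^bsub>R\<^esub> fs i)" if i: "i < r" for i
    proof -
      have xi: "?x i \<in> carrier B" using x by (simp add: free_simps)
      obtain s where s: "s \<in> carrier R" "\<sigma> (?x i) = c2 s" using sc[OF xi] by (auto simp: quot_ring_carrier)
      have "g s = g (c i)" using \<sigma>(3)[OF xi] s gb(2) c(2)[OF i] by (simp add: \<theta>_def)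
      then have "s \<ominus>\<^bsub>R\<^esub> c i \<in> J" using c(1)[OF i] s B.minus_zero_iff[of "g (c i)" "g (c i)"] by (simp add: J_mem a_minus_def)
      then have "(s \<ominus>\<^bsub>R\<^esub> c i) \<otimes>\<^bsub>R\<^esub> fs i \<in> J2" using fJ[OF i] by (rule J2_mult)
      moreover have "(s \<ominus>\<^bsub>R\<^esub> c i) \<otimes>\<^bsub>R\<^esub> fs i = s \<otimes>\<^bsub>R\<^esub> fs i \<ominus>\<^bsub>R\<^esub> c i \<otimes>\<^bsub>R\<^esub> fs i"
        using s c(1)[OF i] fs[OF i] by (simp add: a_minus_def R.l_distr R.l_minus)
      ultimately have "c2 (s \<otimes>\<^bsub>R\<^esub> fs i) = c2 (c i \<otimes>\<^bsub>R\<^esub> fs i)" using s c(1)[OF i] fs[OF i] by (simp add: c2_eq)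
      then show ?thesis using s c(1)[OF i] fs[OF i] by (simp add: q_simps)
    qed
    have "?e ?x = (\<Oplus>\<^bsub>Q\<^esub>i\<in>{..<r}. \<sigma> (?x i) \<otimes>\<^bsub>Q\<^esub> c2 (fs i))"
    proof -
      have "?e ?x = (\<Oplus>\<^bsub>?Z\<^esub>i\<in>{..<r}. \<sigma> (?x i) \<otimes>\<^bsub>Q\<^esub> c2 (fs i))"
        unfolding free_ext_def
        by (rule Z.M.add.finprod_mono_neutral_cong)
          (use x fs sc q_simps(4) ring_hom_zero[OF \<sigma>(1) B.ring_axioms Q.ring_axioms] in \<open>auto simp: free_simps\<close>)
      also have "\<dots> = (\<Oplus>\<^bsub>Q\<^esub>i\<in>{..<r}. \<sigma> (?x i) \<otimes>\<^bsub>Q\<^esub> c2 (fs i))"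
        by (simp add: finsum_def finprod_def restr_def self_module_def)
      finally show ?thesis .
    qed
    also have "\<dots> = (\<Oplus>\<^bsub>Q\<^esub>i\<in>{..<r}. c2 (c i \<otimes>\<^bsub>R\<^esub> fs i))"
      by (rule Q.finsum_cong') (use summand c fs q_simps(4) in auto)
    also have "\<dots> = c2 (\<Oplus>\<^bsub>R\<^esub>i\<in>{..<r}. c i \<otimes>\<^bsub>R\<^esub> fs i)"
    proof -
      interpret qh: ring_hom_ring R Q "\<lambda>x. c2 x" by (intro ring_hom_ringI2 R.ring_axioms Q.ring_axioms q)
      show ?thesis using c fs by (subst qh.hom_finsum) (auto simp: comp_def)
    qed
    finally have "c2 a = c2 (\<Oplus>\<^bsub>R\<^esub>i\<in>{..<r}. c i \<otimes>\<^bsub>R\<^esub> fs i)" using c2a by simp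
    moreover have "(\<Oplus>\<^bsub>R\<^esub>i\<in>{..<r}. c i \<otimes>\<^bsub>R\<^esub> fs i) \<in> carrier R" by (rule R.finsum_closed) (use c fs in auto)
    ultimately show ?thesis using c2_eq aR(1) by blast
  qed
  then show ?thesis using that der by blast
qed

end

subsection \<open>Zariski's lemma\<close>

context field begin

text \<open>Evaluation at a transcendental \<open>x\<close> is injective on polynomials, and the
  units of the polynomial ring over a field are the constants.\<close>

lemma transcendental_units:
  assumes K: "subfield K R" and x: "x \<in> carrier R" "(transcendental over K) x"
    and u: "u \<in> simple_extension K x" "e \<in> simple_extension K x" "u \<otimes> e = \<one>"
  shows "u \<in> K"
proof -
  note Ks = subfieldE(1)[OF K]
  have KR: "K \<subseteq> carrier R" using subfieldE(3)[OF K] .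
  obtain p q where pq: "p \<in> carrier (K[X])" "u = eval p x" "q \<in> carrier (K[X])" "e = eval q x"
    using u(1,2) unfolding simple_extension_as_eval_img[OF KR x(1)] by blast
  interpret P: domain "K[X]" by (rule univ_poly_is_domain[OF Ks])
  interpret ev: ring_hom_cring "K[X]" R "\<lambda>p. eval p x" by (rule eval_cring_hom[OF Ks x(1)])
  have "eval (p \<otimes>\<^bsub>K[X]\<^esub> q) x = eval \<one>\<^bsub>K[X]\<^esub> x" using u(3) pq by simp
  then have "p \<otimes>\<^bsub>K[X]\<^esub> q = \<one>\<^bsub>K[X]\<^esub>"
    using inj_onD[OF x(2)[unfolded over_def transcendental_def] _ P.m_closed P.one_closed] pq by blast
  then have "p \<in> Units (K[X])" using pq P.m_comm[of p q] unfolding Units_def by (auto intro!: bexI[of _ q])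
  then obtain k where k: "p = [k]" "k \<in> K" using univ_poly_units_incl[OF Ks] by auto
  then show ?thesis using pq KR by auto
qed

lemma fractions_subfield:
  assumes "subring S R" shows "subfield {a \<otimes> inv b | a b. a \<in> S \<and> b \<in> S - {\<zero>}} R" (is "subfield ?Q R")
    and "S \<subseteq> {a \<otimes> inv b | a b. a \<in> S \<and> b \<in> S - {\<zero>}}"
proof -
  note D = subringE[OF assms]
  have inv: "inv b \<in> carrier R" "b \<otimes> inv b = \<one>" "inv b \<otimes> b = \<one>" "b \<in> carrier R" if "b \<in> S - {\<zero>}" for b
    using that D(1) field_Units by auto
  have mult: "b \<otimes> c \<in> S - {\<zero>}" if "b \<in> S - {\<zero>}" "c \<in> S - {\<zero>}" for b c
    using that D(1,6) integral by blast
  have invm: "inv (b \<otimes> c) = inv b \<otimes> inv c" if "b \<in> S - {\<zero>}" "c \<in> S - {\<zero>}" for b c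
  proof (rule comm_inv_char)
    have "(b \<otimes> c) \<otimes> (inv b \<otimes> inv c) = (b \<otimes> inv b) \<otimes> (c \<otimes> inv c)" using inv(1,4)[OF that(1)] inv(1,4)[OF that(2)] by (simp add: m_ac)
    then show "(b \<otimes> c) \<otimes> (inv b \<otimes> inv c) = \<one>" using inv(2) that by simp
  qed (use inv(1,4) that in auto)
  show "S \<subseteq> ?Q"
  proof
    fix a assume "a \<in> S"
    then show "a \<in> ?Q" using D(1,3) by (intro CollectI exI[of _ a] exI[of _ \<one>]) auto
  qed
  have sub: "?Q \<subseteq> carrier R" using D(1) inv(1) by auto
  have "subring ?Q R"
  proof (rule subringI[OF sub])
    show "\<one> \<in> ?Q" using \<open>S \<subseteq> ?Q\<close> D(3) by blast
    show "\<ominus> h \<in> ?Q" if "h \<in> ?Q" for h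
    proof -
      obtain a b where ab: "h = a \<otimes> inv b" "a \<in> S" "b \<in> S - {\<zero>}" using \<open>h \<in> ?Q\<close> by blast
      then have "\<ominus> h = (\<ominus> a) \<otimes> inv b" using inv D(1) by (auto simp: l_minus)
      then show ?thesis using ab D(5) by blast
    qed
    fix h1 h2 assume h: "h1 \<in> ?Q" "h2 \<in> ?Q"
    obtain a b where ab: "h1 = a \<otimes> inv b" "a \<in> S" "b \<in> S - {\<zero>}" using h(1) by blast
    obtain c d where cd: "h2 = c \<otimes> inv d" "c \<in> S" "d \<in> S - {\<zero>}" using h(2) by blast
    have cl: "a \<in> carrier R" "c \<in> carrier R" using ab cd D(1) by auto
    note i = inv[OF ab(3)] inv[OF cd(3)]
    have "h1 \<otimes> h2 = (a \<otimes> c) \<otimes> inv (b \<otimes> d)" unfolding invm[OF ab(3) cd(3)] ab(1) cd(1) using cl i by (simp add: m_ac)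
    then show "h1 \<otimes> h2 \<in> ?Q" using D(6)[OF ab(2) cd(2)] mult[OF ab(3) cd(3)] by blast
    have "(a \<otimes> d \<oplus> c \<otimes> b) \<otimes> (inv b \<otimes> inv d) = a \<otimes> inv b \<otimes> (d \<otimes> inv d) \<oplus> c \<otimes> inv d \<otimes> (b \<otimes> inv b)"
      using cl i(1,4,5,8) by (simp add: l_distr) (simp add: m_ac)
    then have "h1 \<oplus> h2 = (a \<otimes> d \<oplus> c \<otimes> b) \<otimes> inv (b \<otimes> d)" unfolding invm[OF ab(3) cd(3)] ab(1) cd(1) using cl i by simp
    moreover have "a \<otimes> d \<oplus> c \<otimes> b \<in> S" using D(6,7) ab cd by auto
    ultimately show "h1 \<oplus> h2 \<in> ?Q" using mult[OF ab(3) cd(3)] by blast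
  qed
  then show "subfield ?Q R"
  proof (rule subfieldI')
    fix k assume k: "k \<in> ?Q - {\<zero>}"
    then obtain a b where ab: "k = a \<otimes> inv b" "a \<in> S" "b \<in> S - {\<zero>}" by blast
    note i = inv[OF ab(3)]
    have aR: "a \<in> carrier R" using ab D(1) by auto
    have a: "a \<in> S - {\<zero>}" using k ab i by auto
    note j = inv[OF a]
    have "k \<otimes> (b \<otimes> inv a) = (a \<otimes> inv a) \<otimes> (inv b \<otimes> b)" unfolding ab(1) using aR i(1,4) j(1) by (simp add: m_ac)
    then have "k \<otimes> (b \<otimes> inv a) = \<one>" using i j by simp
    then have "inv k = b \<otimes> inv a" using k sub i j by (intro comm_inv_char) auto
    then show "inv k \<in> ?Q" using ab a by blast
  qed
qed

lemma module_over_subring: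
  assumes "subring S R" shows "module (R\<lparr>carrier := S\<rparr>) (self_module R)"
proof -
  interpret M: module R "self_module R" by (rule self_is_module[OF is_cring])
  note D = subringE[OF assms]
  have "cring (R\<lparr>carrier := S\<rparr>)" using subcring_iff[OF D(1)] subcringI'[OF assms] by blast
  then show ?thesis
    by (rule moduleI) (use M.M.abelian_group_axioms in \<open>auto simp: l_distr r_distr m_assoc D(1)[THEN subsetD]\<close>)
qed

text \<open>If the field were finite over \<open>K(x)\<close>, clearing denominators in a basis
  would give a finite module \<open>W\<close> over \<open>K[x]\<close> such that, up to powers of a
  single \<open>h\<close>, every element of the field maps \<open>W\<close> to itself. Applied to
  the inverse of a nonunit prime to \<open>h\<close>, this contradicts Nakayama's lemma.\<close>

lemma no_fractions_finite:
  assumes K: "subfield K R" and x: "x \<in> carrier R" "(transcendental over K) x" and xs: "set xs \<subseteq> carrier R"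
    and gen: "\<And>N. subring N R \<Longrightarrow> K \<subseteq> N \<Longrightarrow> insert x (set xs) \<subseteq> N \<Longrightarrow> carrier R \<subseteq> N"
    and S: "S = simple_extension K x" and Q: "Q = {a \<otimes> inv b | a b. a \<in> S \<and> b \<in> S - {\<zero>}}"
  shows "\<not> finite_dimension Q (carrier R)"
proof
  assume "finite_dimension Q (carrier R)"
  then obtain n where n: "dimension n Q (carrier R)" by auto
  have Ss: "subring S R" unfolding S by (rule simple_extension_is_subring[OF subfieldE(1)[OF K] x(1)])
  note D = subringE[OF Ss]
  have Qf: "subfield Q R" unfolding Q by (rule fractions_subfield(1)[OF Ss])
  obtain Us where Us: "set Us \<subseteq> carrier R" "Span Q Us = carrier R" using exists_base[OF Qf n] by blast
  let ?S = "R\<lparr>carrier := S\<rparr>"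
  let ?M = "self_module R"
  interpret SC: cring ?S by (rule module.axioms(1)[OF module_over_subring[OF Ss]])
  interpret M: module ?S ?M by (rule module_over_subring[OF Ss])
  define W where "W = submodule_span ?S ?M (set Us)"
  have Wsub: "submodule W ?S ?M" unfolding W_def by (rule M.span_submodule) (use Us in auto)
  note WD = M.submoduleD[OF Wsub, simplified]
  have Wmult: "s \<otimes> w \<in> W" if "s \<in> S" "w \<in> W" for s w using WD(7) that by simp
  have UW: "set Us \<subseteq> W" unfolding W_def by (rule M.span_incl)
  have WR: "w \<in> W \<Longrightarrow> w \<in> carrier R" for w by (rule WD(2))
  have nz: "b \<otimes> c \<in> S - {\<zero>}" if "b \<in> S - {\<zero>}" "c \<in> S - {\<zero>}" for b c
    using that D(1,6) integral by blast
  have one: "\<one> \<in> S - {\<zero>}" using D(3) by simp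
  \<comment> \<open>Elements with a denominator form an additive group containing all multiples of
    the basis by fractions, hence everything.\<close>
  have den: "\<exists>h\<in>S - {\<zero>}. h \<otimes> y \<in> W" if y: "y \<in> carrier R" for y
  proof -
    let ?D = "{y \<in> carrier R. \<exists>h\<in>S - {\<zero>}. h \<otimes> y \<in> W}"
    have "subgroup ?D (add_monoid R)"
    proof (rule add.subgroupI)
      show "?D \<noteq> {}" using one WD(3) by (auto intro!: exI[of _ \<zero>] bexI[of _ \<one>])
      show "\<ominus> a \<in> ?D" if "a \<in> ?D" for a
      proof -
        obtain h where "h \<in> S - {\<zero>}" "h \<otimes> a \<in> W" "a \<in> carrier R" using \<open>a \<in> ?D\<close> by blast
        moreover then have "h \<otimes> (\<ominus> a) = \<ominus> (h \<otimes> a)" using D(1) by (auto simp: r_minus)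
        ultimately show ?thesis using WD(5)[of "h \<otimes> a"] by (intro CollectI conjI bexI[of _ h]) auto
      qed
      show "a \<oplus> b \<in> ?D" if "a \<in> ?D" "b \<in> ?D" for a b
      proof -
        obtain h where h: "h \<in> S - {\<zero>}" "h \<otimes> a \<in> W" "a \<in> carrier R" using \<open>a \<in> ?D\<close> by blast
        obtain k where k: "k \<in> S - {\<zero>}" "k \<otimes> b \<in> W" "b \<in> carrier R" using \<open>b \<in> ?D\<close> by blast
        have hk: "h \<in> S" "k \<in> S" "h \<in> carrier R" "k \<in> carrier R" using h k D(1) by auto
        have "(h \<otimes> k) \<otimes> (a \<oplus> b) = k \<otimes> (h \<otimes> a) \<oplus> h \<otimes> (k \<otimes> b)" using hk h(3) k(3) by (simp add: r_distr m_ac)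
        then have "(h \<otimes> k) \<otimes> (a \<oplus> b) \<in> W" using WD(4)[OF Wmult[OF hk(2) h(2)] Wmult[OF hk(1) k(2)]] by simp
        then show ?thesis using nz[OF h(1) k(1)] h(3) k(3) by blast
      qed
    qed auto
    moreover have "Q <#> set Us \<subseteq> ?D"
    proof
      fix z assume "z \<in> Q <#> set Us"
      then obtain a b u where z: "z = (a \<otimes> inv b) \<otimes> u" "a \<in> S" "b \<in> S - {\<zero>}" "u \<in> set Us"
        unfolding set_mult_def Q by blast
      have cl: "a \<in> carrier R" "b \<in> carrier R" "u \<in> carrier R" "inv b \<in> carrier R" "b \<otimes> inv b = \<one>"
        using z D(1) Us(1) field_Units by auto
      have "b \<otimes> z = (b \<otimes> inv b) \<otimes> (a \<otimes> u)" unfolding z(1) using cl(1-4) by (simp add: m_ac)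
      then have "b \<otimes> z = a \<otimes> u" using cl by simp
      then have "b \<otimes> z \<in> W" using Wmult[OF z(2)] UW z(4) by auto
      then show "z \<in> ?D" using z cl by auto
    qed
    ultimately have "Span Q Us \<subseteq> ?D" using Span_min[OF Qf Us(1)] by blast
    then show ?thesis using Us(2) y by blast
  qed
  have den_fin: "\<exists>h\<in>S - {\<zero>}. \<forall>y\<in>Y. h \<otimes> y \<in> W" if "finite Y" "Y \<subseteq> carrier R" for Y
    using that
  proof (induction Y)
    case empty then show ?case using one by blast
  next
    case (insert y Y)
    obtain h where h: "h \<in> S - {\<zero>}" "\<forall>y\<in>Y. h \<otimes> y \<in> W" using insert by auto
    obtain k where k: "k \<in> S - {\<zero>}" "k \<otimes> y \<in> W" using den[of y] insert by auto
    have hk: "h \<in> S" "k \<in> S" "h \<in> carrier R" "k \<in> carrier R" using h k D(1) by auto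
    have "(h \<otimes> k) \<otimes> z \<in> W" if z: "z \<in> insert y Y" for z
    proof -
      have zR: "z \<in> carrier R" using z insert.prems by auto
      have "(h \<otimes> k) \<otimes> z = k \<otimes> (h \<otimes> z)" "(h \<otimes> k) \<otimes> z = h \<otimes> (k \<otimes> z)" using hk zR by (simp_all add: m_ac)
      then show ?thesis using z h(2) k(2) Wmult[OF hk(1)] Wmult[OF hk(2)] by (cases "z = y") auto
    qed
    then show ?case using nz[OF h(1) k(1)] by blast
  qed
  \<comment> \<open>The entry one puts \<open>h\<close> itself into \<open>W\<close>; the other
    entries say that \<open>h\<close> times a generator of the field maps the basis into
    \<open>W\<close>.\<close>
  let ?Y = "insert \<one> ((\<lambda>(a, b). a \<otimes> b) ` (set xs \<times> set Us))"
  have "finite ?Y" "?Y \<subseteq> carrier R" using xs Us(1) by auto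
  from den_fin[OF this] obtain h where h: "h \<in> S" "h \<noteq> \<zero>" "h \<otimes> \<one> \<in> W" "\<And>a u. a \<in> set xs \<Longrightarrow> u \<in> set Us \<Longrightarrow> h \<otimes> (a \<otimes> u) \<in> W"
    by fastforce
  have hR: "h \<in> carrier R" using h D(1) by auto
  have hW: "h \<in> W" using h(3) hR by simp
  have hp: "h [^] (i::nat) \<in> S" "h [^] (i::nat) \<in> carrier R" for i
  proof -
    show "h [^] i \<in> S" by (induction i) (use D(3,6) h(1) in auto)
    then show "h [^] i \<in> carrier R" using D(1) by auto
  qed
  have KS: "K \<subseteq> S" unfolding S by (rule simple_extension_incl[OF subfieldE(3)[OF K] x(1)])
  have xS: "x \<in> S" unfolding S by (rule simple_extension_mem[OF subfieldE(1)[OF K] x(1)])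
  \<comment> \<open>The elements that map \<open>W\<close> to itself after multiplication by a power
    of \<open>h\<close> form a ring, and it contains all generators.\<close>
  let ?N = "{y \<in> carrier R. \<exists>m::nat. \<forall>w\<in>W. h [^] m \<otimes> (y \<otimes> w) \<in> W}"
  have SN: "S \<subseteq> ?N" using D(1) Wmult WR by (fastforce intro!: exI[of _ "0::nat"])
  have "subring ?N R"
  proof (rule subringI)
    show "\<one> \<in> ?N" using SN D(3) by blast
    show "\<ominus> y \<in> ?N" if "y \<in> ?N" for y
    proof -
      obtain m :: nat where m: "\<forall>w\<in>W. h [^] m \<otimes> (y \<otimes> w) \<in> W" "y \<in> carrier R" using \<open>y \<in> ?N\<close> by auto
      have "h [^] m \<otimes> (\<ominus> y \<otimes> w) = \<ominus> (h [^] m \<otimes> (y \<otimes> w))" if "w \<in> W" for w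
        using m(2) WR[OF that] hp by (simp add: l_minus r_minus)
      then have "\<forall>w\<in>W. h [^] m \<otimes> (\<ominus> y \<otimes> w) \<in> W" using m(1) WD(5) by simp
      then show ?thesis using m(2) by auto
    qed
    fix y z assume "y \<in> ?N" "z \<in> ?N"
    then obtain k m :: nat where km: "\<And>w. w \<in> W \<Longrightarrow> h [^] k \<otimes> (y \<otimes> w) \<in> W" "\<And>w. w \<in> W \<Longrightarrow> h [^] m \<otimes> (z \<otimes> w) \<in> W"
      and yz: "y \<in> carrier R" "z \<in> carrier R" by blast
    have "h [^] (k + m) \<otimes> ((y \<otimes> z) \<otimes> w) = h [^] k \<otimes> (y \<otimes> (h [^] m \<otimes> (z \<otimes> w)))" if "w \<in> W" for w
      using yz WR[OF that] hp by (simp add: nat_pow_mult[symmetric, OF hR] m_ac)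
    then have "\<forall>w\<in>W. h [^] (k + m) \<otimes> ((y \<otimes> z) \<otimes> w) \<in> W" using km by simp
    then show "y \<otimes> z \<in> ?N" using yz by blast
    have "h [^] (k + m) \<otimes> ((y \<oplus> z) \<otimes> w) = h [^] m \<otimes> (h [^] k \<otimes> (y \<otimes> w)) \<oplus> h [^] k \<otimes> (h [^] m \<otimes> (z \<otimes> w))" if "w \<in> W" for w
      using yz WR[OF that] hp by (simp add: nat_pow_mult[symmetric, OF hR] l_distr r_distr m_ac)
    then have "\<forall>w\<in>W. h [^] (k + m) \<otimes> ((y \<oplus> z) \<otimes> w) \<in> W" using km WD(4) Wmult hp(1) by simp
    then show "y \<oplus> z \<in> ?N" using yz by blast
  qed auto
  moreover have "set xs \<subseteq> ?N"
  proof
    fix a assume a: "a \<in> set xs"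
    have aR: "a \<in> carrier R" using a xs by auto
    have "submodule {w \<in> carrier ?M. h \<otimes> (a \<otimes> w) \<in> W} ?S ?M"
    proof (rule M.submoduleI')
      fix s w assume "s \<in> carrier ?S" "w \<in> {w \<in> carrier ?M. h \<otimes> (a \<otimes> w) \<in> W}"
      then have sw: "s \<in> S" "w \<in> carrier R" "h \<otimes> (a \<otimes> w) \<in> W" by auto
      then have "h \<otimes> (a \<otimes> (s \<otimes> w)) = s \<otimes> (h \<otimes> (a \<otimes> w))" using hR aR D(1) by (auto simp: m_lcomm)
      then show "s \<odot>\<^bsub>?M\<^esub> w \<in> {w \<in> carrier ?M. h \<otimes> (a \<otimes> w) \<in> W}" using Wmult[OF sw(1,3)] sw D(1) by auto
    qed (use hR aR WD(3,4) in \<open>auto simp: r_distr\<close>)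
    then have "W \<subseteq> {w \<in> carrier ?M. h \<otimes> (a \<otimes> w) \<in> W}" unfolding W_def
      by (rule M.span_least) (use Us(1) h(4)[OF a] in \<open>auto simp: W_def\<close>)
    then show "a \<in> ?N" using aR hR by (auto intro!: exI[of _ "1::nat"])
  qed
  ultimately have "carrier R \<subseteq> ?N" using gen[of ?N] KS xS SN by blast
  then have allN: "\<exists>m::nat. \<forall>w\<in>W. h [^] m \<otimes> (y \<otimes> w) \<in> W" if "y \<in> carrier R" for y using that by blast
  have xK: "x \<notin> K" using algebraic_self[OF subfieldE(1)[OF K]] x(2) unfolding over_def by blast
  \<comment> \<open>Euclid's choice: \<open>1 + x h\<close> is prime to \<open>h\<close>. It is not
    constant, for otherwise \<open>x\<close> would divide a nonzero constant in \<open>K[x]\<close>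
    and would be a unit there.\<close>
  define p where "p = \<one> \<oplus> x \<otimes> h"
  have pS: "p \<in> S" "p \<in> carrier R" unfolding p_def using D(3,6,7) xS h(1) x(1) hR by auto
  have pK: "p \<notin> K"
  proof
    assume pK: "p \<in> K"
    note KD = subringE[OF subfieldE(1)[OF K]]
    have "x \<otimes> h = \<ominus> \<one> \<oplus> p" unfolding p_def using x(1) hR by (simp add: r_neg1 r_neg2)
    then have c: "x \<otimes> h \<in> K" using pK KD(3,5,7) by simp
    have xh: "x \<noteq> \<zero>" using xK KD(2) by blast
    then have cn: "x \<otimes> h \<noteq> \<zero>" using integral x(1) hR h(2) by blast
    then have ci: "inv (x \<otimes> h) \<in> K" "x \<otimes> h \<otimes> inv (x \<otimes> h) = \<one>" "inv (x \<otimes> h) \<in> carrier R"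
      using c subfield_m_inv[OF K, of "x \<otimes> h"] KD(1) by auto
    have "x \<otimes> (h \<otimes> inv (x \<otimes> h)) = \<one>" using ci x(1) hR by (simp add: m_assoc)
    moreover have "h \<otimes> inv (x \<otimes> h) \<in> S" using D(6) h(1) ci KS by blast
    ultimately have "x \<in> K" using transcendental_units[OF K x, folded S] xS by blast
    then show False using xK by simp
  qed
  then have p0: "p \<noteq> \<zero>" using subringE(2)[OF subfieldE(1)[OF K]] by blast
  have "\<exists>P. maximalideal P ?S \<and> p \<in> P"
  proof -
    have id: "ideal (PIdl\<^bsub>?S\<^esub> p) ?S" by (rule SC.cgenideal_ideal) (simp add: pS)
    have "\<one>\<^bsub>?S\<^esub> \<notin> PIdl\<^bsub>?S\<^esub> p"
    proof
      assume "\<one>\<^bsub>?S\<^esub> \<in> PIdl\<^bsub>?S\<^esub> p"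
      then obtain e where "e \<in> S" "e \<otimes> p = \<one>" unfolding cgenideal_def by auto
      then have "p \<otimes> e = \<one>" "e \<in> S" using pS D(1) m_comm by auto
      then show False using transcendental_units[OF K x, folded S] pS pK by blast
    qed
    from SC.ex_maximal[OF id this] SC.cgenideal_self[of p] pS show ?thesis by auto
  qed
  then obtain P where P: "maximalideal P ?S" "p \<in> P" by blast
  have Pp: "primeideal P ?S" by (rule SC.maximalideal_prime[OF P(1)])
  interpret P: primeideal P ?S by (rule Pp)
  have hP: "h \<notin> P"
  proof
    assume "h \<in> P"
    then have "(\<ominus> x) \<otimes> h \<in> P" using P.I_l_closed[of h "\<ominus> x"] D(5)[OF xS] by simp
    then have "p \<oplus> (\<ominus> x) \<otimes> h \<in> P" using P.ideal_simps(3)[OF P(2)] by simp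
    moreover have "p \<oplus> (\<ominus> x) \<otimes> h = \<one>" unfolding p_def using x(1) hR by (simp add: l_minus a_assoc r_neg)
    ultimately have "\<one>\<^bsub>?S\<^esub> \<in> P" by simp
    then show False using SC.prime_one_notin[OF Pp] by blast
  qed
  have hpP: "h [^] (i::nat) \<notin> P" for i
  proof (induction i)
    case 0 show ?case using SC.prime_one_notin[OF Pp] by simp
  next
    case (Suc i)
    then show ?case using SC.prime_mult_notin[OF Pp, of "h [^] i" h] hp(1)[of i] h(1) hP by simp
  qed
  have pinv: "inv p \<in> carrier R" "p \<otimes> inv p = \<one>" using pS p0 field_Units by auto
  \<comment> \<open>For the inverse of \<open>p\<close> this says that a power of \<open>h\<close>,
    which lies outside \<open>P\<close>, carries \<open>W\<close> into \<open>p W\<close>; Nakayama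
    then annihilates \<open>W\<close> by an element outside \<open>P\<close>.\<close>
  obtain m where m: "\<And>w. w \<in> W \<Longrightarrow> h [^] (m::nat) \<otimes> (inv p \<otimes> w) \<in> W" using allN[OF pinv(1)] by blast
  have "\<exists>s\<in>carrier ?S - P. \<forall>w\<in>submodule_span ?S ?M (set Us). s \<odot>\<^bsub>?M\<^esub> w \<in> {\<zero>\<^bsub>?M\<^esub>}"
  proof (rule M.nakayama[OF Pp _ _ M.zero_submodule])
    show "finite (set Us)" "set Us \<subseteq> carrier ?M" using Us(1) by auto
    fix w assume w: "w \<in> set Us"
    have wR: "w \<in> carrier R" using w Us(1) by auto
    have "h [^] m \<otimes> w = (p \<otimes> inv p) \<otimes> (h [^] m \<otimes> w)" using pinv wR hp by simp
    also have "\<dots> = p \<otimes> (h [^] m \<otimes> (inv p \<otimes> w))" using pinv(1) pS wR hp by (simp add: m_ac)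
    finally have "h [^] m \<otimes> w \<in> {p \<odot>\<^bsub>?M\<^esub> x |p x. p \<in> P \<and> x \<in> submodule_span ?S ?M (set Us)}"
      using P(2) m[of w] UW w unfolding W_def by auto
    then have "h [^] m \<otimes> w \<in> M.nak P (set Us) {\<zero>\<^bsub>?M\<^esub>}" unfolding M.nak_def by (intro M.span_incl') blast
    then show "\<exists>s\<in>carrier ?S - P. s \<odot>\<^bsub>?M\<^esub> w \<in> M.nak P (set Us) {\<zero>\<^bsub>?M\<^esub>}"
      using hp(1) hpP by (intro bexI[of _ "h [^] m"]) auto
  qed
  then obtain s where s: "s \<in> S" "s \<notin> P" "\<And>w. w \<in> W \<Longrightarrow> s \<otimes> w = \<zero>" unfolding W_def by auto
  have "s \<otimes> h = \<zero>" using s(3) hW by blast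
  then have "s = \<zero>" using integral s(1) D(1) hR h(2) by blast
  then show False using s(2) P.ideal_simps(1) by simp
qed

text \<open>Induction on the generators with the base field varying. If \<open>x\<close> is
  algebraic, its simple extension is a finite intermediate field; if not, the induction hypothesis
  over the fraction field of that extension yields the situation excluded just before.\<close>

lemma zariski:
  assumes "subfield K R" "set xs \<subseteq> carrier R"
    "\<And>N. subring N R \<Longrightarrow> K \<subseteq> N \<Longrightarrow> set xs \<subseteq> N \<Longrightarrow> carrier R \<subseteq> N"
  shows "finite_dimension K (carrier R)"
  using assms
proof (induction xs arbitrary: K)
  case Nil
  have "carrier R = K" using Nil.prems(3)[OF subfieldE(1)[OF Nil.prems(1)]] subfieldE(3)[OF Nil.prems(1)] by auto
  moreover have "dimension 1 K K" by (rule dimension_one[OF Nil.prems(1)])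
  ultimately show ?case using finite_dimensionI by metis
next
  case (Cons x xs)
  note Ks = subfieldE(1)[OF Cons.prems(1)]
  have x: "x \<in> carrier R" "set xs \<subseteq> carrier R" using Cons.prems(2) by auto
  let ?S = "simple_extension K x"
  have Ssub: "subring ?S R" by (rule simple_extension_is_subring[OF Ks x(1)])
  have KS: "K \<subseteq> ?S" "x \<in> ?S" using simple_extension_incl[OF subfieldE(3)[OF Cons.prems(1)] x(1)] simple_extension_mem[OF Ks x(1)] by auto
  show ?case
  proof (cases "(algebraic over K) x")
    case True
    then have sf: "subfield ?S R" and fd: "finite_dimension K ?S"
      using simple_extension_is_subfield finite_dimension_simple_extension Cons.prems(1) x(1) by auto
    have "finite_dimension ?S (carrier R)"
    proof (rule Cons.IH[OF sf x(2)])
      fix N assume "subring N R" "?S \<subseteq> N" "set xs \<subseteq> N"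
      then show "carrier R \<subseteq> N" using Cons.prems(3)[of N] KS by auto
    qed
    then show ?thesis using telescopic_base_dim(1)[OF Cons.prems(1) sf fd] by blast
  next
    case False
    then have tr: "(transcendental over K) x" by (simp add: over_def)
    let ?Q = "{a \<otimes> inv b | a b. a \<in> ?S \<and> b \<in> ?S - {\<zero>}}"
    note Q = fractions_subfield[OF Ssub]
    have "finite_dimension ?Q (carrier R)"
    proof (rule Cons.IH[OF Q(1) x(2)])
      fix N assume N: "subring N R" "?Q \<subseteq> N" "set xs \<subseteq> N"
      then have "K \<subseteq> N" "x \<in> N" using KS Q(2) by blast+
      then show "carrier R \<subseteq> N" using Cons.prems(3)[of N] N by auto
    qed
    moreover have "\<not> finite_dimension ?Q (carrier R)"
      by (rule no_fractions_finite[OF Cons.prems(1) x(1) tr x(2) _ refl refl]) (use Cons.prems(3) in auto)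
    ultimately show ?thesis by blast
  qed
qed

end

subsection \<open>Polynomial rings\<close>

lemma noetherian_image:
  assumes "ring_hom_ring R S h" "noetherian_ring R" "h ` carrier R = carrier S"
  shows "noetherian_ring S"
proof -
  interpret h: ring_hom_ring R S h by fact
  interpret N: noetherian_ring R by fact
  show ?thesis
  proof (rule h.S.noetherian_ringI)
    fix I assume I: "ideal I S"
    then interpret I: ideal I S .
    obtain A where A: "A \<subseteq> carrier R" "finite A" "{r \<in> carrier R. h r \<in> I} = Idl\<^bsub>R\<^esub> A"
      using N.finetely_gen[OF h.ideal_vimage[OF I]] by blast
    have hA: "h ` A \<subseteq> carrier S" using A(1) by auto
    have "I \<subseteq> Idl\<^bsub>S\<^esub> (h ` A)"
    proof
      fix y assume y: "y \<in> I"
      then have "y \<in> h ` carrier R" using assms(3) by auto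
      then obtain r where r: "r \<in> carrier R" "y = h r" by blast
      have "ideal {r \<in> carrier R. h r \<in> Idl\<^bsub>S\<^esub> (h ` A)} R"
        by (rule h.ideal_vimage[OF h.S.genideal_ideal[OF hA]])
      moreover have "A \<subseteq> {r \<in> carrier R. h r \<in> Idl\<^bsub>S\<^esub> (h ` A)}"
        using A(1) h.S.genideal_self[OF hA] by blast
      ultimately have "Idl\<^bsub>R\<^esub> A \<subseteq> {r \<in> carrier R. h r \<in> Idl\<^bsub>S\<^esub> (h ` A)}" by (rule h.R.genideal_minimal)
      then show "y \<in> Idl\<^bsub>S\<^esub> (h ` A)" using A(3) r y by blast
    qed
    moreover have "Idl\<^bsub>S\<^esub> (h ` A) \<subseteq> I"
      by (rule h.S.genideal_minimal[OF I]) (use h.R.genideal_self[OF A(1)] A(3) in blast)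
    ultimately show "\<exists>A\<subseteq>carrier S. finite A \<and> I = Idl\<^bsub>S\<^esub> A" using A(2) hA by blast
  qed
qed

lemma (in field) field_noetherian: "noetherian_ring R"
proof (rule noetherian_ringI)
  fix I assume "ideal I R"
  then have "I = {\<zero>} \<or> I = carrier R" using all_ideals by blast
  then have "I = Idl {\<zero>} \<or> I = Idl {\<one>}" unfolding genideal_zero genideal_one .
  then show "\<exists>A\<subseteq>carrier R. finite A \<and> I = Idl A"
    by (metis empty_subsetI finite.emptyI finite_insert insert_subset one_closed zero_closed)
qed

section \<open>Hilbert's basis theorem\<close>

context UP_cring begin

lemma UP_induct:
  assumes "p \<in> carrier P" "\<And>a n. a \<in> carrier R \<Longrightarrow> up_ring.monom P a n \<in> N" "\<zero>\<^bsub>P\<^esub> \<in> N"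
    "\<And>x y. x \<in> N \<Longrightarrow> y \<in> N \<Longrightarrow> x \<oplus>\<^bsub>P\<^esub> y \<in> N" "N \<subseteq> carrier P"
  shows "p \<in> N"
proof -
  have "(\<Oplus>\<^bsub>P\<^esub> i \<in> {..n}. up_ring.monom P (up_ring.coeff P p i) i) \<in> N" for n
  proof (induction n)
    case 0 then show ?case using assms(1,2) by simp
  next
    case (Suc n) then show ?case using assms by (simp add: Pi_def)
  qed
  then show ?thesis using up_repr[OF assms(1)] by metis
qed

definition lead where
  "lead J n = {up_ring.coeff P f n | f. f \<in> J \<and> (\<forall>i>n. up_ring.coeff P f i = \<zero>)}"

lemma lead_ideal:
  assumes J: "ideal J P" shows "ideal (lead J n) R"
proof (rule R.idealI')
  note D = ideal.ideal_simps[OF J]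
  show "lead J n \<subseteq> carrier R" using D by (auto simp: lead_def)
  show "\<zero> \<in> lead J n" unfolding lead_def using D by (intro CollectI exI[of _ "\<zero>\<^bsub>P\<^esub>"]) auto
  show "x \<oplus> y \<in> lead J n" if xy: "x \<in> lead J n" "y \<in> lead J n" for x y
  proof -
    obtain f g where "f \<in> J" "\<forall>i>n. up_ring.coeff P f i = \<zero>" "x = up_ring.coeff P f n" "g \<in> J" "\<forall>i>n. up_ring.coeff P g i = \<zero>" "y = up_ring.coeff P g n"
      using xy by (auto simp: lead_def)
    then show ?thesis unfolding lead_def using D by (intro CollectI exI[of _ "f \<oplus>\<^bsub>P\<^esub> g"]) auto
  qed
  show "a \<otimes> x \<in> lead J n" if ax: "a \<in> carrier R" "x \<in> lead J n" for a x
  proof -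
    obtain f where "f \<in> J" "\<forall>i>n. up_ring.coeff P f i = \<zero>" "x = up_ring.coeff P f n" using ax by (auto simp: lead_def)
    moreover from this have "up_ring.coeff P (up_ring.monom P a 0 \<otimes>\<^bsub>P\<^esub> f) m = a \<otimes> up_ring.coeff P f m" for m
      using ax D by (simp add: monom_mult_is_smult)
    ultimately show ?thesis unfolding lead_def using D ax by (intro CollectI exI[of _ "up_ring.monom P a 0 \<otimes>\<^bsub>P\<^esub> f"]) auto
  qed
qed

lemma coeff_monom_mult': "a \<in> carrier R \<Longrightarrow> p \<in> carrier P \<Longrightarrow>
    up_ring.coeff P (up_ring.monom P a n \<otimes>\<^bsub>P\<^esub> p) i = (if n \<le> i then a \<otimes> up_ring.coeff P p (i - n) else \<zero>)"
proof (cases "n \<le> i")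
  case True assume "a \<in> carrier R" "p \<in> carrier P"
  from coeff_monom_mult[OF this, of n "i - n"] True show ?thesis by simp
next
  case False assume a: "a \<in> carrier R" "p \<in> carrier P"
  have "up_ring.coeff P (up_ring.monom P a n \<otimes>\<^bsub>P\<^esub> p) i = (\<Oplus>j\<in>{..i}. \<zero>)"
    unfolding coeff_mult[OF monom_closed[OF a(1), of n] a(2)] by (rule R.finsum_cong') (use a False in auto)
  then show ?thesis using False by simp
qed

lemma lead_mono:
  assumes J: "ideal J P" and nm: "n \<le> m" shows "lead J n \<subseteq> lead J m"
proof
  note D = ideal.ideal_simps[OF J]
  fix x assume "x \<in> lead J n"
  then obtain f where f: "f \<in> J" "\<forall>i>n. up_ring.coeff P f i = \<zero>" "x = up_ring.coeff P f n" by (auto simp: lead_def)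
  let ?g = "up_ring.monom P \<one> (m - n) \<otimes>\<^bsub>P\<^esub> f"
  have "up_ring.coeff P ?g i = (if m - n \<le> i then up_ring.coeff P f (i - (m - n)) else \<zero>)" for i
    using f(1) D by (simp add: coeff_monom_mult' del: coeff_mult)
  then have "\<forall>i>m. up_ring.coeff P ?g i = \<zero>" "up_ring.coeff P ?g m = x" using f nm by auto
  then show "x \<in> lead J m" unfolding lead_def using D f(1) by (intro CollectI exI[of _ ?g]) auto
qed

text \<open>Subtracting an element of \<open>J'\<close> with the same leading coefficient lowers the
  degree, and the difference remains in \<open>J\<close>.\<close>

lemma lead_determines:
  assumes J: "ideal J P" and J': "ideal J' P" and sub: "J' \<subseteq> J" and le: "\<And>n. lead J n \<subseteq> lead J' n"
  shows "J \<subseteq> J'"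
proof -
  note D = ideal.ideal_simps[OF J] and D' = ideal.ideal_simps[OF J']
  have "f \<in> J'" if "f \<in> J" "\<forall>i\<ge>n. up_ring.coeff P f i = \<zero>" for f n
    using that
  proof (induction n arbitrary: f)
    case 0
    then have "f = \<zero>\<^bsub>P\<^esub>" using D by (intro up_eqI) auto
    then show ?case using D' by simp
  next
    case (Suc n)
    then have "up_ring.coeff P f n \<in> lead J n" unfolding lead_def by (intro CollectI exI[of _ f]) auto
    then obtain g where g: "g \<in> J'" "\<forall>i>n. up_ring.coeff P g i = \<zero>" "up_ring.coeff P f n = up_ring.coeff P g n" using le[of n] by (auto simp: lead_def)
    have fg: "f \<in> carrier P" "g \<in> carrier P" using Suc.prems(1) g(1) D D' by auto
    have "up_ring.coeff P (f \<ominus>\<^bsub>P\<^esub> g) i = \<zero>" if "i \<ge> n" for i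
      using fg g Suc.prems that by (cases "i = n") (auto simp: R.r_neg R.minus_eq)
    then have "f \<ominus>\<^bsub>P\<^esub> g \<in> J'" using Suc.IH[of "f \<ominus>\<^bsub>P\<^esub> g"] D Suc.prems(1) g(1) sub by auto
    then have "(f \<ominus>\<^bsub>P\<^esub> g) \<oplus>\<^bsub>P\<^esub> g \<in> J'" using D' g(1) by blast
    moreover have "(f \<ominus>\<^bsub>P\<^esub> g) \<oplus>\<^bsub>P\<^esub> g = f" using fg by (simp add: P.minus_eq P.a_assoc P.l_neg)
    ultimately show ?case by simp
  qed
  moreover have "\<exists>n. \<forall>i\<ge>n. up_ring.coeff P f i = \<zero>" if "f \<in> J" for f
    using D(2)[OF that] deg_aboveD[of f] by (intro exI[of _ "Suc (deg R f)"]) auto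
  ultimately show ?thesis by blast
qed

theorem hilbert_basis:
  assumes N: "noetherian_ring R" shows "noetherian_ring P"
proof (rule P.noetherian_ringI)
  fix J assume J: "ideal J P"
  note D = ideal.ideal_simps[OF J]
  \<comment> \<open>Finitely many polynomials whose leading coefficients generate
    \<open>lead J n\<close>. The property is stated for all ideals containing them, as it will be
    applied to the ideal that they generate across degrees.\<close>
  have "\<exists>F. finite F \<and> F \<subseteq> J \<and> (\<forall>J'. ideal J' P \<longrightarrow> F \<subseteq> J' \<longrightarrow> lead J n \<subseteq> lead J' n)" for n
  proof -
    obtain A where A: "A \<subseteq> carrier R" "finite A" "lead J n = Idl A"
      using noetherian_ring.finetely_gen[OF N lead_ideal[OF J]] by blast
    have "\<forall>a\<in>A. \<exists>f\<in>J. (\<forall>i>n. up_ring.coeff P f i = \<zero>) \<and> a = up_ring.coeff P f n"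
      using R.genideal_self[OF A(1)] unfolding A(3)[symmetric] by (auto simp: lead_def)
    then obtain F where F: "\<forall>a\<in>A. F a \<in> J \<and> (\<forall>i>n. up_ring.coeff P (F a) i = \<zero>) \<and> a = up_ring.coeff P (F a) n" by metis
    have "lead J n \<subseteq> lead J' n" if J': "ideal J' P" "F ` A \<subseteq> J'" for J'
    proof -
      have "A \<subseteq> lead J' n"
      proof
        fix a assume "a \<in> A"
        then show "a \<in> lead J' n" unfolding lead_def using F J'(2) by (intro CollectI exI[of _ "F a"]) auto
      qed
      then show ?thesis unfolding A(3) by (rule R.genideal_minimal[OF lead_ideal[OF J'(1)]])
    qed
    then show ?thesis using A(2) F by (intro exI[of _ "F ` A"]) auto
  qed
  then obtain F where F: "\<And>n. finite (F n)" "\<And>n. F n \<subseteq> J"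
    "\<And>n J'. ideal J' P \<Longrightarrow> F n \<subseteq> J' \<Longrightarrow> lead J n \<subseteq> lead J' n" by metis
  have chain: "subset.chain {I. ideal I R} (range (lead J))"
    unfolding subset_chain_def
  proof (intro conjI ballI)
    show "range (lead J) \<subseteq> {I. ideal I R}" using lead_ideal[OF J] by auto
    fix x y assume "x \<in> range (lead J)" "y \<in> range (lead J)"
    then obtain i j where ij: "x = lead J i" "y = lead J j" by blast
    show "x \<subseteq> y \<or> y \<subseteq> x" unfolding ij using lead_mono[OF J, of i j] lead_mono[OF J, of j i] by linarith
  qed
  then have "\<Union>(range (lead J)) \<in> range (lead J)" by (intro noetherian_ring.ideal_chain_is_trivial[OF N]) auto
  then obtain m where m: "\<And>n. lead J n \<subseteq> lead J m" by auto
  let ?G = "\<Union>n\<le>m. F n"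
  have G: "?G \<subseteq> J" "?G \<subseteq> carrier P" using F(2) D by blast+
  note J' = P.genideal_ideal[OF G(2)]
  have sub: "Idl\<^bsub>P\<^esub> ?G \<subseteq> J" by (rule P.genideal_minimal[OF J G(1)])
  have self: "F n \<subseteq> Idl\<^bsub>P\<^esub> ?G" if "n \<le> m" for n using P.genideal_self[OF G(2)] that by blast
  have "lead J n \<subseteq> lead (Idl\<^bsub>P\<^esub> ?G) n" for n
  proof (cases "n \<le> m")
    case True then show ?thesis using F(3)[OF J' self] by blast
  next
    case False
    have "lead J n \<subseteq> lead J m" by (rule m)
    also have "\<dots> \<subseteq> lead (Idl\<^bsub>P\<^esub> ?G) m" using F(3)[OF J' self] by blast
    also have "\<dots> \<subseteq> lead (Idl\<^bsub>P\<^esub> ?G) n" using lead_mono[OF J'] False by simp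
    finally show ?thesis .
  qed
  from lead_determines[OF J J' sub this] have "J = Idl\<^bsub>P\<^esub> ?G" using sub by blast
  then show "\<exists>A\<subseteq>carrier P. finite A \<and> J = Idl\<^bsub>P\<^esub> A" using G(2) F(1) by (intro exI[of _ ?G]) auto
qed

section \<open>Extension of primes to polynomials\<close>

definition extended where "extended Q = {f \<in> carrier P. \<forall>n. up_ring.coeff P f n \<in> Q}"

lemma extended_prime:
  assumes Q: "primeideal Q R" shows "primeideal (extended Q) P"
proof (rule primeidealI)
  note Qi = primeideal.axioms(1)[OF Q]
  note D = ideal.ideal_simps[OF Qi]
  show "cring P" by (rule UP_cring)
  show "ideal (extended Q) P"
  proof (rule P.idealI')
    fix a x assume ax: "a \<in> carrier P" "x \<in> extended Q"
    have x: "x \<in> carrier P" "\<And>n. up_ring.coeff P x n \<in> Q" using ax by (auto simp: extended_def)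
    have "up_ring.coeff P (a \<otimes>\<^bsub>P\<^esub> x) n \<in> Q" for n
      unfolding coeff_mult[OF ax(1) x(1)] by (rule R.finsum_ideal[OF _ Qi]) (use D x(2) ax(1) in auto)
    then show "a \<otimes>\<^bsub>P\<^esub> x \<in> extended Q" using ax x by (auto simp: extended_def)
  qed (use D in \<open>auto simp: extended_def\<close>)
  have "up_ring.coeff P \<one>\<^bsub>P\<^esub> 0 \<notin> Q" using R.prime_one_notin[OF Q] by simp
  then show "carrier P \<noteq> extended Q" unfolding extended_def using UP_one_closed by blast
  fix f g assume fg: "f \<in> carrier P" "g \<in> carrier P" "f \<otimes>\<^bsub>P\<^esub> g \<in> extended Q"
  show "f \<in> extended Q \<or> g \<in> extended Q"
  proof (rule ccontr)
    assume "\<not> ?thesis"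
    then have ex: "\<exists>i. up_ring.coeff P f i \<notin> Q" "\<exists>j. up_ring.coeff P g j \<notin> Q" using fg by (auto simp: extended_def)
    \<comment> \<open>Gauss's argument: in degree \<open>i + j\<close> the product of the two lowest
      coefficients outside \<open>Q\<close> is the only summand not known to lie in
      \<open>Q\<close>.\<close>
    define i where "i = (LEAST i. up_ring.coeff P f i \<notin> Q)"
    define j where "j = (LEAST i. up_ring.coeff P g i \<notin> Q)"
    have i: "up_ring.coeff P f i \<notin> Q" "\<And>k. k < i \<Longrightarrow> up_ring.coeff P f k \<in> Q"
      unfolding i_def using LeastI_ex[OF ex(1)] not_less_Least by blast+
    have j: "up_ring.coeff P g j \<notin> Q" "\<And>k. k < j \<Longrightarrow> up_ring.coeff P g k \<in> Q"
      unfolding j_def using LeastI_ex[OF ex(2)] not_less_Least by blast+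
    let ?t = "\<lambda>k. up_ring.coeff P f k \<otimes> up_ring.coeff P g (i + j - k)"
    have eq: "up_ring.coeff P (f \<otimes>\<^bsub>P\<^esub> g) (i + j) = ?t i \<oplus> (\<Oplus>k\<in>{..i+j} - {i}. ?t k)"
    proof -
      have "{..i+j} = insert i ({..i+j} - {i})" by auto
      then have "(\<Oplus>k\<in>{..i+j}. ?t k) = (\<Oplus>k\<in>insert i ({..i+j} - {i}). ?t k)" by simp
      also have "\<dots> = ?t i \<oplus> (\<Oplus>k\<in>{..i+j} - {i}. ?t k)" by (rule R.finsum_insert) (use fg in auto)
      finally show ?thesis unfolding coeff_mult[OF fg(1,2)] .
    qed
    have rest: "(\<Oplus>k\<in>{..i+j} - {i}. ?t k) \<in> Q"
    proof (rule R.finsum_ideal[OF _ Qi])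
      fix k assume k: "k \<in> {..i+j} - {i}"
      then consider "k < i" | "i + j - k < j" by fastforce
      then show "?t k \<in> Q" using i(2) j(2) D fg by cases auto
    qed simp
    have "up_ring.coeff P (f \<otimes>\<^bsub>P\<^esub> g) (i + j) \<in> Q" using fg(3) by (auto simp: extended_def)
    then have "up_ring.coeff P (f \<otimes>\<^bsub>P\<^esub> g) (i + j) \<ominus> (\<Oplus>k\<in>{..i+j} - {i}. ?t k) \<in> Q" using D rest by blast
    moreover have "up_ring.coeff P (f \<otimes>\<^bsub>P\<^esub> g) (i + j) \<ominus> (\<Oplus>k\<in>{..i+j} - {i}. ?t k) = ?t i" unfolding eq using fg D rest by (simp add: R.minus_eq R.a_assoc R.r_neg)
    ultimately have "?t i \<in> Q" by (simp del: coeff_mult)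
    then show False using R.prime_mult_notin[OF Q _ _ i(1) j(1)] fg by simp
  qed
qed

lemma extended_strict:
  assumes Q: "primeideal Q R" "primeideal Q' R" "Q \<subset> Q'" shows "extended Q \<subset> extended Q'"
proof
  show "extended Q \<subseteq> extended Q'" using Q(3) by (auto simp: extended_def)
  obtain a where a: "a \<in> Q'" "a \<notin> Q" using Q(3) by blast
  note D = ideal.ideal_simps[OF primeideal.axioms(1)[OF Q(2)]]
  have "up_ring.monom P a 0 \<in> extended Q'" using a D by (auto simp: extended_def)
  moreover have "up_ring.coeff P (up_ring.monom P a 0) 0 \<notin> Q" using a D by auto
  ultimately show "extended Q \<noteq> extended Q'" unfolding extended_def by blast
qed

lemma extended_sub:
  assumes M: "ideal M P" shows "extended {a \<in> carrier R. up_ring.monom P a 0 \<in> M} \<subseteq> M"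
proof
  note D = ideal.ideal_simps[OF M]
  fix f assume "f \<in> extended {a \<in> carrier R. up_ring.monom P a 0 \<in> M}"
  then have f: "f \<in> carrier P" "\<And>n. up_ring.monom P (up_ring.coeff P f n) 0 \<in> M" by (auto simp: extended_def)
  have m: "up_ring.monom P (up_ring.coeff P f n) n \<in> M" for n
  proof -
    have "up_ring.monom P (up_ring.coeff P f n) 0 \<otimes>\<^bsub>P\<^esub> up_ring.monom P \<one> n \<in> M" using D f by auto
    then show ?thesis using f(1) by (simp flip: monom_mult)
  qed
  have "(\<Oplus>\<^bsub>P\<^esub> i \<in> {..n}. up_ring.monom P (up_ring.coeff P f i) i) \<in> M" for n
    by (induction n) (use m D f(1) in \<open>simp_all add: Pi_def\<close>)
  then show "f \<in> M" using up_repr[OF f(1)] by metis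
qed

lemma contraction_prime:
  assumes M: "primeideal M P" shows "primeideal {a \<in> carrier R. up_ring.monom P a 0 \<in> M} R"
proof -
  interpret c: ring_hom_ring R P "\<lambda>a. up_ring.monom P a 0" using ring_hom_ringI2[OF R.ring_axioms P.ring_axioms const_ring_hom] .
  show ?thesis by (rule c.primeideal_vimage[OF R.is_cring M])
qed

end

section \<open>Polynomial rings in several variables\<close>

text \<open>\<open>b\<close> is a root, modulo \<open>M\<close>, of a nonzero polynomial over
  \<open>K\<close>. Coefficients are listed from the highest degree down, so the head of the list is
  the leading one.\<close>

definition algebraic_mod where
  "algebraic_mod K R \<kappa> M b \<longleftrightarrow>
    (\<exists>cs. cs \<noteq> [] \<and> set cs \<subseteq> carrier K \<and> hd cs \<noteq> \<zero>\<^bsub>K\<^esub> \<and> ring.eval R (map \<kappa> cs) b \<in> M)"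

text \<open>An interface with the properties of a polynomial ring in \<open>N\<close> variables that
  matter later. Iterating \<open>UP\<close> changes the carrier type at each step, whereas an
  abstract description survives a copy to the test type. The last clause bounds the height of
  \<open>M\<close> below by \<open>N\<close> if the variables are algebraic modulo
  \<open>M\<close>.\<close>

definition poly_cover where
  "poly_cover K N P \<kappa> v \<longleftrightarrow> cring P \<and> noetherian_ring P \<and> \<kappa> \<in> ring_hom K P \<and> v ` {..<N::nat} \<subseteq> carrier P \<and>
    (\<forall>S. subring S P \<longrightarrow> \<kappa> ` carrier K \<subseteq> S \<longrightarrow> v ` {..<N} \<subseteq> S \<longrightarrow> carrier P \<subseteq> S) \<and>
    (\<forall>M. primeideal M P \<longrightarrow> (\<forall>i<N. algebraic_mod K P \<kappa> M (v i)) \<longrightarrow> (\<exists>p. prime_chain P N p \<and> p N = M))"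

lemma ring_hom_eval:
  assumes "ring_hom_ring R S h" "b \<in> carrier R" "set cs \<subseteq> carrier R"
  shows "h (ring.eval R cs b) = ring.eval S (map h cs) (h b)"
  using ring_hom_ring.eval_hom'[OF assms] by simp

lemma subring_vimage:
  assumes "ring_hom_ring R S h" "subring N S" shows "subring {x \<in> carrier R. h x \<in> N} R"
proof -
  interpret ring_hom_ring R S h by fact
  note D = subringE[OF assms(2)]
  show ?thesis by (rule R.subringI) (use D in auto)
qed

lemma prime_chain_vimage:
  assumes h: "ring_hom_ring R S h" and "cring R" "cring S" "h ` carrier R = carrier S" "prime_chain S k p"
  shows "prime_chain R k (\<lambda>i. {x \<in> carrier R. h x \<in> p i})"
proof -
  note D = cring.prime_chainD[OF assms(3,5)]
  have "{x \<in> carrier R. h x \<in> p i} \<subset> {x \<in> carrier R. h x \<in> p (Suc i)}" if i: "i < k" for i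
  proof -
    obtain y where y: "y \<in> p (Suc i)" "y \<notin> p i" using D(2)[OF i] by blast
    have "y \<in> carrier S" using ideal.Icarr[OF primeideal.axioms(1)[OF D(1)[of "Suc i"]] y(1)] i by simp
    then obtain x where "x \<in> carrier R" "y = h x" using assms(4) by blast
    then show ?thesis using y D(2)[OF i] by blast
  qed
  then show ?thesis unfolding prime_chain_def
    using ring_hom_ring.primeideal_vimage[OF h assms(2)] D(1) by blast
qed

lemma poly_cover_transport:
  fixes K :: "('k, 'l) ring_scheme" and U :: "('u, 'v) ring_scheme" and D :: "('d, 'e) ring_scheme"
  assumes U: "poly_cover K N U \<kappa> v" and K: "field K" and D: "cring D" and h: "h \<in> ring_iso U D"
  shows "poly_cover K N D (h \<circ> \<kappa>) (h \<circ> v)"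
proof -
  have cU: "cring U" and nU: "noetherian_ring U" and \<kappa>: "\<kappa> \<in> ring_hom K U" and v: "v ` {..<N} \<subseteq> carrier U"
    and gen: "\<And>S. subring S U \<Longrightarrow> \<kappa> ` carrier K \<subseteq> S \<Longrightarrow> v ` {..<N} \<subseteq> S \<Longrightarrow> carrier U \<subseteq> S"
    and ch: "\<And>M. primeideal M U \<Longrightarrow> (\<forall>i<N. algebraic_mod K U \<kappa> M (v i)) \<Longrightarrow> (\<exists>p. prime_chain U N p \<and> p N = M)"
    using U unfolding poly_cover_def by blast+
  interpret K: field K by fact
  interpret U: cring U by fact
  interpret D: cring D by fact
  obtain k where k: "k \<in> ring_hom D U" "\<And>x. x \<in> carrier D \<Longrightarrow> h (k x) = x" "\<And>x. x \<in> carrier U \<Longrightarrow> k (h x) = x"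
    using ring_iso_inverse[OF cU D h] by blast
  have hh: "h \<in> ring_hom U D" using h by (auto simp: ring_iso_def)
  interpret h: ring_hom_ring U D h using ring_hom_ringI2[OF U.ring_axioms D.ring_axioms hh] .
  interpret k: ring_hom_ring D U k using ring_hom_ringI2[OF D.ring_axioms U.ring_axioms k(1)] .
  interpret \<kappa>: ring_hom_ring K U \<kappa> using ring_hom_ringI2[OF K.ring_axioms U.ring_axioms \<kappa>] .
  have onto: "h ` carrier U = carrier D" "k ` carrier D = carrier U"
  proof -
    have "y \<in> h ` carrier U" if "y \<in> carrier D" for y
      using image_eqI[of y h "k y" "carrier U"] k(2)[OF that] k.hom_closed[OF that] by simp
    moreover have "y \<in> k ` carrier D" if "y \<in> carrier U" for y
      using image_eqI[of y k "h y" "carrier D"] k(3)[OF that] h.hom_closed[OF that] by simp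
    ultimately show "h ` carrier U = carrier D" "k ` carrier D = carrier U"
      using h.hom_closed k.hom_closed by blast+
  qed
  show ?thesis unfolding poly_cover_def
  proof (intro conjI allI impI)
    show "cring D" by fact
    show "noetherian_ring D" by (rule noetherian_image[OF h.ring_hom_ring_axioms nU onto(1)])
    show "h \<circ> \<kappa> \<in> ring_hom K D" using ring_hom_trans[OF \<kappa> hh] .
    show "(h \<circ> v) ` {..<N} \<subseteq> carrier D" using v by auto
    show "carrier D \<subseteq> S" if S: "subring S D" "(h \<circ> \<kappa>) ` carrier K \<subseteq> S" "(h \<circ> v) ` {..<N} \<subseteq> S" for S
    proof -
      have "carrier U \<subseteq> {x \<in> carrier U. h x \<in> S}"
        by (rule gen[OF subring_vimage[OF h.ring_hom_ring_axioms S(1)]]) (use S(2,3) v in auto)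
      then have "h ` carrier U \<subseteq> S" by blast
      then show ?thesis unfolding onto(1) .
    qed
    fix M assume M: "primeideal M D" "\<forall>i<N. algebraic_mod K D (h \<circ> \<kappa>) M ((h \<circ> v) i)"
    let ?M = "{x \<in> carrier U. h x \<in> M}"
    have alg: "algebraic_mod K U \<kappa> ?M (v i)" if i: "i < N" for i
    proof -
      obtain cs where cs: "cs \<noteq> []" "set cs \<subseteq> carrier K" "hd cs \<noteq> \<zero>\<^bsub>K\<^esub>" "ring.eval D (map (h \<circ> \<kappa>) cs) (h (v i)) \<in> M"
        using M(2) i unfolding algebraic_mod_def by auto
      have c: "set (map \<kappa> cs) \<subseteq> carrier U" "v i \<in> carrier U" using cs(2) v i by auto
      then show ?thesis unfolding algebraic_mod_def
        using cs ring_hom_eval[OF h.ring_hom_ring_axioms c(2,1)] U.eval_in_carrier[OF c] by (intro exI[of _ cs]) auto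
    qed
    have MD: "M \<subseteq> carrier D" using ideal.ideal_simps(2)[OF primeideal.axioms(1)[OF M(1)]] by blast
    obtain p where p: "prime_chain U N p" "p N = ?M"
      using ch[OF h.primeideal_vimage[OF cU M(1)]] alg by blast
    have "{x \<in> carrier D. k x \<in> p N} = M" unfolding p(2) using MD k by auto
    then show "\<exists>p. prime_chain D N p \<and> p N = M"
      using prime_chain_vimage[OF k.ring_hom_ring_axioms D cU onto(2) p(1)] by blast
  qed
qed

text \<open>The chain below the contraction of \<open>M\<close> is extended to polynomials
  coefficientwise. Its last member is strictly smaller than \<open>M\<close>, because the new
  variable satisfies an algebraic equation modulo \<open>M\<close>; so \<open>M\<close> adds one
  step.\<close>

lemma poly_cover_Suc:
  fixes K :: "('k, 'l) ring_scheme" and R :: "('u, 'v) ring_scheme"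
  assumes R: "poly_cover K N R \<kappa> v" and K: "field K"
  defines "P \<equiv> UP R" and "e \<equiv> \<lambda>a. up_ring.monom (UP R) a 0"
  shows "poly_cover K (Suc N) P (e \<circ> \<kappa>) (\<lambda>i. if i < N then e (v i) else up_ring.monom P \<one>\<^bsub>R\<^esub> 1)"
proof -
  have cR: "cring R" and nR: "noetherian_ring R" and \<kappa>: "\<kappa> \<in> ring_hom K R" and v: "v ` {..<N} \<subseteq> carrier R"
    and gen: "\<And>S. subring S R \<Longrightarrow> \<kappa> ` carrier K \<subseteq> S \<Longrightarrow> v ` {..<N} \<subseteq> S \<Longrightarrow> carrier R \<subseteq> S"
    and ch: "\<And>M. primeideal M R \<Longrightarrow> (\<forall>i<N. algebraic_mod K R \<kappa> M (v i)) \<Longrightarrow> (\<exists>p. prime_chain R N p \<and> p N = M)"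
    using R unfolding poly_cover_def by blast+
  interpret K: field K by fact
  interpret U: UP_cring R P using cR unfolding P_def by (simp add: UP_cring_def)
  interpret \<kappa>: ring_hom_ring K R \<kappa> using ring_hom_ringI2[OF K.ring_axioms U.R.ring_axioms \<kappa>] .
  have e: "e \<in> ring_hom R P" using U.const_ring_hom unfolding e_def P_def .
  interpret e: ring_hom_ring R P e using ring_hom_ringI2[OF U.R.ring_axioms U.P.ring_axioms e] .
  let ?x = "up_ring.monom P \<one>\<^bsub>R\<^esub> 1"
  have xP: "?x \<in> carrier P" by simp
  have pow: "?x [^]\<^bsub>P\<^esub> n = up_ring.monom P \<one>\<^bsub>R\<^esub> n" for n :: nat
    using U.monom_pow[of "\<one>\<^bsub>R\<^esub>" 1 n] by simp
  have mon: "e a \<otimes>\<^bsub>P\<^esub> ?x [^]\<^bsub>P\<^esub> n = up_ring.monom P a n" if "a \<in> carrier R" for a and n :: nat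
    unfolding pow using U.monom_mult[of a "\<one>\<^bsub>R\<^esub>" 0 n] that by (simp add: e_def P_def)
  show ?thesis unfolding poly_cover_def
  proof (intro conjI allI impI)
    show "cring P" by (rule U.UP_cring)
    show "noetherian_ring P" by (rule U.hilbert_basis[OF nR])
    show "e \<circ> \<kappa> \<in> ring_hom K P" using ring_hom_trans[OF \<kappa> e] .
    show "(\<lambda>i. if i < N then e (v i) else ?x) ` {..<Suc N} \<subseteq> carrier P" using v xP by (auto simp: image_subset_iff)
    show "carrier P \<subseteq> S" if S: "subring S P" "(e \<circ> \<kappa>) ` carrier K \<subseteq> S"
      "(\<lambda>i. if i < N then e (v i) else ?x) ` {..<Suc N} \<subseteq> S" for S
    proof -
      note D = subringE[OF S(1)]
      have xS: "?x \<in> S" using S(3) by (auto simp: image_subset_iff)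
      have "e (v i) \<in> S" if "i < N" for i using S(3) that by (auto simp: image_subset_iff dest!: bspec[of _ _ i])
      then have "carrier R \<subseteq> {x \<in> carrier R. e x \<in> S}"
        by (intro gen[OF subring_vimage[OF e.ring_hom_ring_axioms S(1)]]) (use S(2) v in auto)
      then have eS: "e a \<in> S" if "a \<in> carrier R" for a using that by blast
      have xn: "?x [^]\<^bsub>P\<^esub> n \<in> S" for n :: nat by (induction n) (use D xS in auto)
      have mS: "up_ring.monom P a n \<in> S" if "a \<in> carrier R" for a n
        using D(6)[OF eS[OF that] xn[of n]] unfolding mon[OF that] .
      show ?thesis
      proof
        fix p assume "p \<in> carrier P"
        then show "p \<in> S" by (rule U.UP_induct) (use mS D in auto)
      qed
    qed
    fix M assume M: "primeideal M P"
      "\<forall>i<Suc N. algebraic_mod K P (e \<circ> \<kappa>) M (if i < N then e (v i) else ?x)"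
    note Mi = ideal.ideal_simps[OF primeideal.axioms(1)[OF M(1)]]
    let ?M = "{a \<in> carrier R. up_ring.monom P a 0 \<in> M}"
    have M': "primeideal ?M R" by (rule U.contraction_prime[OF M(1)])
    have alg: "algebraic_mod K R \<kappa> ?M (v i)" if i: "i < N" for i
    proof -
      obtain cs where cs: "cs \<noteq> []" "set cs \<subseteq> carrier K" "hd cs \<noteq> \<zero>\<^bsub>K\<^esub>" "ring.eval P (map (e \<circ> \<kappa>) cs) (e (v i)) \<in> M"
        using M(2)[rule_format, of i] i unfolding algebraic_mod_def by auto
      have c: "set (map \<kappa> cs) \<subseteq> carrier R" "v i \<in> carrier R" using cs(2) v i by auto
      have "e (ring.eval R (map \<kappa> cs) (v i)) \<in> M"
        using cs(4) ring_hom_eval[OF e.ring_hom_ring_axioms c(2,1)] by (simp add: comp_def)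
      then show ?thesis unfolding algebraic_mod_def
        using cs U.R.eval_in_carrier[OF c] by (intro exI[of _ cs]) (auto simp: e_def P_def)
    qed
    obtain p where p: "prime_chain R N p" "p N = ?M" using ch[OF M'] alg by blast
    note Dp = U.R.prime_chainD[OF p(1)]
    have "prime_chain P N (\<lambda>i. U.extended (p i))" unfolding prime_chain_def
      using U.extended_prime U.extended_strict Dp(1,2) by auto
    moreover have "U.extended (p N) \<subset> M"
    proof
      show "U.extended (p N) \<subseteq> M" unfolding p(2) by (rule U.extended_sub[OF primeideal.axioms(1)[OF M(1)]])
      obtain cs where cs: "cs \<noteq> []" "set cs \<subseteq> carrier K" "hd cs \<noteq> \<zero>\<^bsub>K\<^esub>" "ring.eval P (map (e \<circ> \<kappa>) cs) ?x \<in> M"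
        using M(2)[rule_format, of N] unfolding algebraic_mod_def by auto
      \<comment> \<open>Evaluated at the variable, the list \<open>cs\<close> is the polynomial
        itself: its top coefficient is the image of a nonzero constant, hence a unit, which no prime
        contains.\<close>
      have "ring.eval P (map (e \<circ> \<kappa>) cs) ?x \<in> carrier P \<and>
          (\<forall>i\<ge>length cs. up_ring.coeff P (ring.eval P (map (e \<circ> \<kappa>) cs) ?x) i = \<zero>\<^bsub>R\<^esub>) \<and>
          (cs \<noteq> [] \<longrightarrow> up_ring.coeff P (ring.eval P (map (e \<circ> \<kappa>) cs) ?x) (length cs - 1) = \<kappa> (hd cs))"
        using cs(2)
      proof (induction cs)
        case Nil show ?case by simp
      next
        case (Cons c cs)
        then show ?case using mon[of "\<kappa> c" "length cs"] by auto
      qed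
      then have "up_ring.coeff P (ring.eval P (map (e \<circ> \<kappa>) cs) ?x) (length cs - 1) = \<kappa> (hd cs)" using cs(1) by blast
      moreover have "\<kappa> (hd cs) \<notin> p N"
      proof
        assume in_p: "\<kappa> (hd cs) \<in> p N"
        have "hd cs \<in> carrier K" using cs(1,2) hd_in_set by blast
        then have hd: "hd cs \<in> Units K" using cs(3) by (simp add: K.field_Units)
        have "\<kappa> (inv\<^bsub>K\<^esub> (hd cs)) \<otimes>\<^bsub>R\<^esub> \<kappa> (hd cs) \<in> p N"
          using ideal.ideal_simps(5)[OF primeideal.axioms(1)[OF Dp(1)[OF order_refl]] _ in_p, of "\<kappa> (inv\<^bsub>K\<^esub> (hd cs))"] hd by simp
        moreover have "\<kappa> (inv\<^bsub>K\<^esub> (hd cs)) \<otimes>\<^bsub>R\<^esub> \<kappa> (hd cs) = \<one>\<^bsub>R\<^esub>"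
          using \<kappa>.hom_mult[of "inv\<^bsub>K\<^esub> (hd cs)" "hd cs"] hd K.Units_closed[OF hd] by simp
        ultimately show False using U.R.prime_one_notin[OF Dp(1)[OF order_refl]] by simp
      qed
      moreover have "up_ring.coeff P q i \<in> p N" if "q \<in> U.extended (p N)" for q i
        using that unfolding U.extended_def by blast
      ultimately have "ring.eval P (map (e \<circ> \<kappa>) cs) ?x \<notin> U.extended (p N)" by metis
      then show "U.extended (p N) \<noteq> M" using cs(4) by blast
    qed
    ultimately show "\<exists>p. prime_chain P (Suc N) p \<and> p (Suc N) = M"
      using cring.prime_chain_snoc[OF U.UP_cring, of N "\<lambda>i. U.extended (p i)" M] M(1) 
      by (intro exI[of _ "(\<lambda>i. U.extended (p i))(Suc N := M)"]) simp
  qed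
qed

text \<open>After each new variable the polynomial ring is copied back to the test type, so that the
  induction on \<open>N\<close> stays within one type. The evaluation map is extended along with
  it.\<close>

lemma poly_cover_exists:
  fixes K :: "('k, 'l) ring_scheme" and A :: "('a, 'm) ring_scheme"
  assumes K: "field K" and A: "cring A" and \<iota>: "\<iota> \<in> ring_hom K A" and x: "\<And>i. i < N \<Longrightarrow> x i \<in> carrier A"
  shows "\<exists>(P :: 'k test ring) \<kappa> v g. poly_cover K N P \<kappa> v \<and> g \<in> ring_hom P A \<and>
    (\<forall>c\<in>carrier K. g (\<kappa> c) = \<iota> c) \<and> (\<forall>i<N. g (v i) = x i)"
  using x
proof (induction N)
  case 0
  interpret K: field K by fact
  have id: "(\<lambda>c. c) \<in> ring_hom K K" by (rule ring_hom_memI) auto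
  have ft: "finite_type_algebra K K (\<lambda>c. c)" by (rule finite_typeI[of _ "{}"]) (auto simp: K.ring_axioms)
  obtain P :: "'k test ring" and h where P: "cring P" and h: "h \<in> ring_iso K P"
    using test_copy[OF K K.is_cring id ft] by blast
  obtain k where k: "k \<in> ring_hom P K" "\<And>x. x \<in> carrier P \<Longrightarrow> h (k x) = x" "\<And>x. x \<in> carrier K \<Longrightarrow> k (h x) = x"
    using ring_iso_inverse[OF K.is_cring P h] by blast
  have "poly_cover K 0 K (\<lambda>c. c) (\<lambda>_. \<zero>\<^bsub>K\<^esub>)" unfolding poly_cover_def
    using K.is_cring K.field_noetherian id by (auto simp: prime_chain_def)
  from poly_cover_transport[OF this K P h] show ?case
    using ring_hom_trans[OF k(1) \<iota>] k(3) by (intro exI[of _ P] exI[of _ "h \<circ> (\<lambda>c. c)"] exI[of _ "h \<circ> (\<lambda>_. \<zero>\<^bsub>K\<^esub>)"] exI[of _ "\<iota> \<circ> k"]) (simp del: comp_apply, simp)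
next
  case (Suc N)
  then obtain R :: "'k test ring" and \<kappa> v g where R: "poly_cover K N R \<kappa> v" and g: "g \<in> ring_hom R A"
    "\<And>c. c \<in> carrier K \<Longrightarrow> g (\<kappa> c) = \<iota> c" "\<And>i. i < N \<Longrightarrow> g (v i) = x i" by fastforce
  interpret K: field K by fact
  interpret A: cring A by fact
  have cR: "cring R" and v: "v ` {..<N} \<subseteq> carrier R" and \<kappa>: "\<kappa> \<in> ring_hom K R" using R by (auto simp: poly_cover_def)
  interpret U: UP_cring R "UP R" using cR by (simp add: UP_cring_def)
  define e where "e = (\<lambda>a. up_ring.monom (UP R) a 0)"
  define w where "w = (\<lambda>i. if i < N then e (v i) else up_ring.monom (UP R) \<one>\<^bsub>R\<^esub> 1)"
  have cover: "poly_cover K (Suc N) (UP R) (e \<circ> \<kappa>) w" using poly_cover_Suc[OF R K] unfolding e_def w_def .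
  interpret g: UP_pre_univ_prop R A g "UP R"
    using cR A g(1) by (auto simp: UP_pre_univ_prop_def UP_cring_def ring_hom_cring_def ring_hom_cring_axioms_def)
  define G where "G = UnivPoly.eval R A g (x N)"
  have xN: "x N \<in> carrier A" using Suc.prems by simp
  have G: "G \<in> ring_hom (UP R) A" unfolding G_def by (rule g.eval_ring_hom[OF xN])
  have Ge: "G (e a) = g a" if "a \<in> carrier R" for a unfolding G_def e_def using g.eval_const[OF xN that] .
  have Gx: "G (w N) = x N" unfolding G_def w_def using g.eval_monom1[OF xN] by simp
  have cP: "cring (UP R)" and \<kappa>': "e \<circ> \<kappa> \<in> ring_hom K (UP R)" using cover by (auto simp: poly_cover_def)
  have ft: "finite_type_algebra K (UP R) (e \<circ> \<kappa>)"
    by (rule finite_typeI[of _ "w ` {..<Suc N}"])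
      (use cover U.P.ring_axioms ring_hom_closed[OF \<kappa>'] in \<open>simp_all add: poly_cover_def image_subset_iff del: comp_apply\<close>)
  obtain P :: "'k test ring" and h where P: "cring P" and h: "h \<in> ring_iso (UP R) P"
    using test_copy[OF K cP \<kappa>' ft] by blast
  obtain k where k: "k \<in> ring_hom P (UP R)" "\<And>x. x \<in> carrier (UP R) \<Longrightarrow> k (h x) = x"
    using ring_iso_inverse[OF cP P h] by metis
  have wi: "w i \<in> carrier (UP R)" if "i < Suc N" for i using cover that by (auto simp: poly_cover_def image_subset_iff)
  have "G (w i) = x i" if "i < Suc N" for i
  proof (cases "i = N")
    case False
    then have "i < N" "v i \<in> carrier R" using that v by auto
    then show ?thesis using Ge g(3) by (simp add: w_def)
  qed (simp add: Gx)
  moreover have "G (e (\<kappa> c)) = \<iota> c" if "c \<in> carrier K" for c using Ge g(2)[OF that] ring_hom_closed[OF \<kappa> that] by simp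
  moreover have "e (\<kappa> c) \<in> carrier (UP R)" if "c \<in> carrier K" for c using ring_hom_closed[OF \<kappa>' that] by simp
  ultimately have "(\<forall>c\<in>carrier K. (G \<circ> k) ((h \<circ> (e \<circ> \<kappa>)) c) = \<iota> c) \<and> (\<forall>i<Suc N. (G \<circ> k) ((h \<circ> w) i) = x i)"
    using k(2) wi by simp
  then show ?case using poly_cover_transport[OF cover K P h] ring_hom_trans[OF k(1) G] by blast
qed

subsection \<open>Residue fields and generators of the module of differentials\<close>

text \<open>The residue field is generated as a ring by \<open>K\<close> and finitely many elements.
  By Zariski's lemma it is finite over the image of \<open>K\<close>, so \<open>b\<close> is
  algebraic there; coefficients are pulled back to \<open>K\<close>.\<close>

lemma algebraic_mod_maximal:
  assumes K: "field K" and P: "cring P" and \<kappa>: "\<kappa> \<in> ring_hom K P" and xs: "set xs \<subseteq> carrier P"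
    and gen: "\<And>S. subring S P \<Longrightarrow> \<kappa> ` carrier K \<subseteq> S \<Longrightarrow> set xs \<subseteq> S \<Longrightarrow> carrier P \<subseteq> S"
    and M: "maximalideal M P" and b: "b \<in> carrier P"
  shows "algebraic_mod K P \<kappa> M b"
proof -
  interpret K: field K by fact
  interpret P: cring P by fact
  interpret M: maximalideal M P by fact
  interpret F: field "P Quot M" by (rule M.quotient_is_field[OF P])
  interpret q: ring_hom_ring P "P Quot M" "(+>\<^bsub>P\<^esub>) M" by (rule M.rcos_ring_hom_ring)
  interpret \<kappa>: ring_hom_ring K P \<kappa> using ring_hom_ringI2[OF K.ring_axioms P.ring_axioms \<kappa>] .
  let ?q = "\<lambda>x. M +>\<^bsub>P\<^esub> x"
  have hom: "(\<lambda>c. ?q (\<kappa> c)) \<in> ring_hom K (P Quot M)" using ring_hom_trans[OF \<kappa> q.homh] by (simp add: comp_def)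
  interpret k: ring_hom_ring K "P Quot M" "\<lambda>c. ?q (\<kappa> c)"
    using ring_hom_ringI2[OF K.ring_axioms F.ring_axioms hom] .
  let ?K = "(\<lambda>c. ?q (\<kappa> c)) ` carrier K"
  have sub: "subfield ?K (P Quot M)" using k.img_is_subfield(2)[OF K.carrier_is_subfield] F.one_not_zero by blast
  have onto: "carrier (P Quot M) = ?q ` carrier P" by (auto simp: quot_ring_carrier)
  have fd: "F.finite_dimension ?K (carrier (P Quot M))"
  proof (rule F.zariski[OF sub, of "map ?q xs"])
    show "set (map ?q xs) \<subseteq> carrier (P Quot M)" using xs by auto
    fix N assume N: "subring N (P Quot M)" "?K \<subseteq> N" "set (map ?q xs) \<subseteq> N"
    have "carrier P \<subseteq> {x \<in> carrier P. ?q x \<in> N}"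
      by (rule gen[OF subring_vimage[OF q.ring_hom_ring_axioms N(1)]]) (use N(2,3) xs in auto)
    then show "carrier (P Quot M) \<subseteq> N" unfolding onto by blast
  qed
  have "(F.algebraic over ?K) (?q b)"
    by (rule F.finite_dimension_imp_algebraic[OF sub F.carrier_is_subring fd]) (use b in simp)
  then obtain p where p: "p \<in> carrier (?K [X]\<^bsub>P Quot M\<^esub>)" "p \<noteq> []" "F.eval p (?q b) = \<zero>\<^bsub>P Quot M\<^esub>"
    using F.algebraicE[OF subfieldE(1)[OF sub] q.hom_closed[OF b]] by blast
  have pK: "set p \<subseteq> ?K" "hd p \<noteq> \<zero>\<^bsub>P Quot M\<^esub>" using p(1,2) by (auto simp: univ_poly_def polynomial_def)
  have "\<forall>a\<in>set p. \<exists>c\<in>carrier K. a = ?q (\<kappa> c)" using pK(1) by blast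
  then obtain s where s: "\<And>a. a \<in> set p \<Longrightarrow> s a \<in> carrier K \<and> a = ?q (\<kappa> (s a))" by metis
  let ?cs = "map s p"
  have eq: "map ?q (map \<kappa> ?cs) = p" using s by (auto intro!: map_idI)
  have cl: "set (map \<kappa> ?cs) \<subseteq> carrier P" using s by auto
  have zero: "\<zero>\<^bsub>P Quot M\<^esub> = M" unfolding FactRing_def by (simp only: ring.select_convs)
  have q0: "?q (P.eval (map \<kappa> ?cs) b) = M"
    using ring_hom_eval[OF q.ring_hom_ring_axioms b cl] p(3) unfolding eq zero by (rule trans)
  have "P.eval (map \<kappa> ?cs) b \<in> M"
    using M.a_rcos_self[OF P.eval_in_carrier[OF cl b]] unfolding q0 .
  moreover have "hd ?cs \<noteq> \<zero>\<^bsub>K\<^esub>"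
  proof
    assume "hd ?cs = \<zero>\<^bsub>K\<^esub>"
    then have "hd p = ?q (\<kappa> \<zero>\<^bsub>K\<^esub>)" using s[of "hd p"] p(2) by (simp add: hd_map)
    then show False using pK(2) by simp
  qed
  ultimately show ?thesis unfolding algebraic_mod_def using p(2) s by (intro exI[of _ ?cs]) auto
qed

lemma smooth_algebra_cong:
  assumes "\<And>c. c \<in> carrier K \<Longrightarrow> \<iota> c = \<iota>' c"
  shows "smooth_algebra K A \<iota> \<longleftrightarrow> smooth_algebra K A \<iota>'"
proof -
  have "\<iota> ` carrier K = \<iota>' ` carrier K" using assms by (auto simp: image_iff)
  then show ?thesis unfolding smooth_algebra_def finite_type_algebra_def formally_smooth_def lifts_along_def
    using assms by simp
qed

lemma ideal_image:
  assumes h: "ring_hom_ring R S h" "cring S" "h ` carrier R = carrier S" and p: "ideal p R"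
  shows "ideal (h ` p) S"
proof -
  interpret ring_hom_ring R S h by fact
  note D = ideal.ideal_simps[OF p]
  show ?thesis
  proof (rule cring.idealI'[OF assms(2)])
    show "h ` p \<subseteq> carrier S" using D(2) by auto
    show "\<zero>\<^bsub>S\<^esub> \<in> h ` p" using D(1) hom_zero by (metis imageI)
    fix x y assume "x \<in> h ` p" "y \<in> h ` p"
    then obtain a b where ab: "a \<in> p" "b \<in> p" "x = h a" "y = h b" by blast
    then have "x \<oplus>\<^bsub>S\<^esub> y = h (a \<oplus>\<^bsub>R\<^esub> b)" using D(2) by simp
    then show "x \<oplus>\<^bsub>S\<^esub> y \<in> h ` p" using D(3) ab by blast
  next
    fix a x assume "a \<in> carrier S" "x \<in> h ` p"
    then obtain c b where ab: "c \<in> carrier R" "a = h c" "b \<in> p" "x = h b" using assms(3) by blast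
    then have "a \<otimes>\<^bsub>S\<^esub> x = h (c \<otimes>\<^bsub>R\<^esub> b)" using D(2) by simp
    then show "a \<otimes>\<^bsub>S\<^esub> x \<in> h ` p" using D(5) ab by blast
  qed
qed

text \<open>Since the kernel lies in every prime of the chain, an element belongs to
  \<open>p i\<close> as soon as its image belongs to the image of \<open>p i\<close>. Primality and
  strictness follow from this.\<close>

lemma prime_chain_image:
  assumes h: "ring_hom_ring R S h" and R: "cring R" and S: "cring S" and onto: "h ` carrier R = carrier S"
    and p: "prime_chain R k p" and ker: "a_kernel R S h \<subseteq> p 0"
  shows "prime_chain S k (\<lambda>i. h ` p i)"
proof -
  interpret h: ring_hom_ring R S h by fact
  interpret R: cring R by fact
  note D = R.prime_chainD[OF p]
  have kerp: "a_kernel R S h \<subseteq> p i" if "i \<le> k" for i using ker D(3)[of 0 i] that by auto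
  have mem: "x \<in> p i" if x: "x \<in> carrier R" "h x \<in> h ` p i" "i \<le> k" for x i
  proof -
    note Di = ideal.ideal_simps[OF primeideal.axioms(1)[OF D(1)[OF x(3)]]]
    obtain y where y: "y \<in> p i" "h x = h y" using x(2) by blast
    have yc: "y \<in> carrier R" using Di(2) y(1) .
    have "h (x \<ominus>\<^bsub>R\<^esub> y) = h x \<oplus>\<^bsub>S\<^esub> \<ominus>\<^bsub>S\<^esub> h y" using x(1) yc by (simp add: a_minus_def)
    also have "\<dots> = \<zero>\<^bsub>S\<^esub>" unfolding y(2) using yc by (intro h.S.r_neg) simp
    finally have hz: "h (x \<ominus>\<^bsub>R\<^esub> y) = \<zero>\<^bsub>S\<^esub>" .
    have k: "x \<ominus>\<^bsub>R\<^esub> y \<in> a_kernel R S h"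
      unfolding a_kernel_def' using hz h.R.minus_closed[OF x(1) yc] by blast
    have "(x \<ominus>\<^bsub>R\<^esub> y) \<oplus>\<^bsub>R\<^esub> y \<in> p i" by (rule Di(3)[OF subsetD[OF kerp[OF x(3)] k] y(1)])
    then show ?thesis using yc x(1) by (simp add: a_minus_def h.R.a_assoc h.R.l_neg)
  qed
  have "primeideal (h ` p i) S" if i: "i \<le> k" for i
  proof (rule primeidealI)
    note Pi = D(1)[OF i]
    note Di = ideal.ideal_simps[OF primeideal.axioms(1)[OF Pi]]
    show "ideal (h ` p i) S" by (rule ideal_image[OF h S onto primeideal.axioms(1)[OF Pi]])
    show "cring S" by fact
    have "\<one>\<^bsub>S\<^esub> \<notin> h ` p i" using mem[OF h.R.one_closed _ i] R.prime_one_notin[OF Pi] by auto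
    then show "carrier S \<noteq> h ` p i" using h.S.one_closed by metis
    fix a b assume ab: "a \<in> carrier S" "b \<in> carrier S" "a \<otimes>\<^bsub>S\<^esub> b \<in> h ` p i"
    obtain x y where xy: "x \<in> carrier R" "y \<in> carrier R" "a = h x" "b = h y" using ab onto by blast
    then have "x \<otimes>\<^bsub>R\<^esub> y \<in> p i" using mem[of "x \<otimes>\<^bsub>R\<^esub> y" i] ab i by simp
    then show "a \<in> h ` p i \<or> b \<in> h ` p i" using primeideal.I_prime[OF Pi] xy by blast
  qed
  moreover have "h ` p i \<subset> h ` p (Suc i)" if i: "i < k" for i
  proof -
    obtain x where x: "x \<in> p (Suc i)" "x \<notin> p i" using D(2)[OF i] by blast
    have "x \<in> carrier R" using ideal.Icarr[OF primeideal.axioms(1)[OF D(1)[of "Suc i"]] x(1)] i by simp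
    then have "h x \<notin> h ` p i" using mem[of x i] x(2) i by auto
    then show ?thesis using x(1) D(2)[OF i] by blast
  qed
  ultimately show ?thesis unfolding prime_chain_def by blast
qed

lemma (in module) comb_span:
  assumes W: "finite W" "W \<subseteq> carrier M" and Y: "submodule Y R M"
  shows "comb (carrier R) W Y = submodule_span R M (W \<union> Y)"
proof
  note D = submoduleD[OF Y]
  have sub: "W \<union> Y \<subseteq> carrier M" using W D by auto
  note S = submoduleD[OF span_submodule[OF sub]]
  have WY: "w \<in> submodule_span R M (W \<union> Y)" if "w \<in> W \<union> Y" for w using span_incl' that by blast
  show "comb (carrier R) W Y \<subseteq> submodule_span R M (W \<union> Y)"
  proof
    fix x assume "x \<in> comb (carrier R) W Y"
    then obtain c y where *: "x = (\<Oplus>\<^bsub>M\<^esub>v\<in>W. c v \<odot>\<^bsub>M\<^esub> v) \<oplus>\<^bsub>M\<^esub> y" "c \<in> W \<rightarrow> carrier R" "y \<in> Y" by (auto simp: comb_def)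
    have "(\<Oplus>\<^bsub>M\<^esub>v\<in>W. c v \<odot>\<^bsub>M\<^esub> v) \<in> submodule_span R M (W \<union> Y)"
      by (rule submodule_finsum[OF span_submodule[OF sub]]) (use * WY S(7) in auto)
    then show "x \<in> submodule_span R M (W \<union> Y)" using * S(4) WY by blast
  qed
  have "W \<union> Y \<subseteq> nak (carrier R) W Y"
  proof
    fix w assume "w \<in> W \<union> Y"
    then consider "w \<in> Y" | "w \<in> W" by blast
    then show "w \<in> nak (carrier R) W Y"
    proof cases
      case 1 then show ?thesis unfolding nak_def by (intro span_incl') simp
    next
      case 2
      then have "w = \<one> \<odot>\<^bsub>M\<^esub> w" "w \<in> submodule_span R M W" using W span_incl' by auto
      then show ?thesis unfolding nak_def by (intro span_incl') blast
    qed
  qed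
  also have "\<dots> \<subseteq> comb (carrier R) W Y" by (rule nak_sub_comb[OF R.oneideal W Y])
  finally show "submodule_span R M (W \<union> Y) \<subseteq> comb (carrier R) W Y"
    by (rule span_least[OF comb_submodule[OF R.oneideal W Y]])
qed

section \<open>Differentials and alternating maps with few generators\<close>

text \<open>By linearity the arguments are replaced one after another by elements of
  \<open>W\<close>; being more than \<open>card W\<close> in number, they must repeat. The prefix
  \<open>ws\<close> collects the ones already replaced.\<close>

lemma alternating_vanish_span:
  assumes Z: "module R Z" and M: "module R M" and G: "alternating R M Z G"
    and W: "finite W" "W \<subseteq> carrier M" and us: "set us \<subseteq> submodule_span R M W" and len: "card W < length us"
  shows "G us = \<zero>\<^bsub>Z\<^esub>"
proof -
  interpret Z: module R Z by fact
  interpret M: module R M by fact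
  note D = alternatingD[OF G]
  have sc: "submodule_span R M W \<subseteq> carrier M" using M.submoduleD(1)[OF M.span_submodule[OF W(2)]] .
  have "G (ws @ us) = \<zero>\<^bsub>Z\<^esub>" if "set ws \<subseteq> W" "set us \<subseteq> submodule_span R M W" "card W < length ws + length us" for ws us
    using that
  proof (induction us arbitrary: ws)
    case Nil
    then have "\<not> distinct ws" using distinct_card[of ws] card_mono[OF W(1), of "set ws"] by auto
    then show ?case using alternating_vanish_repeat[OF Z M G] Nil W(2) by auto
  next
    case (Cons u us)
    have wsus: "set ws \<subseteq> carrier M" "set us \<subseteq> carrier M" using Cons.prems W(2) sc by auto
    let ?N = "{m \<in> carrier M. G (ws @ m # us) = \<zero>\<^bsub>Z\<^esub>}"
    have "submodule ?N R M"
    proof (rule M.submoduleI', goal_cases)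
      case 2
      have "G (ws @ (\<zero>\<^bsub>R\<^esub> \<odot>\<^bsub>M\<^esub> \<zero>\<^bsub>M\<^esub>) # us) = \<zero>\<^bsub>R\<^esub> \<odot>\<^bsub>Z\<^esub> G (ws @ \<zero>\<^bsub>M\<^esub> # us)" by (rule D(3)) (use wsus in auto)
      then show ?case using D(1)[of "ws @ \<zero>\<^bsub>M\<^esub> # us"] wsus by simp
    qed (use D(2,3) wsus in auto)
    moreover have "W \<subseteq> ?N"
    proof
      fix w assume w: "w \<in> W"
      have "G ((ws @ [w]) @ us) = \<zero>\<^bsub>Z\<^esub>" by (rule Cons.IH) (use Cons.prems w in auto)
      then show "w \<in> ?N" using w W(2) by auto
    qed
    ultimately have "submodule_span R M W \<subseteq> ?N" by (rule M.span_least)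
    then show ?case using Cons.prems by auto
  qed
  from this[of "[]"] us len show ?thesis by simp
qed

lemma alternating_scale:
  assumes Z: "module R Z" and M: "module R M" and G: "alternating R M Z G" and s: "s \<in> carrier R" and us: "set us \<subseteq> carrier M"
  shows "G (map (\<lambda>u. s \<odot>\<^bsub>M\<^esub> u) us) = s [^]\<^bsub>R\<^esub> length us \<odot>\<^bsub>Z\<^esub> G us"
  using G us
proof (induction us arbitrary: G)
  case Nil
  interpret Z: module R Z by fact
  show ?case using alternatingD(1)[OF Nil(1), of "[]"] by simp
next
  case (Cons u us)
  interpret Z: module R Z by fact
  interpret M: module R M by fact
  note D = alternatingD[OF Cons.prems(1)]
  have u: "u \<in> carrier M" "set us \<subseteq> carrier M" using Cons.prems by auto
  have su: "s \<odot>\<^bsub>M\<^esub> u \<in> carrier M" using s u by simp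
  have "G (s \<odot>\<^bsub>M\<^esub> u # map (\<lambda>u. s \<odot>\<^bsub>M\<^esub> u) us) = s [^]\<^bsub>R\<^esub> length us \<odot>\<^bsub>Z\<^esub> G (s \<odot>\<^bsub>M\<^esub> u # us)"
    using Cons.IH[OF alternating_Cons[OF Cons.prems(1) su] u(2)] by simp
  also have "G (s \<odot>\<^bsub>M\<^esub> u # us) = s \<odot>\<^bsub>Z\<^esub> G (u # us)" using D(3)[of "[]" us s u] s u by simp
  finally show ?case using D(1)[of "u # us"] s u by (simp add: Z.smult_assoc1)
qed

context kahler begin

lemma d_zero: "d \<zero>\<^bsub>A\<^esub> = \<zero>\<^bsub>\<Omega>\<^esub>"
  using d_simps(4)[of "\<zero>\<^bsub>K\<^esub>"] ring_hom_zero[OF hom] K A by (simp add: cring_def ring.ring_simprules)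

lemma d_neg: "a \<in> carrier A \<Longrightarrow> d (\<ominus>\<^bsub>A\<^esub> a) = \<ominus>\<^bsub>\<Omega>\<^esub> d a"
  using d_simps(2)[of "\<ominus>\<^bsub>A\<^esub> a" a] by (simp add: A.l_neg d_zero d_simps(1) Om.M.minus_equality)

lemma d_minus: "a \<in> carrier A \<Longrightarrow> b \<in> carrier A \<Longrightarrow> d (a \<ominus>\<^bsub>A\<^esub> b) = d a \<ominus>\<^bsub>\<Omega>\<^esub> d b"
  by (simp add: a_minus_def d_simps(2) d_neg)

lemma d_one: "d \<one>\<^bsub>A\<^esub> = \<zero>\<^bsub>\<Omega>\<^esub>"
proof -
  interpret K: cring K by (rule K)
  show ?thesis using d_simps(4)[of "\<one>\<^bsub>K\<^esub>"] ring_hom_one[OF hom] by simp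
qed

text \<open>The elements with differential in \<open>N\<close> form a subring containing the
  constants, by the Leibniz rule.\<close>

lemma Omega_generated:
  assumes V: "V \<subseteq> carrier A" and gen: "\<And>S. subring S A \<Longrightarrow> \<iota> ` carrier K \<subseteq> S \<Longrightarrow> V \<subseteq> S \<Longrightarrow> carrier A \<subseteq> S"
    and N: "submodule N A \<Omega>" and dV: "\<And>v. v \<in> V \<Longrightarrow> d v \<in> N" and w: "w \<in> carrier \<Omega>"
  shows "w \<in> N"
proof (rule Omega_induct[OF N _ w])
  note D = Om.submoduleD[OF N]
  have "subring {a \<in> carrier A. d a \<in> N} A"
    by (rule A.subringI) (use D in \<open>auto simp: d_one d_neg d_simps(2,3)\<close>)
  then have "carrier A \<subseteq> {a \<in> carrier A. d a \<in> N}"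
    by (rule gen) (use D(3) dV V iota_closed in \<open>auto simp: d_simps(4)\<close>)
  then show "d a \<in> N" if "a \<in> carrier A" for a using that by blast
qed

end

lemma restr_submodule:
  assumes "cring A" "module B Z" "\<pi> \<in> ring_hom A B" "submodule N B Z"
  shows "submodule N A (restr \<pi> Z)"
proof -
  interpret Z: module B Z by fact
  interpret rZ: module A "restr \<pi> Z" by (rule restr_is_module[OF assms(1-3)])
  note D = Z.submoduleD[OF assms(4)]
  show ?thesis by (rule rZ.submoduleI') (use D ring_hom_closed[OF assms(3)] in auto)
qed

text \<open>The conormal map stays injective modulo \<open>M\<close> because it is split: the linear
  map belonging to the derivation \<open>E\<close> restores \<open>x\<close> modulo
  \<open>J2\<close> and sends \<open>M\<close>-multiples of differentials to classes of elements of
  \<open>M J\<close>, which also contains \<open>J2\<close>.\<close>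

lemma (in smooth_quotient) conormal_injective:
  assumes M: "ideal M R" "J \<subseteq> M" and x: "x \<in> J"
    and dx: "universal_derivation K R \<kappa> x \<in> submodule_span R (kahler_module K R \<kappa>)
      {a \<odot>\<^bsub>kahler_module K R \<kappa>\<^esub> w | a w. a \<in> M \<and> w \<in> carrier (kahler_module K R \<kappa>)}"
  shows "x \<in> Idl {p \<otimes> y | p y. p \<in> M \<and> y \<in> J}"
proof -
  interpret k: kahler K R \<kappa> using K.is_cring R \<kappa> by (rule kahler.intro)
  interpret S: module R "self_module R" by (rule self_is_module[OF R])
  note DM = ideal.ideal_simps[OF M(1)]
  note DJ = ideal.ideal_simps[OF J_ideal]
  let ?MJ = "{p \<otimes> y | p y. p \<in> M \<and> y \<in> J}"
  have MJc: "?MJ \<subseteq> carrier R" using DM(2) DJ(2) by auto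
  note JI = R.genideal_ideal[OF MJc]
  note DI = ideal.ideal_simps[OF JI]
  have MJI: "p \<otimes> y \<in> Idl ?MJ" if "p \<in> M" "y \<in> J" for p y
    using R.genideal_self[OF MJc] that by blast
  have J2I: "z \<in> Idl ?MJ" if "z \<in> J2" for z
    using that
  proof (induction rule: ideal_prod.induct)
    case (prod i j) then show ?case using MJI M(2) by blast
  next
    case (sum s1 s2) then show ?case using DI(3) by blast
  qed
  obtain E where E: "derivation K R \<kappa> MQ E" "\<And>j. j \<in> J \<Longrightarrow> E j = c2 j" "\<And>p. p \<in> carrier R \<Longrightarrow> \<exists>j\<in>J. E p = c2 j"
    by (rule conormal_derivation) blast
  have MQ: "module R MQ" by (rule S.quot_is_module[OF J2_submodule])
  interpret MQ: module R MQ by (rule MQ)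
  obtain e where e: "lin_map R k.\<Omega> MQ e" "\<And>a. a \<in> carrier R \<Longrightarrow> e (k.d a) = E a"
    using k.Omega_universal[OF MQ E(1)] by blast
  have ql: "lin_map R (self_module R) MQ c2" using S.quot_lin[OF J2_submodule] unfolding self_coset .
  have sub: "submodule (c2 ` L) R MQ" if "ideal L R" for L
    by (rule lin_map_image_submodule[OF S.module_axioms MQ ql]) (use that self_submodule_iff[OF R] in blast)
  have eJ: "e w \<in> c2 ` J" if "w \<in> carrier k.\<Omega>" for w
  proof -
    have "w \<in> {w \<in> carrier k.\<Omega>. e w \<in> c2 ` J}"
      by (rule k.Omega_induct[OF lin_map_vimage_submodule[OF k.Omega_module MQ e(1) sub[OF J_ideal]] _ that])
        (use e(2) E(3) k.d_simps(1) in \<open>force simp: image_iff\<close>)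
    then show ?thesis by blast
  qed
  have eM: "e (a \<odot>\<^bsub>k.\<Omega>\<^esub> w) \<in> c2 ` (Idl ?MJ)" if aw: "a \<in> M" "w \<in> carrier k.\<Omega>" for a w
  proof -
    obtain j where j: "j \<in> J" "e w = c2 j" using eJ[OF aw(2)] by blast
    have "e (a \<odot>\<^bsub>k.\<Omega>\<^esub> w) = a \<odot>\<^bsub>MQ\<^esub> c2 j" using lin_mapD(3)[OF e(1) DM(2)[OF aw(1)] aw(2)] j(2) by simp
    also have "\<dots> = c2 (a \<otimes> j)" using lin_mapD(3)[OF ql DM(2)[OF aw(1)], of j] DJ(2)[OF j(1)] by simp
    finally show ?thesis using MJI[OF aw(1) j(1)] by blast
  qed
  have "submodule_span R k.\<Omega> {a \<odot>\<^bsub>k.\<Omega>\<^esub> w | a w. a \<in> M \<and> w \<in> carrier k.\<Omega>} \<subseteq> {w \<in> carrier k.\<Omega>. e w \<in> c2 ` (Idl ?MJ)}"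
    by (rule k.Om.span_least[OF lin_map_vimage_submodule[OF k.Omega_module MQ e(1) sub[OF JI]]])
      (use eM DM(2) in auto)
  then have "e (k.d x) \<in> c2 ` (Idl ?MJ)" using dx by blast
  then have "c2 x \<in> c2 ` (Idl ?MJ)" using e(2)[OF DJ(2)[OF x]] E(2)[OF x] by simp
  then obtain y where y: "y \<in> Idl ?MJ" "c2 x = c2 y" by blast
  then have "x \<ominus> y \<in> J2" using c2_eq DJ(2)[OF x] DI(2) by blast
  then have "(x \<ominus> y) \<oplus> y \<in> Idl ?MJ" using J2I DI(3) y(1) by blast
  then show ?thesis using DJ(2)[OF x] DI(2)[OF y(1)] by (simp add: a_minus_def R.a_assoc R.l_neg)
qed

text \<open>A coefficient outside \<open>P\<close> is invertible modulo \<open>P\<close>; as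
  \<open>Y\<close> contains \<open>P M\<close>, its generator could be expressed by the others,
  against minimality. Invertibility modulo \<open>P\<close> is assumed elementwise, so that the
  residue field need not be formed.\<close>

lemma (in module) minimal_generators:
  assumes mx: "\<And>b. b \<in> carrier R - P \<Longrightarrow> \<exists>c\<in>carrier R. c \<otimes> b \<ominus> \<one> \<in> P"
    and W: "finite W" "W \<subseteq> carrier M" and Y: "submodule Y R M"
    and PY: "\<And>a x. a \<in> P \<Longrightarrow> x \<in> carrier M \<Longrightarrow> a \<odot>\<^bsub>M\<^esub> x \<in> Y" and PR: "P \<subseteq> carrier R"
    and gen: "submodule_span R M (W \<union> Y) = carrier M"
    and min: "\<And>w. w \<in> W \<Longrightarrow> submodule_span R M (W - {w} \<union> Y) \<noteq> carrier M"
    and b: "b \<in> W \<rightarrow> carrier R" "(\<Oplus>\<^bsub>M\<^esub>v\<in>W. b v \<odot>\<^bsub>M\<^esub> v) \<in> Y" and u: "u \<in> W"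
  shows "b u \<in> P"
proof (rule ccontr)
  assume bu: "b u \<notin> P"
  have uc: "u \<in> carrier M" "b u \<in> carrier R" using u W(2) b(1) by auto
  obtain c where c: "c \<in> carrier R" "c \<otimes> b u \<ominus> \<one> \<in> P" using mx[of "b u"] bu uc(2) by blast
  let ?N = "submodule_span R M (W - {u} \<union> Y)"
  have WYc: "W - {u} \<union> Y \<subseteq> carrier M" using W submoduleD(1)[OF Y] by auto
  have N: "submodule ?N R M" by (rule span_submodule[OF WYc])
  note D = submoduleD[OF N]
  have incl: "w \<in> ?N" if "w \<in> W - {u} \<union> Y" for w by (rule span_incl'[OF that])
  let ?r = "\<Oplus>\<^bsub>M\<^esub>v\<in>W - {u}. b v \<odot>\<^bsub>M\<^esub> v"
  have r: "?r \<in> ?N"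
  proof (rule submodule_finsum[OF N])
    fix v assume v: "v \<in> W - {u}"
    have "b v \<in> carrier R" using v b(1) by auto
    then show "b v \<odot>\<^bsub>M\<^esub> v \<in> ?N" using D(7) incl[of v] v by blast
  qed
  have "(\<Oplus>\<^bsub>M\<^esub>v\<in>insert u (W - {u}). b v \<odot>\<^bsub>M\<^esub> v) = b u \<odot>\<^bsub>M\<^esub> u \<oplus>\<^bsub>M\<^esub> ?r"
    by (rule M.finsum_insert) (use W b(1) uc in auto)
  then have "b u \<odot>\<^bsub>M\<^esub> u \<oplus>\<^bsub>M\<^esub> ?r \<in> ?N" using b(2) incl by (simp add: insert_absorb[OF u])
  then have "(b u \<odot>\<^bsub>M\<^esub> u \<oplus>\<^bsub>M\<^esub> ?r) \<ominus>\<^bsub>M\<^esub> ?r \<in> ?N" using D(6) r by blast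
  then have "b u \<odot>\<^bsub>M\<^esub> u \<in> ?N" using uc D(2)[OF r] by (simp add: a_minus_def M.a_assoc M.r_neg)
  then have 1: "c \<odot>\<^bsub>M\<^esub> (b u \<odot>\<^bsub>M\<^esub> u) \<in> ?N" using D(7) c(1) by blast
  have 2: "(c \<otimes> b u \<ominus> \<one>) \<odot>\<^bsub>M\<^esub> u \<in> ?N" using PY[OF c(2) uc(1)] incl by blast
  have "c \<odot>\<^bsub>M\<^esub> (b u \<odot>\<^bsub>M\<^esub> u) \<ominus>\<^bsub>M\<^esub> (c \<otimes> b u \<ominus> \<one>) \<odot>\<^bsub>M\<^esub> u = u"
  proof -
    have "(c \<otimes> b u \<ominus> \<one>) \<odot>\<^bsub>M\<^esub> u = c \<odot>\<^bsub>M\<^esub> (b u \<odot>\<^bsub>M\<^esub> u) \<oplus>\<^bsub>M\<^esub> \<ominus>\<^bsub>M\<^esub> u"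
      using c(1) uc by (simp add: a_minus_def smult_l_distr smult_l_minus smult_assoc1)
    then show ?thesis using c(1) uc by (simp add: a_minus_def M.minus_add M.r_neg2)
  qed
  then have "u \<in> ?N" using D(6)[OF 1 2] by simp
  then have "W \<union> Y \<subseteq> ?N" using incl by blast
  then have "carrier M \<subseteq> ?N" using span_least[OF N] gen by blast
  then show False using min[OF u] D(1) by blast
qed

lemma finite_type_cover:
  fixes K :: "('k, 'l) ring_scheme" and B :: "('b, 'n) ring_scheme"
  assumes K: "field K" and B: "cring B" and \<iota>: "\<iota> \<in> ring_hom K B" and ft: "finite_type_algebra K B \<iota>"
  obtains N and P :: "'k test ring" and \<kappa> v g where "poly_cover K N P \<kappa> v" "g \<in> ring_hom P B"
    "\<And>c. c \<in> carrier K \<Longrightarrow> g (\<kappa> c) = \<iota> c" "g ` carrier P = carrier B"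
proof -
  interpret B: cring B by fact
  have iK: "\<iota> ` carrier K \<subseteq> carrier B" using ring_hom_closed[OF \<iota>] by blast
  obtain S where S: "finite S" "S \<subseteq> carrier B"
    "\<And>N. subring N B \<Longrightarrow> \<iota> ` carrier K \<subseteq> N \<Longrightarrow> S \<subseteq> N \<Longrightarrow> carrier B \<subseteq> N"
    using finite_typeE[OF B.ring_axioms ft iK] by blast
  obtain N and x :: "nat \<Rightarrow> 'b" where x: "S = x ` {..<N}"
    using finite_imp_nat_seg_image_inj_on[OF S(1)] by (metis lessThan_def)
  have xB: "x i \<in> carrier B" if "i < N" for i using S(2) x that by auto
  obtain P :: "'k test ring" and \<kappa> v g where P: "poly_cover K N P \<kappa> v" and g: "g \<in> ring_hom P B"
    and g\<kappa>: "\<And>c. c \<in> carrier K \<Longrightarrow> g (\<kappa> c) = \<iota> c" and gv: "\<And>i. i < N \<Longrightarrow> g (v i) = x i"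
    using poly_cover_exists[OF K B \<iota>, of N x, OF xB] by blast
  have cP: "cring P" and \<kappa>: "\<kappa> \<in> ring_hom K P" and v: "v ` {..<N} \<subseteq> carrier P"
    using P unfolding poly_cover_def by blast+
  interpret P: cring P by fact
  interpret g: ring_hom_ring P B g using ring_hom_ringI2[OF P.ring_axioms B.ring_axioms g] .
  have "carrier B \<subseteq> g ` carrier P"
  proof (rule S(3)[OF g.img_is_subring[OF P.carrier_is_subring]])
    have "\<iota> c \<in> g ` carrier P" if "c \<in> carrier K" for c
      using g\<kappa>[OF that, symmetric] ring_hom_closed[OF \<kappa> that] by simp
    then show "\<iota> ` carrier K \<subseteq> g ` carrier P" by blast
    have "x i \<in> g ` carrier P" if "i < N" for i
      unfolding gv[OF that, symmetric] using v that by (intro imageI) auto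
    then show "S \<subseteq> g ` carrier P" unfolding x by blast
  qed
  then have "g ` carrier P = carrier B" by auto
  then show ?thesis using that[OF P g g\<kappa>] by blast
qed

lemma finite_type_noetherian:
  fixes K :: "('k, 'l) ring_scheme"
  assumes "field K" "cring B" "\<iota> \<in> ring_hom K B" "finite_type_algebra K B \<iota>"
  shows "noetherian_ring B"
proof -
  obtain N and P :: "'k test ring" and \<kappa> v g where P: "poly_cover K N P \<kappa> v" and g: "g \<in> ring_hom P B" "g ` carrier P = carrier B"
    by (rule finite_type_cover[OF assms]) blast
  interpret P: cring P using P by (simp add: poly_cover_def)
  interpret B: cring B by fact
  have "noetherian_ring P" using P by (simp add: poly_cover_def)
  from noetherian_image[OF ring_hom_ringI2[OF P.ring_axioms B.ring_axioms g(1)] this g(2)] show ?thesis .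
qed

text \<open>Supplies at each maximal ideal a generating set up to the denominator \<open>s\<close>.
  The set consists of images of coordinate differentials forming a basis of the fibre at
  \<open>m\<close>; their number is bounded by a chain, and Nakayama's lemma passes from the fibre
  to a multiple by \<open>s\<close>.\<close>

lemma differentials_local_generators:
  fixes K :: "('k, 'l) ring_scheme" and B :: "('b, 'n) ring_scheme"
  assumes K: "field K" and B: "cring B" and \<iota>: "\<iota> \<in> ring_hom K B" and smooth: "smooth_algebra K B \<iota>"
    and dim: "\<forall>k p. prime_chain B k p \<longrightarrow> k \<le> d" and m: "maximalideal m B"
  shows "\<exists>W s. finite W \<and> W \<subseteq> carrier (kahler_module K B \<iota>) \<and> card W \<le> d \<and> s \<in> carrier B - m \<and>
    (\<forall>w\<in>carrier (kahler_module K B \<iota>). s \<odot>\<^bsub>kahler_module K B \<iota>\<^esub> w \<in> submodule_span B (kahler_module K B \<iota>) W)"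
proof -
  interpret K: field K by fact
  interpret B: cring B by fact
  interpret kB: kahler K B \<iota> using K.is_cring B \<iota> by (rule kahler.intro)
  interpret m: maximalideal m B by fact
  have mp: "primeideal m B" using B.maximalideal_prime[OF m] .
  have ftB: "finite_type_algebra K B \<iota>" using smooth unfolding smooth_algebra_def by simp
  obtain N and P :: "'k test ring" and \<kappa> v g where P: "poly_cover K N P \<kappa> v" and g: "g \<in> ring_hom P B"
    and g\<kappa>: "\<And>c. c \<in> carrier K \<Longrightarrow> g (\<kappa> c) = \<iota> c" and onto: "g ` carrier P = carrier B"
    by (rule finite_type_cover[OF K B \<iota> ftB]) blast
  have cP: "cring P" and nP: "noetherian_ring P" and \<kappa>: "\<kappa> \<in> ring_hom K P" and v: "v ` {..<N} \<subseteq> carrier P"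
    and gen: "\<And>S. subring S P \<Longrightarrow> \<kappa> ` carrier K \<subseteq> S \<Longrightarrow> v ` {..<N} \<subseteq> S \<Longrightarrow> carrier P \<subseteq> S"
    and ch: "\<And>M. primeideal M P \<Longrightarrow> (\<forall>i<N. algebraic_mod K P \<kappa> M (v i)) \<Longrightarrow> (\<exists>p. prime_chain P N p \<and> p N = M)"
    using P unfolding poly_cover_def by blast+
  interpret P: cring P by fact
  interpret g: ring_hom_ring P B g using ring_hom_ringI2[OF P.ring_axioms B.ring_axioms g] .
  have \<kappa>P: "\<kappa> ` carrier K \<subseteq> carrier P" using ring_hom_closed[OF \<kappa>] by blast
  define x where "x i = g (v i)" for i
  let ?S = "x ` {..<N}"
  have S: "finite ?S" "?S \<subseteq> carrier B" using v by (auto simp: x_def)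
  have genS: "carrier B \<subseteq> L" if Ls: "subring L B" "\<iota> ` carrier K \<subseteq> L" "?S \<subseteq> L" for L
  proof -
    have "carrier P \<subseteq> {p \<in> carrier P. g p \<in> L}"
      by (rule gen[OF subring_vimage[OF g.ring_hom_ring_axioms Ls(1)]]) (use \<kappa>P v Ls(2,3) g\<kappa> in \<open>auto simp: x_def image_subset_iff\<close>)
    then have "g ` carrier P \<subseteq> L" by blast
    then show ?thesis unfolding onto .
  qed
  have ftP: "finite_type_algebra K P \<kappa>"
    by (rule finite_typeI[OF P.ring_axioms _ v \<kappa>P gen]) auto
  have smB: "smooth_algebra K B (g \<circ> \<kappa>)"
    using smooth_algebra_cong[of K "g \<circ> \<kappa>" \<iota> B] g\<kappa> smooth by simp
  interpret SQ: smooth_quotient K P \<kappa> B g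
    by (rule smooth_quotient.intro[OF K cP \<kappa> ftP B g onto smB])
  interpret kP: kahler K P \<kappa> using K.is_cring cP \<kappa> by (rule kahler.intro)
  let ?O = "kahler_module K P \<kappa>" let ?d = "universal_derivation K P \<kappa>"
  define J where "J = a_kernel P B g"
  note J_mem = SQ.J_mem[folded J_def] and J_ideal = SQ.J_ideal[folded J_def]
  note DJ = ideal.ideal_simps[OF J_ideal]
  define M where "M = {p \<in> carrier P. g p \<in> m}"
  have Mp: "primeideal M P" unfolding M_def by (rule g.primeideal_vimage[OF cP mp])
  note Mi = primeideal.axioms(1)[OF Mp]
  note DM = ideal.ideal_simps[OF Mi]
  have JM: "J \<subseteq> M" using J_mem ideal.ideal_simps(1)[OF m.is_ideal] by (auto simp: M_def)
  have Minv: "\<exists>c\<in>carrier P. c \<otimes>\<^bsub>P\<^esub> b \<ominus>\<^bsub>P\<^esub> \<one>\<^bsub>P\<^esub> \<in> M" if b: "b \<in> carrier P - M" for b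
  proof -
    have gb: "g b \<in> carrier B" "g b \<notin> m" using b by (auto simp: M_def)
    have "B.adj m (g b) = carrier B"
      using m.I_maximal[OF B.adj_ideal(1)[OF m.is_ideal gb(1)] B.adj_ideal(2)[OF m.is_ideal gb(1)]]
        B.adj_ideal(3)[OF m.is_ideal gb(1)] ideal.ideal_simps(2)[OF B.adj_ideal(1)[OF m.is_ideal gb(1)]] gb(2) by blast
    then have "\<one>\<^bsub>B\<^esub> \<in> B.adj m (g b)" by simp
    then obtain j c' where jc: "j \<in> m" "c' \<in> carrier B" "\<one>\<^bsub>B\<^esub> = j \<oplus>\<^bsub>B\<^esub> c' \<otimes>\<^bsub>B\<^esub> g b" by (auto simp: B.adj_def)
    obtain c where c: "c \<in> carrier P" "c' = g c" using jc(2) onto by blast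
    have jB: "j \<in> carrier B" using m.Icarr[OF jc(1)] .
    have "g (c \<otimes>\<^bsub>P\<^esub> b \<ominus>\<^bsub>P\<^esub> \<one>\<^bsub>P\<^esub>) = c' \<otimes>\<^bsub>B\<^esub> g b \<oplus>\<^bsub>B\<^esub> \<ominus>\<^bsub>B\<^esub> \<one>\<^bsub>B\<^esub>" using b c by (simp add: a_minus_def)
    also have "\<dots> = \<ominus>\<^bsub>B\<^esub> j" unfolding jc(3) using jB jc(2) gb(1)
      by (simp add: B.minus_add B.a_comm[of "\<ominus>\<^bsub>B\<^esub> j"] B.r_neg2)
    finally have "g (c \<otimes>\<^bsub>P\<^esub> b \<ominus>\<^bsub>P\<^esub> \<one>\<^bsub>P\<^esub>) \<in> m" using m.a_inv_closed[OF jc(1)] by simp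
    then show ?thesis using c(1) b by (intro bexI[of _ c]) (auto simp: M_def)
  qed
  have Mmax: "maximalideal M P"
  proof (rule maximalidealI[OF Mi])
    show "carrier P \<noteq> M" using primeideal.I_notcarr[OF Mp] .
    fix L assume L: "ideal L P" "M \<subseteq> L" "L \<subseteq> carrier P"
    note DL = ideal.ideal_simps[OF L(1)]
    show "L = M \<or> L = carrier P"
    proof (rule ccontr)
      assume c: "\<not> ?thesis"
      then obtain b where b: "b \<in> L" "b \<in> carrier P - M" using L by blast
      then obtain c where c: "c \<in> carrier P" "c \<otimes>\<^bsub>P\<^esub> b \<ominus>\<^bsub>P\<^esub> \<one>\<^bsub>P\<^esub> \<in> M" using Minv by blast
      have "c \<otimes>\<^bsub>P\<^esub> b \<ominus>\<^bsub>P\<^esub> (c \<otimes>\<^bsub>P\<^esub> b \<ominus>\<^bsub>P\<^esub> \<one>\<^bsub>P\<^esub>) \<in> L" using DL(4)[OF DL(5)[OF c(1) b(1)] subsetD[OF L(2) c(2)]] .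
      moreover have "c \<otimes>\<^bsub>P\<^esub> b \<ominus>\<^bsub>P\<^esub> (c \<otimes>\<^bsub>P\<^esub> b \<ominus>\<^bsub>P\<^esub> \<one>\<^bsub>P\<^esub>) = \<one>\<^bsub>P\<^esub>"
        using b c(1) by (simp add: a_minus_def P.minus_add P.r_neg2)
      ultimately have "\<one>\<^bsub>P\<^esub> \<in> L" by simp
      then show False using ideal.one_imp_carrier[OF L(1)] \<open>\<not> (L = M \<or> L = carrier P)\<close> by blast
    qed
  qed
  \<comment> \<open>\<open>M\<close> is maximal, so all variables are algebraic modulo
    \<open>M\<close>, and a chain of full length \<open>N\<close> ends there.\<close>
  have "algebraic_mod K P \<kappa> M (v i)" if "i < N" for i
    by (rule algebraic_mod_maximal[OF K cP \<kappa>, of "map v [0..<N]"]) (use v gen Mmax that in \<open>auto simp: atLeast0LessThan\<close>)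
  then obtain p where p: "prime_chain P N p" "p N = M" using ch[OF Mp] by blast

  let ?MO = "submodule_span P ?O {a \<odot>\<^bsub>?O\<^esub> w | a w. a \<in> M \<and> w \<in> carrier ?O}"
  have MOc: "{a \<odot>\<^bsub>?O\<^esub> w | a w. a \<in> M \<and> w \<in> carrier ?O} \<subseteq> carrier ?O" using DM(2) by auto
  note MOs = kP.Om.span_submodule[OF MOc]
  note DMO = kP.Om.submoduleD[OF MOs]
  have MOi: "a \<odot>\<^bsub>?O\<^esub> w \<in> ?MO" if "a \<in> M" "w \<in> carrier ?O" for a w
    by (rule kP.Om.span_incl') (use that in blast)
  \<comment> \<open>The sum of the differentials of \<open>I\<close> and the
    \<open>M\<close>-multiples of all differentials. Dividing by \<open>Z J\<close> gives the fibre
    at \<open>m\<close> of the differentials of \<open>B\<close>.\<close>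
  define Z where "Z I = {?d j \<oplus>\<^bsub>?O\<^esub> y | j y. j \<in> I \<and> y \<in> ?MO}" for I
  have Zs: "submodule (Z I) P ?O" if I: "ideal I P" "I \<subseteq> M" for I
  proof (rule kP.Om.submoduleI')
    note DI = ideal.ideal_simps[OF I(1)]
    show "Z I \<subseteq> carrier ?O" using DI(2) DMO(2) kP.d_simps(1) by (auto simp: Z_def)
    show "\<zero>\<^bsub>?O\<^esub> \<in> Z I" unfolding Z_def using DI(1) DMO(3) kP.d_zero
      by (intro CollectI exI[of _ "\<zero>\<^bsub>P\<^esub>"] exI[of _ "\<zero>\<^bsub>?O\<^esub>"]) auto
    show "s \<oplus>\<^bsub>?O\<^esub> t \<in> Z I" if st: "s \<in> Z I" "t \<in> Z I" for s t
    proof -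
      obtain i y j z where *: "s = ?d i \<oplus>\<^bsub>?O\<^esub> y" "i \<in> I" "y \<in> ?MO" "t = ?d j \<oplus>\<^bsub>?O\<^esub> z" "j \<in> I" "z \<in> ?MO"
        using st unfolding Z_def by blast
      have "s \<oplus>\<^bsub>?O\<^esub> t = ?d (i \<oplus>\<^bsub>P\<^esub> j) \<oplus>\<^bsub>?O\<^esub> (y \<oplus>\<^bsub>?O\<^esub> z)"
        using * DI(2) DMO(2) by (simp add: kP.d_simps(1,2) kP.Om.M.a_ac)
      then show ?thesis unfolding Z_def using DI(3)[OF *(2,5)] DMO(4)[OF *(3,6)] by blast
    qed
    show "a \<odot>\<^bsub>?O\<^esub> s \<in> Z I" if as: "a \<in> carrier P" "s \<in> Z I" for a s
    proof -
      obtain j y where *: "s = ?d j \<oplus>\<^bsub>?O\<^esub> y" "j \<in> I" "y \<in> ?MO" using as unfolding Z_def by blast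
      have jP: "j \<in> carrier P" "y \<in> carrier ?O" using DI(2)[OF *(2)] DMO(2)[OF *(3)] .
      have jd: "j \<odot>\<^bsub>?O\<^esub> ?d a \<in> ?MO" using MOi[OF subsetD[OF I(2) *(2)]] kP.d_simps(1)[OF as(1)] by blast
      have y': "a \<odot>\<^bsub>?O\<^esub> y \<ominus>\<^bsub>?O\<^esub> j \<odot>\<^bsub>?O\<^esub> ?d a \<in> ?MO" using DMO(6)[OF DMO(7)[OF as(1) *(3)] jd] .
      \<comment> \<open>By the Leibniz rule \<open>a dj\<close> is \<open>d(aj) - j da\<close>, and
        the last term is an \<open>M\<close>-multiple; so the set of sums is already closed under
        scalars.\<close>
      have "a \<odot>\<^bsub>?O\<^esub> s = ?d (a \<otimes>\<^bsub>P\<^esub> j) \<oplus>\<^bsub>?O\<^esub> (a \<odot>\<^bsub>?O\<^esub> y \<ominus>\<^bsub>?O\<^esub> j \<odot>\<^bsub>?O\<^esub> ?d a)"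
        using * jP as(1)
        by (simp add: kP.d_simps(1,3) kP.Om.smult_r_distr a_minus_def kP.Om.M.a_ac kP.Om.M.r_neg2 kP.Om.M.r_neg)
      then show ?thesis unfolding Z_def using DI(5)[OF as(1) *(2)] y' by blast
    qed
  qed
  have MOZ: "?MO \<subseteq> Z I" if I: "ideal I P" for I
  proof
    fix y assume y: "y \<in> ?MO"
    then have "y = ?d \<zero>\<^bsub>P\<^esub> \<oplus>\<^bsub>?O\<^esub> y" using DMO(2) kP.d_zero by simp
    then show "y \<in> Z I" unfolding Z_def using ideal.ideal_simps(1)[OF I] y by blast
  qed
  have dZ: "?d j \<in> Z I" if "j \<in> I" "ideal I P" for I j
  proof -
    have "?d j = ?d j \<oplus>\<^bsub>?O\<^esub> \<zero>\<^bsub>?O\<^esub>" using ideal.Icarr[OF that(2,1)] kP.d_simps(1) by simp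
    then show ?thesis unfolding Z_def using that(1) DMO(3) by blast
  qed
  note Ys = Zs[OF J_ideal JM]
  note DY = kP.Om.submoduleD[OF Ys]
  define D where "D = ?d ` v ` {..<N}"
  have Dfin: "finite D" "card D \<le> N" and Dc: "D \<subseteq> carrier ?O"
    unfolding D_def using v kP.d_simps(1) card_image_le[of "{..<N}" v] card_image_le[of "v ` {..<N}" ?d] by auto
  have genO: "carrier ?O \<subseteq> L" if "submodule L P ?O" "D \<subseteq> L" for L
    using kP.Omega_generated[OF v gen that(1)] that(2) unfolding D_def by blast
  have spanD: "submodule_span P ?O (D \<union> Z J) = carrier ?O"
  proof
    have "D \<union> Z J \<subseteq> carrier ?O" using Dc DY(1) by blast
    note s = kP.Om.span_submodule[OF this]
    show "submodule_span P ?O (D \<union> Z J) \<subseteq> carrier ?O" using kP.Om.submoduleD(1)[OF s] .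
    show "carrier ?O \<subseteq> submodule_span P ?O (D \<union> Z J)" by (rule genO[OF s]) (use kP.Om.span_incl[of "D \<union> Z J"] in blast)
  qed
  \<comment> \<open>A subset of the coordinate differentials of least cardinality that generates
    modulo \<open>Z J\<close> is a basis of the fibre.\<close>
  define gens where "gens W \<longleftrightarrow> W \<subseteq> D \<and> submodule_span P ?O (W \<union> Z J) = carrier ?O" for W
  have "gens D" using spanD unfolding gens_def by simp
  then obtain W where gW: "gens W" and Wmin: "\<And>W'. gens W' \<Longrightarrow> card W \<le> card W'"
    using ex_has_least_nat[of gens D card] by blast
  have W: "W \<subseteq> D" "submodule_span P ?O (W \<union> Z J) = carrier ?O" using gW unfolding gens_def by simp_all
  have Wf: "finite W" "W \<subseteq> carrier ?O" using finite_subset[OF W(1) Dfin(1)] W(1) Dc by blast+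
  have key: "b u \<in> M" if b: "b \<in> W \<rightarrow> carrier P" "(\<Oplus>\<^bsub>?O\<^esub>v\<in>W. b v \<odot>\<^bsub>?O\<^esub> v) \<in> Z J" "u \<in> W" for b u
  proof (rule kP.Om.minimal_generators[OF Minv Wf Ys _ _ W(2) _ b])
    show "a \<odot>\<^bsub>?O\<^esub> w \<in> Z J" if "a \<in> M" "w \<in> carrier ?O" for a w using MOi[OF that] MOZ[OF J_ideal] by blast
    show "M \<subseteq> carrier P" using DM(2) by blast
    fix w assume w: "w \<in> W"
    have "card (W - {w}) < card W" using w Wf(1) by (intro psubset_card_mono) auto
    then have "\<not> gens (W - {w})" using Wmin[of "W - {w}"] by linarith
    then show "submodule_span P ?O (W - {w} \<union> Z J) \<noteq> carrier ?O" using W(1) unfolding gens_def by blast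
  qed
  \<comment> \<open>Each remaining coordinate differential is accounted for, modulo the span of
    \<open>W\<close> and \<open>?MO\<close>, by the differential of a single element of
    \<open>J\<close>.\<close>
  have ex_g: "\<exists>g. g \<in> J \<and> u \<in> submodule_span P ?O (W \<union> insert (?d g) ?MO)" if u: "u \<in> D" for u
  proof -
    have "u \<in> kP.Om.comb (carrier P) W (Z J)" using u Dc W(2) kP.Om.comb_span[OF Wf Ys] by blast
    then obtain b y where bY: "u = (\<Oplus>\<^bsub>?O\<^esub>v\<in>W. b v \<odot>\<^bsub>?O\<^esub> v) \<oplus>\<^bsub>?O\<^esub> y" "b \<in> W \<rightarrow> carrier P" "y \<in> Z J"
      by (auto simp: kP.Om.comb_def)
    then obtain j z where jz: "y = ?d j \<oplus>\<^bsub>?O\<^esub> z" "j \<in> J" "z \<in> ?MO" unfolding Z_def by blast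
    have c: "W \<union> insert (?d j) ?MO \<subseteq> carrier ?O" using Wf DMO(1) kP.d_simps(1) DJ(2)[OF jz(2)] by blast
    note s = kP.Om.span_submodule[OF c]
    note Ds = kP.Om.submoduleD[OF s]
    have i: "t \<in> submodule_span P ?O (W \<union> insert (?d j) ?MO)" if "t \<in> W \<union> insert (?d j) ?MO" for t
      by (rule kP.Om.span_incl'[OF that])
    have "(\<Oplus>\<^bsub>?O\<^esub>v\<in>W. b v \<odot>\<^bsub>?O\<^esub> v) \<in> submodule_span P ?O (W \<union> insert (?d j) ?MO)"
    proof (rule kP.Om.submodule_finsum[OF s])
      fix v assume v: "v \<in> W"
      have "b v \<in> carrier P" using v bY(2) by auto
      then show "b v \<odot>\<^bsub>?O\<^esub> v \<in> submodule_span P ?O (W \<union> insert (?d j) ?MO)" using Ds(7) i[of v] v by blast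
    qed
    moreover have "y \<in> submodule_span P ?O (W \<union> insert (?d j) ?MO)" unfolding jz(1)
      by (rule Ds(4)[OF i i]) (use jz in auto)
    ultimately have "u \<in> submodule_span P ?O (W \<union> insert (?d j) ?MO)" unfolding bY(1) by (rule Ds(4))
    then show ?thesis using jz(2) by blast
  qed
  define gg where "gg u = (SOME g. g \<in> J \<and> u \<in> submodule_span P ?O (W \<union> insert (?d g) ?MO))" for u
  have gg: "gg u \<in> J" "u \<in> submodule_span P ?O (W \<union> insert (?d (gg u)) ?MO)" if "u \<in> D" for u
    using someI_ex[OF ex_g[OF that]] unfolding gg_def by (rule conjunct1, rule conjunct2)
  let ?G = "gg ` (D - W)"
  have Gc: "?G \<subseteq> carrier P" "?G \<subseteq> J" using gg(1) DJ(2) by auto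
  let ?GI = "Idl\<^bsub>P\<^esub> ?G"
  note GI = P.genideal_ideal[OF Gc(1)]
  have GJ: "?GI \<subseteq> J" by (rule P.genideal_minimal[OF J_ideal Gc(2)])
  note DG = ideal.ideal_simps[OF GI]
  note ZGs = Zs[OF GI order_trans[OF GJ JM]]
  have spanG: "carrier ?O \<subseteq> submodule_span P ?O (W \<union> Z ?GI)"
  proof (rule genO)
    have c: "W \<union> Z ?GI \<subseteq> carrier ?O" using Wf kP.Om.submoduleD(1)[OF ZGs] by blast
    note s = kP.Om.span_submodule[OF c]
    show "submodule (submodule_span P ?O (W \<union> Z ?GI)) P ?O" by (rule s)
    show "D \<subseteq> submodule_span P ?O (W \<union> Z ?GI)"
    proof
      fix u assume u: "u \<in> D"
      show "u \<in> submodule_span P ?O (W \<union> Z ?GI)"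
      proof (cases "u \<in> W")
        case True then show ?thesis by (intro kP.Om.span_incl') simp
      next
        case False
        then have "gg u \<in> ?GI" using P.genideal_self[OF Gc(1)] u by blast
        then have "W \<union> insert (?d (gg u)) ?MO \<subseteq> W \<union> Z ?GI" using dZ[OF _ GI] MOZ[OF GI] by blast
        from kP.Om.span_mono[OF this] show ?thesis using gg(2)[OF u] by blast
      qed
    qed
  qed
  \<comment> \<open>Locally \<open>J\<close> is generated by \<open>?G\<close>. Write
    \<open>dj\<close> by means of \<open>W\<close>, some \<open>dh\<close> with \<open>h\<close> in
    \<open>?GI\<close>, and \<open>?MO\<close>. The coefficients at \<open>W\<close> lie in
    \<open>M\<close> by minimality, so \<open>d(j - h)\<close> is in \<open>?MO\<close>; injectivity
    of the conormal map puts \<open>j - h\<close> in \<open>M J\<close>, and Nakayama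
    finishes.\<close>
  have Jsat: "J \<subseteq> P.sat M ?GI"
  proof (rule P.nakayama_ideal[OF nP Mp J_ideal GI])
    have gc: "{p \<otimes>\<^bsub>P\<^esub> x | p x. p \<in> M \<and> x \<in> J} \<union> ?GI \<subseteq> carrier P" using DM(2) DJ(2) DG(2) by auto
    note Hi = P.genideal_ideal[OF gc]
    note DH = ideal.ideal_simps[OF Hi]
    have "j \<in> Idl\<^bsub>P\<^esub> ({p \<otimes>\<^bsub>P\<^esub> x | p x. p \<in> M \<and> x \<in> J} \<union> ?GI)" if j: "j \<in> J" for j
    proof -
      have jP: "j \<in> carrier P" using DJ(2)[OF j] .
      have "?d j \<in> kP.Om.comb (carrier P) W (Z ?GI)"
        using spanG kP.d_simps(1)[OF jP] kP.Om.comb_span[OF Wf ZGs] by blast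
      then obtain b y where bY: "?d j = (\<Oplus>\<^bsub>?O\<^esub>v\<in>W. b v \<odot>\<^bsub>?O\<^esub> v) \<oplus>\<^bsub>?O\<^esub> y" "b \<in> W \<rightarrow> carrier P" "y \<in> Z ?GI"
        by (auto simp: kP.Om.comb_def)
      then obtain h z where hz: "y = ?d h \<oplus>\<^bsub>?O\<^esub> z" "h \<in> ?GI" "z \<in> ?MO" unfolding Z_def by blast
      have hP: "h \<in> carrier P" "z \<in> carrier ?O" using DG(2)[OF hz(2)] DMO(2)[OF hz(3)] .
      have hJ: "j \<ominus>\<^bsub>P\<^esub> h \<in> J" using DJ(4)[OF j] GJ hz(2) by blast
      let ?s = "\<Oplus>\<^bsub>?O\<^esub>v\<in>W. b v \<odot>\<^bsub>?O\<^esub> v"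
      have sc: "?s \<in> carrier ?O" by (rule kP.Om.M.finsum_closed) (use bY(2) Wf in auto)
      have eq: "?d (j \<ominus>\<^bsub>P\<^esub> h) = ?s \<oplus>\<^bsub>?O\<^esub> z"
        unfolding kP.d_minus[OF jP hP(1)] bY(1) hz(1) using sc hP kP.d_simps(1)[OF hP(1)]
        by (simp add: a_minus_def kP.Om.M.a_ac kP.Om.M.r_neg2 kP.Om.M.r_neg)
      then have "?s = ?d (j \<ominus>\<^bsub>P\<^esub> h) \<oplus>\<^bsub>?O\<^esub> \<ominus>\<^bsub>?O\<^esub> z" using sc hP(2) by (simp add: kP.Om.M.a_assoc kP.Om.M.r_neg)
      then have "?s \<in> Z J" unfolding Z_def using hJ DMO(5)[OF hz(3)] by blast
      then have bM: "b u \<in> M" if "u \<in> W" for u using key[OF bY(2)] that by blast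
      have "?s \<in> ?MO" by (rule kP.Om.submodule_finsum[OF MOs]) (use bM MOi Wf(2) in blast)
      then have "?d (j \<ominus>\<^bsub>P\<^esub> h) \<in> ?MO" unfolding eq using DMO(4) hz(3) by blast
      then have "j \<ominus>\<^bsub>P\<^esub> h \<in> Idl\<^bsub>P\<^esub> {p \<otimes>\<^bsub>P\<^esub> x | p x. p \<in> M \<and> x \<in> J}"
        using SQ.conormal_injective[OF Mi, folded J_def, OF JM hJ] by blast
      moreover have "Idl\<^bsub>P\<^esub> {p \<otimes>\<^bsub>P\<^esub> x | p x. p \<in> M \<and> x \<in> J} \<subseteq> Idl\<^bsub>P\<^esub> ({p \<otimes>\<^bsub>P\<^esub> x | p x. p \<in> M \<and> x \<in> J} \<union> ?GI)"
        by (rule P.genideal_minimal[OF Hi]) (use P.genideal_self[OF gc] in blast)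
      ultimately have 1: "j \<ominus>\<^bsub>P\<^esub> h \<in> Idl\<^bsub>P\<^esub> ({p \<otimes>\<^bsub>P\<^esub> x | p x. p \<in> M \<and> x \<in> J} \<union> ?GI)" by blast
      have 2: "h \<in> Idl\<^bsub>P\<^esub> ({p \<otimes>\<^bsub>P\<^esub> x | p x. p \<in> M \<and> x \<in> J} \<union> ?GI)" using P.genideal_self[OF gc] hz(2) by blast
      have "(j \<ominus>\<^bsub>P\<^esub> h) \<oplus>\<^bsub>P\<^esub> h = j" using jP hP(1) by (simp add: a_minus_def P.a_assoc P.l_neg)
      then show ?thesis using DH(3)[OF 1 2] by simp
    qed
    then have "J \<subseteq> Idl\<^bsub>P\<^esub> ({p \<otimes>\<^bsub>P\<^esub> x | p x. p \<in> M \<and> x \<in> J} \<union> ?GI)" by blast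
    also have "\<dots> \<subseteq> P.sat M (Idl\<^bsub>P\<^esub> ({p \<otimes>\<^bsub>P\<^esub> x | p x. p \<in> M \<and> x \<in> J} \<union> ?GI))"
      by (rule P.sat_incl[OF Mp]) (use DH(2) in blast)
    finally show "J \<subseteq> P.sat M (Idl\<^bsub>P\<^esub> ({p \<otimes>\<^bsub>P\<^esub> x | p x. p \<in> M \<and> x \<in> J} \<union> ?GI))" .
  qed

  have Gfin: "finite ?G" using Dfin(1) by simp
  have cG: "card ?G + card W \<le> N"
  proof -
    have "card ?G \<le> card (D - W)" by (rule card_image_le) (use Dfin in simp)
    moreover have "card (D - W) = card D - card W" by (rule card_Diff_subset[OF Wf(1) W(1)])
    moreover have "card W \<le> card D" by (rule card_mono[OF Dfin(1) W(1)])
    ultimately show ?thesis using Dfin(2) by linarith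
  qed
  have "card ?G \<le> N" "?G \<subseteq> p N" using cG Gc(2) JM p(2) by auto
  \<comment> \<open>Every element of \<open>?G\<close> costs one step of the chain. What remains
    begins above \<open>?G\<close>, hence above \<open>J\<close>, and therefore lives in
    \<open>B\<close>.\<close>
  then obtain p' where p': "prime_chain P (N - card ?G) p'" "p' (N - card ?G) = p N" "?G \<subseteq> p' 0"
    using P.prime_chain_through_set[OF nP Gfin _ p(1)] by blast
  note Dp = P.prime_chainD[OF p'(1)]
  have p0: "primeideal (p' 0) P" "p' 0 \<subseteq> M" using Dp(1)[of 0] Dp(3)[of 0 "N - card ?G"] p'(2) p(2) by auto
  have "?GI \<subseteq> p' 0" by (rule P.genideal_minimal[OF primeideal.axioms(1)[OF p0(1)] p'(3)])
  then have "J \<subseteq> p' 0" using Jsat P.sat_mono[of ?GI "p' 0" M] P.sat_prime[OF p0] by blast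
  then have "prime_chain B (N - card ?G) (\<lambda>i. g ` p' i)"
    using prime_chain_image[OF g.ring_hom_ring_axioms cP B onto p'(1)] unfolding J_def by blast
  then have "N - card ?G \<le> d" using dim by blast
  then have cW: "card W \<le> d" using cG by linarith

  let ?OB = "kahler_module K B \<iota>" let ?dB = "universal_derivation K B \<iota>"
  have rm: "module P (restr g ?OB)" by (rule restr_is_module[OF cP kB.Omega_module g])
  have "derivation K P \<kappa> (restr g ?OB) (\<lambda>p. ?dB (g p))"
    unfolding derivation_def using g\<kappa> by (auto simp: kB.d_simps)
  from kP.Omega_universal[OF rm this] obtain \<psi> where \<psi>: "lin_map P ?O (restr g ?OB) \<psi>" "\<And>p. p \<in> carrier P \<Longrightarrow> \<psi> (?d p) = ?dB (g p)"
    by blast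
  note L = lin_mapD[OF \<psi>(1)]
  \<comment> \<open>\<open>?Wa\<close> generates the differentials of \<open>B\<close>, and
    \<open>?Wb\<close> does so modulo \<open>m\<close>.\<close>
  let ?Wb = "\<psi> ` W" let ?Wa = "?dB ` ?S"
  have Wbc: "?Wb \<subseteq> carrier ?OB" using L(1) Wf(2) by auto
  have Wac: "?Wa \<subseteq> carrier ?OB" using S(2) kB.d_simps(1) by auto
  have all: "w \<in> submodule_span B ?OB ?Wa" if "w \<in> carrier ?OB" for w
    by (rule kB.Omega_generated[OF S(2) genS kB.Om.span_submodule[OF Wac] _ that]) (auto intro: kB.Om.span_incl')
  note Ybs = kB.Om.span_submodule[OF Wbc]
  let ?N = "kB.Om.nak m ?Wa (submodule_span B ?OB ?Wb)"
  have Nc: "{p \<odot>\<^bsub>?OB\<^esub> x | p x. p \<in> m \<and> x \<in> submodule_span B ?OB ?Wa} \<union> submodule_span B ?OB ?Wb \<subseteq> carrier ?OB"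
    using kB.Om.submoduleD(2)[OF kB.Om.span_submodule[OF Wac]] kB.Om.submoduleD(1)[OF Ybs] m.Icarr by auto
  have Ns: "submodule ?N B ?OB" unfolding kB.Om.nak_def by (rule kB.Om.span_submodule[OF Nc])
  note DN = kB.Om.submoduleD[OF Ns]
  have Ni1: "a \<odot>\<^bsub>?OB\<^esub> w \<in> ?N" if "a \<in> m" "w \<in> carrier ?OB" for a w
    unfolding kB.Om.nak_def by (rule kB.Om.span_incl') (use that all in blast)
  have Ni2: "w \<in> ?N" if "w \<in> ?Wb" for w
    unfolding kB.Om.nak_def by (rule kB.Om.span_incl') (use kB.Om.span_incl'[OF that] in blast)
  let ?V = "{w \<in> carrier ?O. \<psi> w \<in> ?N}"
  have Vs: "submodule ?V P ?O"
    by (rule lin_map_vimage_submodule[OF kP.Omega_module rm \<psi>(1) restr_submodule[OF cP kB.Omega_module g Ns]])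
  have MOV: "?MO \<subseteq> ?V"
  proof (rule kP.Om.span_least[OF Vs], clarify)
    fix a w assume aw: "a \<in> M" "w \<in> carrier ?O"
    then have "\<psi> (a \<odot>\<^bsub>?O\<^esub> w) = g a \<odot>\<^bsub>?OB\<^esub> \<psi> w" using L(3) DM(2) by simp
    moreover have "g a \<in> m" "\<psi> w \<in> carrier ?OB" using aw L(1) by (auto simp: M_def)
    ultimately show "a \<odot>\<^bsub>?O\<^esub> w \<in> carrier ?O \<and> \<psi> (a \<odot>\<^bsub>?O\<^esub> w) \<in> ?N" using Ni1 aw DM(2) by simp
  qed
  have "W \<union> Z J \<subseteq> ?V"
  proof
    fix t assume "t \<in> W \<union> Z J"
    then consider "t \<in> W" | "t \<in> Z J" by blast
    then show "t \<in> ?V"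
    proof cases
      case 1 then show ?thesis using Ni2 Wf(2) by blast
    next
      case 2
      then obtain j y where jy: "t = ?d j \<oplus>\<^bsub>?O\<^esub> y" "j \<in> J" "y \<in> ?MO" unfolding Z_def by blast
      have "\<psi> (?d j) = \<zero>\<^bsub>?OB\<^esub>" using \<psi>(2) J_mem jy(2) kB.d_zero by simp
      then have "?d j \<in> ?V" using DN(3) kP.d_simps(1) DJ(2)[OF jy(2)] by simp
      then show ?thesis unfolding jy(1) using kP.Om.submoduleD(4)[OF Vs] MOV jy(3) by blast
    qed
  qed
  then have V: "carrier ?O \<subseteq> ?V" using kP.Om.span_least[OF Vs] W(2) by blast
  have "\<exists>s\<in>carrier B - m. s \<odot>\<^bsub>?OB\<^esub> w \<in> ?N" if w: "w \<in> ?Wa" for w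
  proof -
    obtain i where i: "i < N" "w = ?dB (x i)" using w by auto
    have vi: "v i \<in> carrier P" using v i(1) by auto
    have "w = \<psi> (?d (v i))" using \<psi>(2)[OF vi] i(2) by (simp add: x_def)
    then have "w \<in> ?N" using V kP.d_simps(1)[OF vi] by blast
    then show ?thesis using B.prime_one_notin[OF mp] DN(2) by (intro bexI[of _ "\<one>\<^bsub>B\<^esub>"]) auto
  qed
  from kB.Om.nakayama[OF mp _ Wac Ybs this] S(1)
  obtain s where s: "s \<in> carrier B - m" "\<And>w. w \<in> submodule_span B ?OB ?Wa \<Longrightarrow> s \<odot>\<^bsub>?OB\<^esub> w \<in> submodule_span B ?OB ?Wb"
    by auto
  have "finite ?Wb" "card ?Wb \<le> d" using Wf(1) card_image_le[OF Wf(1), of \<psi>] cW by auto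
  then show ?thesis using Wbc s all by blast
qed

text \<open>At each maximal ideal a power of \<open>s\<close> times the wedge is the wedge of the
  multiples by \<open>s\<close>, which lie in the span of at most \<open>d\<close> elements. So the
  wedge is locally zero.\<close>

lemma wedge_vanish:
  fixes K :: "('k, 'l) ring_scheme" and B :: "('b, 'n) ring_scheme"
  assumes K: "field K" and B: "cring B" and \<iota>: "\<iota> \<in> ring_hom K B" and smooth: "smooth_algebra K B \<iota>"
    and dim: "\<forall>k p. prime_chain B k p \<longrightarrow> k \<le> d"
    and us: "set us \<subseteq> carrier (kahler_module K B \<iota>)" "d < length us"
  shows "wedge_list B (kahler_module K B \<iota>) us = \<zero>\<^bsub>exterior_algebra B (kahler_module K B \<iota>)\<^esub>"
proof -
  interpret K: field K by fact
  interpret B: cring B by fact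
  interpret kB: kahler K B \<iota> using K.is_cring B \<iota> by (rule kahler.intro)
  interpret E: exterior B "kahler_module K B \<iota>" by (rule exterior.intro[OF kB.Omega_module])
  have "E.wl us \<in> {\<zero>\<^bsub>E.Ext\<^esub>}"
  proof (rule B.local_global[OF E.Ext_module])
    show "submodule {\<zero>\<^bsub>E.Ext\<^esub>} B E.Ext" by (rule module.zero_submodule[OF E.Ext_module])
    show "E.wl us \<in> carrier E.Ext" by (rule E.wl_closed[OF us(1)])
    fix m assume m: "maximalideal m B"
    have mp: "primeideal m B" using B.maximalideal_prime[OF m] .
    from differentials_local_generators[OF K B \<iota> smooth dim m]
    obtain W s where W: "finite W" "W \<subseteq> carrier kB.\<Omega>" "card W \<le> d" and s: "s \<in> carrier B - m"
      "\<forall>w\<in>carrier kB.\<Omega>. s \<odot>\<^bsub>kB.\<Omega>\<^esub> w \<in> submodule_span B kB.\<Omega> W"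
      by (elim exE conjE)
    have "E.wl (map (\<lambda>u. s \<odot>\<^bsub>kB.\<Omega>\<^esub> u) us) = \<zero>\<^bsub>E.Ext\<^esub>"
      by (rule alternating_vanish_span[OF E.Ext_module kB.Omega_module E.wl_alternating W(1,2)]) (use s us W(3) in auto)
    then have "s [^]\<^bsub>B\<^esub> length us \<odot>\<^bsub>E.Ext\<^esub> E.wl us = \<zero>\<^bsub>E.Ext\<^esub>"
      using alternating_scale[OF E.Ext_module kB.Omega_module E.wl_alternating, of s us] s(1) us(1) by simp
    moreover have "s [^]\<^bsub>B\<^esub> (k::nat) \<notin> m" for k
      by (induction k) (use B.prime_one_notin[OF mp] B.prime_mult_notin[OF mp] s(1) in auto)
    ultimately show "\<exists>s\<in>carrier B - m. s \<odot>\<^bsub>E.Ext\<^esub> E.wl us \<in> {\<zero>\<^bsub>E.Ext\<^esub>}"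
      using s(1) by (intro bexI[of _ "s [^]\<^bsub>B\<^esub> length us"]) auto
  qed
  then show ?thesis by simp
qed

subsection \<open>Dimension and dual derivations\<close>

text \<open>An infinite set of extended naturals has supremum infinity, so a finite supremum is a
  maximum.\<close>

lemma Sup_enat_attained:
  assumes "Sup S = enat r" "S \<noteq> {}" shows "enat r \<in> S"
proof -
  have fin: "finite S" and "Max S = enat r" using assms by (auto simp: Sup_enat_def split: if_splits)
  then show ?thesis using Max_in[OF fin assms(2)] by simp
qed

lemma (in cring) height_chain:
  assumes P: "primeideal P R" and h: "height R P = enat r"
  obtains p where "prime_chain R r p" "p r = P"
proof -
  have "prime_chain R 0 (\<lambda>_. P)" using P by (auto simp: prime_chain_def)
  then have "{enat k | k. \<exists>p. prime_chain R k p \<and> p k = P} \<noteq> {}" by fastforce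
  from Sup_enat_attained[OF h[unfolded height_def] this] show ?thesis using that by auto
qed

text \<open>Below \<open>q 0\<close> lies a prime minimal over \<open>I\<close>, and below that
  prime a chain of length \<open>r\<close>. The joined chain begins above a minimal prime of the
  ring, and its image in the quotient is bounded by the dimension.\<close>

lemma (in cring) prime_chain_length:
  assumes dim: "pure_dim R n" and codim: "pure_codim R I r" and q: "prime_chain R k q" "I \<subseteq> q 0"
  shows "r + k \<le> n"
proof -
  note Dq = prime_chainD[OF q(1)]
  obtain P where P: "minimal_prime_over R I P" "P \<subseteq> q 0" using ex_minimal_prime[OF Dq(1)[of 0] q(2)] by blast
  have pP: "primeideal P R" using P(1) by (simp add: minimal_prime_over_def)
  obtain c where c: "prime_chain R r c" "c r = P"
    using height_chain[OF pP] codim P(1) unfolding pure_codim_def by blast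
  note Dc = prime_chainD[OF c(1)]
  \<comment> \<open>At index \<open>r\<close> the value is \<open>q 0\<close> and not
    \<open>c r\<close>, so no repetition occurs if the two coincide.\<close>
  define s where "s i = (if i < r then c i else q (i - r))" for i
  have "s i \<subset> s (Suc i)" if i: "i < r + k" for i
  proof -
    consider "Suc i < r" | "Suc i = r" | "r \<le> i" by linarith
    then show ?thesis
    proof cases
      case 1 then show ?thesis using Dc(2) by (simp add: s_def)
    next
      case 2 then show ?thesis using Dc(2)[of i] c(2) P(2) by (auto simp: s_def)
    next
      case 3 then show ?thesis using Dq(2)[of "i - r"] i by (simp add: s_def Suc_diff_le)
    qed
  qed
  moreover have "primeideal (s i) R" if "i \<le> r + k" for i
    using Dc(1) Dq(1) that by (simp add: s_def)
  ultimately have s: "prime_chain R (r + k) s" unfolding prime_chain_def by blast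
  note Ds = prime_chainD[OF s]
  have s0: "primeideal (s 0) R" using Ds(1)[of 0] by simp
  then have "{\<zero>} \<subseteq> s 0" using ideal.ideal_simps(1)[OF primeideal.axioms(1)] by blast
  then obtain P0 where P0: "minimal_prime_over R {\<zero>} P0" "P0 \<subseteq> s 0" using ex_minimal_prime[OF s0] by blast
  then interpret P0: ideal P0 R using primeideal.axioms(1) by (auto simp: minimal_prime_over_def)
  have onto: "(\<lambda>a. P0 +> a) ` carrier R = carrier (R Quot P0)" by (auto simp: quot_ring_carrier)
  have "a_kernel R (R Quot P0) (\<lambda>a. P0 +> a) = P0"
    using P0.a_rcos_const P0.a_rcos_self P0.Icarr by (auto simp: a_kernel_def kernel_def FactRing_def)
  then have "prime_chain (R Quot P0) (r + k) (\<lambda>i. (\<lambda>a. P0 +> a) ` s i)"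
    using prime_chain_image[OF P0.rcos_ring_hom_ring is_cring P0.quotient_is_cring[OF is_cring] onto s] P0(2) by simp
  then have "enat (r + k) \<in> {enat k | k. \<exists>p. prime_chain (R Quot P0) k p}" by blast
  then have "enat (r + k) \<le> krull_dim (R Quot P0)" unfolding krull_dim_def by (rule Sup_upper)
  then show ?thesis using dim P0(1) unfolding pure_dim_def by simp
qed

lemma (in cring) finsum_lessThan_split:
  assumes "i < (r::nat)" "\<And>j. j < r \<Longrightarrow> h j \<in> carrier R"
  shows "(\<Oplus>j\<in>{..<r}. h j) = h i \<oplus> (\<Oplus>j\<in>{..<r} - {i}. h j)"
proof -
  have "(\<Oplus>j\<in>insert i ({..<r} - {i}). h j) = h i \<oplus> (\<Oplus>j\<in>{..<r} - {i}. h j)"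
    by (rule finsum_insert) (use assms in auto)
  then show ?thesis using assms(1) by (simp add: insert_absorb)
qed

section \<open>Derivations dual to the generators of the ideal\<close>

context smooth_quotient begin

text \<open>A coefficient outside \<open>q\<close> would make its generator redundant near
  \<open>q\<close>; then \<open>r - 1\<close> elements would generate \<open>J\<close> there, and a
  chain of length \<open>r\<close> below \<open>q\<close> leaves a smaller prime over
  \<open>J\<close>.\<close>

lemma conormal_coefficients:
  fixes fs :: "nat \<Rightarrow> 'a" and c :: "nat \<Rightarrow> 'a"
  assumes N: "noetherian_ring R" and fs: "\<And>i. i < r \<Longrightarrow> fs i \<in> carrier R" and J: "J = Idl (fs ` {..<r})"
    and codim: "pure_codim R J r" and q: "minimal_prime_over R J q"
    and c: "\<And>i. i < r \<Longrightarrow> c i \<in> carrier R" "(\<Oplus>i\<in>{..<r}. c i \<otimes> fs i) \<in> J2" and i: "i < r"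
  shows "c i \<in> q"
proof (rule ccontr)
  assume ci: "c i \<notin> q"
  have qp: "primeideal q R" and Jq: "J \<subseteq> q" and qmin: "\<And>Q. primeideal Q R \<Longrightarrow> J \<subseteq> Q \<Longrightarrow> Q \<subseteq> q \<Longrightarrow> Q = q"
    using q by (auto simp: minimal_prime_over_def)
  note Dq = ideal.ideal_simps[OF primeideal.axioms(1)[OF qp]]
  let ?F = "fs ` ({..<r} - {i})" let ?L = "Idl ?F"
  have Fc: "?F \<subseteq> carrier R" using fs by auto
  note L = R.genideal_ideal[OF Fc]
  note DL = ideal.ideal_simps[OF L]
  note DJ = ideal.ideal_simps[OF J_ideal]
  have fsJ: "fs j \<in> J" if "j < r" for j
    unfolding J by (rule subsetD[OF R.genideal_self]) (use that fs in auto)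
  have FL: "fs j \<in> ?L" if "j < r" "j \<noteq> i" for j
    by (rule subsetD[OF R.genideal_self[OF Fc]]) (use that in auto)
  note fi = fs[OF i]
  note adj = R.adj_ideal[OF L fi]
  have "J \<subseteq> R.adj ?L (fs i)" unfolding J
  proof (rule R.genideal_minimal[OF adj(1)])
    show "fs ` {..<r} \<subseteq> R.adj ?L (fs i)" using adj(2,3) FL by force
  qed
  then have Jadj: "\<exists>l\<in>?L. \<exists>b\<in>carrier R. y = l \<oplus> b \<otimes> fs i" if "y \<in> J" for y
    using that unfolding R.adj_def by blast
  \<comment> \<open>In a product of two elements of \<open>J\<close>, one factor is expressed by the
    generators: the \<open>i\<close>-th contributes a multiple of \<open>fs i\<close> with
    coefficient in \<open>J\<close>, and the rest lies in \<open>?L\<close>.\<close>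
  have J2form: "\<exists>l\<in>?L. \<exists>g\<in>J. z = l \<oplus> g \<otimes> fs i" if "z \<in> J2" for z
    using that
  proof (induction rule: ideal_prod.induct)
    case (prod x y)
    obtain l b where lb: "l \<in> ?L" "b \<in> carrier R" "y = l \<oplus> b \<otimes> fs i" using Jadj[OF prod(2)] by blast
    have "x \<otimes> y = x \<otimes> l \<oplus> (x \<otimes> b) \<otimes> fs i"
      unfolding lb(3) using DJ(2)[OF prod(1)] DL(2)[OF lb(1)] lb(2) fi by (simp add: R.r_distr R.m_assoc)
    then show ?case using DL(5)[OF DJ(2)[OF prod(1)] lb(1)] DJ(6)[OF lb(2) prod(1)] by blast
  next
    case (sum s t)
    obtain l g l' g' where *: "l \<in> ?L" "g \<in> J" "s = l \<oplus> g \<otimes> fs i" "l' \<in> ?L" "g' \<in> J" "t = l' \<oplus> g' \<otimes> fs i"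
      using sum.IH by blast
    have "s \<oplus> t = (l \<oplus> l') \<oplus> (g \<oplus> g') \<otimes> fs i"
      unfolding *(3,6) using DL(2)[OF *(1)] DL(2)[OF *(4)] DJ(2)[OF *(2)] DJ(2)[OF *(5)] fi by (simp add: R.l_distr R.a_ac)
    then show ?case using DL(3)[OF *(1,4)] DJ(3)[OF *(2,5)] by blast
  qed
  obtain l g where lg: "l \<in> ?L" "g \<in> J" "(\<Oplus>i\<in>{..<r}. c i \<otimes> fs i) = l \<oplus> g \<otimes> fs i"
    using J2form[OF c(2)] by blast
  let ?t = "\<Oplus>j\<in>{..<r} - {i}. c j \<otimes> fs j"
  have t: "?t \<in> ?L" by (rule R.finsum_ideal[OF _ L]) (use FL c(1) DL(5) in auto)
  have eq: "c i \<otimes> fs i \<oplus> ?t = l \<oplus> g \<otimes> fs i"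
    using R.finsum_lessThan_split[OF i, of "\<lambda>j. c j \<otimes> fs j"] c(1) fs lg(3) by simp
  have cl: "c i \<in> carrier R" "g \<in> carrier R" "l \<in> carrier R" "?t \<in> carrier R"
    using c(1)[OF i] DJ(2)[OF lg(2)] DL(2)[OF lg(1)] DL(2)[OF t] .
  have "(c i \<ominus> g) \<otimes> fs i = (c i \<otimes> fs i \<oplus> ?t) \<ominus> ?t \<ominus> g \<otimes> fs i"
    using cl fi by (simp add: a_minus_def R.l_distr R.l_minus R.a_assoc R.r_neg)
  also have "\<dots> = l \<ominus> ?t"
    unfolding eq using cl fi by (simp add: a_minus_def R.a_ac R.r_neg2 R.r_neg R.r_neg1)
  finally have sL: "(c i \<ominus> g) \<otimes> fs i \<in> ?L" using DL(4)[OF lg(1) t] by simp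
  have snq: "c i \<ominus> g \<notin> q"
  proof
    assume "c i \<ominus> g \<in> q"
    then have "(c i \<ominus> g) \<oplus> g \<in> q" using Dq(3) Jq lg(2) by blast
    then show False using ci cl by (simp add: a_minus_def R.a_assoc R.l_neg)
  qed
  obtain p where p: "prime_chain R r p" "p r = q"
    using R.height_chain[OF qp] codim q unfolding pure_codim_def by blast
  have cF: "card ?F < r"
  proof -
    have "card ?F \<le> card ({..<r} - {i})" by (rule card_image_le) simp
    also have "\<dots> < r" using i by simp
    finally show ?thesis .
  qed
  have Fq: "?F \<subseteq> p r" unfolding p(2) using fsJ Jq by auto
  obtain p' where p': "prime_chain R (r - card ?F) p'" "p' (r - card ?F) = q" "?F \<subseteq> p' 0"
    using R.prime_chain_through_set[OF N _ less_imp_le[OF cF] p(1) Fq] unfolding p(2) by auto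
  note Dp = R.prime_chainD[OF p'(1)]
  have Q: "primeideal (p' 0) R" using Dp(1)[of 0] by simp
  \<comment> \<open>Fewer than \<open>r\<close> elements were used, so at least one strict step to
    \<open>q\<close> remains.\<close>
  have "p' 0 \<subset> p' (Suc 0)" "p' (Suc 0) \<subseteq> q" using Dp(2)[of 0] Dp(3)[of "Suc 0" "r - card ?F"] cF p'(2) by simp_all
  then have strict: "p' 0 \<subset> q" by blast
  have "?L \<subseteq> p' 0" by (rule R.genideal_minimal[OF primeideal.axioms(1)[OF Q] p'(3)])
  then have "fs i \<in> p' 0" using primeideal.I_prime[OF Q _ fi, of "c i \<ominus> g"] sL snq strict cl by auto
  then have "fs ` {..<r} \<subseteq> p' 0" using p'(3) by (auto simp: image_subset_iff)
  then have "J \<subseteq> p' 0" unfolding J by (rule R.genideal_minimal[OF primeideal.axioms(1)[OF Q]])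
  then show False using qmin[OF Q] strict by blast
qed

lemma derivation_self:
  assumes "derivation K R \<kappa> (restr g (self_module B)) D"
  shows "a \<in> carrier R \<Longrightarrow> D a \<in> carrier B"
    and "a \<in> carrier R \<Longrightarrow> b \<in> carrier R \<Longrightarrow> D (a \<oplus> b) = D a \<oplus>\<^bsub>B\<^esub> D b"
    and "a \<in> carrier R \<Longrightarrow> b \<in> carrier R \<Longrightarrow> D (a \<otimes> b) = g a \<otimes>\<^bsub>B\<^esub> D b \<oplus>\<^bsub>B\<^esub> g b \<otimes>\<^bsub>B\<^esub> D a"
  using derivationD[OF assms] by auto

lemma derivation_self_finsum:
  assumes D: "derivation K R \<kappa> (restr g (self_module B)) D" and "finite S" "\<And>i. i \<in> S \<Longrightarrow> h i \<in> carrier R"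
  shows "D (\<Oplus>i\<in>S. h i) = (\<Oplus>\<^bsub>B\<^esub>i\<in>S. D (h i))"
  using assms(2,3)
proof (induction S rule: finite_induct)
  case empty
  have "D \<zero> = D \<zero> \<oplus>\<^bsub>B\<^esub> D \<zero>" using derivation_self(2)[OF D, of "\<zero>" "\<zero>"] by simp
  then show ?case using derivation_self(1)[OF D, of "\<zero>"] B.add.l_cancel_one[of "D \<zero>" "D \<zero>"] by simp
next
  case (insert x S)
  then show ?case using derivation_self(1,2)[OF D] by (simp add: Pi_def)
qed

lemma derivation_self_J2:
  assumes D: "derivation K R \<kappa> (restr g (self_module B)) D" and "z \<in> J2"
  shows "D z = \<zero>\<^bsub>B\<^esub>"
  using assms(2)
proof (induction rule: ideal_prod.induct)
  case (prod x y)
  then have "x \<in> carrier R" "y \<in> carrier R" "g x = \<zero>\<^bsub>B\<^esub>" "g y = \<zero>\<^bsub>B\<^esub>" using J_mem by auto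
  then show ?case using derivation_self[OF D] by simp
next
  case (sum s t)
  then show ?case using derivation_self(2)[OF D] J2.Icarr by simp
qed

lemma dual_derivations:
  fixes fs :: "nat \<Rightarrow> 'a"
  assumes N: "noetherian_ring R" and smoothR: "smooth_algebra K R \<kappa>"
    and fs: "\<And>i. i < r \<Longrightarrow> fs i \<in> carrier R" and J: "J = Idl (fs ` {..<r})"
    and codim: "pure_codim R J r"
  obtains \<theta> where "\<And>i. i < r \<Longrightarrow> derivation K R \<kappa> (restr g (self_module B)) (\<theta> i)"
    "\<And>i k. i < r \<Longrightarrow> k < r \<Longrightarrow> \<theta> i (fs k) = (if i = k then \<one>\<^bsub>B\<^esub> else \<zero>\<^bsub>B\<^esub>)"
proof -
  obtain \<theta> where \<theta>: "\<And>i. i < r \<Longrightarrow> derivation K R \<kappa> (restr g (self_module B)) (\<theta> i)"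
    and coord: "\<And>a c. a \<in> J \<Longrightarrow> (\<And>i. i < r \<Longrightarrow> c i \<in> carrier R) \<Longrightarrow> (\<And>i. i < r \<Longrightarrow> g (c i) = \<theta> i a) \<Longrightarrow>
       a \<ominus> (\<Oplus>i\<in>{..<r}. c i \<otimes> fs i) \<in> J2"
    using conormal_coordinates[OF smoothR fs J] by blast
  note \<theta>D = derivation_self[OF \<theta>]
  define t where "t i k = (SOME a. a \<in> carrier R \<and> g a = \<theta> i (fs k))" for i k
  have t: "t i k \<in> carrier R" "g (t i k) = \<theta> i (fs k)" if "i < r" "k < r" for i k
  proof -
    have "\<theta> i (fs k) \<in> g ` carrier R" unfolding onto by (rule \<theta>D(1)[OF that(1) fs[OF that(2)]])
    then have "\<exists>a. a \<in> carrier R \<and> g a = \<theta> i (fs k)" by auto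
    from someI_ex[OF this] show "t i k \<in> carrier R" "g (t i k) = \<theta> i (fs k)" unfolding t_def by auto
  qed
  define \<delta> where "\<delta> i k = (if i = k then \<one> else \<zero>)" for i k :: nat
  have \<delta>c: "\<delta> i k \<in> carrier R" for i k by (simp add: \<delta>_def)
  define e where "e i k = \<delta> i k \<ominus> t i k" for i k
  have ec: "e i k \<in> carrier R" if "i < r" "k < r" for i k using t that \<delta>c by (simp add: e_def)
  have fsJ: "fs j \<in> J" if "j < r" for j
    unfolding J by (rule subsetD[OF R.genideal_self]) (use that fs in auto)
  \<comment> \<open>The \<open>k\<close>-th column of the matrix \<open>e\<close> is a relation
    modulo \<open>J2\<close>: it is the coordinate expansion of \<open>fs k\<close> subtracted from
    the trivial one.\<close>
  have eJ2: "(\<Oplus>i\<in>{..<r}. e i k \<otimes> fs i) \<in> J2" if k: "k < r" for k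
  proof -
    have 1: "(\<Oplus>i\<in>{..<r}. \<delta> i k \<otimes> fs i) = fs k"
    proof -
      have "(\<Oplus>i\<in>{..<r}. \<delta> i k \<otimes> fs i) = (\<Oplus>i\<in>{..<r}. if k = i then fs i else \<zero>)"
        by (rule R.finsum_cong') (use fs in \<open>auto simp: \<delta>_def\<close>)
      also have "\<dots> = fs k" by (rule R.add.finprod_singleton) (use k fs in auto)
      finally show ?thesis .
    qed
    have "(\<Oplus>i\<in>{..<r}. e i k \<otimes> fs i) \<oplus> (\<Oplus>i\<in>{..<r}. t i k \<otimes> fs i)
        = (\<Oplus>i\<in>{..<r}. e i k \<otimes> fs i \<oplus> t i k \<otimes> fs i)"
      by (rule R.finsum_addf[symmetric]) (use ec t fs k in auto)
    also have "\<dots> = (\<Oplus>i\<in>{..<r}. \<delta> i k \<otimes> fs i)"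
    proof (rule R.finsum_cong')
      fix i assume "i \<in> {..<r}"
      then have i: "i < r" by simp
      have "e i k \<otimes> fs i \<oplus> t i k \<otimes> fs i = (e i k \<oplus> t i k) \<otimes> fs i"
        using ec[OF i k] t(1)[OF i k] fs[OF i] by (simp add: R.l_distr)
      also have "e i k \<oplus> t i k = \<delta> i k" using t(1)[OF i k] \<delta>c by (simp add: e_def a_minus_def R.a_assoc R.l_neg)
      finally show "e i k \<otimes> fs i \<oplus> t i k \<otimes> fs i = \<delta> i k \<otimes> fs i" .
    qed (use \<delta>c fs in auto)
    finally have sum: "(\<Oplus>i\<in>{..<r}. e i k \<otimes> fs i) \<oplus> (\<Oplus>i\<in>{..<r}. t i k \<otimes> fs i) = fs k" unfolding 1 .
    have c: "(\<Oplus>i\<in>{..<r}. e i k \<otimes> fs i) \<in> carrier R" "(\<Oplus>i\<in>{..<r}. t i k \<otimes> fs i) \<in> carrier R"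
      by (rule R.finsum_closed; use ec t fs k in auto)+
    have "fs k \<ominus> (\<Oplus>i\<in>{..<r}. t i k \<otimes> fs i) \<in> J2"
      by (rule coord[OF fsJ[OF k]]) (use t k in auto)
    then show ?thesis unfolding sum[symmetric] using c by (simp add: a_minus_def R.a_assoc R.r_neg)
  qed
  define E where "E i k = g (e i k)" for i k
  have Ec: "E i k \<in> carrier B" if "i < r" "k < r" for i k using ec[OF that] by (simp add: E_def)
  have \<theta>e: "\<theta> i (fs k) = g (\<delta> i k) \<ominus>\<^bsub>B\<^esub> E i k" if "i < r" "k < r" for i k
  proof -
    have "g (\<delta> i k) \<ominus>\<^bsub>B\<^esub> E i k = g (t i k)"
      using t(1)[OF that] \<delta>c[of i k] by (simp add: E_def e_def a_minus_def B.minus_add B.r_neg2)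
    then show ?thesis using t(2)[OF that] by simp
  qed
  \<comment> \<open>Apply \<open>\<theta> j\<close> to the relation of column \<open>k\<close>.
    Derivations into \<open>B\<close> vanish on \<open>J2\<close>, and as \<open>fs i\<close> maps
    to zero only the terms with \<open>\<theta> j (fs i)\<close> survive; this says that
    \<open>E\<close> equals its square.\<close>
  have idem: "E j k = (\<Oplus>\<^bsub>B\<^esub>i\<in>{..<r}. E i k \<otimes>\<^bsub>B\<^esub> E j i)" if j: "j < r" and k: "k < r" for j k
  proof -
    have term1: "\<theta> j (e i k \<otimes> fs i) = E i k \<otimes>\<^bsub>B\<^esub> g (\<delta> j i) \<ominus>\<^bsub>B\<^esub> E i k \<otimes>\<^bsub>B\<^esub> E j i" if i: "i < r" for i
    proof -
      have "g (fs i) = \<zero>\<^bsub>B\<^esub>" using fsJ[OF i] J_mem by blast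
      then have "\<theta> j (e i k \<otimes> fs i) = E i k \<otimes>\<^bsub>B\<^esub> \<theta> j (fs i)"
        using \<theta>D(3)[OF j ec[OF i k] fs[OF i]] \<theta>D(1)[OF j] ec[OF i k] fs[OF i] by (simp add: E_def)
      then show ?thesis using \<theta>e[OF j i] Ec[OF i k] Ec[OF j i] \<delta>c[of j i]
        by (simp add: a_minus_def B.r_distr B.r_minus)
    qed
    have "\<zero>\<^bsub>B\<^esub> = \<theta> j (\<Oplus>i\<in>{..<r}. e i k \<otimes> fs i)" using derivation_self_J2[OF \<theta>[OF j] eJ2[OF k]] by simp
    also have "\<dots> = (\<Oplus>\<^bsub>B\<^esub>i\<in>{..<r}. \<theta> j (e i k \<otimes> fs i))"
      by (rule derivation_self_finsum[OF \<theta>[OF j]]) (use ec fs k in auto)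
    finally have z: "(\<Oplus>\<^bsub>B\<^esub>i\<in>{..<r}. \<theta> j (e i k \<otimes> fs i)) = \<zero>\<^bsub>B\<^esub>" by simp
    have "(\<Oplus>\<^bsub>B\<^esub>i\<in>{..<r}. E i k \<otimes>\<^bsub>B\<^esub> E j i) = (\<Oplus>\<^bsub>B\<^esub>i\<in>{..<r}. \<theta> j (e i k \<otimes> fs i)) \<oplus>\<^bsub>B\<^esub> (\<Oplus>\<^bsub>B\<^esub>i\<in>{..<r}. E i k \<otimes>\<^bsub>B\<^esub> E j i)"
    proof -
      have "(\<Oplus>\<^bsub>B\<^esub>i\<in>{..<r}. E i k \<otimes>\<^bsub>B\<^esub> E j i) \<in> carrier B" by (rule B.finsum_closed) (use Ec j k in auto)
      then show ?thesis unfolding z by simp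
    qed
    also have "\<dots> = (\<Oplus>\<^bsub>B\<^esub>i\<in>{..<r}. \<theta> j (e i k \<otimes> fs i) \<oplus>\<^bsub>B\<^esub> E i k \<otimes>\<^bsub>B\<^esub> E j i)"
      by (rule B.finsum_addf[symmetric]) (use Ec j k \<theta>D(1) ec fs in auto)
    also have "\<dots> = (\<Oplus>\<^bsub>B\<^esub>i\<in>{..<r}. if j = i then E i k else \<zero>\<^bsub>B\<^esub>)"
    proof (rule B.finsum_cong')
      fix i assume "i \<in> {..<r}"
      then have i: "i < r" by simp
      show "\<theta> j (e i k \<otimes> fs i) \<oplus>\<^bsub>B\<^esub> E i k \<otimes>\<^bsub>B\<^esub> E j i = (if j = i then E i k else \<zero>\<^bsub>B\<^esub>)"
        unfolding term1[OF i] using Ec[OF i k] Ec[OF j i] by (simp add: \<delta>_def a_minus_def B.a_assoc B.l_neg)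
    qed (use Ec k in auto)
    also have "\<dots> = E j k" by (rule B.add.finprod_singleton) (use Ec j k in auto)
    finally show ?thesis by simp
  qed
  have Em: "E i k \<in> m" if m: "primeideal m B" and ik: "i < r" "k < r" for m i k
  proof -
    have "primeideal {x \<in> carrier R. g x \<in> m} R" by (rule g.primeideal_vimage[OF R m])
    moreover have "J \<subseteq> {x \<in> carrier R. g x \<in> m}"
      using J_mem ideal.ideal_simps(1)[OF primeideal.axioms(1)[OF m]] by auto
    ultimately obtain q where q: "minimal_prime_over R J q" "q \<subseteq> {x \<in> carrier R. g x \<in> m}"
      using R.ex_minimal_prime by blast
    have "e i k \<in> q"
      by (rule conormal_coefficients[OF N fs J codim q(1) _ eJ2[OF ik(2)] ik(1)]) (use ec ik in auto)
    then show ?thesis using q(2) by (auto simp: E_def)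
  qed
  interpret S: module B "self_module B" by (rule self_is_module[OF B])
  have E0: "E j k = \<zero>\<^bsub>B\<^esub>" if jk: "j < r" "k < r" for j k
  proof -
    \<comment> \<open>The ideal of entries of \<open>E\<close>. Each entry is a sum of products of
      two entries, one of them in \<open>m\<close>, which is the hypothesis of Nakayama's lemma with
      zero as the smaller submodule.\<close>
    let ?W = "(\<lambda>(i, k). E i k) ` ({..<r} \<times> {..<r})"
    have W: "finite ?W" "?W \<subseteq> carrier (self_module B)" using Ec by auto
    have EW: "E i k \<in> ?W" if "i < r" "k < r" for i k using that by force
    note Z = S.zero_submodule
    have "E j k \<in> {\<zero>\<^bsub>self_module B\<^esub>}"
    proof (rule B.local_global[OF S.module_axioms Z])
      show "E j k \<in> carrier (self_module B)" using Ec jk by simp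
      fix m assume "maximalideal m B"
      then have mp: "primeideal m B" by (rule B.maximalideal_prime)
      note Dm = ideal.ideal_simps[OF primeideal.axioms(1)[OF mp]]
      have sc: "submodule_span B (self_module B) ?W \<subseteq> carrier (self_module B)"
        using S.submoduleD(1)[OF S.span_submodule[OF W(2)]] .
      have nc: "{p \<odot>\<^bsub>self_module B\<^esub> x | p x. p \<in> m \<and> x \<in> submodule_span B (self_module B) ?W} \<union> {\<zero>\<^bsub>self_module B\<^esub>} \<subseteq> carrier (self_module B)"
        using sc Dm(2) by auto
      have ns: "submodule (S.nak m ?W {\<zero>\<^bsub>self_module B\<^esub>}) B (self_module B)"
        unfolding S.nak_def by (rule S.span_submodule[OF nc])
      have "E i k \<in> S.nak m ?W {\<zero>\<^bsub>self_module B\<^esub>}" if ik: "i < r" "k < r" for i k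
      proof -
        have "(\<Oplus>\<^bsub>self_module B\<^esub>l\<in>{..<r}. E l k \<odot>\<^bsub>self_module B\<^esub> E i l) \<in> S.nak m ?W {\<zero>\<^bsub>self_module B\<^esub>}"
        proof (rule S.submodule_finsum[OF ns])
          fix l assume "l \<in> {..<r}"
          then have "E l k \<in> m" "E i l \<in> submodule_span B (self_module B) ?W"
            using Em[OF mp] ik S.span_incl'[OF EW[of i l]] by auto
          then show "E l k \<odot>\<^bsub>self_module B\<^esub> E i l \<in> S.nak m ?W {\<zero>\<^bsub>self_module B\<^esub>}"
            unfolding S.nak_def by (intro S.span_incl') blast
        qed
        moreover have "(\<Oplus>\<^bsub>self_module B\<^esub>l\<in>{..<r}. E l k \<odot>\<^bsub>self_module B\<^esub> E i l) = E i k"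
          unfolding idem[OF ik] by (simp add: finsum_def finprod_def self_module_def)
        ultimately show ?thesis by simp
      qed
      then have "\<exists>s\<in>carrier B - m. s \<odot>\<^bsub>self_module B\<^esub> w \<in> S.nak m ?W {\<zero>\<^bsub>self_module B\<^esub>}" if "w \<in> ?W" for w
        using that B.prime_one_notin[OF mp] Ec by (intro bexI[of _ "\<one>\<^bsub>B\<^esub>"]) auto
      from S.nakayama[OF mp W Z this]
      obtain s where "s \<in> carrier B - m" "\<forall>w\<in>submodule_span B (self_module B) ?W. s \<odot>\<^bsub>self_module B\<^esub> w \<in> {\<zero>\<^bsub>self_module B\<^esub>}"
        by blast
      then show "\<exists>s\<in>carrier B - m. s \<odot>\<^bsub>self_module B\<^esub> E j k \<in> {\<zero>\<^bsub>self_module B\<^esub>}"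
        using S.span_incl'[OF EW[OF jk]] by blast
    qed
    then show ?thesis by simp
  qed
  have "\<theta> i (fs k) = (if i = k then \<one>\<^bsub>B\<^esub> else \<zero>\<^bsub>B\<^esub>)" if "i < r" "k < r" for i k
    unfolding \<theta>e[OF that] E0[OF that] by (simp add: \<delta>_def B.minus_zero_right)
  then show ?thesis using that \<theta> by blast
qed

end

subsection \<open>Descent of alternating maps to a quotient\<close>

text \<open>A map given in one degree only becomes a function on all lists through extension by
  zero; the conditions for \<open>alternating\<close> never compare lists of different
  lengths.\<close>

lemma (in exterior) alternating_degree:
  assumes Z: "module R Z" and h: "lin_map R (Pw k) Z h"
  shows "alternating R M Z (\<lambda>xs. if int (length xs) = k then h (wl xs) else \<zero>\<^bsub>Z\<^esub>)"
proof -
  interpret Z: module R Z by fact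
  note H = lin_mapD[OF h] and D = alternatingD[OF wl_alternating]
  have add: "x \<oplus>\<^bsub>Pw k\<^esub> y = x \<oplus>\<^bsub>Ext\<^esub> y" and smult: "a \<odot>\<^bsub>Pw k\<^esub> x = a \<odot>\<^bsub>Ext\<^esub> x" for x y a by (simp_all add: Pw_simps)
  have zero: "h \<zero>\<^bsub>Ext\<^esub> = \<zero>\<^bsub>Z\<^esub>" using lin_map_zero[OF Pw_module Z h] by (simp add: Pw_simps)
  show ?thesis
  proof (rule alternatingI, goal_cases)
    case (1 xs) then show ?case using H(1) wl_Pw by simp
  next
    case (2 xs ys m m')
    then show ?case using D(2)[of xs ys m m'] H(2)[OF wl_Pw wl_Pw, of "xs @ m # ys" "xs @ m' # ys"] by (simp add: add)
  next
    case (3 xs ys a m)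
    then show ?case using D(3)[of xs ys a m] H(3)[OF _ wl_Pw, of a "xs @ m # ys"] by (simp add: smult)
  next
    case (4 xs ys m)
    then show ?case using D(4)[of xs ys m] zero by simp
  qed
qed

section \<open>The canonical map of differentials and its kernel\<close>

locale quotient_setting =
  fixes K :: "('k, 'l) ring_scheme" and A :: "('a, 'm) ring_scheme" and \<iota> :: "'k \<Rightarrow> 'a"
    and B :: "('b, 'n) ring_scheme" and \<pi> :: "'a \<Rightarrow> 'b" and fs :: "'a list"
  assumes K: "cring K" and A: "cring A" and \<iota>: "\<iota> \<in> ring_hom K A" and B: "cring B" and \<pi>: "\<pi> \<in> ring_hom A B"
    and onto: "\<pi> ` carrier A = carrier B" and fs: "set fs \<subseteq> carrier A" and ker: "a_kernel A B \<pi> = Idl\<^bsub>A\<^esub> (set fs)"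
begin

sublocale A: cring A by (rule A)
sublocale B: cring B by (rule B)
sublocale \<pi>: ring_hom_ring A B \<pi> by (rule ring_hom_ringI2[OF A.ring_axioms B.ring_axioms \<pi>])
sublocale kA: kahler K A \<iota> by (rule kahler.intro[OF K A \<iota>])
sublocale kB: kahler K B "\<pi> \<circ> \<iota>" by (rule kahler.intro[OF K B ring_hom_trans[OF \<iota> \<pi>]])
sublocale EA: exterior A "kahler_module K A \<iota>" by (rule exterior.intro[OF kA.Omega_module])
sublocale EB: exterior B "kahler_module K B (\<pi> \<circ> \<iota>)" by (rule exterior.intro[OF kB.Omega_module])

abbreviation "\<Omega>A \<equiv> kahler_module K A \<iota>"
abbreviation "\<Omega>B \<equiv> kahler_module K B (\<pi> \<circ> \<iota>)"
abbreviation "dA \<equiv> universal_derivation K A \<iota>"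
abbreviation "dB \<equiv> universal_derivation K B (\<pi> \<circ> \<iota>)"

lemma fs_zero: "x \<in> set fs \<Longrightarrow> \<pi> x = \<zero>\<^bsub>B\<^esub>"
  using A.genideal_self[OF fs] ker unfolding a_kernel_def' by blast

definition psi where
  "psi = (SOME h. lin_map A \<Omega>A (restr \<pi> \<Omega>B) h \<and> (\<forall>a\<in>carrier A. h (dA a) = dB (\<pi> a)))"

lemma psi: "lin_map A \<Omega>A (restr \<pi> \<Omega>B) psi" "a \<in> carrier A \<Longrightarrow> psi (dA a) = dB (\<pi> a)"
proof -
  have "derivation K A \<iota> (restr \<pi> \<Omega>B) (\<lambda>a. dB (\<pi> a))"
    unfolding derivation_def by (auto simp: kB.d_simps(1-3)) (use kB.d_simps(4) in auto)
  from kA.Omega_universal[OF restr_is_module[OF A kB.Omega_module \<pi>] this]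
  obtain h where "lin_map A \<Omega>A (restr \<pi> \<Omega>B) h" "\<And>a. a \<in> carrier A \<Longrightarrow> h (dA a) = dB (\<pi> a)" by blast
  then have "\<exists>h. lin_map A \<Omega>A (restr \<pi> \<Omega>B) h \<and> (\<forall>a\<in>carrier A. h (dA a) = dB (\<pi> a))" by (intro exI[of _ h] conjI) simp_all
  from someI_ex[OF this] have "lin_map A \<Omega>A (restr \<pi> \<Omega>B) psi \<and> (\<forall>a\<in>carrier A. psi (dA a) = dB (\<pi> a))"
    unfolding psi_def .
  then show "lin_map A \<Omega>A (restr \<pi> \<Omega>B) psi" "a \<in> carrier A \<Longrightarrow> psi (dA a) = dB (\<pi> a)" by simp_all
qed

lemma psi_simps:
  "x \<in> carrier \<Omega>A \<Longrightarrow> psi x \<in> carrier \<Omega>B"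
  "x \<in> carrier \<Omega>A \<Longrightarrow> y \<in> carrier \<Omega>A \<Longrightarrow> psi (x \<oplus>\<^bsub>\<Omega>A\<^esub> y) = psi x \<oplus>\<^bsub>\<Omega>B\<^esub> psi y"
  "a \<in> carrier A \<Longrightarrow> x \<in> carrier \<Omega>A \<Longrightarrow> psi (a \<odot>\<^bsub>\<Omega>A\<^esub> x) = \<pi> a \<odot>\<^bsub>\<Omega>B\<^esub> psi x"
  using lin_mapD[OF psi(1)] by simp_all

lemma psi_fs: "x \<in> set fs \<Longrightarrow> psi (dA x) = \<zero>\<^bsub>\<Omega>B\<^esub>"
  using psi(2)[of x] fs fs_zero kB.d_zero by auto

lemma psi_onto: "psi ` carrier \<Omega>A = carrier \<Omega>B"
proof
  show "psi ` carrier \<Omega>A \<subseteq> carrier \<Omega>B" using psi_simps(1) by blast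
  have "submodule (psi ` carrier \<Omega>A) B \<Omega>B"
  proof (rule kB.Om.submoduleI')
    have z: "\<zero>\<^bsub>\<Omega>B\<^esub> = psi \<zero>\<^bsub>\<Omega>A\<^esub>"
      using lin_map_zero[OF kA.Omega_module restr_is_module[OF A kB.Omega_module \<pi>] psi(1)] by simp
    show "\<zero>\<^bsub>\<Omega>B\<^esub> \<in> psi ` carrier \<Omega>A" unfolding z by (rule imageI) simp
    fix x y assume "x \<in> psi ` carrier \<Omega>A" "y \<in> psi ` carrier \<Omega>A"
    then obtain a b where "a \<in> carrier \<Omega>A" "b \<in> carrier \<Omega>A" "x = psi a" "y = psi b" by blast
    then show "x \<oplus>\<^bsub>\<Omega>B\<^esub> y \<in> psi ` carrier \<Omega>A" using psi_simps(2)[of a b, symmetric] by simp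
  next
    fix b x assume "b \<in> carrier B" "x \<in> psi ` carrier \<Omega>A"
    then obtain a y where "a \<in> carrier A" "b = \<pi> a" "y \<in> carrier \<Omega>A" "x = psi y" using onto by blast
    then show "b \<odot>\<^bsub>\<Omega>B\<^esub> x \<in> psi ` carrier \<Omega>A" using psi_simps(3)[of a y, symmetric] by simp
  qed (use psi_simps(1) in blast)
  then show "carrier \<Omega>B \<subseteq> psi ` carrier \<Omega>A"
  proof (rule subsetI[OF kB.Omega_induct])
    fix b assume "b \<in> carrier B"
    then obtain a where a: "a \<in> carrier A" "b = \<pi> a" using onto by blast
    then show "dB b \<in> psi ` carrier \<Omega>A" using psi(2)[of a, symmetric] kA.d_simps(1) by simp
  qed
qed

text \<open>A section of \<open>psi\<close> on sets only. Descended maps are defined through it, and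
  their linearity comes from independence of the choice.\<close>

definition sig where "sig y = (SOME x. x \<in> carrier \<Omega>A \<and> psi x = y)"

lemma sig: "y \<in> carrier \<Omega>B \<Longrightarrow> sig y \<in> carrier \<Omega>A" "y \<in> carrier \<Omega>B \<Longrightarrow> psi (sig y) = y"
proof -
  have "y \<in> carrier \<Omega>B \<Longrightarrow> \<exists>x. x \<in> carrier \<Omega>A \<and> psi x = y" unfolding psi_onto[symmetric] by auto
  from someI_ex[OF this] show "y \<in> carrier \<Omega>B \<Longrightarrow> sig y \<in> carrier \<Omega>A" "y \<in> carrier \<Omega>B \<Longrightarrow> psi (sig y) = y"
    unfolding sig_def by blast+
qed

text \<open>Right exactness of the conormal sequence in the form needed: a linear map into a
  \<open>B\<close>-module that kills the differentials of the generators depends only on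
  \<open>psi\<close>, since it induces a derivation of \<open>B\<close>.\<close>

lemma linear_descends:
  assumes Z: "module B Z" and l: "lin_map A \<Omega>A (restr \<pi> Z) l" and v: "\<And>x. x \<in> set fs \<Longrightarrow> l (dA x) = \<zero>\<^bsub>Z\<^esub>"
    and xy: "x \<in> carrier \<Omega>A" "y \<in> carrier \<Omega>A" "psi x = psi y"
  shows "l x = l y"
proof -
  interpret Z: module B Z by fact
  have rZ: "module A (restr \<pi> Z)" by (rule restr_is_module[OF A Z \<pi>])
  note L = lin_mapD[OF l, simplified]
  \<comment> \<open>The condition that \<open>a\<close> maps to zero in \<open>B\<close> makes the
    second Leibniz term vanish, so the set is closed under multiplication by ring elements.\<close>
  have "ideal {a \<in> carrier A. \<pi> a = \<zero>\<^bsub>B\<^esub> \<and> l (dA a) = \<zero>\<^bsub>Z\<^esub>} A"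
  proof (rule A.idealI')
    show "\<zero>\<^bsub>A\<^esub> \<in> {a \<in> carrier A. \<pi> a = \<zero>\<^bsub>B\<^esub> \<and> l (dA a) = \<zero>\<^bsub>Z\<^esub>}"
      using lin_map_zero[OF kA.Omega_module rZ l] kA.d_zero by simp
  qed (auto simp: kA.d_simps L)
  then have "Idl\<^bsub>A\<^esub> (set fs) \<subseteq> {a \<in> carrier A. \<pi> a = \<zero>\<^bsub>B\<^esub> \<and> l (dA a) = \<zero>\<^bsub>Z\<^esub>}"
    by (rule A.genideal_minimal) (use fs fs_zero v in auto)
  then have kerl: "l (dA a) = \<zero>\<^bsub>Z\<^esub>" if "a \<in> carrier A" "\<pi> a = \<zero>\<^bsub>B\<^esub>" for a
    using that ker unfolding a_kernel_def' by blast
  define s where "s b = (SOME a. a \<in> carrier A \<and> \<pi> a = b)" for b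
  have s: "s b \<in> carrier A" "\<pi> (s b) = b" if "b \<in> carrier B" for b
  proof -
    have "\<exists>a. a \<in> carrier A \<and> \<pi> a = b" using that unfolding onto[symmetric] by auto
    from someI_ex[OF this] show "s b \<in> carrier A" "\<pi> (s b) = b" unfolding s_def by auto
  qed
  have eq: "l (dA a) = l (dA a')" if "a \<in> carrier A" "a' \<in> carrier A" "\<pi> a = \<pi> a'" for a a'
  proof -
    have "\<pi> (a \<ominus>\<^bsub>A\<^esub> a') = \<zero>\<^bsub>B\<^esub>" using that by (simp add: a_minus_def B.r_neg)
    then have "l (dA a \<ominus>\<^bsub>\<Omega>A\<^esub> dA a') = \<zero>\<^bsub>Z\<^esub>" using kerl[of "a \<ominus>\<^bsub>A\<^esub> a'"] that kA.d_minus by simp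
    then have "l (dA a) \<ominus>\<^bsub>Z\<^esub> l (dA a') = \<zero>\<^bsub>Z\<^esub>"
      using lin_map_minus[OF kA.Omega_module rZ l] that kA.d_simps(1) by simp
    then show ?thesis using Z.M.minus_zero_iff L(1) kA.d_simps(1) that by simp
  qed
  have "derivation K B (\<pi> \<circ> \<iota>) Z (\<lambda>b. l (dA (s b)))"
    unfolding derivation_def
  proof (intro conjI ballI)
    show "(\<lambda>b. l (dA (s b))) \<in> carrier B \<rightarrow> carrier Z" using L(1) kA.d_simps(1) s by auto
    fix b c assume bc: "b \<in> carrier B" "c \<in> carrier B"
    have "l (dA (s (b \<oplus>\<^bsub>B\<^esub> c))) = l (dA (s b \<oplus>\<^bsub>A\<^esub> s c))" by (rule eq) (use s bc in simp_all)
    then show "l (dA (s (b \<oplus>\<^bsub>B\<^esub> c))) = l (dA (s b)) \<oplus>\<^bsub>Z\<^esub> l (dA (s c))" using s bc by (simp add: kA.d_simps L)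
    have "l (dA (s (b \<otimes>\<^bsub>B\<^esub> c))) = l (dA (s b \<otimes>\<^bsub>A\<^esub> s c))" by (rule eq) (use s bc in simp_all)
    then show "l (dA (s (b \<otimes>\<^bsub>B\<^esub> c))) = b \<odot>\<^bsub>Z\<^esub> l (dA (s c)) \<oplus>\<^bsub>Z\<^esub> c \<odot>\<^bsub>Z\<^esub> l (dA (s b))" using s bc by (simp add: kA.d_simps L)
  next
    fix c assume c: "c \<in> carrier K"
    have "l (dA (s ((\<pi> \<circ> \<iota>) c))) = l (dA (\<iota> c))" by (rule eq) (use s kA.iota_closed[OF c] in simp_all)
    then show "l (dA (s ((\<pi> \<circ> \<iota>) c))) = \<zero>\<^bsub>Z\<^esub>" using kA.d_simps(4)[OF c] lin_map_zero[OF kA.Omega_module rZ l] by simp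
  qed
  from kB.Omega_universal[OF Z this] obtain lb where lb: "lin_map B \<Omega>B Z lb" "\<And>b. b \<in> carrier B \<Longrightarrow> lb (dB b) = l (dA (s b))"
    by blast
  note LB = lin_mapD[OF lb(1)]
  have "lb (psi w) = l w" if "w \<in> carrier \<Omega>A" for w
  proof -
    have "submodule {w \<in> carrier \<Omega>A. lb (psi w) = l w} A \<Omega>A"
    proof (rule kA.Om.submoduleI')
      have "psi \<zero>\<^bsub>\<Omega>A\<^esub> = \<zero>\<^bsub>\<Omega>B\<^esub>" using lin_map_zero[OF kA.Omega_module restr_is_module[OF A kB.Omega_module \<pi>] psi(1)] by simp
      then show "\<zero>\<^bsub>\<Omega>A\<^esub> \<in> {w \<in> carrier \<Omega>A. lb (psi w) = l w}"
        using lin_map_zero[OF kA.Omega_module rZ l] lin_map_zero[OF kB.Omega_module Z lb(1)] by simp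
    qed (auto simp: psi_simps L LB)
    from kA.Omega_induct[OF this _ that] show ?thesis
      using psi(2) lb(2) eq[OF s(1)] s(2) kA.d_simps(1) by auto
  qed
  then show ?thesis using xy by metis
qed

lemma alternating_slot:
  assumes G: "alternating A \<Omega>A (restr \<pi> Z) G" and "set p \<subseteq> carrier \<Omega>A" "set q \<subseteq> carrier \<Omega>A"
  shows "lin_map A \<Omega>A (restr \<pi> Z) (\<lambda>x. G (p @ x # q))"
  by (rule lin_mapI) (use alternatingD[OF G] assms(2,3) in auto)

text \<open>Each slot separately depends only on the image under \<open>psi\<close>, so arguments
  may be exchanged one by one. This yields an alternating map on the differentials of
  \<open>B\<close>, and then a linear map on its forms.\<close>

theorem alternating_descends:
  assumes Z: "module B Z" and G: "alternating A \<Omega>A (restr \<pi> Z) G"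
    and v: "\<And>p x q. x \<in> set fs \<Longrightarrow> set p \<subseteq> carrier \<Omega>A \<Longrightarrow> set q \<subseteq> carrier \<Omega>A \<Longrightarrow> G (p @ dA x # q) = \<zero>\<^bsub>Z\<^esub>"
  obtains g where "lin_map B EB.Ext Z g" "\<And>xs. set xs \<subseteq> carrier \<Omega>A \<Longrightarrow> g (EB.wl (map psi xs)) = G xs"
proof -
  interpret Z: module B Z by fact
  note D = alternatingD[OF G, simplified]
  have slot: "G (p @ x # q) = G (p @ y # q)"
    if "set p \<subseteq> carrier \<Omega>A" "set q \<subseteq> carrier \<Omega>A" "x \<in> carrier \<Omega>A" "y \<in> carrier \<Omega>A" "psi x = psi y" for p q x y
    using linear_descends[OF Z alternating_slot[OF G that(1,2)] _ that(3-5)] v that(1,2) by simp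
  have dep: "G (p @ xs) = G (p @ ys)"
    if "set p \<subseteq> carrier \<Omega>A" "set xs \<subseteq> carrier \<Omega>A" "set ys \<subseteq> carrier \<Omega>A" "map psi xs = map psi ys" for p xs ys
    using that
  proof (induction xs arbitrary: ys p)
    case (Cons x xs)
    then obtain y ys' where ys: "ys = y # ys'" "psi x = psi y" "map psi xs = map psi ys'" by auto
    have "G (p @ x # xs) = G (p @ y # xs)" by (rule slot) (use Cons.prems ys in auto)
    also have "\<dots> = G ((p @ [y]) @ ys')" using Cons.IH[of "p @ [y]" ys'] Cons.prems ys by simp
    finally show ?case using ys by simp
  qed simp
  define Gb where "Gb ys = G (map sig ys)" for ys
  have Gb: "Gb (map psi xs) = G xs" if "set xs \<subseteq> carrier \<Omega>A" for xs
  proof -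
    have "map psi (map sig (map psi xs)) = map psi xs" using that sig(2)[OF psi_simps(1)] by auto
    moreover have "set (map sig (map psi xs)) \<subseteq> carrier \<Omega>A" using that sig(1)[OF psi_simps(1)] by auto
    ultimately show ?thesis unfolding Gb_def using dep[of "[]" "map sig (map psi xs)" xs] that by simp
  qed
  have ms: "map psi (map sig ys) = ys" "set (map sig ys) \<subseteq> carrier \<Omega>A" if "set ys \<subseteq> carrier \<Omega>B" for ys
    using that sig by (auto intro!: map_idI)
  have "alternating B \<Omega>B Z Gb"
  proof (rule alternatingI, goal_cases)
    case (1 xs) then show ?case unfolding Gb_def by (intro D(1) ms(2))
  next
    case (2 xs ys m m')
    note x = ms[OF 2(1)] and y = ms[OF 2(2)]
    have "Gb (xs @ (m \<oplus>\<^bsub>\<Omega>B\<^esub> m') # ys) = Gb (map psi (map sig xs @ (sig m \<oplus>\<^bsub>\<Omega>A\<^esub> sig m') # map sig ys))"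
      using x(1) y(1) 2 sig by (simp add: psi_simps)
    also have "\<dots> = G (map sig xs @ (sig m \<oplus>\<^bsub>\<Omega>A\<^esub> sig m') # map sig ys)" by (rule Gb) (use x(2) y(2) 2 sig in simp)
    finally show ?case using D(2)[OF x(2) y(2)] 2 sig(1) by (simp add: Gb_def)
  next
    case (3 xs ys b m)
    note x = ms[OF 3(1)] and y = ms[OF 3(2)]
    obtain a where a: "a \<in> carrier A" "b = \<pi> a" using 3 onto by blast
    have "Gb (xs @ (b \<odot>\<^bsub>\<Omega>B\<^esub> m) # ys) = Gb (map psi (map sig xs @ (a \<odot>\<^bsub>\<Omega>A\<^esub> sig m) # map sig ys))"
      using x(1) y(1) 3 sig a by (simp add: psi_simps)
    also have "\<dots> = G (map sig xs @ (a \<odot>\<^bsub>\<Omega>A\<^esub> sig m) # map sig ys)" by (rule Gb) (use x(2) y(2) 3 sig a in simp)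
    finally show ?case using D(3)[OF x(2) y(2) a(1)] 3 sig(1) a by (simp add: Gb_def)
  next
    case (4 xs ys m)
    then show ?case using D(4)[OF ms(2)[OF 4(1)] ms(2)[OF 4(2)]] sig(1) by (simp add: Gb_def)
  qed
  from EB.Ext_universal[OF Z this] obtain g where g: "lin_map B EB.Ext Z g" "\<And>xs. set xs \<subseteq> carrier \<Omega>B \<Longrightarrow> g (EB.wl xs) = Gb xs"
    by blast
  have "g (EB.wl (map psi xs)) = G xs" if "set xs \<subseteq> carrier \<Omega>A" for xs
    using g(2)[of "map psi xs"] Gb[OF that] that psi_simps(1) by auto
  then show ?thesis using that g(1) by blast
qed

end

subsection \<open>The comparison isomorphism\<close>

lemma contract_zero:
  assumes "module B Z" "\<theta> \<in> carrier M \<rightarrow> carrier B" "\<And>l. set l \<subseteq> carrier M \<Longrightarrow> G l = \<zero>\<^bsub>Z\<^esub>" "set xs \<subseteq> carrier M"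
  shows "contract Z \<theta> G xs = \<zero>\<^bsub>Z\<^esub>"
  using assms(3,4)
proof (induction xs arbitrary: G)
  case (Cons y ys)
  interpret Z: module B Z by fact
  have "contract Z \<theta> (\<lambda>l. G (y # l)) ys = \<zero>\<^bsub>Z\<^esub>" by (rule Cons.IH) (use Cons.prems in auto)
  then show ?case using Cons.prems assms(2) by (simp add: Pi_iff Z.M.minus_zero_iff)
qed simp

lemma (in kahler) foldr_d_wedge:
  assumes "set gs \<subseteq> carrier A"
  shows "lin_map A (all_forms K A \<iota>) (all_forms K A \<iota>) (foldr (d_wedge K A \<iota>) gs)"
    and "set xs \<subseteq> carrier \<Omega> \<Longrightarrow> foldr (d_wedge K A \<iota>) gs (wedge_list A \<Omega> xs) = wedge_list A \<Omega> (map d gs @ xs)"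
    and "x \<in> carrier (forms K A \<iota> k) \<Longrightarrow> foldr (d_wedge K A \<iota>) gs x \<in> carrier (forms K A \<iota> (k + int (length gs)))"
proof -
  interpret E: exterior A "kahler_module K A \<iota>" by (rule exterior.intro[OF Omega_module])
  have w: "d_wedge K A \<iota> g = (\<lambda>x. E.wl [d g] \<otimes>\<^bsub>E.Ext\<^esub> x)" for g
    by (simp add: fun_eq_iff d_wedge_def dfun_def all_forms_def)
  note L = E.left_wedge E.left_wedge_Pw
  show "lin_map A (all_forms K A \<iota>) (all_forms K A \<iota>) (foldr (d_wedge K A \<iota>) gs)"
    using assms
  proof (induction gs)
    case Nil show ?case by (rule lin_mapI) auto
  next
    case (Cons g gs)
    have "lin_map A E.Ext E.Ext (d_wedge K A \<iota> g)" unfolding w by (rule L(1)) (use Cons.prems d_simps(1) in auto)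
    from lin_map_comp[OF Cons.IH[unfolded all_forms_def] this] Cons.prems show ?case by (simp add: all_forms_def comp_def)
  qed
  show "set xs \<subseteq> carrier \<Omega> \<Longrightarrow> foldr (d_wedge K A \<iota>) gs (E.wl xs) = E.wl (map d gs @ xs)"
    using assms
  proof (induction gs)
    case (Cons g gs)
    then have "set (map d gs @ xs) \<subseteq> carrier \<Omega>" "d g \<in> carrier \<Omega>" using d_simps(1) by auto
    then show ?case using Cons L(2)[of "d g" "map d gs @ xs"] by (simp add: w)
  qed simp
  show "x \<in> carrier (forms K A \<iota> k) \<Longrightarrow> foldr (d_wedge K A \<iota>) gs x \<in> carrier (forms K A \<iota> (k + int (length gs)))"
    using assms
  proof (induction gs)
    case (Cons g gs)
    then have "foldr (d_wedge K A \<iota>) gs x \<in> carrier (E.Pw (k + int (length gs)))" "d g \<in> carrier \<Omega>"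
      using d_simps(1) by (auto simp: forms_def)
    from L(3)[OF this(2,1)] show ?case by (simp add: w[of g] forms_def add_ac)
  qed simp
qed

lemma (in kahler) foldr_d_wedge_submodule:
  assumes gs: "set gs \<subseteq> carrier A" and m: "k + int (length gs) = m"
  shows "submodule ((\<lambda>\<omega>. foldr (d_wedge K A \<iota>) gs \<omega>) ` carrier (forms K A \<iota> k)) A (forms K A \<iota> m)"
proof -
  interpret E: exterior A "kahler_module K A \<iota>" by (rule exterior.intro[OF Omega_module])
  note fold = foldr_d_wedge[OF gs, unfolded all_forms_def forms_def]
  show ?thesis unfolding forms_def E.Pw_sub_iff
  proof (intro conjI subsetI)
    show "submodule (foldr (d_wedge K A \<iota>) gs ` carrier (E.Pw k)) A E.Ext"
      by (rule lin_map_image_submodule[OF E.Ext_module E.Ext_module fold(1) E.Pw_submodule])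
    fix y assume "y \<in> foldr (d_wedge K A \<iota>) gs ` carrier (E.Pw k)"
    then show "y \<in> carrier (E.Pw m)" using fold(3) m by auto
  qed
qed

lemma zero_ring_module:
  assumes "module R M" "\<one>\<^bsub>R\<^esub> = \<zero>\<^bsub>R\<^esub>" shows "carrier M = {\<zero>\<^bsub>M\<^esub>}"
proof -
  interpret module R M by fact
  have "x = \<zero>\<^bsub>M\<^esub>" if "x \<in> carrier M" for x using smult_one[OF that] assms(2) that by simp
  then show ?thesis by auto
qed

context quotient_setting begin

text \<open>Over the zero ring both sides are zero modules. The degree \<open>k\<close> is an
  arbitrary integer here, since it can be negative when nothing bounds the number of
  generators.\<close>

lemma koszul_comparison_zero_ring:
  assumes zero: "\<one>\<^bsub>B\<^esub> = \<zero>\<^bsub>B\<^esub>" and f: "f \<in> carrier A" and k: "k + int (length fs) = m"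
  shows "\<exists>h. h \<in> module_iso B
      (cohomology (forms K B (\<pi> \<circ> \<iota>)) (d_wedge K B (\<pi> \<circ> \<iota>) (\<pi> f)) k)
      (tensor_product A B \<pi> (quot_module (forms K A \<iota> m)
        ((\<lambda>\<omega>. foldr (d_wedge K A \<iota>) (f # fs) \<omega>) ` carrier (forms K A \<iota> (k - 1)))))"
proof -
  let ?Q = "quot_module (forms K A \<iota> m) ((\<lambda>\<omega>. foldr (d_wedge K A \<iota>) (f # fs) \<omega>) ` carrier (forms K A \<iota> (k - 1)))"
  have W: "submodule ((\<lambda>\<omega>. foldr (d_wedge K A \<iota>) (f # fs) \<omega>) ` carrier (forms K A \<iota> (k - 1))) A (forms K A \<iota> m)"
    by (rule kA.foldr_d_wedge_submodule) (use f fs k in auto)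
  have P: "module A (forms K A \<iota> m)" unfolding forms_def by (rule EA.Pw_module)
  have Q: "module A ?Q" by (rule module.quot_is_module[OF P W])
  interpret bc: base_change A B \<pi> ?Q by (rule base_change.intro[OF B \<pi> Q])
  let ?T = "tensor_product A B \<pi> ?Q"
  have T: "carrier ?T = {\<zero>\<^bsub>?T\<^esub>}" by (rule zero_ring_module[OF bc.T_module zero])
  have Pk: "carrier (EB.Pw k) = {\<zero>\<^bsub>EB.Ext\<^esub>}" using zero_ring_module[OF EB.Pw_module zero] by (simp add: EB.Pw_simps)
  have v0: "dB (\<pi> f) \<in> carrier \<Omega>B" using f kB.d_simps(1) by simp
  have "d_wedge K B (\<pi> \<circ> \<iota>) (\<pi> f) \<zero>\<^bsub>EB.Ext\<^esub> = \<zero>\<^bsub>EB.Ext\<^esub>"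
    using lin_map_zero[OF EB.Ext_module EB.Ext_module EB.left_wedge(1)[OF v0]] by (simp add: d_wedge_def dfun_def all_forms_def)
  then have "{x \<in> carrier (EB.Pw k). d_wedge K B (\<pi> \<circ> \<iota>) (\<pi> f) x = \<zero>\<^bsub>EB.Pw (k + 1)\<^esub>} = {\<zero>\<^bsub>EB.Ext\<^esub>}"
    using Pk by (auto simp: EB.Pw_simps(1))
  then have "\<exists>c. carrier (cohomology (forms K B (\<pi> \<circ> \<iota>)) (d_wedge K B (\<pi> \<circ> \<iota>) (\<pi> f)) k) = {c}"
    by (simp add: cohomology_def forms_def quot_module_def A_RCOSETS_def')
  then obtain c where c: "carrier (cohomology (forms K B (\<pi> \<circ> \<iota>)) (d_wedge K B (\<pi> \<circ> \<iota>) (\<pi> f)) k) = {c}" by blast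
  have "(\<lambda>_. \<zero>\<^bsub>?T\<^esub>) \<in> module_iso B (cohomology (forms K B (\<pi> \<circ> \<iota>)) (d_wedge K B (\<pi> \<circ> \<iota>) (\<pi> f)) k) ?T"
    unfolding module_iso_def c T
  proof (intro CollectI conjI ballI)
    show "\<zero>\<^bsub>?T\<^esub> = \<zero>\<^bsub>?T\<^esub> \<oplus>\<^bsub>?T\<^esub> \<zero>\<^bsub>?T\<^esub>" by (rule bc.T.M.l_zero[symmetric]) (rule bc.T.M.zero_closed)
    show "\<zero>\<^bsub>?T\<^esub> = a \<odot>\<^bsub>?T\<^esub> \<zero>\<^bsub>?T\<^esub>" if "a \<in> carrier B" for a by (rule bc.T.smult_r_null[OF that, symmetric])
  qed (simp add: bij_betw_def)
  then show ?thesis by blast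
qed

text \<open>Contracting with all \<open>\<Theta> i\<close> undoes prefixing the \<open>e k\<close>.
  The hypothesis that \<open>G\<close> vanishes on lists containing some \<open>e k\<close> removes
  all terms of the alternating sums but the leading one.\<close>

lemma iterated_contraction:
  assumes Z: "module B Z" and G: "alternating A \<Omega>A (restr \<pi> Z) G"
    and \<Theta>: "\<And>i. i < r \<Longrightarrow> lin_map A \<Omega>A (restr \<pi> (self_module B)) (\<Theta> i)"
    and e: "\<And>k. k < r \<Longrightarrow> e k \<in> carrier \<Omega>A"
    and dual: "\<And>i k. i < r \<Longrightarrow> k < r \<Longrightarrow> \<Theta> i (e k) = (if i = k then \<one>\<^bsub>B\<^esub> else \<zero>\<^bsub>B\<^esub>)"
    and G0: "\<And>k l. k < r \<Longrightarrow> set l \<subseteq> carrier \<Omega>A \<Longrightarrow> e k \<in> set l \<Longrightarrow> G l = \<zero>\<^bsub>Z\<^esub>"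
  obtains C where "alternating A \<Omega>A (restr \<pi> Z) C"
    "\<And>xs. set xs \<subseteq> carrier \<Omega>A \<Longrightarrow> C (map e [0..<r] @ xs) = G xs"
proof -
  interpret Z: module B Z by fact
  define C where "C j = foldr (\<lambda>i G. contract Z (\<Theta> i) G) [j..<r] G" for j
  have Cs: "C j = contract Z (\<Theta> j) (C (Suc j))" if "j < r" for j unfolding C_def using that by (simp add: upt_conv_Cons)
  \<comment> \<open>Downward induction from \<open>r\<close>, as \<open>C j\<close> contracts with
    \<open>\<Theta> j\<close> last. The invariant says that \<open>C j\<close> still vanishes on
    lists containing \<open>e k\<close> for \<open>k < j\<close>; duality preserves it.\<close>
  have "alternating A \<Omega>A (restr \<pi> Z) (C 0) \<and> (\<forall>k l. k < 0 \<longrightarrow> set l \<subseteq> carrier \<Omega>A \<longrightarrow> e k \<in> set l \<longrightarrow> C 0 l = \<zero>\<^bsub>Z\<^esub>)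
    \<and> (\<forall>xs. set xs \<subseteq> carrier \<Omega>A \<longrightarrow> C 0 (map e [0..<r] @ xs) = G xs)"
  proof (rule inc_induct[of 0 r])
    show "alternating A \<Omega>A (restr \<pi> Z) (C r) \<and> (\<forall>k l. k < r \<longrightarrow> set l \<subseteq> carrier \<Omega>A \<longrightarrow> e k \<in> set l \<longrightarrow> C r l = \<zero>\<^bsub>Z\<^esub>)
      \<and> (\<forall>xs. set xs \<subseteq> carrier \<Omega>A \<longrightarrow> C r (map e [r..<r] @ xs) = G xs)"
      using G G0 by (simp add: C_def)
    fix j assume j: "0 \<le> j" "j < r" and IH: "alternating A \<Omega>A (restr \<pi> Z) (C (Suc j)) \<and>
      (\<forall>k l. k < Suc j \<longrightarrow> set l \<subseteq> carrier \<Omega>A \<longrightarrow> e k \<in> set l \<longrightarrow> C (Suc j) l = \<zero>\<^bsub>Z\<^esub>)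
      \<and> (\<forall>xs. set xs \<subseteq> carrier \<Omega>A \<longrightarrow> C (Suc j) (map e [Suc j..<r] @ xs) = G xs)"
    note t = lin_mapD(1)[OF \<Theta>[OF j(2)], simplified]
    have IH1: "alternating A \<Omega>A (restr \<pi> Z) (C (Suc j))"
      and IH2: "\<And>k l. k < Suc j \<Longrightarrow> set l \<subseteq> carrier \<Omega>A \<Longrightarrow> e k \<in> set l \<Longrightarrow> C (Suc j) l = \<zero>\<^bsub>Z\<^esub>"
      and IH3: "\<And>xs. set xs \<subseteq> carrier \<Omega>A \<Longrightarrow> C (Suc j) (map e [Suc j..<r] @ xs) = G xs" using IH by blast+
    note D = alternatingD[OF IH1, simplified]
    show "alternating A \<Omega>A (restr \<pi> Z) (C j) \<and> (\<forall>k l. k < j \<longrightarrow> set l \<subseteq> carrier \<Omega>A \<longrightarrow> e k \<in> set l \<longrightarrow> C j l = \<zero>\<^bsub>Z\<^esub>)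
      \<and> (\<forall>xs. set xs \<subseteq> carrier \<Omega>A \<longrightarrow> C j (map e [j..<r] @ xs) = G xs)"
      unfolding Cs[OF j(2)]
    proof (intro conjI allI impI)
      show "alternating A \<Omega>A (restr \<pi> Z) (contract Z (\<Theta> j) (C (Suc j)))"
        by (rule contract_alternating[OF A \<pi> Z kA.Omega_module \<Theta>[OF j(2)] IH1])
      fix k l assume k: "k < j" and l: "set l \<subseteq> carrier \<Omega>A" "e k \<in> set l"
      show "contract Z (\<Theta> j) (C (Suc j)) l = \<zero>\<^bsub>Z\<^esub>"
        by (rule contract_vanish[OF Z, of _ \<Omega>A "e k"]) (use t dual[of j k] k j D(1) IH2[of k] l in auto)
    next
      fix xs assume xs: "set xs \<subseteq> carrier \<Omega>A"
      have c: "set (map e [Suc j..<r] @ xs) \<subseteq> carrier \<Omega>A" using e xs by auto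
      have "contract Z (\<Theta> j) (\<lambda>l. C (Suc j) (e j # l)) (map e [Suc j..<r] @ xs) = \<zero>\<^bsub>Z\<^esub>"
        by (rule contract_zero[OF Z, of _ \<Omega>A]) (use t IH2[of j] e[OF j(2)] c in auto)
      moreover have "map e [j..<r] @ xs = e j # map e [Suc j..<r] @ xs" using j(2) by (simp add: upt_conv_Cons)
      ultimately show "contract Z (\<Theta> j) (C (Suc j)) (map e [j..<r] @ xs) = G xs"
        using dual[OF j(2) j(2)] IH3[OF xs] D(1)[OF c] by (simp add: Z.M.minus_zero_right)
    qed
  qed simp
  then show ?thesis using that by blast
qed

lemma alternating_pullback:
  assumes g: "alternating B \<Omega>B Z g"
  shows "alternating A \<Omega>A (restr \<pi> Z) (\<lambda>xs. g (map psi xs))"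
proof -
  note D = alternatingD[OF g]
  have m: "set (map psi xs) \<subseteq> carrier \<Omega>B" if "set xs \<subseteq> carrier \<Omega>A" for xs using that psi_simps(1) by auto
  show ?thesis
  proof (rule alternatingI, goal_cases)
    case (1 xs) then show ?case using D(1)[OF m[OF 1]] by simp
  next
    case (2 xs ys a b)
    then show ?case using D(2)[OF m[OF 2(1)] m[OF 2(2)] psi_simps(1)[OF 2(3)] psi_simps(1)[OF 2(4)]] by (simp add: psi_simps)
  next
    case (3 xs ys b a)
    then show ?case using D(3)[OF m[OF 3(1)] m[OF 3(2)] _ psi_simps(1)[OF 3(4)], of "\<pi> b"] by (simp add: psi_simps)
  next
    case (4 xs ys a)
    then show ?case using D(4)[OF m[OF 4(1)] m[OF 4(2)] psi_simps(1)[OF 4(3)]] by simp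
  qed
qed

text \<open>The geometry enters only through \<open>vanish\<close> and the dual derivations
  \<open>\<theta>\<close>; the rest is multilinear algebra. The isomorphism is \<open>hb\<close>,
  with \<open>\<Gamma>\<close> as a left inverse.\<close>

theorem koszul_comparison:
  assumes f: "f \<in> carrier A" and r: "length fs = r" and n: "n = d + r"
    and vanish: "\<And>us. set us \<subseteq> carrier \<Omega>B \<Longrightarrow> d < length us \<Longrightarrow> EB.wl us = \<zero>\<^bsub>EB.Ext\<^esub>"
    and \<theta>: "\<And>i. i < r \<Longrightarrow> derivation K A \<iota> (restr \<pi> (self_module B)) (\<theta> i)"
    and dual: "\<And>i k. i < r \<Longrightarrow> k < r \<Longrightarrow> \<theta> i (fs ! k) = (if i = k then \<one>\<^bsub>B\<^esub> else \<zero>\<^bsub>B\<^esub>)"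
  shows "\<exists>h. h \<in> module_iso B
      (cohomology (forms K B (\<pi> \<circ> \<iota>)) (d_wedge K B (\<pi> \<circ> \<iota>) (\<pi> f)) (int d))
      (tensor_product A B \<pi> (quot_module (forms K A \<iota> (int n))
        ((\<lambda>\<omega>. foldr (d_wedge K A \<iota>) (f # fs) \<omega>) ` carrier (forms K A \<iota> (int d - 1)))))"
proof -
  define W where "W = (\<lambda>\<omega>. foldr (d_wedge K A \<iota>) (f # fs) \<omega>) ` carrier (forms K A \<iota> (int d - 1))"
  let ?P = "EA.Pw (int n)" let ?Q = "quot_module ?P W"
  let ?us = "map dA fs"
  have gs: "set (f # fs) \<subseteq> carrier A" using f fs by auto
  note fold = kA.foldr_d_wedge[OF gs, unfolded all_forms_def forms_def]
  have us: "set ?us \<subseteq> carrier \<Omega>A" using fs kA.d_simps(1) by auto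
  have u0: "dA f \<in> carrier \<Omega>A" using f kA.d_simps(1) by blast
  have Wdef: "W = foldr (d_wedge K A \<iota>) (f # fs) ` carrier (EA.Pw (int d - 1))" by (simp add: W_def forms_def)
  have W: "submodule W A ?P"
    using kA.foldr_d_wedge_submodule[OF gs, of "int d - 1" "int n"] n r unfolding W_def by (simp add: forms_def)
  interpret P: module A ?P by (rule EA.Pw_module)
  have Q: "module A ?Q" by (rule P.quot_is_module[OF W])
  interpret bc: base_change A B \<pi> ?Q by (rule base_change.intro[OF B \<pi> Q])
  let ?T = "tensor_product A B \<pi> ?Q"
  have T: "module B ?T" by (rule bc.T_module)
  have rT: "module A (restr \<pi> ?T)" by (rule restr_is_module[OF A T \<pi>])
  define h where "h x = bc.tens (W +>\<^bsub>?P\<^esub> x) \<one>\<^bsub>B\<^esub>" for x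
  have h: "lin_map A ?P (restr \<pi> ?T) h"
    unfolding h_def by (rule lin_map_comp[OF P.quot_lin[OF W] bc.tens_one])
  have hW: "h x = \<zero>\<^bsub>?T\<^esub>" if "x \<in> W" for x
  proof -
    have "W +>\<^bsub>?P\<^esub> x = \<zero>\<^bsub>?Q\<^esub>" using P.coset_eq_zero[OF W P.submoduleD(2)[OF W that]] that P.quot_zero by simp
    then show ?thesis using lin_map_zero[OF Q rT bc.tens_one] by (simp add: h_def)
  qed
  define G where "G l = (if int (length l) = int n then h (EA.wl l) else \<zero>\<^bsub>?T\<^esub>)" for l
  have G: "alternating A \<Omega>A (restr \<pi> ?T) G"
    unfolding G_def using EA.alternating_degree[OF rT h] by (simp only: restr_simps)
  have Gn: "G l = h (EA.wl l)" if "length l = n" for l using that by (simp add: G_def)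
  \<comment> \<open>Elements of \<open>W\<close> carry \<open>df\<close> in front, whereas the wedge
    map places the \<open>df_i\<close> first; the permutation between the two preserves
    vanishing.\<close>
  have GW: "G (?us @ dA f # xs) = \<zero>\<^bsub>?T\<^esub>" if xs: "set xs \<subseteq> carrier \<Omega>A" "int (length xs) = int d - 1" for xs
  proof -
    have "foldr (d_wedge K A \<iota>) (f # fs) (EA.wl xs) \<in> W" unfolding Wdef by (rule imageI[OF EA.wl_Pw[OF xs]])
    then have "EA.wl (map dA (f # fs) @ xs) \<in> W" unfolding fold(2)[OF xs(1)] .
    then have "G (map dA (f # fs) @ xs) = \<zero>\<^bsub>restr \<pi> ?T\<^esub>" using Gn[of "map dA (f # fs) @ xs"] hW xs(2) n r by simp
    from alternating_vanish_perm[OF rT kA.Omega_module G _ _ this, of "?us @ dA f # xs"]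
    show ?thesis using us u0 xs(1) by simp
  qed
  have fsv: "G l = \<zero>\<^bsub>?T\<^esub>" if "\<not> distinct l" "set l \<subseteq> carrier \<Omega>A" for l
    using alternating_vanish_repeat[OF rT kA.Omega_module G that] by simp
  \<comment> \<open>The condition for descent: the new factor repeats one of the \<open>df_i\<close>
    in the prefix.\<close>
  have "G (?us @ p @ dA x # q) = \<zero>\<^bsub>?T\<^esub>" if "x \<in> set fs" "set p \<subseteq> carrier \<Omega>A" "set q \<subseteq> carrier \<Omega>A" for p x q
    by (rule fsv) (use that us fs kA.d_simps(1) in auto)
  from alternating_descends[OF T alternating_append[OF G us] this]
  obtain \<Psi> where \<Psi>: "lin_map B EB.Ext ?T \<Psi>" "\<And>xs. set xs \<subseteq> carrier \<Omega>A \<Longrightarrow> \<Psi> (EB.wl (map psi xs)) = G (?us @ xs)"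
    by blast

  let ?PB = "EB.Pw (int d)"
  let ?\<phi> = "\<lambda>x. EB.wl [dB (\<pi> f)] \<otimes>\<^bsub>EB.Ext\<^esub> x"
  define NB where "NB = ?\<phi> ` carrier (EB.Pw (int d - 1))"
  have v0: "dB (\<pi> f) \<in> carrier \<Omega>B" using f kB.d_simps(1) by simp
  have \<phi>lin: "lin_map B EB.Ext EB.Ext ?\<phi>" by (rule EB.left_wedge(1)[OF v0])
  have wphi: "d_wedge K B (\<pi> \<circ> \<iota>) (\<pi> f) = ?\<phi>" by (simp add: fun_eq_iff d_wedge_def dfun_def all_forms_def)
  have N: "submodule NB B ?PB"
    unfolding EB.Pw_sub_iff
  proof (intro conjI subsetI)
    show "submodule NB B EB.Ext" unfolding NB_def by (rule lin_map_image_submodule[OF EB.Ext_module EB.Ext_module \<phi>lin EB.Pw_submodule])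
    fix y assume "y \<in> NB"
    then obtain x where x: "x \<in> carrier (EB.Pw (int d - 1))" "y = ?\<phi> x" unfolding NB_def by blast
    have deg: "int d - 1 + 1 = int d" by simp
    show "y \<in> carrier ?PB" unfolding x(2) using EB.left_wedge_Pw[OF v0 x(1)] unfolding deg .
  qed
  interpret PB: module B ?PB by (rule EB.Pw_module)
  let ?H = "quot_module ?PB NB"
  have \<phi>0: "?\<phi> x = \<zero>\<^bsub>EB.Ext\<^esub>" if x: "x \<in> carrier ?PB" for x
  proof -
    have "x \<in> {x \<in> carrier EB.Ext. ?\<phi> x \<in> {\<zero>\<^bsub>EB.Ext\<^esub>}}"
    proof (rule EB.Pw_induct[OF lin_map_vimage_submodule[OF EB.Ext_module EB.Ext_module \<phi>lin module.zero_submodule[OF EB.Ext_module]] _ x])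
      fix xs assume xs: "set xs \<subseteq> carrier \<Omega>B" "int (length xs) = int d"
      then have "?\<phi> (EB.wl xs) = \<zero>\<^bsub>EB.Ext\<^esub>" using EB.left_wedge(2)[OF v0 xs(1)] vanish[of "dB (\<pi> f) # xs"] v0 by simp
      then show "EB.wl xs \<in> {x \<in> carrier EB.Ext. ?\<phi> x \<in> {\<zero>\<^bsub>EB.Ext\<^esub>}}" using EB.wl_closed[OF xs(1)] by simp
    qed
    then show ?thesis by simp
  qed
  have coh: "cohomology (forms K B (\<pi> \<circ> \<iota>)) (d_wedge K B (\<pi> \<circ> \<iota>) (\<pi> f)) (int d) = ?H"
  proof -
    have "{x \<in> carrier ?PB. ?\<phi> x = \<zero>\<^bsub>EB.Pw (int d + 1)\<^esub>} = carrier ?PB" using \<phi>0 by (auto simp: EB.Pw_simps(1))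
    then show ?thesis unfolding cohomology_def wphi forms_def NB_def by simp
  qed
  have H: "module B ?H" by (rule PB.quot_is_module[OF N])
  interpret H: module B ?H by (rule H)
  have rH: "module A (restr \<pi> ?H)" by (rule restr_is_module[OF A H \<pi>])
  note cls = PB.quot_lin[OF N]
  have clsN: "NB +>\<^bsub>?PB\<^esub> x = \<zero>\<^bsub>?H\<^esub>" if "x \<in> NB" for x
    using PB.coset_eq_zero[OF N PB.submoduleD(2)[OF N that]] that PB.quot_zero by simp

  have lift: "\<exists>xs. set xs \<subseteq> carrier \<Omega>A \<and> map psi xs = ys" if "set ys \<subseteq> carrier \<Omega>B" for ys
    by (rule exI[of _ "map sig ys"]) (use that sig in \<open>auto intro!: map_idI\<close>)
  have \<Psi>N: "\<Psi> x = \<zero>\<^bsub>?T\<^esub>" if xN: "x \<in> NB" for x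
  proof -
    obtain w where w: "w \<in> carrier (EB.Pw (int d - 1))" "x = ?\<phi> w" using xN unfolding NB_def by blast
    have c: "lin_map B EB.Ext ?T (\<lambda>w. \<Psi> (?\<phi> w))" by (rule lin_map_comp[OF \<phi>lin \<Psi>(1)])
    have "w \<in> {w \<in> carrier EB.Ext. \<Psi> (?\<phi> w) \<in> {\<zero>\<^bsub>?T\<^esub>}}"
    proof (rule EB.Pw_induct[OF lin_map_vimage_submodule[OF EB.Ext_module T c module.zero_submodule[OF T]] _ w(1)])
      fix ys assume ys: "set ys \<subseteq> carrier \<Omega>B" "int (length ys) = int d - 1"
      obtain xs where xs: "set xs \<subseteq> carrier \<Omega>A" "map psi xs = ys" using lift[OF ys(1)] by blast
      have "?\<phi> (EB.wl ys) = EB.wl (map psi (dA f # xs))"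
        using EB.left_wedge(2)[OF v0 ys(1)] psi(2)[OF f] xs(2) by simp
      then have "\<Psi> (?\<phi> (EB.wl ys)) = G (?us @ dA f # xs)" using \<Psi>(2)[of "dA f # xs"] xs(1) u0 by simp
      also have "\<dots> = \<zero>\<^bsub>?T\<^esub>" by (rule GW[OF xs(1)]) (use xs(2) ys(2) in auto)
      finally show "EB.wl ys \<in> {w \<in> carrier EB.Ext. \<Psi> (?\<phi> w) \<in> {\<zero>\<^bsub>?T\<^esub>}}" using EB.wl_closed[OF ys(1)] by simp
    qed
    then show ?thesis using w(2) by simp
  qed
  from quot_induced[OF EB.Pw_module T N EB.Pw_lin[OF \<Psi>(1)] \<Psi>N]
  obtain hb where hb: "lin_map B ?H ?T hb" "\<And>x. x \<in> carrier ?PB \<Longrightarrow> hb (NB +>\<^bsub>?PB\<^esub> x) = \<Psi> x" by blast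

  \<comment> \<open>The cohomology class of a form on \<open>B\<close>, read on lists over
    \<open>A\<close>. It vanishes on lists containing some \<open>df_i\<close> because
    \<open>psi\<close> does, as the iterated contraction requires.\<close>
  define g0 where "g0 xs = (if int (length (map psi xs)) = int d then NB +>\<^bsub>?PB\<^esub> EB.wl (map psi xs) else \<zero>\<^bsub>?H\<^esub>)" for xs
  have g0: "alternating A \<Omega>A (restr \<pi> ?H) g0"
    unfolding g0_def by (rule alternating_pullback[OF EB.alternating_degree[OF H cls]])
  have g0v: "g0 l = \<zero>\<^bsub>?H\<^esub>" if k: "k < r" and l: "set l \<subseteq> carrier \<Omega>A" "dA (fs ! k) \<in> set l" for k l
  proof -
    obtain p q where pq: "l = p @ dA (fs ! k) # q" using split_list[OF l(2)] by blast
    have c: "set p \<subseteq> carrier \<Omega>A" "set q \<subseteq> carrier \<Omega>A" using l pq by auto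
    have kf: "fs ! k \<in> set fs" "fs ! k \<in> carrier A" using k r fs by auto
    have eq: "map psi (p @ dA (fs ! k) # q) = map psi (p @ \<zero>\<^bsub>\<Omega>A\<^esub> # q)"
      using psi_fs[OF kf(1)] lin_map_zero[OF kA.Omega_module restr_is_module[OF A kB.Omega_module \<pi>] psi(1)] by simp
    have "g0 l = g0 (p @ \<zero>\<^bsub>\<Omega>A\<^esub> # q)" unfolding g0_def pq eq ..
    also have "\<dots> = \<zero>\<^bsub>?H\<^esub>" using lin_map_zero[OF kA.Omega_module rH alternating_slot[OF g0 c]] by simp
    finally show ?thesis .
  qed
  have ex_t: "\<exists>t. lin_map A \<Omega>A (restr \<pi> (self_module B)) t \<and> (\<forall>a\<in>carrier A. t (dA a) = \<theta> i a)" if i: "i < r" for i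
  proof -
    from kA.Omega_universal[OF restr_is_module[OF A self_is_module[OF B] \<pi>] \<theta>[OF i]]
    obtain t where "lin_map A \<Omega>A (restr \<pi> (self_module B)) t" "\<And>a. a \<in> carrier A \<Longrightarrow> t (dA a) = \<theta> i a" by blast
    then show ?thesis by (intro exI[of _ t] conjI ballI)
  qed
  define \<Theta> where "\<Theta> i = (SOME t. lin_map A \<Omega>A (restr \<pi> (self_module B)) t \<and> (\<forall>a\<in>carrier A. t (dA a) = \<theta> i a))" for i
  have \<Theta>: "lin_map A \<Omega>A (restr \<pi> (self_module B)) (\<Theta> i)" "\<forall>a\<in>carrier A. \<Theta> i (dA a) = \<theta> i a" if "i < r" for i
    using someI_ex[OF ex_t[OF that]] unfolding \<Theta>_def by (rule conjunct1, rule conjunct2)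
  have fsk: "fs ! k \<in> carrier A" if "k < r" for k using that r fs by auto
  have fse: "dA (fs ! k) \<in> carrier \<Omega>A" if "k < r" for k using kA.d_simps(1)[OF fsk[OF that]] .
  have fsd: "\<Theta> i (dA (fs ! k)) = (if i = k then \<one>\<^bsub>B\<^esub> else \<zero>\<^bsub>B\<^esub>)" if "i < r" "k < r" for i k
    using \<Theta>(2)[OF that(1)] fsk[OF that(2)] dual[OF that] by simp
  have "\<exists>C. alternating A \<Omega>A (restr \<pi> ?H) C \<and>
    (\<forall>xs. set xs \<subseteq> carrier \<Omega>A \<longrightarrow> C (map (\<lambda>k. dA (fs ! k)) [0..<r] @ xs) = g0 xs)"
  proof (rule iterated_contraction[where r = r and \<Theta> = \<Theta> and e = "\<lambda>k. dA (fs ! k)", OF H g0])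
    show "lin_map A \<Omega>A (restr \<pi> (self_module B)) (\<Theta> i)" if "i < r" for i by (rule \<Theta>(1)[OF that])
    show "dA (fs ! k) \<in> carrier \<Omega>A" if "k < r" for k by (rule fse[OF that])
    show "\<Theta> i (dA (fs ! k)) = (if i = k then \<one>\<^bsub>B\<^esub> else \<zero>\<^bsub>B\<^esub>)" if "i < r" "k < r" for i k by (rule fsd[OF that])
    show "g0 l = \<zero>\<^bsub>?H\<^esub>" if "k < r" "set l \<subseteq> carrier \<Omega>A" "dA (fs ! k) \<in> set l" for k l by (rule g0v[OF that])
  qed blast
  then obtain C where C: "alternating A \<Omega>A (restr \<pi> ?H) C"
    "\<And>xs. set xs \<subseteq> carrier \<Omega>A \<Longrightarrow> C (map (\<lambda>k. dA (fs ! k)) [0..<r] @ xs) = g0 xs"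
    by blast
  have mus: "map (\<lambda>k. dA (fs ! k)) [0..<r] = ?us" using r by (intro nth_equalityI) simp_all
  have Cus: "C (?us @ xs) = g0 xs" if "set xs \<subseteq> carrier \<Omega>A" for xs using C(2)[OF that] unfolding mus .
  from EA.Ext_universal[OF rH C(1)] obtain c where c: "lin_map A EA.Ext (restr \<pi> ?H) c"
    "\<And>xs. set xs \<subseteq> carrier \<Omega>A \<Longrightarrow> c (EA.wl xs) = C xs" by blast
  have cW: "c x = \<zero>\<^bsub>restr \<pi> ?H\<^esub>" if xW: "x \<in> W" for x
  proof -
    obtain w where w: "w \<in> carrier (EA.Pw (int d - 1))" "x = foldr (d_wedge K A \<iota>) (f # fs) w" using xW unfolding Wdef by blast
    note cc = lin_map_comp[OF fold(1) c(1)]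
    have "w \<in> {w \<in> carrier EA.Ext. c (foldr (d_wedge K A \<iota>) (f # fs) w) \<in> {\<zero>\<^bsub>restr \<pi> ?H\<^esub>}}"
    proof (rule EA.Pw_induct[OF lin_map_vimage_submodule[OF EA.Ext_module rH cc module.zero_submodule[OF rH]] _ w(1)])
      fix xs assume xs: "set xs \<subseteq> carrier \<Omega>A" "int (length xs) = int d - 1"
      have "C (?us @ dA f # xs) = g0 (dA f # xs)" by (rule Cus) (use xs(1) u0 in simp)
      also have "\<dots> = NB +>\<^bsub>?PB\<^esub> EB.wl (dB (\<pi> f) # map psi xs)" using xs(2) psi(2)[OF f] by (simp add: g0_def)
      also have "EB.wl (dB (\<pi> f) # map psi xs) = ?\<phi> (EB.wl (map psi xs))"
        using EB.left_wedge(2)[OF v0, of "map psi xs"] xs(1) psi_simps(1) by auto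
      also have "NB +>\<^bsub>?PB\<^esub> ?\<phi> (EB.wl (map psi xs)) = \<zero>\<^bsub>?H\<^esub>"
        by (rule clsN, unfold NB_def, rule imageI, rule EB.wl_Pw) (use xs psi_simps(1) in auto)
      finally have z: "C (?us @ dA f # xs) = \<zero>\<^bsub>restr \<pi> ?H\<^esub>" by simp
      have cl: "set (map dA (f # fs) @ xs) \<subseteq> carrier \<Omega>A" using us u0 xs(1) by simp
      have "c (foldr (d_wedge K A \<iota>) (f # fs) (EA.wl xs)) = C (map dA (f # fs) @ xs)" unfolding fold(2)[OF xs(1)] by (rule c(2)[OF cl])
      also have "\<dots> = \<zero>\<^bsub>restr \<pi> ?H\<^esub>" by (rule alternating_vanish_perm[OF rH kA.Omega_module C(1) _ _ z]) (use cl in simp_all)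
      finally show "EA.wl xs \<in> {w \<in> carrier EA.Ext. c (foldr (d_wedge K A \<iota>) (f # fs) w) \<in> {\<zero>\<^bsub>restr \<pi> ?H\<^esub>}}"
        using EA.wl_closed[OF xs(1)] by blast
    qed
    then show ?thesis using w(2) by simp
  qed
  from quot_induced[OF EA.Pw_module rH W EA.Pw_lin[OF c(1)] cW]
  obtain cb where cb: "lin_map A ?Q (restr \<pi> ?H) cb" "\<And>x. x \<in> carrier ?P \<Longrightarrow> cb (W +>\<^bsub>?P\<^esub> x) = c x" by blast
  from bc.T_universal[OF H cb(1)] obtain \<Gamma> where \<Gamma>: "lin_map B ?T ?H \<Gamma>"
    "\<And>q. q \<in> carrier ?Q \<Longrightarrow> \<Gamma> (bc.tens q \<one>\<^bsub>B\<^esub>) = cb q" by blast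
  have \<Gamma>h: "\<Gamma> (h x) = c x" if "x \<in> carrier ?P" for x
    unfolding h_def using \<Gamma>(2)[of "W +>\<^bsub>?P\<^esub> x"] cb(2)[OF that] that P.quot_carrier by auto
  \<comment> \<open>On wedges, \<open>\<Psi>\<close> puts the \<open>df_i\<close> in front and the
    contraction takes them off again, which leaves the class of the form.\<close>
  have \<Gamma>\<Psi>: "\<Gamma> (\<Psi> x) = NB +>\<^bsub>?PB\<^esub> x" if x: "x \<in> carrier ?PB" for x
  proof -
    note l = lin_map_comp[OF EB.Pw_lin[OF \<Psi>(1)] \<Gamma>(1)]
    note L = lin_mapD[OF l] and L' = lin_mapD[OF cls]
    have "submodule {x \<in> carrier ?PB. \<Gamma> (\<Psi> x) = NB +>\<^bsub>?PB\<^esub> x} B ?PB"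
    proof (rule PB.submoduleI')
      show "\<zero>\<^bsub>?PB\<^esub> \<in> {x \<in> carrier ?PB. \<Gamma> (\<Psi> x) = NB +>\<^bsub>?PB\<^esub> x}"
        using lin_map_zero[OF EB.Pw_module H l] lin_map_zero[OF EB.Pw_module H cls] by simp
    qed (simp_all add: L L')
    then have s: "submodule {x \<in> carrier ?PB. \<Gamma> (\<Psi> x) = NB +>\<^bsub>?PB\<^esub> x} B EB.Ext" unfolding EB.Pw_sub_iff by blast
    have "x \<in> {x \<in> carrier ?PB. \<Gamma> (\<Psi> x) = NB +>\<^bsub>?PB\<^esub> x}"
    proof (rule EB.Pw_induct[OF s _ x])
      fix ys assume ys: "set ys \<subseteq> carrier \<Omega>B" "int (length ys) = int d"
      obtain xs where xs: "set xs \<subseteq> carrier \<Omega>A" "map psi xs = ys" using lift[OF ys(1)] by blast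
      have len: "length (?us @ xs) = n" using xs(2) ys(2) n r by auto
      have cl: "set (?us @ xs) \<subseteq> carrier \<Omega>A" using us xs(1) by simp
      have "\<Psi> (EB.wl ys) = h (EA.wl (?us @ xs))" using \<Psi>(2)[OF xs(1)] Gn[OF len] xs(2) by simp
      then have "\<Gamma> (\<Psi> (EB.wl ys)) = c (EA.wl (?us @ xs))" using \<Gamma>h[OF EA.wl_Pw[OF cl]] len by simp
      also have "\<dots> = g0 xs" using c(2)[OF cl] Cus[OF xs(1)] by simp
      also have "\<dots> = NB +>\<^bsub>?PB\<^esub> EB.wl ys" using xs(2) ys(2) by (simp add: g0_def)
      finally show "EB.wl ys \<in> {x \<in> carrier ?PB. \<Gamma> (\<Psi> x) = NB +>\<^bsub>?PB\<^esub> x}" using EB.wl_Pw[OF ys] by blast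
    qed
    then show ?thesis by simp
  qed
  have left_inv: "\<Gamma> (hb y) = y" if yH: "y \<in> carrier ?H" for y
  proof -
    obtain x where x: "x \<in> carrier ?PB" "y = NB +>\<^bsub>?PB\<^esub> x" using yH PB.quot_carrier by auto
    show ?thesis unfolding x(2) hb(2)[OF x(1)] by (rule \<Gamma>\<Psi>[OF x(1)])
  qed

  let ?S = "hb ` carrier ?H"
  have S: "submodule ?S B ?T" by (rule lin_map_image_submodule[OF H T hb(1) H.carrier_is_submodule])
  let ?TS = "quot_module ?T ?S"
  have TS: "module B ?TS" by (rule bc.T.quot_is_module[OF S])
  have rTS: "module A (restr \<pi> ?TS)" by (rule restr_is_module[OF A TS \<pi>])
  note tcls = bc.T.quot_lin[OF S]
  \<comment> \<open>Surjectivity is tested in the quotient by the image: the universal alternating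
    map into it has to vanish in degree \<open>n\<close>.\<close>
  define G' where "G' l = ?S +>\<^bsub>?T\<^esub> G l" for l
  have G': "alternating A \<Omega>A (restr \<pi> ?TS) G'"
    unfolding G'_def by (rule alternating_lin[OF rT rTS G restr_lin[OF \<pi> tcls]])
  have Gc: "G l \<in> carrier ?T" if "set l \<subseteq> carrier \<Omega>A" for l using alternatingD(1)[OF G that] by simp
  have G'0: "G' l = \<zero>\<^bsub>?TS\<^esub> \<longleftrightarrow> G l \<in> ?S" if "set l \<subseteq> carrier \<Omega>A" for l
    unfolding G'_def bc.T.quot_zero by (rule bc.T.coset_eq_zero[OF S Gc[OF that]])
  \<comment> \<open>The list \<open>l\<close> collects factors \<open>df_i\<close>, and the
    induction runs downward on their number. A repeated factor gives zero, and a full set of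
    \<open>r\<close> factors gives a value in the image of \<open>hb\<close>. With fewer, the map in
    \<open>xs\<close> kills one more \<open>df_i\<close> by induction, so it descends to forms on
    \<open>B\<close> of degree above \<open>d\<close>.\<close>
  have claim: "G' (l @ xs) = \<zero>\<^bsub>?TS\<^esub>"
    if "set l \<subseteq> set ?us" "set xs \<subseteq> carrier \<Omega>A" "length l + length xs = n" for l xs
    using that
  proof (induction "Suc r - length l" arbitrary: l xs rule: less_induct)
    case less
    have lc: "set l \<subseteq> carrier \<Omega>A" using less.prems(1) us by blast
    have lxc: "set (l @ xs) \<subseteq> carrier \<Omega>A" using lc less.prems(2) by simp
    consider "\<not> distinct l" | "distinct l" "r \<le> length l" | "length l < r" by linarith
    then show ?case
    proof cases
      case 1
      then show ?thesis using alternating_vanish_repeat[OF rTS kA.Omega_module G' _ lxc] by simp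
    next
      case 2
      have "card (set l) = length l" using distinct_card[OF 2(1)] .
      moreover have "card (set l) \<le> card (set ?us)" by (rule card_mono[OF _ less.prems(1)]) simp
      moreover have "card (set ?us) \<le> length ?us" by (rule card_length)
      ultimately have eqs: "length l = r" "card (set l) = card (set ?us)" "card (set ?us) = length ?us" using 2(2) r by simp_all
      have "set l = set ?us" using card_subset_eq[OF _ less.prems(1) eqs(2)] by simp
      then have "mset l = mset ?us" using set_eq_iff_mset_eq_distinct[OF 2(1) card_distinct[OF eqs(3)]] by (rule iffD1[rotated])
      then have ml: "mset (?us @ xs) = mset (l @ xs)" by simp
      have "G (?us @ xs) = \<Psi> (EB.wl (map psi xs))" using \<Psi>(2)[OF less.prems(2)] by simp
      also have "\<dots> = hb (NB +>\<^bsub>?PB\<^esub> EB.wl (map psi xs))"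
        by (rule hb(2)[symmetric], rule EB.wl_Pw) (use less.prems psi_simps(1) eqs(1) n in auto)
      also have "\<dots> \<in> ?S"
      proof (rule imageI)
        have "EB.wl (map psi xs) \<in> carrier ?PB" by (rule EB.wl_Pw) (use less.prems psi_simps(1) eqs(1) n in auto)
        then show "NB +>\<^bsub>?PB\<^esub> EB.wl (map psi xs) \<in> carrier ?H" using PB.quot_carrier by blast
      qed
      finally have "G' (?us @ xs) = \<zero>\<^bsub>restr \<pi> ?TS\<^esub>" using G'0[of "?us @ xs"] us less.prems(2) by simp
      from alternating_vanish_perm[OF rTS kA.Omega_module G' ml _ this] show ?thesis using us less.prems(2) by simp
    next
      case 3
      have IH: "G' (l @ p @ dA x # q) = \<zero>\<^bsub>?TS\<^esub>" if pq: "x \<in> set fs" "set p \<subseteq> carrier \<Omega>A" "set q \<subseteq> carrier \<Omega>A" for p x q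
      proof -
        have xc: "dA x \<in> carrier \<Omega>A" using pq(1) fs kA.d_simps(1) by auto
        have c': "set (l @ p @ dA x # q) \<subseteq> carrier \<Omega>A" using lc pq xc by simp
        show ?thesis
        proof (cases "length (l @ p @ dA x # q) = n")
          case True
          have "G' ((l @ [dA x]) @ p @ q) = \<zero>\<^bsub>?TS\<^esub>"
            by (rule less.hyps) (use 3 less.prems(1) pq True in auto)
          then have z: "G' ((l @ [dA x]) @ p @ q) = \<zero>\<^bsub>restr \<pi> ?TS\<^esub>" by simp
          have "G' (l @ p @ dA x # q) = \<zero>\<^bsub>restr \<pi> ?TS\<^esub>"
            by (rule alternating_vanish_perm[OF rTS kA.Omega_module G' _ _ z]) (use c' in auto)
          then show ?thesis by simp
        next
          \<comment> \<open>Lists of any length occur in the descent condition, but \<open>G\<close>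
            was extended by zero outside degree \<open>n\<close>.\<close>
          case False
          then have "G (l @ p @ dA x # q) = \<zero>\<^bsub>?T\<^esub>" unfolding G_def by simp
          then have "G (l @ p @ dA x # q) \<in> ?S" using bc.T.submoduleD(3)[OF S] by simp
          then show ?thesis using G'0[OF c'] by blast
        qed
      qed
      from alternating_descends[OF TS alternating_append[OF G' lc] IH]
      obtain g where g: "lin_map B EB.Ext ?TS g" "\<And>xs. set xs \<subseteq> carrier \<Omega>A \<Longrightarrow> g (EB.wl (map psi xs)) = G' (l @ xs)" by blast
      have "EB.wl (map psi xs) = \<zero>\<^bsub>EB.Ext\<^esub>" by (rule vanish) (use less.prems psi_simps(1) 3 n in auto)
      then show ?thesis using g(2)[OF less.prems(2)] lin_map_zero[OF EB.Ext_module TS g(1)] by simp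
    qed
  qed
  have hS: "h x \<in> ?S" if x: "x \<in> carrier ?P" for x
  proof -
    have "submodule {x \<in> carrier ?P. h x \<in> ?S} A ?P"
      by (rule lin_map_vimage_submodule[OF EA.Pw_module rT h restr_submodule[OF A T \<pi> S]])
    then have s: "submodule {x \<in> carrier ?P. h x \<in> ?S} A EA.Ext" unfolding EA.Pw_sub_iff by blast
    have "x \<in> {x \<in> carrier ?P. h x \<in> ?S}"
    proof (rule EA.Pw_induct[OF s _ x])
      fix xs assume xs: "set xs \<subseteq> carrier \<Omega>A" "int (length xs) = int n"
      have "G' xs = \<zero>\<^bsub>?TS\<^esub>" using claim[of "[]" xs] xs by simp
      then have "h (EA.wl xs) \<in> ?S" using G'0[OF xs(1)] Gn[of xs] xs(2) by simp
      then show "EA.wl xs \<in> {x \<in> carrier ?P. h x \<in> ?S}" using EA.wl_Pw[OF xs] by blast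
    qed
    then show ?thesis by simp
  qed
  have "carrier ?T \<subseteq> ?S"
  proof (rule subsetI[OF bc.T_induct[OF S]])
    fix q assume "q \<in> carrier ?Q"
    then obtain x where "x \<in> carrier ?P" "q = W +>\<^bsub>?P\<^esub> x" using P.quot_carrier by auto
    then show "bc.tens q \<one>\<^bsub>B\<^esub> \<in> ?S" using hS unfolding h_def by blast
  qed
  then have "?S = carrier ?T" using bc.T.submoduleD(1)[OF S] by blast
  moreover have "inj_on hb (carrier ?H)" by (rule inj_on_inverseI[of _ \<Gamma>]) (rule left_inv)
  ultimately have "hb \<in> module_iso B ?H ?T" using lin_mapD[OF hb(1)] by (auto simp: module_iso_def bij_betw_def)
  then have "hb \<in> module_iso B ?H (tensor_product A B \<pi> (quot_module (forms K A \<iota> (int n)) W))" by (simp add: forms_def)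
  then show ?thesis unfolding coh W_def by blast
qed

end

theorem theorem1p2:
  fixes K :: "('k, 'l) ring_scheme" and A :: "('a, 'm) ring_scheme" and \<iota> :: "'k \<Rightarrow> 'a"
    and n r :: nat and f :: 'a and fs :: "'a list"
    and I :: "'a set" and B :: "'a set ring" and \<pi> :: "'a \<Rightarrow> 'a set" and \<iota>\<^sub>B :: "'k \<Rightarrow> 'a set"
  assumes "field K"
    and "cring A" and "\<iota> \<in> ring_hom K A"
    and "smooth_algebra K A \<iota>" and "pure_dim A n"
    and "f \<in> carrier A"
    and "set fs \<subseteq> carrier A" and "length fs = r" and "r \<ge> 1"
    and I_def: "I = Idl\<^bsub>A\<^esub> (set fs)"
    and B_def: "B = A Quot I"
    and \<pi>_def: "\<pi> = (\<lambda>a. I +>\<^bsub>A\<^esub> a)"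
    and \<iota>\<^sub>B_def: "\<iota>\<^sub>B = \<pi> \<circ> \<iota>"
    and "smooth_algebra K B \<iota>\<^sub>B" and "pure_codim A I r"
  shows "\<exists>h. h \<in> module_iso B
      (cohomology (forms K B \<iota>\<^sub>B) (d_wedge K B \<iota>\<^sub>B (\<pi> f)) (int n - int r))
      (tensor_product A B \<pi>
        (quot_module (forms K A \<iota> (int n))
          ((\<lambda>\<omega>. foldr (d_wedge K A \<iota>) (f # fs) \<omega>) `
            carrier (forms K A \<iota> (int n - int r - 1)))))"
proof -
  interpret K: field K by fact
  interpret A: cring A by fact
  have I: "ideal I A" unfolding I_def by (rule A.genideal_ideal) fact
  interpret I: ideal I A by (rule I)
  have B: "cring B" unfolding B_def by (rule I.quotient_is_cring) fact
  have ft: "finite_type_algebra K A \<iota>" using assms(4) by (simp add: smooth_algebra_def)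
  have SQ: "smooth_quotient K A \<iota> B \<pi>" and ker: "a_kernel A B \<pi> = I"
    using smooth_quotient_quot[OF assms(1-3) ft I] assms(14) unfolding \<iota>\<^sub>B_def B_def \<pi>_def by auto
  interpret SQ: smooth_quotient K A \<iota> B \<pi> by (rule SQ)
  have QS: "quotient_setting K A \<iota> B \<pi> fs"
    by (rule quotient_setting.intro[OF K.is_cring assms(2,3) B SQ.g SQ.onto assms(7)]) (simp add: ker I_def)
  show ?thesis
  proof (cases "I = carrier A")
    case True
    then have "\<one>\<^bsub>A\<^esub> \<in> a_kernel A B \<pi>" using ker by simp
    then have "\<one>\<^bsub>B\<^esub> = \<zero>\<^bsub>B\<^esub>" using ring_hom_one[OF SQ.g] SQ.J_mem by simp
    from quotient_setting.koszul_comparison_zero_ring[OF QS this assms(6), of "int n - int r" "int n"]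
    show ?thesis using assms(8) unfolding \<iota>\<^sub>B_def by simp
  next
    case False
    then have "\<one>\<^bsub>A\<^esub> \<notin> I" using I.one_imp_carrier by blast
    \<comment> \<open>A maximal ideal over \<open>I\<close> is a chain of length 0; it already
      forces \<open>r \<le> n\<close>, so that subtraction of naturals agrees with that of
      integers.\<close>
    then obtain m where m: "maximalideal m A" "I \<subseteq> m" using A.ex_maximal[OF I] by blast
    have "prime_chain A 0 (\<lambda>_. m)" using A.maximalideal_prime[OF m(1)] by (simp add: prime_chain_def)
    from A.prime_chain_length[OF assms(5,15) this] m(2) have rn: "r \<le> n" by simp
    \<comment> \<open>Preimages in \<open>A\<close> of the primes of \<open>B\<close> form a chain
      above \<open>I\<close>, to which the bound for \<open>A\<close> applies.\<close>
    have dim: "\<forall>k p. prime_chain B k p \<longrightarrow> k \<le> n - r"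
    proof (intro allI impI)
      fix k p assume p: "prime_chain B k p"
      have "\<zero>\<^bsub>B\<^esub> \<in> p 0"
        using cring.prime_chainD(1)[OF B p, of 0] ideal.ideal_simps(1)[OF primeideal.axioms(1)] by blast
      then have "I \<subseteq> {x \<in> carrier A. \<pi> x \<in> p 0}" using SQ.J_mem unfolding ker by auto
      from A.prime_chain_length[OF assms(5,15) prime_chain_vimage[OF SQ.g.ring_hom_ring_axioms assms(2) B SQ.onto p] this]
      show "k \<le> n - r" by simp
    qed
    have N: "noetherian_ring A" by (rule finite_type_noetherian[OF assms(1-3) ft])
    have img: "((!) fs) ` {..<r} = set fs" using assms(8) by (auto simp: set_conv_nth)
    have fsi: "fs ! i \<in> carrier A" if "i < r" for i using that assms(7,8) by auto
    obtain \<theta> where \<theta>: "\<And>i. i < r \<Longrightarrow> derivation K A \<iota> (restr \<pi> (self_module B)) (\<theta> i)"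
      "\<And>i k. i < r \<Longrightarrow> k < r \<Longrightarrow> \<theta> i (fs ! k) = (if i = k then \<one>\<^bsub>B\<^esub> else \<zero>\<^bsub>B\<^esub>)"
      using SQ.dual_derivations[OF N assms(4), of r "(!) fs"] fsi ker I_def img assms(15) by auto
    have hB: "\<pi> \<circ> \<iota> \<in> ring_hom K B" by (rule ring_hom_trans[OF assms(3) SQ.g])
    have n: "n = (n - r) + r" using rn by simp
    have deg: "int n - int r = int (n - r)" using rn by simp
    note vanish = wedge_vanish[OF assms(1) B hB assms(14)[unfolded \<iota>\<^sub>B_def] dim]
    show ?thesis unfolding deg \<iota>\<^sub>B_def
      by (rule quotient_setting.koszul_comparison[OF QS assms(6,8) n vanish \<theta>])
  qed
qed

end
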